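(* Let $\rho\ge 2$, let $\Gamma=\Pi_\rho=\langle\alpha_i,\beta_i\ (1\le i\le\rho):\prod_{i=1}^\rho[\alpha_i,\beta_i]=1\rangle$, and let $G$ be a finite additively written abelian group with $r\le 2\rho$ invariant factors $n_1\ge n_2\ge\dots\ge n_r$, $n_{i+1}\mid n_i$, and a fixed set of generators $\omega_1,\dots,\omega_r$ of orders $n_1,\dots,n_r$ respectively. Then any epimorphism $\eta:\Gamma\to G$ is $\mathrm{Aut}(G)\times\mathrm{Aut}(\Gamma)$-equivalent to one of those described below, where the $N_{\beta_i,\omega_j}$ are integers. (1) If $r\le\rho$: $$\eta(\alpha_i)=\begin{cases}\omega_i & i\le r\\ 0 & i>r\end{cases},\qquad \eta(\beta_i)=\begin{cases}\sum_{j=i+1}^{r}N_{\beta_i,\omega_j}\omega_j & i\le r\\ 0& i>r\end{cases}$$ where - $\gcd(n_{i+1},N_{\beta_i,\omega_{i+1}})>1$ or $N_{\beta_i,\omega_{i+1}}=1$ for each $i\le r-1$; - for each $i$, if $j>i+1$ is the largest integer such that $N_{\beta_i,\omega_j}\neq 0$, then $\langle N_{\beta_i,\omega_j}\omega_j\rangle\le\langle N_{\beta_{i+1},\omega_j}\omega_j\rangle$. (2) If $r>\rho$: $$\eta(\alpha_i)=\omega_i\quad (1\le i\le\rho),$$ $$\eta(\beta_i)=\begin{cases}\sum_{j=i+1}^{r}N_{\beta_i,\omega_j}\omega_j & 1\le i\le 2\rho-r\\ \omega_{2\rho-i+1}+\sum_{j=i+1}^{2\rho-i}N_{\beta_i,\omega_j}\omega_j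 & 2\rho-r<i<\rho\\ \omega_{\rho+1}& i=\rho\end{cases}$$ where - for $i>2\rho-r$, either the order of $N_{\beta_i,\omega_j}\omega_j$ does not divide $n_r$ or $N_{\beta_i,\omega_j}=0$ (for the coefficients $N_{\beta_i,\omega_j}$ appearing in the sums above); - for $i\le 2\rho-r$, if $j>i+1$ is the largest integer such that $N_{\beta_i,\omega_j}\ne 0$, then $\langle N_{\beta_i,\omega_j}\omega_j\rangle\le\langle N_{\beta_{i+1},\omega_j}\omega_j\rangle$; - for $i\le 2\rho-r-1$, $\gcd(n_i,N_{\beta_i,\omega_{i+1}})>1$ or $N_{\beta_i,\omega_{i+1}}=1$.
   Context: $\Gamma=\Pi_\rho$ is a torsion-free Fuchsian surface group (so $\rho\geq2$), the fundamental group of a closed oriented surface $T$ of genus $\rho$ with canonical generators $\alpha_i,\beta_i$. $\mathrm{Aut}(\Gamma)$ denotes the group of automorphisms of $\Gamma$ induced by orientation-preserving homeomorphisms of $T$ fixing the base point. Two epimorphisms $\eta_1,\eta_2:\Gamma\to G$ are $\mathrm{Aut}(G)\times\mathrm{Aut}(\Gamma)$-equivalent if $\eta_2=\omega\circ\eta_1\circ\xi^{-1}$ for some $\omega\in\mathrm{Aut}(G)$, $\xi\in\mathrm{Aut}(\Gamma)$. The invariant factors of $G$ are integers $n_i>1$ with $G\cong C_{n_1}\times\cdots\times C_{n_r}$, and $\omega_1,\dots,\omega_r$ are generators giving such a decomposition, i.e. $G=\langle\omega_1\rangle\oplus\cdots\oplus\langle\omega_r\rangle$. In general $N_{\beta_i,\omega_j}$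 denotes the coefficient of $\omega_j$ in the displayed expression for $\eta(\beta_i)$; thus in case (2), for $i=2\rho-r$ and $j=r$, $N_{\beta_{i+1},\omega_r}$ is the coefficient $1$ of $\omega_r$ in $\eta(\beta_{2\rho-r+1})$. Also $\gcd(n,0)=n$. *)

theory Defs
  imports "HOL-Homology.Homology"
begin

section \<open>Groups given by generators and relators\<close>

text \<open>
  The letter \<open>(x, False)\<close> stands for the generator \<open>x\<close> and \<open>(x, True)\<close> for its inverse.
\<close>

type_synonym 'g word = "('g \<times> bool) list"

definition words :: "'g set \<Rightarrow> 'g word set" where
  "words S = lists (S \<times> UNIV)"

inductive pres_step :: "'g set \<Rightarrow> 'g word set \<Rightarrow> 'g word \<Rightarrow> 'g word \<Rightarrow> bool"
  for S :: "'g set" and R :: "'g word set" where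
  cancel: "u \<in> words S \<Longrightarrow> v \<in> words S \<Longrightarrow> x \<in> S \<Longrightarrow>
             pres_step S R (u @ [(x, b), (x, \<not> b)] @ v) (u @ v)"
| relator: "u \<in> words S \<Longrightarrow> v \<in> words S \<Longrightarrow> w \<in> R \<inter> words S \<Longrightarrow>
             pres_step S R (u @ w @ v) (u @ v)"

definition pres_class :: "'g set \<Rightarrow> 'g word set \<Rightarrow> 'g word \<Rightarrow> 'g word set" where
  "pres_class S R w = {v. equivclp (pres_step S R) w v}"

definition presented_group :: "'g set \<Rightarrow> 'g word set \<Rightarrow> 'g word set monoid" where
  "presented_group S R =
     \<lparr>carrier = pres_class S R ` words S,
      monoid.mult = (\<lambda>A B. \<Union>u\<in>A. \<Union>v\<in>B. pres_class S R (u @ v)),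
      one = pres_class S R []\<rparr>"

lemma pres_class_self: "w \<in> pres_class S R w"
  by (simp add: pres_class_def)

lemma pres_class_eq_iff:
  "pres_class S R u = pres_class S R v \<longleftrightarrow> equivclp (pres_step S R) u v"
proof
  assume "pres_class S R u = pres_class S R v"
  then show "equivclp (pres_step S R) u v"
    using pres_class_self[of v S R] unfolding pres_class_def by blast
next
  assume "equivclp (pres_step S R) u v"
  then have "equivclp (pres_step S R) u w \<longleftrightarrow> equivclp (pres_step S R) v w" for w
    by (meson equivclp_sym equivclp_trans)
  then show "pres_class S R u = pres_class S R v"
    by (simp add: pres_class_def)
qed

lemma words_append [simp]: "u @ v \<in> words S \<longleftrightarrow> u \<in> words S \<and> v \<in> words S"
  by (auto simp: words_def)

lemma words_Nil [simp]: "[] \<in> words S"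
  by (simp add: words_def)

lemma pres_step_words: "pres_step S R u v \<Longrightarrow> u \<in> words S \<and> v \<in> words S"
  by (induction rule: pres_step.induct) (auto simp: words_def)

lemma equivclp_pres_step_words:
  "equivclp (pres_step S R) u v \<Longrightarrow> u \<in> words S \<longleftrightarrow> v \<in> words S"
  by (induction rule: equivclp_induct) (auto dest: pres_step_words)

lemma pres_step_context:
  assumes "pres_step S R u v" "x \<in> words S" "y \<in> words S"
  shows "pres_step S R (x @ u @ y) (x @ v @ y)"
  using assms
proof (induction rule: pres_step.induct)
  case (cancel u v g b)
  then show ?case
    using pres_step.cancel[of "x @ u" S "v @ y" g R b] by simp
next
  case (relator u v w)
  then show ?case
    using pres_step.relator[of "x @ u" S "v @ y" w R] by simp
qed

lemma equivclp_pres_step_context: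
  assumes "equivclp (pres_step S R) u v" "x \<in> words S" "y \<in> words S"
  shows "equivclp (pres_step S R) (x @ u @ y) (x @ v @ y)"
  using assms(1)
proof (induction rule: equivclp_induct)
  case base
  show ?case by simp
next
  case (step v w)
  then have "pres_step S R (x @ v @ y) (x @ w @ y) \<or> pres_step S R (x @ w @ y) (x @ v @ y)"
    using pres_step_context assms(2,3) by blast
  then show ?case
    using step.IH equivclp_into_equivclp by metis
qed

lemma mult_presented_group:
  assumes "u \<in> words S" "v \<in> words S"
  shows "pres_class S R u \<otimes>\<^bsub>presented_group S R\<^esub> pres_class S R v = pres_class S R (u @ v)"
proof -
  have "pres_class S R (u' @ v') = pres_class S R (u @ v)"
    if "u' \<in> pres_class S R u" "v' \<in> pres_class S R v" for u' v'
  proof -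
    have e: "equivclp (pres_step S R) u u'" "equivclp (pres_step S R) v v'"
      using that by (simp_all add: pres_class_def)
    have "u' \<in> words S"
      using e(1) assms(1) equivclp_pres_step_words by blast
    then have "equivclp (pres_step S R) (u @ v) (u' @ v')"
      using equivclp_pres_step_context[OF e(1), of "[]" v]
        equivclp_pres_step_context[OF e(2), of u' "[]"] assms equivclp_trans
      by fastforce
    then show ?thesis
      using pres_class_eq_iff by metis
  qed
  then have "(\<Union>u'\<in>pres_class S R u. \<Union>v'\<in>pres_class S R v. pres_class S R (u' @ v')) =
      (\<Union>u'\<in>pres_class S R u. \<Union>v'\<in>pres_class S R v. pres_class S R (u @ v))"
    by simp
  also have "\<dots> = pres_class S R (u @ v)"
    using pres_class_self[of u S R] pres_class_self[of v S R] by blast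
  finally show ?thesis
    by (simp add: presented_group_def)
qed

definition word_inv :: "'g word \<Rightarrow> 'g word" where
  "word_inv w = rev (map (\<lambda>(x, b). (x, \<not> b)) w)"

lemma word_inv_words: "w \<in> words S \<Longrightarrow> word_inv w \<in> words S"
  by (auto simp: words_def word_inv_def)

lemma word_inv_left:
  "w \<in> words S \<Longrightarrow> equivclp (pres_step S R) (word_inv w @ w) []"
proof (induction w)
  case Nil
  show ?case by (simp add: word_inv_def)
next
  case (Cons l w)
  obtain x b where l: "l = (x, b)" by fastforce
  have w: "w \<in> words S" and x: "x \<in> S"
    using Cons.prems l by (auto simp: words_def)
  have "pres_step S R (word_inv w @ [(x, \<not> b), (x, \<not> \<not> b)] @ w) (word_inv w @ w)"
    using word_inv_words[OF w] w x by (rule pres_step.cancel)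
  then have "equivclp (pres_step S R) (word_inv (l # w) @ l # w) (word_inv w @ w)"
    by (simp add: l word_inv_def r_into_equivclp)
  then show ?case
    using Cons.IH[OF w] equivclp_trans by metis
qed

lemma group_presented_group: "group (presented_group S R)"
proof (rule groupI)
  let ?P = "presented_group S R"
  have car: "carrier ?P = pres_class S R ` words S" and one: "\<one>\<^bsub>?P\<^esub> = pres_class S R []"
    by (simp_all add: presented_group_def)
  show "\<one>\<^bsub>?P\<^esub> \<in> carrier ?P"
    by (simp add: car one)
  show "x \<otimes>\<^bsub>?P\<^esub> y \<in> carrier ?P" if "x \<in> carrier ?P" "y \<in> carrier ?P" for x y
    using that by (auto simp: car mult_presented_group)
  show "x \<otimes>\<^bsub>?P\<^esub> y \<otimes>\<^bsub>?P\<^esub> z = x \<otimes>\<^bsub>?P\<^esub> (y \<otimes>\<^bsub>?P\<^esub> z)"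
    if "x \<in> carrier ?P" "y \<in> carrier ?P" "z \<in> carrier ?P" for x y z
    using that by (auto simp: car mult_presented_group)
  show "\<one>\<^bsub>?P\<^esub> \<otimes>\<^bsub>?P\<^esub> x = x" if "x \<in> carrier ?P" for x
    using that by (auto simp: car one mult_presented_group)
  show "\<exists>y\<in>carrier ?P. y \<otimes>\<^bsub>?P\<^esub> x = \<one>\<^bsub>?P\<^esub>" if x: "x \<in> carrier ?P" for x
  proof -
    obtain w where w: "w \<in> words S" "x = pres_class S R w"
      using x car by auto
    have "pres_class S R (word_inv w) \<otimes>\<^bsub>?P\<^esub> x = \<one>\<^bsub>?P\<^esub>"
      using w word_inv_words[OF w(1)] word_inv_left[OF w(1)]
      by (simp add: mult_presented_group one pres_class_eq_iff)
    then show ?thesis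
      using w(1) word_inv_words[OF w(1)] by (auto simp: car)
  qed
qed


section \<open>The surface group\<close>

datatype surface_gen = Alpha nat | Beta nat

definition surface_gens :: "nat \<Rightarrow> surface_gen set" where
  "surface_gens \<rho> = Alpha ` {1..\<rho>} \<union> Beta ` {1..\<rho>}"

definition surface_relator :: "nat \<Rightarrow> surface_gen word" where
  "surface_relator \<rho> =
     concat (map (\<lambda>i. [(Alpha i, False), (Beta i, False), (Alpha i, True), (Beta i, True)])
                 [1..<Suc \<rho>])"

definition surface_group :: "nat \<Rightarrow> surface_gen word set monoid" where
  "surface_group \<rho> = presented_group (surface_gens \<rho>) {surface_relator \<rho>}"

definition gen :: "nat \<Rightarrow> surface_gen \<Rightarrow> surface_gen word set" where
  "gen \<rho> x = pres_class (surface_gens \<rho>) {surface_relator \<rho>} [(x, False)]"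

lemma group_surface_group: "group (surface_group \<rho>)"
  by (simp add: surface_group_def group_presented_group)


section \<open>The fundamental group of a topological space\<close>

text \<open>
  The library's operation on paths requires the points to form a type of class
  \<open>topological_space\<close>, so paths in an abstract topology are concatenated explicitly.
\<close>

definition loops :: "'a topology \<Rightarrow> 'a \<Rightarrow> (real \<Rightarrow> 'a) set" where
  "loops X x = {p. pathin X p \<and> p 0 = x \<and> p 1 = x}"

definition loop_join :: "(real \<Rightarrow> 'a) \<Rightarrow> (real \<Rightarrow> 'a) \<Rightarrow> real \<Rightarrow> 'a" where
  "loop_join p q = (\<lambda>t. if t \<le> 1/2 then p (2 * t) else q (2 * t - 1))"

definition loop_class :: "'a topology \<Rightarrow> 'a \<Rightarrow> (real \<Rightarrow> 'a) \<Rightarrow> (real \<Rightarrow> 'a) set" where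
  "loop_class X x p =
     {q. homotopic_with (\<lambda>h. h 0 = x \<and> h 1 = x) (top_of_set {0..1}) X p q}"

definition fundamental_group :: "'a topology \<Rightarrow> 'a \<Rightarrow> (real \<Rightarrow> 'a) set monoid" where
  "fundamental_group X x =
     \<lparr>carrier = loop_class X x ` loops X x,
      monoid.mult = (\<lambda>A B. \<Union>p\<in>A. \<Union>q\<in>B. loop_class X x (loop_join p q)),
      one = loop_class X x (\<lambda>_. x)\<rparr>"

definition pi1_induced ::
    "'a topology \<Rightarrow> 'a \<Rightarrow> ('a \<Rightarrow> 'a) \<Rightarrow> (real \<Rightarrow> 'a) set \<Rightarrow> (real \<Rightarrow> 'a) set" where
  "pi1_induced X x h A = (\<Union>p\<in>A. loop_class X x (h \<circ> p))"


section \<open>The closed oriented surface of genus \<open>\<rho>\<close>\<close>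

text \<open>
  The surface is the quotient of the closed unit disc, regarded as a polygon with \<open>4\<rho>\<close> sides
  numbered counterclockwise from \<open>0\<close>, whose boundary reads
  \<open>\<alpha>\<^sub>1 \<beta>\<^sub>1 \<alpha>\<^sub>1\<^sup>-\<^sup>1 \<beta>\<^sub>1\<^sup>-\<^sup>1 \<dots> \<alpha>\<^sub>\<rho> \<beta>\<^sub>\<rho> \<alpha>\<^sub>\<rho>\<^sup>-\<^sup>1 \<beta>\<^sub>\<rho>\<^sup>-\<^sup>1\<close>: the sides \<open>k\<close> and \<open>k + 2\<close>, for
  \<open>k mod 4 \<in> {0, 1}\<close>, are glued with opposite directions.
  All vertices are identified with each other.
\<close>

definition side :: "nat \<Rightarrow> nat \<Rightarrow> real \<Rightarrow> complex" where
  "side \<rho> k t = cis (2 * pi * (real k + t) / (4 * real \<rho>))"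

definition side_pairing :: "nat \<Rightarrow> complex \<Rightarrow> complex \<Rightarrow> bool" where
  "side_pairing \<rho> z w \<longleftrightarrow>
     (\<exists>k t. k < 4 * \<rho> \<and> k mod 4 \<in> {0, 1} \<and> t \<in> {0..1} \<and>
            z = side \<rho> k t \<and> w = side \<rho> (k + 2) (1 - t))"

definition glue :: "nat \<Rightarrow> complex \<Rightarrow> complex set" where
  "glue \<rho> z = {w. equivclp (side_pairing \<rho>) z w}"

definition surface :: "nat \<Rightarrow> complex set topology" where
  "surface \<rho> = topology (\<lambda>U. U \<subseteq> glue \<rho> ` cball 0 1 \<and>
                 openin (top_of_set (cball 0 1)) {z \<in> cball 0 1. glue \<rho> z \<in> U})"

lemma openin_surface:
  "openin (surface \<rho>) U \<longleftrightarrow>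
     U \<subseteq> glue \<rho> ` cball 0 1 \<and>
     openin (top_of_set (cball 0 1)) {z \<in> cball 0 1. glue \<rho> z \<in> U}"
proof -
  have "istopology (\<lambda>U. U \<subseteq> glue \<rho> ` cball 0 1 \<and>
          openin (top_of_set (cball 0 1)) {z \<in> cball 0 1. glue \<rho> z \<in> U})"
    unfolding istopology_def
  proof (intro conjI allI impI)
    fix U V
    assume "U \<subseteq> glue \<rho> ` cball 0 1 \<and> openin (top_of_set (cball 0 1)) {z \<in> cball 0 1. glue \<rho> z \<in> U}"
      and "V \<subseteq> glue \<rho> ` cball 0 1 \<and> openin (top_of_set (cball 0 1)) {z \<in> cball 0 1. glue \<rho> z \<in> V}"
    moreover have "{z \<in> cball 0 1. glue \<rho> z \<in> U \<inter> V} =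
        {z \<in> cball 0 1. glue \<rho> z \<in> U} \<inter> {z \<in> cball 0 1. glue \<rho> z \<in> V}"
      by auto
    ultimately show "U \<inter> V \<subseteq> glue \<rho> ` cball 0 1"
      and "openin (top_of_set (cball 0 1)) {z \<in> cball 0 1. glue \<rho> z \<in> U \<inter> V}"
      by auto
  next
    fix \<U>
    assume *: "\<forall>U\<in>\<U>. U \<subseteq> glue \<rho> ` cball 0 1 \<and>
        openin (top_of_set (cball 0 1)) {z \<in> cball 0 1. glue \<rho> z \<in> U}"
    show "\<Union>\<U> \<subseteq> glue \<rho> ` cball 0 1"
      using * by blast
    have "{z \<in> cball 0 1. glue \<rho> z \<in> \<Union>\<U>} = (\<Union>U\<in>\<U>. {z \<in> cball 0 1. glue \<rho> z \<in> U})"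
      by auto
    then show "openin (top_of_set (cball 0 1)) {z \<in> cball 0 1. glue \<rho> z \<in> \<Union>\<U>}"
      using * by (metis (no_types, lifting) imageE openin_Union)
  qed
  then show ?thesis
    by (simp add: surface_def)
qed

lemma topspace_surface: "topspace (surface \<rho>) = glue \<rho> ` cball 0 1"
proof
  show "topspace (surface \<rho>) \<subseteq> glue \<rho> ` cball 0 1"
    using openin_surface[of \<rho> "topspace (surface \<rho>)"] by simp
  have "{z \<in> cball 0 1. glue \<rho> z \<in> glue \<rho> ` cball 0 1} = topspace (top_of_set (cball 0 1))"
    by auto
  then have "openin (surface \<rho>) (glue \<rho> ` cball 0 1)"
    unfolding openin_surface by (metis openin_topspace order_refl)
  then show "glue \<rho> ` cball 0 1 \<subseteq> topspace (surface \<rho>)"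
    by (rule openin_subset)
qed

lemma quotient_map_glue: "quotient_map (top_of_set (cball 0 1)) (surface \<rho>) (glue \<rho>)"
  by (auto simp: quotient_map_def topspace_surface openin_surface)

definition surface_base :: "nat \<Rightarrow> complex set" where
  "surface_base \<rho> = glue \<rho> 1"

fun canonical_loop :: "nat \<Rightarrow> surface_gen \<Rightarrow> real \<Rightarrow> complex set" where
  "canonical_loop \<rho> (Alpha i) = (\<lambda>t. glue \<rho> (side \<rho> (4 * (i - 1)) t))"
| "canonical_loop \<rho> (Beta i) = (\<lambda>t. glue \<rho> (side \<rho> (4 * (i - 1) + 1) t))"

text \<open>
  A self-homeomorphism of a closed connected oriented surface preserves the orientation iff it
  fixes the fundamental class, which generates the infinite cyclic group \<open>H\<^sub>2\<close>.
\<close>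

definition orientation_preserving :: "'a topology \<Rightarrow> ('a \<Rightarrow> 'a) \<Rightarrow> bool" where
  "orientation_preserving T h \<longleftrightarrow>
     (\<forall>c \<in> carrier (homology_group 2 T). hom_induced 2 T {} T {} h c = c)"

text \<open>
  The surface group is identified with the fundamental group of the surface by the homomorphism
  \<open>\<Phi>\<close> that sends the canonical generators to the classes of the canonical loops.  It is
  determined by these values, it exists because the boundary of the polygon is contractible in
  the surface, and it is bijective by the theorem of Seifert and van Kampen.
\<close>

definition Aut_surface_group :: "nat \<Rightarrow> (surface_gen word set \<Rightarrow> surface_gen word set) set" where
  "Aut_surface_group \<rho> =
     (let \<Gamma> = surface_group \<rho>; T = surface \<rho>; x = surface_base \<rho>; \<pi> = fundamental_group T x
      in {\<xi> \<in> iso \<Gamma> \<Gamma>.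
            \<exists>h. homeomorphic_map T T h \<and> orientation_preserving T h \<and> h x = x \<and>
                (\<exists>\<Phi> \<in> hom \<Gamma> \<pi>.
                    (\<forall>s \<in> surface_gens \<rho>. \<Phi> (gen \<rho> s) = loop_class T x (canonical_loop \<rho> s)) \<and>
                    (\<forall>\<gamma> \<in> carrier \<Gamma>. \<Phi> (\<xi> \<gamma>) = pi1_induced T x h (\<Phi> \<gamma>)))})"

definition aut_equivalent ::
    "nat \<Rightarrow> ('a, 'b) monoid_scheme \<Rightarrow> (surface_gen word set \<Rightarrow> 'a) \<Rightarrow> (surface_gen word set \<Rightarrow> 'a) \<Rightarrow> bool"
  where
  "aut_equivalent \<rho> G \<eta>1 \<eta>2 \<longleftrightarrow>
     (\<exists>\<omega> \<in> iso G G. \<exists>\<xi> \<in> Aut_surface_group \<rho>. \<forall>\<gamma> \<in> carrier (surface_group \<rho>).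
        \<eta>2 \<gamma> = \<omega> (\<eta>1 (inv_into (carrier (surface_group \<rho>)) \<xi> \<gamma>)))"


section \<open>Finite abelian groups and the normal forms\<close>

text \<open>
  \<open>G\<close> is the internal direct product of the cyclic groups generated by \<open>\<omega> 1, \<dots>, \<omega> r\<close>, whose
  orders \<open>n 1, \<dots>, n r\<close> are the invariant factors.  The group operation of \<open>G\<close>
  is written multiplicatively here.
\<close>

definition invariant_factor_generators ::
    "('a, 'b) monoid_scheme \<Rightarrow> nat \<Rightarrow> (nat \<Rightarrow> nat) \<Rightarrow> (nat \<Rightarrow> 'a) \<Rightarrow> bool" where
  "invariant_factor_generators G r n \<omega> \<longleftrightarrow>
     (\<forall>i \<in> {1..r}. n i > 1 \<and> \<omega> i \<in> carrier G \<and> group.ord G (\<omega> i) = n i) \<and>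
     (\<forall>i. 1 \<le> i \<and> i < r \<longrightarrow> n (i + 1) \<le> n i \<and> n (i + 1) dvd n i) \<and>
     (\<lambda>x. finprod G x {1..r}) \<in> iso (product_group {1..r} (\<lambda>i. subgroup_generated G {\<omega> i})) G"

text \<open>
  The coefficients \<open>N i j\<close> are integers, not residues: they need not be reduced modulo \<open>n j\<close>, and
  \<open>N i j = 0\<close>, \<open>N i j = 1\<close> and the greatest common divisors refer to the integer itself.
\<close>

definition normal_form_small_rank ::
    "nat \<Rightarrow> ('a, 'b) monoid_scheme \<Rightarrow> nat \<Rightarrow> (nat \<Rightarrow> nat) \<Rightarrow> (nat \<Rightarrow> 'a) \<Rightarrow>
     (nat \<Rightarrow> nat \<Rightarrow> int) \<Rightarrow> (surface_gen word set \<Rightarrow> 'a) \<Rightarrow> bool" where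
  "normal_form_small_rank \<rho> G r n \<omega> N \<eta> \<longleftrightarrow>
     (\<forall>i \<in> {1..\<rho>}. \<eta> (gen \<rho> (Alpha i)) = (if i \<le> r then \<omega> i else \<one>\<^bsub>G\<^esub>)) \<and>
     (\<forall>i \<in> {1..\<rho>}. \<eta> (gen \<rho> (Beta i)) =
        (if i \<le> r then (\<Otimes>\<^bsub>G\<^esub>j\<in>{i+1..r}. \<omega> j [^]\<^bsub>G\<^esub> N i j) else \<one>\<^bsub>G\<^esub>)) \<and>
     (\<forall>i. 1 \<le> i \<and> i + 1 \<le> r \<longrightarrow>
        gcd (int (n (i + 1))) (N i (i + 1)) > 1 \<or> N i (i + 1) = 1) \<and>
     (\<forall>i j. 1 \<le> i \<and> i + 1 < j \<and> j \<le> r \<and> N i j \<noteq> 0 \<and> (\<forall>k \<in> {j+1..r}. N i k = 0) \<longrightarrow>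
        generate G {\<omega> j [^]\<^bsub>G\<^esub> N i j} \<subseteq> generate G {\<omega> j [^]\<^bsub>G\<^esub> N (i + 1) j})"

text \<open>
  The coefficient of \<open>\<omega> j\<close> in the expression for \<open>\<eta>(\<beta>\<^sub>i)\<close> in the case \<open>r > \<rho>\<close>: in the rows
  \<open>i > 2\<rho> - r\<close> the last coefficient is the constant \<open>1\<close> at \<open>j = 2\<rho> - i + 1\<close>.
\<close>

definition large_rank_coeff :: "nat \<Rightarrow> nat \<Rightarrow> (nat \<Rightarrow> nat \<Rightarrow> int) \<Rightarrow> nat \<Rightarrow> nat \<Rightarrow> int" where
  "large_rank_coeff \<rho> r N i j =
     (if i \<le> 2 * \<rho> - r then (if i < j \<and> j \<le> r then N i j else 0)
      else if j = 2 * \<rho> - i + 1 then 1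
      else if i < j \<and> j \<le> 2 * \<rho> - i then N i j
      else 0)"

definition normal_form_large_rank ::
    "nat \<Rightarrow> ('a, 'b) monoid_scheme \<Rightarrow> nat \<Rightarrow> (nat \<Rightarrow> nat) \<Rightarrow> (nat \<Rightarrow> 'a) \<Rightarrow>
     (nat \<Rightarrow> nat \<Rightarrow> int) \<Rightarrow> (surface_gen word set \<Rightarrow> 'a) \<Rightarrow> bool" where
  "normal_form_large_rank \<rho> G r n \<omega> N \<eta> \<longleftrightarrow>
     (\<forall>i \<in> {1..\<rho>}. \<eta> (gen \<rho> (Alpha i)) = \<omega> i) \<and>
     (\<forall>i. 1 \<le> i \<and> i \<le> 2 * \<rho> - r \<longrightarrow>
        \<eta> (gen \<rho> (Beta i)) = (\<Otimes>\<^bsub>G\<^esub>j\<in>{i+1..r}. \<omega> j [^]\<^bsub>G\<^esub> N i j)) \<and>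
     (\<forall>i. 2 * \<rho> - r < i \<and> i < \<rho> \<longrightarrow>
        \<eta> (gen \<rho> (Beta i)) =
          \<omega> (2 * \<rho> - i + 1) \<otimes>\<^bsub>G\<^esub> (\<Otimes>\<^bsub>G\<^esub>j\<in>{i+1..2*\<rho>-i}. \<omega> j [^]\<^bsub>G\<^esub> N i j)) \<and>
     \<eta> (gen \<rho> (Beta \<rho>)) = \<omega> (\<rho> + 1) \<and>
     (\<forall>i j. 2 * \<rho> - r < i \<and> i < \<rho> \<and> j \<in> {i+1..2*\<rho>-i} \<longrightarrow>
        \<not> group.ord G (\<omega> j [^]\<^bsub>G\<^esub> N i j) dvd n r \<or> N i j = 0) \<and>
     (\<forall>i j. 1 \<le> i \<and> i \<le> 2 * \<rho> - r \<and> i + 1 < j \<and> j \<le> r \<and>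
            N i j \<noteq> 0 \<and> (\<forall>k \<in> {j+1..r}. N i k = 0) \<longrightarrow>
        generate G {\<omega> j [^]\<^bsub>G\<^esub> N i j}
          \<subseteq> generate G {\<omega> j [^]\<^bsub>G\<^esub> large_rank_coeff \<rho> r N (i + 1) j}) \<and>
     (\<forall>i. 1 \<le> i \<and> i + 1 \<le> 2 * \<rho> - r \<longrightarrow>
        gcd (int (n i)) (N i (i + 1)) > 1 \<or> N i (i + 1) = 1)"

end

theory Submission
  imports Defs "HOL-Computational_Algebra.Primes"
begin

text \<open>
  An epimorphism is recorded by the integer matrices of the \<open>\<omega>\<close>-coordinates of \<open>\<eta>(\<alpha>\<^sub>i)\<close> and
  \<open>\<eta>(\<beta>\<^sub>i)\<close>. Three kinds of Dehn twists, about \<open>\<alpha>\<^sub>i\<close>, about \<open>\<beta>\<^sub>i\<close> and about a curve in the homology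
  class \<open>\<beta>\<^sub>i + \<beta>\<^sub>i\<^sub>+\<^sub>1\<close>, act on them by symplectic transvections. They provide Euclid's algorithm within
  a handle and between adjacent handles, and together with the automorphisms of \<open>G\<close> they make
  \<open>\<eta>(\<alpha>\<^sub>i) = \<omega>\<^sub>i\<close> and then reduce the coordinates of the \<open>\<eta>(\<beta>\<^sub>i)\<close>.

  Each twist is an explicit homeomorphism supported in an annulus made of one or two strips of
  parallel chords of the polygon. The image of every canonical loop under it is homotopic to a
  product of chords between vertices, which gives the induced automorphism. A twist fixes \<open>H\<^sub>2\<close>
  because it is the identity outside an open annulus, whose second homology group vanishes.
\<close>

section \<open>Homomorphisms out of the surface group\<close>

text \<open>An automorphism is given by words in the generators and a homeomorphism by a formula on
  the polygon; the two are matched on the canonical generators through \<open>surface_Phi\<close>.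
  That an annulus is embedded in the quotient is checked entirely in the disc, where its preimage
  consists of strips of parallel chords.

  Euclid's algorithm is run as a minimality argument over the whole orbit: a minimal positive entry
  divides its column, and surjectivity then makes it 1. For the \<beta>-rows the minimised quantity
  is a gcd with an order, whence the lemma that such a gcd is attained by adding one multiple.

  The obstacle is that a finished row cannot be left alone when one handle is added to another: the
  move disturbs an \<alpha>-row, and its repair by an automorphism of \<open>G\<close> disturbs the
  \<beta>-rows above. The lemma \<open>down\<close> confines this damage to multiples of
  \<open>A t\<close> in rows \<open>p < t\<close>, and \<open>A t\<close> vanishes in all columns
  where such a row must be zero. Scaling by units comes last because it preserves the gcds arranged
  before.\<close>

definition word_eval :: "('a, 'b) monoid_scheme \<Rightarrow> ('g \<Rightarrow> 'a) \<Rightarrow> 'g word \<Rightarrow> 'a" where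
  "word_eval G f w = foldr (\<lambda>(x, b) a. (if b then inv\<^bsub>G\<^esub> f x else f x) \<otimes>\<^bsub>G\<^esub> a) w \<one>\<^bsub>G\<^esub>"

lemma word_eval_Nil [simp]: "word_eval G f [] = \<one>\<^bsub>G\<^esub>"
  by (simp add: word_eval_def)

lemma word_eval_Cons [simp]:
  "word_eval G f ((x, b) # w) = (if b then inv\<^bsub>G\<^esub> f x else f x) \<otimes>\<^bsub>G\<^esub> word_eval G f w"
  by (simp add: word_eval_def)

lemma words_Cons [simp]: "(x, b) # w \<in> words S \<longleftrightarrow> x \<in> S \<and> w \<in> words S"
  by (auto simp: words_def)

text \<open>An element of the presented group is a set of words, so the induced map evaluates a
  chosen word. Evaluation is constant on classes as soon as the relators evaluate to one, which
  makes the choice harmless.\<close>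

definition pres_lift :: "('a, 'b) monoid_scheme \<Rightarrow> ('g \<Rightarrow> 'a) \<Rightarrow> 'g word set \<Rightarrow> 'a" where
  "pres_lift G f A = word_eval G f (SOME w. w \<in> A)"

context group
begin

lemma word_eval_closed [simp]:
  "f \<in> S \<rightarrow> carrier G \<Longrightarrow> w \<in> words S \<Longrightarrow> word_eval G f w \<in> carrier G"
  by (induction w) (auto simp: Pi_iff)

lemma word_eval_append:
  "f \<in> S \<rightarrow> carrier G \<Longrightarrow> u \<in> words S \<Longrightarrow> v \<in> words S \<Longrightarrow>
    word_eval G f (u @ v) = word_eval G f u \<otimes> word_eval G f v"
proof (induction u)
  case (Cons l u)
  obtain x b where "l = (x, b)" by fastforce
  then show ?case
    using Cons by (cases b) (auto simp: m_assoc Pi_iff)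
qed simp

lemma word_eval_pres_step:
  assumes "pres_step S R u v" "f \<in> S \<rightarrow> carrier G" "\<And>w. w \<in> R \<inter> words S \<Longrightarrow> word_eval G f w = \<one>"
  shows "word_eval G f u = word_eval G f v"
  using assms(1)
proof cases
  case (cancel u' v' x b)
  have fx: "f x \<in> carrier G" using cancel assms(2) by auto
  have "word_eval G f u = word_eval G f u' \<otimes> word_eval G f ([(x, b), (x, \<not> b)] @ v')"
    unfolding cancel(1) by (rule word_eval_append[OF assms(2)]) (use cancel in auto)
  also have "word_eval G f ([(x, b), (x, \<not> b)] @ v') = word_eval G f [(x, b), (x, \<not> b)] \<otimes> word_eval G f v'"
    by (rule word_eval_append[OF assms(2)]) (use cancel in auto)
  also have "word_eval G f [(x, b), (x, \<not> b)] = \<one>"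
    using fx by (cases b) auto
  finally show ?thesis
    using cancel assms(2) by (simp add: word_eval_append[of f S])
next
  case (relator u' v' w)
  then show ?thesis
    using assms(2,3) by (simp add: word_eval_append[of f S])
qed

lemma word_eval_equiv:
  assumes "equivclp (pres_step S R) u v" "f \<in> S \<rightarrow> carrier G"
    "\<And>w. w \<in> R \<inter> words S \<Longrightarrow> word_eval G f w = \<one>"
  shows "word_eval G f u = word_eval G f v"
  using assms(1)
  by (induction rule: equivclp_induct) (use word_eval_pres_step[OF _ assms(2,3)] in metis)+

lemma pres_lift_class:
  assumes "f \<in> S \<rightarrow> carrier G" "\<And>w. w \<in> R \<inter> words S \<Longrightarrow> word_eval G f w = \<one>"
  shows "pres_lift G f (pres_class S R w) = word_eval G f w"
proof -
  have "(SOME v. v \<in> pres_class S R w) \<in> pres_class S R w"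
    using pres_class_self by (metis someI)
  then show ?thesis
    unfolding pres_lift_def using word_eval_equiv[OF _ assms] by (simp add: pres_class_def)
qed

lemma pres_lift_hom:
  assumes "f \<in> S \<rightarrow> carrier G" "\<And>w. w \<in> R \<inter> words S \<Longrightarrow> word_eval G f w = \<one>"
  shows "pres_lift G f \<in> hom (presented_group S R) G"
proof (rule homI)
  have car: "carrier (presented_group S R) = pres_class S R ` words S"
    by (simp add: presented_group_def)
  fix x assume "x \<in> carrier (presented_group S R)"
  then obtain u where u: "u \<in> words S" "x = pres_class S R u"
    using car by auto
  then show "pres_lift G f x \<in> carrier G"
    using pres_lift_class[of f S R u] assms by simp
  fix y assume "y \<in> carrier (presented_group S R)"
  then obtain v where v: "v \<in> words S" "y = pres_class S R v"
    using car by auto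
  show "pres_lift G f (x \<otimes>\<^bsub>presented_group S R\<^esub> y) = pres_lift G f x \<otimes> pres_lift G f y"
    using u v pres_lift_class[of f S R, OF assms] assms(1)
    by (simp add: mult_presented_group word_eval_append)
qed

text \<open>Induction on the word: its class is the product of the classes of its letters, and
  \<open>(x, True)\<close> is the inverse of \<open>(x, False)\<close> by a single cancellation.
  Hence a homomorphism is determined by its values on the generators.\<close>

lemma hom_presented_group_eval:
  assumes h: "h \<in> hom (presented_group S R) G" and w: "w \<in> words S"
  shows "h (pres_class S R w) = word_eval G (\<lambda>x. h (pres_class S R [(x, False)])) w"
  using w
proof (induction w)
  case Nil
  interpret P: group "presented_group S R" by (rule group_presented_group)
  have "pres_class S R [] = \<one>\<^bsub>presented_group S R\<^esub>"
    by (simp add: presented_group_def)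
  then show ?case
    using hom_one[OF h] P.is_group is_group by simp
next
  case (Cons l w)
  interpret P: group "presented_group S R" by (rule group_presented_group)
  obtain x b where l: "l = (x, b)" by fastforce
  have x: "x \<in> S" and w: "w \<in> words S"
    using Cons.prems by (auto simp: l)
  have car: "pres_class S R v \<in> carrier (presented_group S R)" if "v \<in> words S" for v
    using that by (simp add: presented_group_def)
  have one: "pres_class S R [] = \<one>\<^bsub>presented_group S R\<^esub>"
    by (simp add: presented_group_def)
  have "pres_step S R ([] @ [(x, True), (x, \<not> True)] @ []) ([] @ [])"
    by (rule pres_step.cancel) (use x in auto)
  then have "equivclp (pres_step S R) [(x, True), (x, False)] []"
    by (simp add: r_into_equivclp)
  then have "pres_class S R [(x, True)] \<otimes>\<^bsub>presented_group S R\<^esub> pres_class S R [(x, False)] = \<one>\<^bsub>presented_group S R\<^esub>"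
    using x by (simp add: mult_presented_group one[symmetric] pres_class_eq_iff)
  then have "pres_class S R [(x, True)] = inv\<^bsub>presented_group S R\<^esub> pres_class S R [(x, False)]"
    using x by (intro P.inv_equality[symmetric] car) auto
  then have T: "h (pres_class S R [(x, True)]) = inv h (pres_class S R [(x, False)])"
    using x car[of "[(x, False)]"] h group_hom.hom_inv[of "presented_group S R" G h]
    by (simp add: group_hom_def group_hom_axioms_def P.is_group is_group)
  have "pres_class S R (l # w) = pres_class S R [(x, b)] \<otimes>\<^bsub>presented_group S R\<^esub> pres_class S R w"
    using x w by (simp add: mult_presented_group l)
  then have "h (pres_class S R (l # w)) = h (pres_class S R [(x, b)]) \<otimes> h (pres_class S R w)"
    using x w car h by (simp add: hom_mult)
  then show ?case
    using Cons.IH[OF w] T by (cases b) (auto simp: l)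
qed

end

lemma hom_presented_group_eqI:
  assumes "group G" "h \<in> hom (presented_group S R) G" "k \<in> hom (presented_group S R) G"
    and "\<And>x. x \<in> S \<Longrightarrow> h (pres_class S R [(x, False)]) = k (pres_class S R [(x, False)])"
    and "\<gamma> \<in> carrier (presented_group S R)"
  shows "h \<gamma> = k \<gamma>"
proof -
  interpret group G by fact
  obtain w where w: "w \<in> words S" "\<gamma> = pres_class S R w"
    using assms(5) by (auto simp: presented_group_def)
  have "word_eval G (\<lambda>x. h (pres_class S R [(x, False)])) w = word_eval G (\<lambda>x. k (pres_class S R [(x, False)])) w"
    using w(1)
  proof (induction w)
    case (Cons l w)
    then show ?case using assms(4) by (cases l) auto
  qed simp
  then show ?thesis
    using hom_presented_group_eval assms(2,3) w by metis
qed

definition surface_block :: "nat \<Rightarrow> surface_gen word" where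
  "surface_block i = [(Alpha i, False), (Beta i, False), (Alpha i, True), (Beta i, True)]"

lemma surface_relator_eq: "surface_relator \<rho> = concat (map surface_block [1..<Suc \<rho>])"
proof -
  have "surface_block = (\<lambda>i. [(Alpha i, False), (Beta i, False), (Alpha i, True), (Beta i, True)])"
    by (rule ext) (simp add: surface_block_def)
  then show ?thesis by (simp only: surface_relator_def)
qed

lemma surface_gens_iff [simp]:
  "Alpha i \<in> surface_gens \<rho> \<longleftrightarrow> 1 \<le> i \<and> i \<le> \<rho>" "Beta i \<in> surface_gens \<rho> \<longleftrightarrow> 1 \<le> i \<and> i \<le> \<rho>"
  by (auto simp: surface_gens_def)

lemma surface_block_words: "1 \<le> i \<Longrightarrow> i \<le> \<rho> \<Longrightarrow> surface_block i \<in> words (surface_gens \<rho>)"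
  by (simp add: surface_block_def)

lemma concat_surface_block_words:
  "set is \<subseteq> {1..\<rho>} \<Longrightarrow> concat (map surface_block is) \<in> words (surface_gens \<rho>)"
  by (induction "is") (auto simp: surface_block_words)

lemma surface_relator_words: "surface_relator \<rho> \<in> words (surface_gens \<rho>)"
  unfolding surface_relator_eq by (rule concat_surface_block_words) auto

lemma gen_carrier: "s \<in> surface_gens \<rho> \<Longrightarrow> gen \<rho> s \<in> carrier (surface_group \<rho>)"
  by (auto simp: gen_def surface_group_def presented_group_def)

definition surface_lift :: "nat \<Rightarrow> ('a, 'b) monoid_scheme \<Rightarrow> (surface_gen \<Rightarrow> 'a) \<Rightarrow> surface_gen word set \<Rightarrow> 'a" where
  "surface_lift \<rho> G f = pres_lift G f"

lemma surface_lift: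
  assumes "group G" "f \<in> surface_gens \<rho> \<rightarrow> carrier G" "word_eval G f (surface_relator \<rho>) = \<one>\<^bsub>G\<^esub>"
  shows "surface_lift \<rho> G f \<in> hom (surface_group \<rho>) G"
    and "s \<in> surface_gens \<rho> \<Longrightarrow> surface_lift \<rho> G f (gen \<rho> s) = f s"
proof -
  interpret group G by fact
  show "surface_lift \<rho> G f \<in> hom (surface_group \<rho>) G"
    unfolding surface_lift_def surface_group_def using assms(2,3) by (intro pres_lift_hom) auto
  show "surface_lift \<rho> G f (gen \<rho> s) = f s" if "s \<in> surface_gens \<rho>"
    unfolding surface_lift_def gen_def using assms(2,3) that
    by (subst pres_lift_class) (auto simp: Pi_iff)
qed

lemma surface_hom_eqI:
  assumes "group G" "h \<in> hom (surface_group \<rho>) G" "k \<in> hom (surface_group \<rho>) G"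
    and "\<And>s. s \<in> surface_gens \<rho> \<Longrightarrow> h (gen \<rho> s) = k (gen \<rho> s)"
    and "\<gamma> \<in> carrier (surface_group \<rho>)"
  shows "h \<gamma> = k \<gamma>"
  using hom_presented_group_eqI[OF assms(1)] assms(2-5) unfolding surface_group_def gen_def by blast

lemma surface_hom_eval:
  assumes "group G" "h \<in> hom (surface_group \<rho>) G"
  shows "word_eval G (\<lambda>s. h (gen \<rho> s)) (surface_relator \<rho>) = \<one>\<^bsub>G\<^esub>"
proof -
  interpret group G by fact
  let ?R = "{surface_relator \<rho>}" and ?S = "surface_gens \<rho>"
  have "pres_step ?S ?R ([] @ surface_relator \<rho> @ []) ([] @ [])"
    by (rule pres_step.relator) (use surface_relator_words in auto)
  then have "pres_class ?S ?R (surface_relator \<rho>) = pres_class ?S ?R []"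
    by (simp add: pres_class_eq_iff r_into_equivclp)
  then show ?thesis
    using hom_presented_group_eval[of h ?S ?R "surface_relator \<rho>"]
      hom_presented_group_eval[of h ?S ?R "[]"] assms(2) surface_relator_words
    by (simp add: gen_def surface_group_def)
qed

text \<open>Both composites of the two lifts fix the generators and are therefore the identity, so
  the lift of \<open>g\<close> is the inverse map.\<close>

lemma surface_iso:
  assumes f: "f \<in> surface_gens \<rho> \<rightarrow> carrier (surface_group \<rho>)" "word_eval (surface_group \<rho>) f (surface_relator \<rho>) = \<one>\<^bsub>surface_group \<rho>\<^esub>"
    and g: "g \<in> surface_gens \<rho> \<rightarrow> carrier (surface_group \<rho>)" "word_eval (surface_group \<rho>) g (surface_relator \<rho>) = \<one>\<^bsub>surface_group \<rho>\<^esub>"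
    and gf: "\<And>s. s \<in> surface_gens \<rho> \<Longrightarrow> surface_lift \<rho> (surface_group \<rho>) g (f s) = gen \<rho> s"
    and fg: "\<And>s. s \<in> surface_gens \<rho> \<Longrightarrow> surface_lift \<rho> (surface_group \<rho>) f (g s) = gen \<rho> s"
  shows "surface_lift \<rho> (surface_group \<rho>) f \<in> iso (surface_group \<rho>) (surface_group \<rho>)"
proof -
  have G: "group (surface_group \<rho>)" by (simp add: group_surface_group)
  let ?F = "surface_lift \<rho> (surface_group \<rho>) f" and ?H = "surface_lift \<rho> (surface_group \<rho>) g"
  have F: "?F \<in> hom (surface_group \<rho>) (surface_group \<rho>)" and H: "?H \<in> hom (surface_group \<rho>) (surface_group \<rho>)"
    using surface_lift(1)[OF G] f g by blast+
  have id: "(\<lambda>x. x) \<in> hom (surface_group \<rho>) (surface_group \<rho>)" by (simp add: hom_def)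
  have "?H (?F x) = x" if "x \<in> carrier (surface_group \<rho>)" for x
    using surface_hom_eqI[OF G, of "?H \<circ> ?F" \<rho> "\<lambda>x. x"] id that gf
      hom_compose[OF F H] surface_lift(2)[OF G f]
    by auto
  moreover have "?F (?H x) = x" if "x \<in> carrier (surface_group \<rho>)" for x
    using surface_hom_eqI[OF G, of "?F \<circ> ?H" \<rho> "\<lambda>x. x"] id that fg
      hom_compose[OF H F] surface_lift(2)[OF G g]
    by auto
  ultimately have "bij_betw ?F (carrier (surface_group \<rho>)) (carrier (surface_group \<rho>))"
    using F H by (intro bij_betw_byWitness[where f' = ?H]) (auto simp: hom_def)
  then show ?thesis
    using F by (simp add: iso_def)
qed

section \<open>The fundamental group\<close>

abbreviation loop_homotopic :: "'a topology \<Rightarrow> 'a \<Rightarrow> (real \<Rightarrow> 'a) \<Rightarrow> (real \<Rightarrow> 'a) \<Rightarrow> bool" where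
  "loop_homotopic X x \<equiv> homotopic_with (\<lambda>h. h 0 = x \<and> h 1 = x) (top_of_set {0..1}) X"

text \<open>The straight-line homotopy in the convex set \<open>C\<close>, pushed forward by \<phi>.
  It serves twice: with the unit interval as \<open>C\<close> for reparametrisations, and with the
  disc for paths in the polygon.\<close>

lemma loop_homotopic_convex:
  fixes C :: "'c::real_normed_vector set"
  assumes \<phi>: "continuous_map (top_of_set C) X \<phi>" and C: "convex C"
    and f: "continuous_on {0..1} f" "f ` {0..1} \<subseteq> C" and g: "continuous_on {0..1} g" "g ` {0..1} \<subseteq> C"
    and e: "f 0 = g 0" "f 1 = g 1" "\<phi> (f 0) = x" "\<phi> (f 1) = x"
    and p: "\<And>t. t \<in> {0..1} \<Longrightarrow> p t = \<phi> (f t)" and q: "\<And>t. t \<in> {0..1} \<Longrightarrow> q t = \<phi> (g t)"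
  shows "loop_homotopic X x p q"
proof -
  define h where "h = (\<lambda>z :: real \<times> real. (1 - fst z) *\<^sub>R f (snd z) + fst z *\<^sub>R g (snd z))"
  have "continuous_on ({0..1} \<times> {0..1}) h"
    unfolding h_def
    by (intro continuous_intros continuous_on_compose2[OF f(1)] continuous_on_compose2[OF g(1)]) auto
  moreover have "h ` ({0..1} \<times> {0..1}) \<subseteq> C"
  proof clarify
    fix s t :: real assume "s \<in> {0..1}" "t \<in> {0..1}"
    then show "h (s, t) \<in> C"
      unfolding h_def using convexD[OF C, of "f t" "g t" "1 - s" s] f(2) g(2)
      by (simp add: image_subset_iff)
  qed
  ultimately have "continuous_map (top_of_set ({0..1} \<times> {0..1})) (top_of_set C) h"
    by (auto simp: continuous_map_in_subtopology)
  then have "continuous_map (top_of_set ({0..1} \<times> {0..1})) X (\<phi> \<circ> h)"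
    using \<phi> continuous_map_compose by blast
  then have ch: "continuous_map (prod_topology (top_of_set {0..1}) (top_of_set {0..1})) X (\<phi> \<circ> h)"
    by (simp add: prod_topology_subtopology_eu)
  have "loop_homotopic X x (\<phi> \<circ> f) (\<phi> \<circ> g)"
    unfolding homotopic_with_def
    by (rule exI[of _ "\<phi> \<circ> h"]) (use ch e in \<open>auto simp: h_def simp flip: scaleR_add_left\<close>)
  then show ?thesis
    by (rule homotopic_with_eq) (use p q in auto)
qed

context
  fixes X :: "'a topology" and x :: 'a
begin

lemma loop_class_eqI: "loop_homotopic X x p q \<Longrightarrow> loop_class X x p = loop_class X x q"
  unfolding loop_class_def using homotopic_with_sym homotopic_with_trans by blast

lemma mem_loop_class_self: "p \<in> loops X x \<Longrightarrow> p \<in> loop_class X x p"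
  by (simp add: loop_class_def loops_def pathin_def)

text \<open>Paths are functions on all of the reals, but a loop class only sees the values on the
  unit interval.\<close>

lemma loop_class_eq_on:
  assumes "p \<in> loops X x" "\<And>t. t \<in> {0..1} \<Longrightarrow> p t = q t"
  shows "loop_class X x p = loop_class X x q"
proof (rule loop_class_eqI, rule homotopic_with_equal)
  show "continuous_map (top_of_set {0..1}) X p" using assms by (simp add: loops_def pathin_def)
qed (use assms in \<open>auto simp: loops_def\<close>)

lemma loop_join_loops:
  assumes "p \<in> loops X x" "q \<in> loops X x"
  shows "loop_join p q \<in> loops X x"
proof -
  have "continuous_map (top_of_set {0..1}) X (\<lambda>t. if t \<le> 1/2 then (p \<circ> (\<lambda>t. 2 * t)) t else (q \<circ> (\<lambda>t. 2 * t - 1)) t)"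
  proof (rule continuous_map_cases_le)
    show "continuous_map (subtopology (top_of_set {0..1}) {t \<in> topspace (top_of_set {0..1}). t \<le> 1/2}) X (p \<circ> (\<lambda>t. 2 * t))"
      using assms by (intro continuous_map_compose[where X' = "top_of_set {0..1}"])
        (auto simp: loops_def pathin_def subtopology_subtopology continuous_map_in_subtopology intro!: continuous_intros)
    show "continuous_map (subtopology (top_of_set {0..1}) {t \<in> topspace (top_of_set {0..1}). 1/2 \<le> t}) X (q \<circ> (\<lambda>t. 2 * t - 1))"
      using assms by (intro continuous_map_compose[where X' = "top_of_set {0..1}"])
        (auto simp: loops_def pathin_def subtopology_subtopology continuous_map_in_subtopology intro!: continuous_intros)
    show "(p \<circ> (\<lambda>t. 2 * t)) t = (q \<circ> (\<lambda>t. 2 * t - 1)) t" if "t \<in> topspace (top_of_set {0..1})" "t = 1/2" for t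
      unfolding that(2) using assms by (simp add: loops_def)
  qed auto
  then have "continuous_map (top_of_set {0..1}) X (loop_join p q)"
    by (simp only: loop_join_def o_def)
  then show ?thesis
    using assms by (simp add: loops_def pathin_def loop_join_def)
qed

lemma loop_join_homotopic:
  assumes "loop_homotopic X x p p'" "loop_homotopic X x q q'"
  shows "loop_homotopic X x (loop_join p q) (loop_join p' q')"
proof -
  let ?I = "top_of_set {0..1::real}"
  let ?II = "prod_topology ?I ?I"
  obtain h where h: "continuous_map ?II X h" "\<And>t. h (0, t) = p t" "\<And>t. h (1, t) = p' t"
      "\<And>s. s \<in> {0..1} \<Longrightarrow> h (s, 0) = x \<and> h (s, 1) = x"
    using assms(1) unfolding homotopic_with_def by auto
  obtain k where k: "continuous_map ?II X k" "\<And>t. k (0, t) = q t" "\<And>t. k (1, t) = q' t"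
      "\<And>s. s \<in> {0..1} \<Longrightarrow> k (s, 0) = x \<and> k (s, 1) = x"
    using assms(2) unfolding homotopic_with_def by auto
  have II: "?II = top_of_set ({0..1} \<times> {0..1})"
    by (simp add: prod_topology_subtopology_eu)
  have "continuous_map ?II X (\<lambda>z. if snd z \<le> 1/2 then (h \<circ> (\<lambda>z. (fst z, 2 * snd z))) z
      else (k \<circ> (\<lambda>z. (fst z, 2 * snd z - 1))) z)"
  proof (rule continuous_map_cases_le)
    show "continuous_map (subtopology ?II {z \<in> topspace ?II. snd z \<le> 1/2}) X (h \<circ> (\<lambda>z. (fst z, 2 * snd z)))"
      using h(1) unfolding II by (intro continuous_map_compose[where X' = "top_of_set ({0..1} \<times> {0..1})"])
        (auto simp: subtopology_subtopology continuous_map_in_subtopology intro!: continuous_intros)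
    show "continuous_map (subtopology ?II {z \<in> topspace ?II. 1/2 \<le> snd z}) X (k \<circ> (\<lambda>z. (fst z, 2 * snd z - 1)))"
      using k(1) unfolding II by (intro continuous_map_compose[where X' = "top_of_set ({0..1} \<times> {0..1})"])
        (auto simp: subtopology_subtopology continuous_map_in_subtopology intro!: continuous_intros)
    show "continuous_map ?II euclideanreal snd"
      unfolding II by (auto intro!: continuous_intros)
    show "(h \<circ> (\<lambda>z. (fst z, 2 * snd z))) z = (k \<circ> (\<lambda>z. (fst z, 2 * snd z - 1))) z"
      if "z \<in> topspace ?II" "snd z = 1/2" for z
      unfolding o_def that(2) using that(1) h(4) k(4) by (auto simp: II)
  qed auto
  then have "continuous_map ?II X (\<lambda>z. if snd z \<le> 1/2 then h (fst z, 2 * snd z) else k (fst z, 2 * snd z - 1))"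
    by (simp only: o_def)
  then show ?thesis
    unfolding homotopic_with_def
    by (intro exI[of _ "\<lambda>z. if snd z \<le> 1/2 then h (fst z, 2 * snd z) else k (fst z, 2 * snd z - 1)"])
      (use h k in \<open>auto simp: loop_join_def o_def\<close>)
qed

lemma mult_fundamental_group:
  assumes "p \<in> loops X x" "q \<in> loops X x"
  shows "loop_class X x p \<otimes>\<^bsub>fundamental_group X x\<^esub> loop_class X x q = loop_class X x (loop_join p q)"
proof -
  have e: "loop_class X x (loop_join p' q') = loop_class X x (loop_join p q)"
    if "p' \<in> loop_class X x p" "q' \<in> loop_class X x q" for p' q'
    using loop_class_eqI[OF loop_join_homotopic, of p p' q q'] that by (simp add: loop_class_def)
  then have "(\<Union>p'\<in>loop_class X x p. \<Union>q'\<in>loop_class X x q. loop_class X x (loop_join p' q')) =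
      (\<Union>p'\<in>loop_class X x p. \<Union>q'\<in>loop_class X x q. loop_class X x (loop_join p q))"
    by simp
  also have "\<dots> = loop_class X x (loop_join p q)"
    using mem_loop_class_self[OF assms(1)] mem_loop_class_self[OF assms(2)] by blast
  finally show ?thesis
    by (simp add: fundamental_group_def)
qed

lemma carrier_fundamental_group: "carrier (fundamental_group X x) = loop_class X x ` loops X x"
  and one_fundamental_group: "\<one>\<^bsub>fundamental_group X x\<^esub> = loop_class X x (\<lambda>_. x)"
  by (simp_all add: fundamental_group_def)

text \<open>The parameter functions \<open>f\<close> and \<open>g\<close> have the same ends, so
  they are homotopic in the interval, and \<open>p\<close> carries this homotopy to the space.
  Associativity, the unit law and inverses are all instances.\<close>

lemma loop_class_reparam:
  assumes p: "p \<in> loops X x"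
    and f: "continuous_on {0..1} f" "f ` {0..1} \<subseteq> {0..1}" and g: "continuous_on {0..1} g" "g ` {0..1} \<subseteq> {0..1}"
    and e: "f 0 = g 0" "f 1 = g 1" "p (f 0) = x" "p (f 1) = x"
    and q: "\<And>t. t \<in> {0..1} \<Longrightarrow> q t = p (f t)" and r: "\<And>t. t \<in> {0..1} \<Longrightarrow> r t = p (g t)"
  shows "loop_class X x q = loop_class X x r"
  by (rule loop_class_eqI, rule loop_homotopic_convex[where \<phi> = p and C = "{0..1}" and f = f and g = g])
    (use assms in \<open>auto simp: loops_def pathin_def\<close>)

lemma const_loop: "x \<in> topspace X \<Longrightarrow> (\<lambda>_. x) \<in> loops X x"
  by (simp add: loops_def pathin_def)

lemma reverse_loop:
  assumes "p \<in> loops X x" shows "(\<lambda>t. p (1 - t)) \<in> loops X x"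
proof -
  have "continuous_map (top_of_set {0..1}) X (p \<circ> (\<lambda>t. 1 - t))"
    using assms by (intro continuous_map_compose[where X' = "top_of_set {0..1}"])
        (auto simp: loops_def pathin_def continuous_map_in_subtopology intro!: continuous_intros)
  then show ?thesis using assms by (simp add: loops_def pathin_def o_def)
qed

lemma loop_class_join_reverse:
  assumes "p \<in> loops X x"
  shows "loop_class X x (loop_join (\<lambda>t. p (1 - t)) p) = loop_class X x (\<lambda>_. x)"
\<comment> \<open>The joined loop is \<open>p\<close> evaluated along |1 - 2t|, which runs from 1 to
  0 and back; it is compared with the constant parameter 1.\<close>
proof (rule loop_class_reparam[OF assms, where f = "\<lambda>t. \<bar>1 - 2 * t\<bar>" and g = "\<lambda>_. 1"])
  show "continuous_on {0..1} (\<lambda>t::real. \<bar>1 - 2 * t\<bar>)"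
    by (intro continuous_intros)
qed (use assms in \<open>auto simp: loops_def loop_join_def abs_if intro!: arg_cong[of _ _ p]\<close>)

lemma group_fundamental_group:
  assumes x: "x \<in> topspace X"
  shows "group (fundamental_group X x)"
proof (rule groupI)
  let ?P = "fundamental_group X x"
  note car = carrier_fundamental_group and one = one_fundamental_group
  show "\<one>\<^bsub>?P\<^esub> \<in> carrier ?P"
    using const_loop[OF x] by (simp add: car one)
  show "a \<otimes>\<^bsub>?P\<^esub> b \<in> carrier ?P" if "a \<in> carrier ?P" "b \<in> carrier ?P" for a b
    using that loop_join_loops by (auto simp: car mult_fundamental_group)
  show "a \<otimes>\<^bsub>?P\<^esub> b \<otimes>\<^bsub>?P\<^esub> c = a \<otimes>\<^bsub>?P\<^esub> (b \<otimes>\<^bsub>?P\<^esub> c)"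
    if abc: "a \<in> carrier ?P" "b \<in> carrier ?P" "c \<in> carrier ?P" for a b c
  proof -
    obtain p q r where p: "p \<in> loops X x" "a = loop_class X x p" and q: "q \<in> loops X x" "b = loop_class X x q"
        and r: "r \<in> loops X x" "c = loop_class X x r"
      using abc by (auto simp: car)
    \<comment> \<open>The piecewise linear map with slopes 1/2, 1 and 2 and corners at 1/2 and 3/4;
      the form with \<open>max\<close> and \<open>min\<close> makes continuity immediate.\<close>
    let ?f = "\<lambda>t::real. max (t / 2) (max (min (t - 1/4) (1/2)) (2 * t - 1))"
    have "loop_class X x (loop_join p (loop_join q r)) = loop_class X x (loop_join (loop_join p q) r)"
    proof (rule loop_class_reparam[where f = ?f and g = "\<lambda>t. t" and p = "loop_join (loop_join p q) r"])
      show "loop_join p (loop_join q r) t = loop_join (loop_join p q) r (?f t)" if "t \<in> {0..1}" for t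
      proof -
        consider "t \<le> 1/2" | "1/2 < t" "t \<le> 3/4" | "3/4 < t" by linarith
        then show ?thesis
        proof cases
          case 1
          then have "?f t = t / 2" using that by (auto simp: max_def min_def)
          then show ?thesis using 1 by (simp add: loop_join_def)
        next
          case 2
          then have "?f t = t - 1/4" using that by (auto simp: max_def min_def)
          then show ?thesis using 2 by (simp add: loop_join_def algebra_simps)
        next
          case 3
          then have "?f t = 2 * t - 1" using that by (auto simp: max_def min_def)
          then show ?thesis using 3 by (simp add: loop_join_def algebra_simps)
        qed
      qed
      show "continuous_on {0..1} ?f"
        by (intro continuous_intros) auto
      show "loop_join (loop_join p q) r \<in> loops X x"
        using p q r loop_join_loops by blast
    qed (use p q r in \<open>auto simp: loop_join_def loops_def max_def min_def\<close>)
    then show ?thesis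
      using p q r loop_join_loops by (simp add: mult_fundamental_group)
  qed
  show "\<one>\<^bsub>?P\<^esub> \<otimes>\<^bsub>?P\<^esub> a = a" if "a \<in> carrier ?P" for a
  proof -
    obtain p where p: "p \<in> loops X x" "a = loop_class X x p"
      using \<open>a \<in> carrier ?P\<close> by (auto simp: car)
    have "loop_class X x (loop_join (\<lambda>_. x) p) = loop_class X x p"
    proof (rule loop_class_reparam[OF p(1), where f = "\<lambda>t. max 0 (2 * t - 1)" and g = "\<lambda>t. t"])
      show "loop_join (\<lambda>_. x) p t = p (max 0 (2 * t - 1))" if "t \<in> {0..1}" for t
      proof (cases "t \<le> 1/2")
        case True
        then have "max 0 (2 * t - 1) = 0" by simp
        then show ?thesis using True p(1) by (simp add: loop_join_def loops_def)
      qed (simp add: loop_join_def)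
    qed (use p(1) in \<open>auto simp: loops_def intro!: continuous_intros\<close>)
    then show ?thesis
      using p const_loop[OF x] by (simp add: one mult_fundamental_group)
  qed
  show "\<exists>b\<in>carrier ?P. b \<otimes>\<^bsub>?P\<^esub> a = \<one>\<^bsub>?P\<^esub>" if "a \<in> carrier ?P" for a
  proof -
    obtain p where p: "p \<in> loops X x" "a = loop_class X x p"
      using \<open>a \<in> carrier ?P\<close> by (auto simp: car)
    then have "loop_class X x (\<lambda>t. p (1 - t)) \<otimes>\<^bsub>?P\<^esub> a = \<one>\<^bsub>?P\<^esub>"
      using reverse_loop loop_class_join_reverse by (simp add: mult_fundamental_group one)
    then show ?thesis
      using reverse_loop[OF p(1)] car by blast
  qed
qed

lemma loops_compose:
  assumes "continuous_map X X h" "h x = x" "p \<in> loops X x"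
  shows "h \<circ> p \<in> loops X x"
  using assms continuous_map_compose by (auto simp: loops_def pathin_def)

lemma pi1_induced_loop_class:
  assumes h: "continuous_map X X h" "h x = x" and p: "p \<in> loops X x"
  shows "pi1_induced X x h (loop_class X x p) = loop_class X x (h \<circ> p)"
proof -
  have "loop_class X x (h \<circ> q) = loop_class X x (h \<circ> p)" if "q \<in> loop_class X x p" for q
  proof (rule loop_class_eqI[symmetric])
    have "loop_homotopic X x p q" using that by (simp add: loop_class_def)
    then show "loop_homotopic X x (h \<circ> p) (h \<circ> q)"
      by (rule homotopic_with_compose_continuous_map_left[OF _ h(1)]) (use h(2) in auto)
  qed
  then show ?thesis
    using mem_loop_class_self[OF p] unfolding pi1_induced_def by blast
qed

lemma pi1_induced_hom:
  assumes h: "continuous_map X X h" "h x = x"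
  shows "pi1_induced X x h \<in> hom (fundamental_group X x) (fundamental_group X x)"
proof (rule homI)
  fix a assume "a \<in> carrier (fundamental_group X x)"
  then obtain p where p: "p \<in> loops X x" "a = loop_class X x p" by (auto simp: carrier_fundamental_group)
  then show "pi1_induced X x h a \<in> carrier (fundamental_group X x)"
    using loops_compose[OF h p(1)] by (simp add: pi1_induced_loop_class[OF h] carrier_fundamental_group)
  fix b assume "b \<in> carrier (fundamental_group X x)"
  then obtain q where q: "q \<in> loops X x" "b = loop_class X x q" by (auto simp: carrier_fundamental_group)
  have "h \<circ> loop_join p q = loop_join (h \<circ> p) (h \<circ> q)"
    by (auto simp: loop_join_def)
  then show "pi1_induced X x h (a \<otimes>\<^bsub>fundamental_group X x\<^esub> b) =
      pi1_induced X x h a \<otimes>\<^bsub>fundamental_group X x\<^esub> pi1_induced X x h b"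
    using p q loop_join_loops loops_compose[OF h]
    by (simp add: pi1_induced_loop_class[OF h] mult_fundamental_group)
qed

end

section \<open>Automorphisms of the surface group\<close>

context group
begin

lemma inv_mult_cancel_left [simp]: "x \<in> carrier G \<Longrightarrow> y \<in> carrier G \<Longrightarrow> inv x \<otimes> (x \<otimes> y) = y"
  by (simp flip: m_assoc)

lemma mult_inv_cancel_left [simp]: "x \<in> carrier G \<Longrightarrow> y \<in> carrier G \<Longrightarrow> x \<otimes> (inv x \<otimes> y) = y"
  by (simp flip: m_assoc)

lemma word_eval_surface_blocks:
  assumes f: "f \<in> surface_gens \<rho> \<rightarrow> carrier G" and f': "f' \<in> surface_gens \<rho> \<rightarrow> carrier G"
    and "set is \<subseteq> {1..\<rho>}"
    and "\<And>j. j \<in> set is \<Longrightarrow> word_eval G f' (surface_block j) = word_eval G f (surface_block j)"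
  shows "word_eval G f' (concat (map surface_block is)) = word_eval G f (concat (map surface_block is))"
  using assms(3,4)
proof (induction "is")
  case (Cons j "is")
  then show ?case
    using word_eval_append[OF f, of "surface_block j"] word_eval_append[OF f', of "surface_block j"]
      surface_block_words[of j \<rho>] concat_surface_block_words[of "is" \<rho>] by simp
qed simp

text \<open>A substitution mixing the handles \<open>i\<close> and \<open>Suc i\<close> need not
  preserve their two commutators separately: only the product of these adjacent blocks enters the
  relator.\<close>

lemma word_eval_surface_relator_cong:
  assumes f: "f \<in> surface_gens \<rho> \<rightarrow> carrier G" and f': "f' \<in> surface_gens \<rho> \<rightarrow> carrier G"
    and i: "1 \<le> i" "i < \<rho>"
    and e: "\<And>j. j \<in> {1..\<rho>} \<Longrightarrow> j \<noteq> i \<Longrightarrow> j \<noteq> Suc i \<Longrightarrow>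
      word_eval G f' (surface_block j) = word_eval G f (surface_block j)"
    and ei: "word_eval G f' (surface_block i @ surface_block (Suc i)) =
      word_eval G f (surface_block i @ surface_block (Suc i))"
  shows "word_eval G f' (surface_relator \<rho>) = word_eval G f (surface_relator \<rho>)"
proof -
  define u where "u = concat (map surface_block [1..<i])"
  define v where "v = concat (map surface_block [Suc (Suc i)..<Suc \<rho>])"
  have "[1..<Suc \<rho>] = [1..<i] @ [i..<Suc \<rho>]"
    using upt_add_eq_append[of 1 i "Suc \<rho> - i"] i by simp
  also have "[i..<Suc \<rho>] = i # Suc i # [Suc (Suc i)..<Suc \<rho>]"
    using i by (simp add: upt_conv_Cons)
  finally have r: "surface_relator \<rho> = u @ (surface_block i @ surface_block (Suc i)) @ v"
    by (simp add: surface_relator_eq u_def v_def)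
  have "set [1..<i] \<subseteq> {1..\<rho>}" "set [Suc (Suc i)..<Suc \<rho>] \<subseteq> {1..\<rho>}"
    using i by (auto simp del: upt_Suc)
  then have w: "u \<in> words (surface_gens \<rho>)" "v \<in> words (surface_gens \<rho>)"
    "surface_block i @ surface_block (Suc i) \<in> words (surface_gens \<rho>)"
    unfolding u_def v_def words_append
    using i by (intro concat_surface_block_words conjI surface_block_words; simp)+
  have "word_eval G f' u = word_eval G f u" "word_eval G f' v = word_eval G f v"
    unfolding u_def v_def
    by (rule word_eval_surface_blocks[OF f f']; use i e in \<open>auto simp del: upt_Suc\<close>)+
  then show ?thesis
    unfolding r using w ei f f'
    by (simp only: word_eval_append[OF f] word_eval_append[OF f'] words_append)
qed

end

lemma hom_word_eval:
  assumes "group G" "group H" "h \<in> hom G H" "f \<in> S \<rightarrow> carrier G" "w \<in> words S"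
  shows "h (word_eval G f w) = word_eval H (\<lambda>s. h (f s)) w"
  using assms(5)
proof (induction w)
  case Nil
  then show ?case using hom_one assms by fastforce
next
  case (Cons l w)
  interpret group_hom G H h
    using assms by (simp add: group_hom_def group_hom_axioms_def)
  obtain x b where l: "l = (x, b)" by fastforce
  then show ?case
    using Cons assms(4) G.word_eval_closed[OF assms(4)] by (cases b) (auto simp: Pi_iff)
qed

lemma word_eval_cong:
  "(\<And>s. s \<in> S \<Longrightarrow> f s = g s) \<Longrightarrow> w \<in> words S \<Longrightarrow> word_eval G f w = word_eval G g w"
  by (induction w) auto

definition word_subst :: "nat \<Rightarrow> (surface_gen \<Rightarrow> surface_gen word) \<Rightarrow> surface_gen word set \<Rightarrow> surface_gen word set" where
  "word_subst \<rho> \<sigma> = surface_lift \<rho> (surface_group \<rho>) (\<lambda>s. word_eval (surface_group \<rho>) (gen \<rho>) (\<sigma> s))"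

lemma gen_Pi: "gen \<rho> \<in> surface_gens \<rho> \<rightarrow> carrier (surface_group \<rho>)"
  using gen_carrier by auto

text \<open>The identities are required for every assignment \<open>f\<close> into the group, so
  they can be verified by formal cancellation of words. For \<open>gen\<close> they say that both
  substitutions respect the relator and are inverse to each other.\<close>

lemma word_subst_iso:
  assumes \<sigma>: "\<And>s. s \<in> surface_gens \<rho> \<Longrightarrow> \<sigma> s \<in> words (surface_gens \<rho>)"
    and \<tau>: "\<And>s. s \<in> surface_gens \<rho> \<Longrightarrow> \<tau> s \<in> words (surface_gens \<rho>)"
    and rel: "\<And>f. f \<in> surface_gens \<rho> \<rightarrow> carrier (surface_group \<rho>) \<Longrightarrow>
        word_eval (surface_group \<rho>) (\<lambda>s. word_eval (surface_group \<rho>) f (\<sigma> s)) (surface_relator \<rho>) =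
        word_eval (surface_group \<rho>) f (surface_relator \<rho>)"
      "\<And>f. f \<in> surface_gens \<rho> \<rightarrow> carrier (surface_group \<rho>) \<Longrightarrow>
        word_eval (surface_group \<rho>) (\<lambda>s. word_eval (surface_group \<rho>) f (\<tau> s)) (surface_relator \<rho>) =
        word_eval (surface_group \<rho>) f (surface_relator \<rho>)"
    and inv: "\<And>s f. f \<in> surface_gens \<rho> \<rightarrow> carrier (surface_group \<rho>) \<Longrightarrow> s \<in> surface_gens \<rho> \<Longrightarrow>
        word_eval (surface_group \<rho>) (\<lambda>s. word_eval (surface_group \<rho>) f (\<sigma> s)) (\<tau> s) = f s"
      "\<And>s f. f \<in> surface_gens \<rho> \<rightarrow> carrier (surface_group \<rho>) \<Longrightarrow> s \<in> surface_gens \<rho> \<Longrightarrow>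
        word_eval (surface_group \<rho>) (\<lambda>s. word_eval (surface_group \<rho>) f (\<tau> s)) (\<sigma> s) = f s"
  shows "word_subst \<rho> \<sigma> \<in> iso (surface_group \<rho>) (surface_group \<rho>)"
    and "s \<in> surface_gens \<rho> \<Longrightarrow> word_subst \<rho> \<sigma> (gen \<rho> s) = word_eval (surface_group \<rho>) (gen \<rho>) (\<sigma> s)"
proof -
  interpret group "surface_group \<rho>" by (rule group_surface_group)
  let ?f = "\<lambda>\<sigma> s. word_eval (surface_group \<rho>) (gen \<rho>) (\<sigma> s)"
  have "(\<lambda>\<gamma>. \<gamma>) \<in> hom (surface_group \<rho>) (surface_group \<rho>)"
    by (simp add: hom_def)
  from surface_hom_eval[OF is_group this] have R: "word_eval (surface_group \<rho>) (gen \<rho>) (surface_relator \<rho>) = \<one>\<^bsub>surface_group \<rho>\<^esub>"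
    by simp
  have c: "?f \<sigma> \<in> surface_gens \<rho> \<rightarrow> carrier (surface_group \<rho>)" "?f \<tau> \<in> surface_gens \<rho> \<rightarrow> carrier (surface_group \<rho>)"
    using word_eval_closed[OF gen_Pi] \<sigma> \<tau> by auto
  have e: "word_eval (surface_group \<rho>) (?f \<sigma>) (surface_relator \<rho>) = \<one>\<^bsub>surface_group \<rho>\<^esub>"
    "word_eval (surface_group \<rho>) (?f \<tau>) (surface_relator \<rho>) = \<one>\<^bsub>surface_group \<rho>\<^esub>"
    using rel gen_Pi R by auto
  show "word_subst \<rho> \<sigma> (gen \<rho> s) = ?f \<sigma> s" if "s \<in> surface_gens \<rho>"
    unfolding word_subst_def using surface_lift(2)[OF is_group c(1) e(1) that] .
  have lift: "surface_lift \<rho> (surface_group \<rho>) (?f \<beta>) (?f \<alpha> s) = word_eval (surface_group \<rho>) (?f \<beta>) (\<alpha> s)"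
    if "?f \<beta> \<in> surface_gens \<rho> \<rightarrow> carrier (surface_group \<rho>)"
      "word_eval (surface_group \<rho>) (?f \<beta>) (surface_relator \<rho>) = \<one>\<^bsub>surface_group \<rho>\<^esub>"
      "\<alpha> s \<in> words (surface_gens \<rho>)" "s \<in> surface_gens \<rho>" for \<alpha> \<beta> s
    unfolding hom_word_eval[OF is_group is_group surface_lift(1)[OF is_group that(1,2)] gen_Pi that(3)]
    by (rule word_eval_cong[OF surface_lift(2)[OF is_group that(1,2)] that(3)])
  show "word_subst \<rho> \<sigma> \<in> iso (surface_group \<rho>) (surface_group \<rho>)"
    unfolding word_subst_def
    by (rule surface_iso[OF c(1) e(1) c(2) e(2)])
      (use lift[OF c(2) e(2)] lift[OF c(1) e(1)] \<sigma> \<tau> inv[OF gen_Pi] in auto)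
qed

text \<open>The substitutions induced by the Dehn twists about \<open>\<alpha>\<^sub>i\<close>, about \<open>\<beta>\<^sub>i\<close>, and about a curve in
  the homology class \<open>\<beta>\<^sub>i + \<beta>\<^sub>i\<^sub>+\<^sub>1\<close>, in this order; each is followed by its inverse.\<close>

definition subst_alpha :: "nat \<Rightarrow> surface_gen \<Rightarrow> surface_gen word" where
  "subst_alpha i = (\<lambda>s. [(s, False)])(Beta i := [(Beta i, False), (Alpha i, False)])"

definition subst_alpha_inv :: "nat \<Rightarrow> surface_gen \<Rightarrow> surface_gen word" where
  "subst_alpha_inv i = (\<lambda>s. [(s, False)])(Beta i := [(Beta i, False), (Alpha i, True)])"

definition subst_beta :: "nat \<Rightarrow> surface_gen \<Rightarrow> surface_gen word" where
  "subst_beta i = (\<lambda>s. [(s, False)])(Alpha i := [(Alpha i, False), (Beta i, True)])"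

definition subst_beta_inv :: "nat \<Rightarrow> surface_gen \<Rightarrow> surface_gen word" where
  "subst_beta_inv i = (\<lambda>s. [(s, False)])(Alpha i := [(Alpha i, False), (Beta i, False)])"

definition subst_mix :: "nat \<Rightarrow> surface_gen \<Rightarrow> surface_gen word" where
  "subst_mix i = (\<lambda>s. [(s, False)])(
     Alpha i := [(Alpha i, False), (Beta i, False), (Alpha i, True), (Beta i, True),
       (Alpha (Suc i), False), (Beta (Suc i), False), (Alpha (Suc i), True), (Beta i, False), (Alpha i, False)],
     Alpha (Suc i) := [(Beta i, False), (Alpha i, False), (Beta i, False), (Alpha i, True), (Beta i, True),
       (Alpha (Suc i), False), (Beta (Suc i), False)])"

definition subst_mix_inv :: "nat \<Rightarrow> surface_gen \<Rightarrow> surface_gen word" where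
  "subst_mix_inv i = (\<lambda>s. [(s, False)])(
     Alpha i := [(Beta i, True), (Alpha (Suc i), False), (Beta (Suc i), True), (Alpha (Suc i), True),
       (Beta i, False), (Alpha i, False), (Beta i, True)],
     Alpha (Suc i) := [(Alpha (Suc i), False), (Beta (Suc i), True), (Alpha (Suc i), True),
       (Beta i, False), (Alpha i, False), (Beta i, True), (Alpha i, True), (Beta i, True), (Alpha (Suc i), False)])"

lemmas subst_single_defs = subst_alpha_def subst_alpha_inv_def subst_beta_def subst_beta_inv_def
lemmas subst_mix_defs = subst_mix_def subst_mix_inv_def

context group
begin

text \<open>Each commutator survives on its own: [a, b a] = [a, b] and [a b^-1, b] = [a, b], and
  likewise for the inverse substitutions.\<close>

lemma word_eval_single_relator:
  assumes f: "f \<in> surface_gens \<rho> \<rightarrow> carrier G" and i: "1 \<le> i" "i \<le> \<rho>"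
    and \<sigma>: "\<sigma> \<in> {subst_alpha i, subst_alpha_inv i, subst_beta i, subst_beta_inv i}"
  shows "word_eval G (\<lambda>s. word_eval G f (\<sigma> s)) (surface_relator \<rho>) = word_eval G f (surface_relator \<rho>)"
  unfolding surface_relator_eq
proof (rule word_eval_surface_blocks[OF f])
  have c: "f (Alpha j) \<in> carrier G" "f (Beta j) \<in> carrier G" if "1 \<le> j" "j \<le> \<rho>" for j
    using f that by auto
  show "(\<lambda>s. word_eval G f (\<sigma> s)) \<in> surface_gens \<rho> \<rightarrow> carrier G"
    using \<sigma> f i c[OF i] by (auto simp: subst_single_defs Pi_iff)
  show "word_eval G (\<lambda>s. word_eval G f (\<sigma> s)) (surface_block j) = word_eval G f (surface_block j)"
    if "j \<in> set [1..<Suc \<rho>]" for j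
    using \<sigma> c[of j] that i by (cases "j = i") (auto simp: subst_single_defs surface_block_def m_assoc inv_mult_group)
qed auto

text \<open>Write a, b for the generators of handle \<open>i\<close>, c, d for those of the next,
  and x = a b a^-1 b^-1 c d c^-1 b. Then \<open>subst_mix\<close> is a -> x a, c -> b x b^-1 c, and
  the product of the two commutators becomes x x x^-1 b^-1 d^-1 = x b^-1 d^-1, which is the old
  product.\<close>

lemma word_eval_mix_relator:
  assumes f: "f \<in> surface_gens \<rho> \<rightarrow> carrier G" and i: "1 \<le> i" "i < \<rho>"
    and \<sigma>: "\<sigma> \<in> {subst_mix i, subst_mix_inv i}"
  shows "word_eval G (\<lambda>s. word_eval G f (\<sigma> s)) (surface_relator \<rho>) = word_eval G f (surface_relator \<rho>)"
proof (rule word_eval_surface_relator_cong[OF f _ i])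
  have c: "f (Alpha j) \<in> carrier G" "f (Beta j) \<in> carrier G" if "1 \<le> j" "j \<le> \<rho>" for j
    using f that by auto
  have ci: "f (Alpha i) \<in> carrier G" "f (Beta i) \<in> carrier G" "f (Alpha (Suc i)) \<in> carrier G" "f (Beta (Suc i)) \<in> carrier G"
    using c i by auto
  show "(\<lambda>s. word_eval G f (\<sigma> s)) \<in> surface_gens \<rho> \<rightarrow> carrier G"
    using \<sigma> f i ci by (auto simp: subst_mix_defs Pi_iff)
  show "word_eval G (\<lambda>s. word_eval G f (\<sigma> s)) (surface_block j) = word_eval G f (surface_block j)"
    if "j \<in> {1..\<rho>}" "j \<noteq> i" "j \<noteq> Suc i" for j
    using \<sigma> c[of j] that i by (auto simp: subst_mix_defs surface_block_def)
  show "word_eval G (\<lambda>s. word_eval G f (\<sigma> s)) (surface_block i @ surface_block (Suc i)) =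
      word_eval G f (surface_block i @ surface_block (Suc i))"
    using \<sigma> ci by (auto simp: subst_mix_defs surface_block_def m_assoc inv_mult_group)
qed

lemma word_eval_single_inverse:
  assumes f: "f \<in> surface_gens \<rho> \<rightarrow> carrier G" and i: "1 \<le> i" "i \<le> \<rho>" and s: "s \<in> surface_gens \<rho>"
    and "(\<sigma>, \<tau>) \<in> {(subst_alpha i, subst_alpha_inv i), (subst_alpha_inv i, subst_alpha i),
      (subst_beta i, subst_beta_inv i), (subst_beta_inv i, subst_beta i)}"
  shows "word_eval G (\<lambda>s. word_eval G f (\<sigma> s)) (\<tau> s) = f s"
proof -
  have ci: "f (Alpha i) \<in> carrier G" "f (Beta i) \<in> carrier G" "f s \<in> carrier G"
    using f i s by auto
  then show ?thesis
    using assms(5) by (auto simp: subst_single_defs m_assoc inv_mult_group)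
qed

text \<open>The element x = a b a^-1 b^-1 c d c^-1 b is fixed by a -> x a, c -> b x b^-1 c.
  Therefore a -> x^-1 a, c -> b x^-1 b^-1 c, which is \<open>subst_mix_inv\<close>, undoes this
  substitution.\<close>

lemma word_eval_mix_inverse:
  assumes f: "f \<in> surface_gens \<rho> \<rightarrow> carrier G" and i: "1 \<le> i" "i < \<rho>" and s: "s \<in> surface_gens \<rho>"
    and "(\<sigma>, \<tau>) \<in> {(subst_mix i, subst_mix_inv i), (subst_mix_inv i, subst_mix i)}"
  shows "word_eval G (\<lambda>s. word_eval G f (\<sigma> s)) (\<tau> s) = f s"
proof -
  have ci: "f (Alpha i) \<in> carrier G" "f (Beta i) \<in> carrier G" "f (Alpha (Suc i)) \<in> carrier G"
     "f (Beta (Suc i)) \<in> carrier G" "f s \<in> carrier G"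
    using f i s by auto
  then show ?thesis
    using assms(5) by (auto simp: subst_mix_defs m_assoc inv_mult_group)
qed

end

lemma subst_words:
  assumes "1 \<le> i" "s \<in> surface_gens \<rho>"
  shows "i \<le> \<rho> \<Longrightarrow> \<sigma> \<in> {subst_alpha i, subst_alpha_inv i, subst_beta i, subst_beta_inv i} \<Longrightarrow> \<sigma> s \<in> words (surface_gens \<rho>)"
    and "i < \<rho> \<Longrightarrow> \<sigma> \<in> {subst_mix i, subst_mix_inv i} \<Longrightarrow> \<sigma> s \<in> words (surface_gens \<rho>)"
  using assms by (auto simp: subst_single_defs subst_mix_defs)

lemma word_subst_single:
  assumes "1 \<le> i" "i \<le> \<rho>" "\<sigma> \<in> {subst_alpha i, subst_beta i}"
  shows "word_subst \<rho> \<sigma> \<in> iso (surface_group \<rho>) (surface_group \<rho>)"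
    and "s \<in> surface_gens \<rho> \<Longrightarrow> word_subst \<rho> \<sigma> (gen \<rho> s) = word_eval (surface_group \<rho>) (gen \<rho>) (\<sigma> s)"
proof -
  interpret group "surface_group \<rho>" by (rule group_surface_group)
  obtain \<tau> where \<tau>: "(\<sigma>, \<tau>) \<in> {(subst_alpha i, subst_alpha_inv i), (subst_beta i, subst_beta_inv i)}"
    using assms(3) by auto
  have m: "\<sigma> \<in> {subst_alpha i, subst_alpha_inv i, subst_beta i, subst_beta_inv i}"
    "\<tau> \<in> {subst_alpha i, subst_alpha_inv i, subst_beta i, subst_beta_inv i}"
    "(\<sigma>, \<tau>) \<in> {(subst_alpha i, subst_alpha_inv i), (subst_alpha_inv i, subst_alpha i),
      (subst_beta i, subst_beta_inv i), (subst_beta_inv i, subst_beta i)}"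
    "(\<tau>, \<sigma>) \<in> {(subst_alpha i, subst_alpha_inv i), (subst_alpha_inv i, subst_alpha i),
      (subst_beta i, subst_beta_inv i), (subst_beta_inv i, subst_beta i)}"
    using \<tau> by auto
  note r = subst_words(1)[OF assms(1) _ assms(2) m(1)] subst_words(1)[OF assms(1) _ assms(2) m(2)]
    word_eval_single_relator[OF _ assms(1,2) m(1)] word_eval_single_relator[OF _ assms(1,2) m(2)]
    word_eval_single_inverse[OF _ assms(1,2) _ m(3)] word_eval_single_inverse[OF _ assms(1,2) _ m(4)]
  show "word_subst \<rho> \<sigma> \<in> iso (surface_group \<rho>) (surface_group \<rho>)"
    by (rule word_subst_iso(1)[OF r])
  show "word_subst \<rho> \<sigma> (gen \<rho> s) = word_eval (surface_group \<rho>) (gen \<rho>) (\<sigma> s)" if "s \<in> surface_gens \<rho>"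
    by (rule word_subst_iso(2)[OF r that])
qed

lemma word_subst_mix:
  assumes "1 \<le> i" "i < \<rho>"
  shows "word_subst \<rho> (subst_mix i) \<in> iso (surface_group \<rho>) (surface_group \<rho>)"
    and "s \<in> surface_gens \<rho> \<Longrightarrow> word_subst \<rho> (subst_mix i) (gen \<rho> s) = word_eval (surface_group \<rho>) (gen \<rho>) (subst_mix i s)"
proof -
  interpret group "surface_group \<rho>" by (rule group_surface_group)
  have m: "subst_mix i \<in> {subst_mix i, subst_mix_inv i}" "subst_mix_inv i \<in> {subst_mix i, subst_mix_inv i}"
    "(subst_mix i, subst_mix_inv i) \<in> {(subst_mix i, subst_mix_inv i), (subst_mix_inv i, subst_mix i)}"
    "(subst_mix_inv i, subst_mix i) \<in> {(subst_mix i, subst_mix_inv i), (subst_mix_inv i, subst_mix i)}"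
    by auto
  note r = subst_words(2)[OF assms(1) _ assms(2) m(1)] subst_words(2)[OF assms(1) _ assms(2) m(2)]
    word_eval_mix_relator[OF _ assms(1,2) m(1)] word_eval_mix_relator[OF _ assms(1,2) m(2)]
    word_eval_mix_inverse[OF _ assms(1,2) _ m(3)] word_eval_mix_inverse[OF _ assms(1,2) _ m(4)]
  show "word_subst \<rho> (subst_mix i) \<in> iso (surface_group \<rho>) (surface_group \<rho>)"
    by (rule word_subst_iso(1)[OF r])
  show "word_subst \<rho> (subst_mix i) (gen \<rho> s) = word_eval (surface_group \<rho>) (gen \<rho>) (subst_mix i s)" if "s \<in> surface_gens \<rho>"
    by (rule word_subst_iso(2)[OF r that])
qed

section \<open>Twisting an annulus\<close>

lemma chain_map_fixes:
  assumes "singular_chain p (subtopology X B) c" "\<And>x. x \<in> B \<Longrightarrow> h x = x"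
  shows "chain_map p h c = c"
  by (rule chain_map_id_gen[OF assms(1)]) (use assms(2) in auto)

text \<open>Subdivision replaces the cycle by a sum \<open>zA + zB\<close> of chains in
  \<open>A\<close> and \<open>B\<close>. Since \<open>h\<close> fixes \<open>zB\<close>, the
  difference between the cycle and its image lies in \<open>A\<close>, is a cycle there, and bounds
  because the homology of \<open>A\<close> vanishes.\<close>

lemma hom_induced_id_of_support:
  assumes A: "openin X A" and B: "openin X B" and AB: "topspace X \<subseteq> A \<union> B"
    and h: "continuous_map X X h" and hB: "\<And>x. x \<in> B \<Longrightarrow> h x = x" and hA: "h ` A \<subseteq> A"
    and triv: "trivial_group (homology_group (int p) (subtopology X A))"
    and c: "c \<in> carrier (homology_group (int p) X)"
  shows "hom_induced (int p) X {} X {} h c = c"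
proof -
  obtain z where z: "singular_relcycle p X {} z" "c = homologous_rel_set p X {} z"
    using c by (auto simp: carrier_relative_homology_group)
  have oAB: "openin X U" if "U \<in> {A, B}" for U
    using that A B by auto
  have cov: "topspace X \<subseteq> \<Union>{A, B}"
    using AB by auto
  obtain z' where z': "singular_relcycle p X {} z'" "homologous_rel p X {} z z'"
    and small: "\<And>f. f \<in> Poly_Mapping.keys z' \<Longrightarrow> \<exists>V \<in> {A, B}. f \<in> (standard_simplex p) \<rightarrow> V"
    using small_homologous_rel_relcycle_exists[OF oAB cov z(1)] by metis
  have cz: "singular_chain p X z'"
    using z'(1) by (simp add: singular_cycle)
  have "Poly_Mapping.keys z' \<subseteq> singular_simplex_set p (subtopology X A) \<union> singular_simplex_set p (subtopology X B)"
  proof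
    fix f assume f: "f \<in> Poly_Mapping.keys z'"
    then have "singular_simplex p X f"
      using cz by (auto simp: singular_chain_def)
    then show "f \<in> singular_simplex_set p (subtopology X A) \<union> singular_simplex_set p (subtopology X B)"
      using small[OF f] by (auto simp: singular_simplex_subtopology)
  qed
  then obtain zA zB where zz: "singular_chain p (subtopology X A) zA"
      "singular_chain p (subtopology X B) zB" "z' = zA + zB"
    unfolding singular_chain_def using frag_split by metis
  define w where "w = chain_map p h zA - zA"
  \<comment> \<open>\<open>zA\<close> alone need not be a cycle, but the parts in \<open>B\<close>
    cancel, so \<open>w\<close> is a difference of two cycles.\<close>
  have w: "w = chain_map p h z' - z'"
    using chain_map_fixes[OF zz(2) hB] by (simp add: w_def zz(3) chain_map_add)
  have hz': "singular_relcycle p X {} (chain_map p h z')"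
    using z'(1) h by (simp add: singular_relcycle_chain_map[of p X "{}" z' X h "{}"])
  have contA: "continuous_map (subtopology X A) (subtopology X A) h"
    using h hA openin_subset[OF A]
    by (auto simp: continuous_map_in_subtopology continuous_map_from_subtopology)
  have "singular_chain p (subtopology X A) w"
    unfolding w_def by (intro singular_chain_diff singular_chain_chain_map[OF zz(1) contA] zz(1))
  moreover have "chain_boundary p w = 0"
    unfolding w using hz' z'(1) by (simp add: singular_cycle chain_boundary_diff)
  ultimately have wc: "singular_relcycle p (subtopology X A) {} w"
    by (simp add: singular_cycle)
  then have "homologous_rel_set p (subtopology X A) {} w \<in> carrier (homology_group (int p) (subtopology X A))"
    by (auto simp: carrier_relative_homology_group)
  then have "homologous_rel_set p (subtopology X A) {} w = singular_relboundary_set p (subtopology X A) {}"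
    using triv unfolding trivial_group_def by auto
  then have "singular_relboundary p (subtopology X A) {} w"
    by (simp add: homologous_rel_set_eq_relboundary)
  then have "singular_relboundary p X {} w"
    unfolding singular_boundary using singular_chain_subtopology by blast
  then have "homologous_rel p X {} (chain_map p h z') z'"
    by (simp add: homologous_rel_def w)
  then have "homologous_rel_set p X {} (chain_map p h z') = c"
    using z z' by (metis homologous_rel_set_eq)
  moreover have "c = homologous_rel_set p X {} z'"
    using z z' by (metis homologous_rel_set_eq)
  ultimately show ?thesis
    using hom_induced_chain_map[OF h _ z'(1), of "{}"] by auto
qed

section \<open>Second homology of the open annulus\<close>

abbreviation open_annulus :: "(complex \<times> real) set" where
  "open_annulus \<equiv> sphere 0 1 \<times> {0<..<1}"

text \<open>The annulus deforms to its middle circle: \<open>f\<close> projects to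
  \<open>nsphere 1\<close>, whose points are sequences of reals, \<open>g\<close> puts the circle at
  height 1/2, and \<open>g \<circ> f\<close> is joined to the identity by vertical segments. So
  every class factors through the second homology of a circle, which is trivial.\<close>

lemma trivial_H2_open_annulus: "trivial_group (homology_group 2 (top_of_set open_annulus))"
proof -
  let ?A = "top_of_set open_annulus"
  define f :: "complex \<times> real \<Rightarrow> nat \<Rightarrow> real"
    where "f p = (\<lambda>i. if i = 0 then Re (fst p) else if i = 1 then Im (fst p) else 0)" for p
  define g :: "(nat \<Rightarrow> real) \<Rightarrow> complex \<times> real" where "g x = (Complex (x 0) (x 1), 1/2)" for x
  have sq: "(\<Sum>i\<le>1. (x i)\<^sup>2) = (x 0)\<^sup>2 + (x 1)\<^sup>2" for x :: "nat \<Rightarrow> real"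
    by simp
  have f: "continuous_map ?A (nsphere 1) f"
    unfolding nsphere continuous_map_in_subtopology
  proof
    show "continuous_map ?A (powertop_real UNIV) f"
      unfolding continuous_map_componentwise_UNIV
    proof
      fix k :: nat
      show "continuous_map ?A euclideanreal (\<lambda>x. f x k)"
        by (cases "k = 0"; cases "k = 1") (auto simp: f_def intro!: continuous_intros)
    qed
    show "f \<in> topspace ?A \<rightarrow> {x. (\<Sum>i\<le>1. (x i)\<^sup>2) = 1 \<and> (\<forall>i>1. x i = 0)}"
      by (auto simp: f_def cmod_power2 simp flip: sq) (metis cmod_power2 power_one)
  qed
  have g: "continuous_map (nsphere 1) ?A g"
    unfolding continuous_map_in_subtopology
  proof
    have re: "continuous_map (nsphere 1) euclidean (\<lambda>x. complex_of_real (x k))" for k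
      using continuous_map_compose[OF continuous_map_nsphere_projection, of euclidean complex_of_real 1 k]
      by (simp add: o_def continuous_on_of_real_id)
    have "continuous_map (nsphere 1) euclidean (\<lambda>x. \<i> * complex_of_real (x 1))"
      using continuous_map_compose[OF re[of 1], of euclidean "(*) \<i>"]
      by (simp add: o_def continuous_intros)
    with re have "continuous_map (nsphere 1) euclidean (\<lambda>x. complex_of_real (x 0) + \<i> * complex_of_real (x 1))"
      by (intro continuous_map_add)
    then show "continuous_map (nsphere 1) euclidean g"
      unfolding g_def Complex_eq continuous_map_pairwise prod_topology_euclidean[symmetric]
      by (simp add: o_def)
    show "g \<in> topspace (nsphere 1) \<rightarrow> open_annulus"
      by (auto simp: g_def nsphere cmod_def)
  qed
  have gf: "homotopic_with (\<lambda>_. True) ?A ?A (g \<circ> f) id"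
  proof (rule homotopic_with_linear)
    show "continuous_on open_annulus (g \<circ> f)"
      using continuous_map_compose[OF f g] by (simp add: continuous_map_in_subtopology)
    show "closed_segment ((g \<circ> f) x) (id x) \<subseteq> open_annulus" if x: "x \<in> open_annulus" for x
    proof -
      obtain z s where zs: "x = (z, s)" by fastforce
      have "(g \<circ> f) x = (z, 1/2)"
        by (simp add: zs f_def g_def complex_eq_iff)
      moreover have "closed_segment (z, 1/2) (z, s) \<subseteq> sphere 0 1 \<times> {0<..<1::real}"
      proof -
        have "closed_segment (1/2) s \<subseteq> {0<..<1::real}"
          using x zs by (intro closed_segment_subset) auto
        moreover have "closed_segment (z, 1/2) (z, s) \<subseteq> {z} \<times> closed_segment (1/2) s"
          by (auto simp: closed_segment_def algebra_simps simp flip: scaleR_add_left)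
        ultimately show ?thesis
          using x zs by auto
      qed
      ultimately show ?thesis by (simp add: zs)
    qed
  qed (simp add: continuous_on_id)
  have "c = \<one>\<^bsub>homology_group 2 ?A\<^esub>" if c: "c \<in> carrier (homology_group 2 ?A)" for c
  proof -
    have t: "trivial_group (homology_group 2 (nsphere 1))"
      using trivial_reduced_homology_group_nsphere[of 2 1] un_reduced_homology_group[of 2 "nsphere 1"] by simp
    have "hom_induced 2 ?A {} (nsphere 1) {} f c \<in> carrier (homology_group 2 (nsphere 1))"
      by (rule hom_induced_carrier)
    then have fc: "hom_induced 2 ?A {} (nsphere 1) {} f c = \<one>\<^bsub>homology_group 2 (nsphere 1)\<^esub>"
      using t unfolding trivial_group_def by auto
    have "c = hom_induced 2 ?A {} ?A {} id c"
      using hom_induced_id[OF c] by simp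
    also have "\<dots> = hom_induced 2 ?A {} ?A {} (g \<circ> f) c"
      using homology_homotopy_empty[OF gf] by simp
    also have "\<dots> = hom_induced 2 (nsphere 1) {} ?A {} g (hom_induced 2 ?A {} (nsphere 1) {} f c)"
      by (rule hom_induced_compose'[symmetric, OF f _ g]) auto
    also have "\<dots> = \<one>\<^bsub>homology_group 2 ?A\<^esub>"
      unfolding fc by (rule hom_one[OF hom_induced_hom]) auto
    finally show ?thesis .
  qed
  moreover have "group (homology_group 2 ?A)"
    by simp
  ultimately show ?thesis
    unfolding trivial_group_def using group.is_monoid monoid.one_closed by blast
qed


text \<open>Constant near both boundary circles: 0 up to height 1/4 and 1 from 3/4 on. A twist by an
  integral number of turns is then the identity near the boundary of the annulus and extends by the
  identity.\<close>

definition twist_profile :: "real \<Rightarrow> real" where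
  "twist_profile s = max 0 (min 1 (2 * s - 1/2))"

definition annulus_twist :: "real \<Rightarrow> complex \<times> real \<Rightarrow> complex \<times> real" where
  "annulus_twist \<sigma> p = (fst p * cis (2 * pi * \<sigma> * twist_profile (snd p)), snd p)"

abbreviation closed_annulus :: "(complex \<times> real) set" where
  "closed_annulus \<equiv> sphere 0 1 \<times> {0..1}"

lemma continuous_twist_profile [continuous_intros]:
  "continuous_on S f \<Longrightarrow> continuous_on S (\<lambda>x. twist_profile (f x))"
  unfolding twist_profile_def by (intro continuous_intros)

lemma continuous_annulus_twist: "continuous_on S (annulus_twist \<sigma>)"
  unfolding annulus_twist_def by (intro continuous_intros)

lemma annulus_twist_inverse: "annulus_twist (- \<sigma>) (annulus_twist \<sigma> p) = p"
  by (simp add: annulus_twist_def mult.assoc cis_mult)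

lemma annulus_twist_mem:
  "p \<in> sphere 0 1 \<times> T \<Longrightarrow> annulus_twist \<sigma> p \<in> sphere 0 1 \<times> T"
  by (auto simp: annulus_twist_def norm_mult)

lemma annulus_twist_eq_self:
  "\<sigma> \<in> \<int> \<Longrightarrow> snd p \<notin> {1/4<..<3/4} \<Longrightarrow> annulus_twist \<sigma> p = p"
  by (cases p) (auto simp: annulus_twist_def twist_profile_def cis_multiple_2pi)

text \<open>For a Hausdorff target \<open>closedE\<close> would follow from compactness; with
  \<open>injE\<close> it makes \<open>E\<close> a homeomorphism onto a closed set. By
  \<open>openE\<close> the image borders on the rest of the space only along the two boundary
  circles, near which the twist is the identity.\<close>

locale embedded_annulus =
  fixes X :: "'a topology" and E :: "complex \<times> real \<Rightarrow> 'a"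
  assumes contE: "continuous_map (top_of_set closed_annulus) X E"
    and closedE: "\<And>C. C \<subseteq> closed_annulus \<Longrightarrow> compact C \<Longrightarrow> closedin X (E ` C)"
    and injE: "inj_on E closed_annulus"
    and openE: "openin X (E ` open_annulus)"
begin

definition twist :: "real \<Rightarrow> 'a \<Rightarrow> 'a" where
  "twist \<sigma> x = (if x \<in> E ` closed_annulus then E (annulus_twist \<sigma> (inv_into closed_annulus E x)) else x)"

lemma twist_E: "p \<in> closed_annulus \<Longrightarrow> twist \<sigma> (E p) = E (annulus_twist \<sigma> p)"
  by (simp add: twist_def inv_into_f_f[OF injE])

lemma E_topspace: "p \<in> closed_annulus \<Longrightarrow> E p \<in> topspace X"
  using contE by (auto simp: continuous_map_def Pi_iff)

lemma twist_eq_self: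
  assumes "\<sigma> \<in> \<int>" "x \<notin> E ` (sphere 0 1 \<times> {1/4<..<3/4})"
  shows "twist \<sigma> x = x"
proof (cases "x \<in> E ` closed_annulus")
  case True
  then obtain p where p: "p \<in> closed_annulus" "x = E p" by auto
  then have "snd p \<notin> {1/4<..<3/4}"
    using assms(2) by (cases p) auto
  then show ?thesis
    using p assms(1) by (simp add: twist_E annulus_twist_eq_self)
qed (auto simp: twist_def)

lemma twist_inverse: "twist (- \<sigma>) (twist \<sigma> x) = x"
proof (cases "x \<in> E ` closed_annulus")
  case True
  then obtain p where p: "p \<in> closed_annulus" "x = E p" by auto
  then show ?thesis
    using annulus_twist_mem[OF p(1), of \<sigma>] by (simp add: twist_E annulus_twist_inverse)
qed (auto simp: twist_def)

lemma twist_topspace: "x \<in> topspace X \<Longrightarrow> twist \<sigma> x \<in> topspace X"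
proof (cases "x \<in> E ` closed_annulus")
  case True
  then obtain p where p: "p \<in> closed_annulus" "x = E p" by blast
  then show ?thesis
    unfolding p(2) twist_E[OF p(1)] by (intro E_topspace annulus_twist_mem)
qed (auto simp: twist_def)

lemma compact_closed_annulus: "compact closed_annulus"
  by (intro compact_Times) auto

text \<open>The preimage of a closed set \<open>C\<close> is the union of two closed pieces: the
  image of a compact set of the annulus, and \<open>C\<close> minus the open annulus. On the
  boundary circles the two descriptions overlap and agree, the twist being the identity
  there.\<close>

lemma continuous_twist:
  assumes "\<sigma> \<in> \<int>"
  shows "continuous_map X X (twist \<sigma>)"
  unfolding continuous_map_closedin
proof (intro conjI ballI allI impI)
  show "twist \<sigma> \<in> topspace X \<rightarrow> topspace X"
    using twist_topspace by blast
  fix C assume C: "closedin X C"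
  define D where "D = {p \<in> closed_annulus. E p \<in> C}"
  have "closedin (top_of_set closed_annulus) D"
    using contE C closedin_continuous_map_preimage unfolding D_def by fastforce
  then have D: "compact D" "D \<subseteq> closed_annulus"
    using compact_closed_annulus closedin_compact closedin_subset unfolding D_def by blast+
  define D' where "D' = {p \<in> closed_annulus. annulus_twist \<sigma> p \<in> D}"
  have "D' = annulus_twist (- \<sigma>) ` D"
  proof
    show "D' \<subseteq> annulus_twist (- \<sigma>) ` D"
      unfolding D'_def using annulus_twist_inverse[of \<sigma>] by (metis (no_types, lifting) imageI mem_Collect_eq subsetI)
    show "annulus_twist (- \<sigma>) ` D \<subseteq> D'"
    proof
      fix q assume "q \<in> annulus_twist (- \<sigma>) ` D"
      then obtain p where p: "p \<in> D" "q = annulus_twist (- \<sigma>) p" by blast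
      then show "q \<in> D'"
        using D(2) annulus_twist_inverse[of "- \<sigma>" p] annulus_twist_mem[of p "{0..1}" "- \<sigma>"]
        unfolding D'_def by auto
    qed
  qed
  then have D': "compact D'" "D' \<subseteq> closed_annulus"
    using D compact_continuous_image[OF continuous_annulus_twist] by (auto simp: D'_def)
  have "{x \<in> topspace X. twist \<sigma> x \<in> C} = E ` D' \<union> (C - E ` open_annulus)"
  proof (rule Set.set_eqI, rule iffI)
    fix x assume x: "x \<in> {x \<in> topspace X. twist \<sigma> x \<in> C}"
    show "x \<in> E ` D' \<union> (C - E ` open_annulus)"
    proof (cases "x \<in> E ` closed_annulus")
      case True
      then obtain p where p: "p \<in> closed_annulus" "x = E p" by auto
      then have "p \<in> D'"
        using x annulus_twist_mem[OF p(1)] by (auto simp: D'_def D_def twist_E)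
      then show ?thesis using p by blast
    next
      case False
      then have "x \<notin> E ` open_annulus" by auto
      then show ?thesis using False x by (auto simp: twist_def)
    qed
  next
    fix x assume "x \<in> E ` D' \<union> (C - E ` open_annulus)"
    then show "x \<in> {x \<in> topspace X. twist \<sigma> x \<in> C}"
    proof
      assume "x \<in> E ` D'"
      then show "x \<in> {x \<in> topspace X. twist \<sigma> x \<in> C}" by (auto simp: D'_def D_def twist_E E_topspace)
    next
      assume x: "x \<in> C - E ` open_annulus"
      then have "x \<notin> E ` (sphere 0 1 \<times> {1/4<..<3/4})"
        by force
      then show "x \<in> {x \<in> topspace X. twist \<sigma> x \<in> C}"
        using x twist_eq_self[OF assms] closedin_subset[OF C] by auto
    qed
  qed
  moreover have "closedin X (C - E ` open_annulus)"
    using C openE by blast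
  ultimately show "closedin X {x \<in> topspace X. twist \<sigma> x \<in> C}"
    using closedE[OF D'(2,1)] by auto
qed

lemma homeomorphic_twist: "homeomorphic_map X X (twist 1)"
proof -
  have "homeomorphic_maps X X (twist 1) (twist (-1))"
    unfolding homeomorphic_maps_def
    using continuous_twist[of 1] continuous_twist[of "-1"] twist_inverse[of 1] twist_inverse[of "-1"]
    by auto
  then show ?thesis
    using homeomorphic_map_maps by blast
qed

lemma open_annulus_homeomorphic:
  "subtopology X (E ` open_annulus) homeomorphic_space top_of_set open_annulus"
proof -
  have oc: "open_annulus \<subseteq> closed_annulus" by auto
  let ?Y = "subtopology X (E ` closed_annulus)"
  have "continuous_map (top_of_set closed_annulus) ?Y E"
    using contE by (simp add: continuous_map_in_subtopology)
  moreover have "closed_map (top_of_set closed_annulus) ?Y E"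
    unfolding closed_map_def
  proof (intro allI impI)
    fix C assume "closedin (top_of_set closed_annulus) C"
    then have "compact C" "C \<subseteq> closed_annulus"
      using compact_closed_annulus closedin_compact closedin_subset by fastforce+
    then show "closedin ?Y (E ` C)"
      using closedE by (intro closedin_subset_topspace) auto
  qed
  ultimately have hm: "homeomorphic_map (top_of_set closed_annulus) ?Y E"
    using injE E_topspace by (intro bijective_closed_imp_homeomorphic_map) auto
  have "homeomorphic_map (top_of_set open_annulus) (subtopology X (E ` open_annulus)) E"
  proof -
    have "homeomorphic_map (subtopology (top_of_set closed_annulus) open_annulus)
        (subtopology ?Y (E ` open_annulus)) E"
      using E_topspace injE oc
      by (intro homeomorphic_map_subtopologies[OF hm]) (auto simp: inj_on_def)
    moreover have "E ` closed_annulus \<inter> E ` open_annulus = E ` open_annulus"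
      "closed_annulus \<inter> open_annulus = open_annulus"
      using oc by blast+
    ultimately show ?thesis
      by (simp only: subtopology_subtopology)
  qed
  then show ?thesis
    using homeomorphic_map_imp_homeomorphic_space homeomorphic_space_sym by blast
qed

lemma orientation_preserving_twist: "orientation_preserving X (twist 1)"
  unfolding orientation_preserving_def
proof
  fix c assume c: "c \<in> carrier (homology_group 2 X)"
  let ?A = "E ` open_annulus"
  \<comment> \<open>The points moved by the twist lie in the image of this compact band. Its
    complement \<open>?B\<close> is therefore open, the twist is the identity on it, and together
    with \<open>?A\<close> it covers the space.\<close>
  let ?K = "sphere (0::complex) 1 \<times> {1/4..3/4::real}"
  let ?B = "topspace X - E ` ?K"
  have K: "closedin X (E ` ?K)"
    by (rule closedE) (auto intro!: compact_Times)
  have triv: "trivial_group (homology_group (int 2) (subtopology X ?A))"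
    using trivial_H2_open_annulus homeomorphic_space_imp_isomorphic_homology_groups[OF open_annulus_homeomorphic, of 2]
      isomorphic_group_triviality by (metis group_relative_homology_group of_nat_numeral)
  have "hom_induced (int 2) X {} X {} (twist 1) c = c"
  proof (rule hom_induced_id_of_support[OF openE, where B = ?B])
    show "openin X ?B" using K by blast
    show "topspace X \<subseteq> ?A \<union> ?B" by force
    show "continuous_map X X (twist 1)" by (rule continuous_twist) auto
    show "twist 1 x = x" if "x \<in> ?B" for x
      using that by (intro twist_eq_self) force+
    show "twist 1 ` ?A \<subseteq> ?A"
    proof
      fix y assume "y \<in> twist 1 ` ?A"
      then obtain p where p: "p \<in> open_annulus" "y = twist 1 (E p)" by auto
      then have "y = E (annulus_twist 1 p)"
        by (subst p(2), intro twist_E) auto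
      then show "y \<in> ?A"
        using annulus_twist_mem[OF p(1)] by blast
    qed
  qed (use triv c in auto)
  then show "hom_induced 2 X {} X {} (twist 1) c = c" by simp
qed

end

section \<open>Paths in the polygon\<close>

text \<open>The coordinate on the boundary circle measured in sides: vertex \<open>k\<close> has
  coordinate \<open>k\<close>, and the whole boundary has length \<open>4 * \<rho>\<close>.\<close>

definition boundary_point :: "nat \<Rightarrow> real \<Rightarrow> complex" where
  "boundary_point \<rho> y = cis (2 * pi * y / (4 * real \<rho>))"

abbreviation vertex :: "nat \<Rightarrow> nat \<Rightarrow> complex" where
  "vertex \<rho> k \<equiv> boundary_point \<rho> (real k)"

lemma side_eq: "side \<rho> k t = boundary_point \<rho> (real k + t)"
  by (simp add: side_def boundary_point_def)

lemma norm_boundary_point [simp]: "norm (boundary_point \<rho> y) = 1"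
  by (simp add: boundary_point_def)

lemma continuous_boundary_point [continuous_intros]:
  "continuous_on S f \<Longrightarrow> continuous_on S (\<lambda>t. boundary_point \<rho> (f t))"
  unfolding boundary_point_def by (cases "\<rho> = 0") (auto intro!: continuous_intros)

lemma boundary_point_wrap: "\<rho> > 0 \<Longrightarrow> boundary_point \<rho> (4 * real \<rho>) = boundary_point \<rho> 0"
  by (simp add: boundary_point_def)

lemma glue_eq_iff: "glue \<rho> z = glue \<rho> w \<longleftrightarrow> equivclp (side_pairing \<rho>) z w"
proof
  assume "glue \<rho> z = glue \<rho> w"
  moreover have "w \<in> glue \<rho> w" by (simp add: glue_def)
  ultimately show "equivclp (side_pairing \<rho>) z w" by (simp add: glue_def set_eq_iff)
next
  assume "equivclp (side_pairing \<rho>) z w"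
  then have "equivclp (side_pairing \<rho>) z u \<longleftrightarrow> equivclp (side_pairing \<rho>) w u" for u
    by (meson equivclp_sym equivclp_trans)
  then show "glue \<rho> z = glue \<rho> w" by (simp add: glue_def)
qed

lemma glue_side:
  assumes "k < 4 * \<rho>" "k mod 4 \<in> {0, 1}" "t \<in> {0..1}"
  shows "glue \<rho> (boundary_point \<rho> (real k + t)) = glue \<rho> (boundary_point \<rho> (real k + 3 - t))"
proof -
  have "side_pairing \<rho> (side \<rho> k t) (side \<rho> (k + 2) (1 - t))"
    unfolding side_pairing_def by (rule exI[of _ k], rule exI[of _ t]) (use assms in simp)
  then show ?thesis
    unfolding glue_eq_iff side_eq by (simp add: r_into_equivclp algebra_simps)
qed

text \<open>The ends of the sides \<open>4 * m\<close> and \<open>4 * m + 1\<close> are glued to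
  those of their partners, which links the five vertices from \<open>4 * m\<close> to
  \<open>4 * m + 4\<close>; consecutive handles share a vertex.\<close>

lemma glue_vertex:
  assumes "k \<le> 4 * \<rho>" shows "glue \<rho> (vertex \<rho> k) = surface_base \<rho>"
proof -
  have four: "glue \<rho> (vertex \<rho> (4 * m + j)) = glue \<rho> (vertex \<rho> (4 * m))" if "m < \<rho>" "j \<le> 4" for m j
  proof -
    note g = glue_side[of "4 * m" \<rho>] glue_side[of "4 * m + 1" \<rho>]
    have m: "4 * m < 4 * \<rho>" "4 * m + 1 < 4 * \<rho>" "(4 * m) mod 4 \<in> {0, 1}" "(4 * m + 1) mod 4 \<in> {0, 1}"
      using that(1) by (auto simp: mod_Suc)
    have "glue \<rho> (boundary_point \<rho> (4 * real m)) = glue \<rho> (boundary_point \<rho> (4 * real m + 3))"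
      "glue \<rho> (boundary_point \<rho> (4 * real m + 1)) = glue \<rho> (boundary_point \<rho> (4 * real m + 2))"
      "glue \<rho> (boundary_point \<rho> (4 * real m + 1)) = glue \<rho> (boundary_point \<rho> (4 * real m + 4))"
      "glue \<rho> (boundary_point \<rho> (4 * real m + 2)) = glue \<rho> (boundary_point \<rho> (4 * real m + 3))"
      using g(1)[OF m(1,3), of 0] g(1)[OF m(1,3), of 1] g(2)[OF m(2,4), of 0] g(2)[OF m(2,4), of 1]
      by (simp_all add: algebra_simps)
    moreover have "j = 0 \<or> j = 1 \<or> j = 2 \<or> j = 3 \<or> j = 4" using that(2) by linarith
    ultimately show ?thesis by (elim disjE) (simp_all add: add.commute[of _ "4 * real m"])
  qed
  have mult: "glue \<rho> (vertex \<rho> (4 * m)) = surface_base \<rho>" if "m \<le> \<rho>" for m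
    using that
  proof (induction m)
    case 0
    then show ?case by (simp add: surface_base_def boundary_point_def)
  next
    case (Suc m)
    then show ?case using four[of m 4] by (simp add: algebra_simps)
  qed
  show ?thesis
  proof (cases "k = 4 * \<rho>")
    case True
    then show ?thesis using mult[of \<rho>] by simp
  next
    case False
    then have "k div 4 < \<rho>" "k mod 4 \<le> 4" using assms by auto
    then show ?thesis using four[of "k div 4" "k mod 4"] mult[of "k div 4"] by simp
  qed
qed

lemma continuous_map_glue: "continuous_map (top_of_set (cball 0 1)) (surface \<rho>) (glue \<rho>)"
  using quotient_map_glue quotient_imp_continuous_map by blast

lemma surface_base_topspace: "surface_base \<rho> \<in> topspace (surface \<rho>)"
  unfolding topspace_surface surface_base_def by auto

section \<open>The fundamental group of the surface described by chords between vertices\<close>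

abbreviation surface_loop_class :: "nat \<Rightarrow> (real \<Rightarrow> complex set) \<Rightarrow> (real \<Rightarrow> complex set) set" where
  "surface_loop_class \<rho> \<equiv> loop_class (surface \<rho>) (surface_base \<rho>)"

abbreviation surface_loops :: "nat \<Rightarrow> (real \<Rightarrow> complex set) set" where
  "surface_loops \<rho> \<equiv> loops (surface \<rho>) (surface_base \<rho>)"

abbreviation surface_pi1 :: "nat \<Rightarrow> (real \<Rightarrow> complex set) set monoid" where
  "surface_pi1 \<rho> \<equiv> fundamental_group (surface \<rho>) (surface_base \<rho>)"

lemma group_surface_pi1: "group (surface_pi1 \<rho>)"
  by (rule group_fundamental_group[OF surface_base_topspace])

text \<open>All vertices are one point of the surface, so a chord between two of them is a loop. As
  the disc is convex, every path in the disc between the same vertices has this class, and the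
  classes compose like the arrows of a groupoid with exactly one arrow between any two
  vertices.\<close>

definition disc_class :: "nat \<Rightarrow> nat \<Rightarrow> nat \<Rightarrow> (real \<Rightarrow> complex set) set" where
  "disc_class \<rho> i j = surface_loop_class \<rho> (\<lambda>t. glue \<rho> (linepath (vertex \<rho> i) (vertex \<rho> j) t))"

lemma disc_path_loop:
  assumes "continuous_on {0..1} f" "f ` {0..1} \<subseteq> cball 0 1" "f 0 = vertex \<rho> i" "f 1 = vertex \<rho> j"
    "i \<le> 4 * \<rho>" "j \<le> 4 * \<rho>" "\<And>t. t \<in> {0..1} \<Longrightarrow> p t = glue \<rho> (f t)"
  shows "p \<in> surface_loops \<rho>"
proof -
  have "continuous_map (top_of_set {0..1}) (top_of_set (cball 0 1)) f"
    using assms by (auto simp: continuous_map_in_subtopology)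
  then have "continuous_map (top_of_set {0..1}) (surface \<rho>) (glue \<rho> \<circ> f)"
    using continuous_map_compose continuous_map_glue by blast
  then have "continuous_map (top_of_set {0..1}) (surface \<rho>) p"
    by (rule continuous_map_eq) (use assms(7) in auto)
  moreover have "p 0 = surface_base \<rho>" "p 1 = surface_base \<rho>"
    using assms(3-6) assms(7)[of 0] assms(7)[of 1] glue_vertex by simp_all
  ultimately show ?thesis
    by (simp add: loops_def pathin_def)
qed

lemma linepath_in_cball:
  fixes a b :: complex
  assumes "norm a \<le> 1" "norm b \<le> 1" "t \<in> {0..1}"
  shows "linepath a b t \<in> cball 0 1"
proof -
  have "linepath a b t \<in> closed_segment a b"
    using assms(3) linepath_in_path by blast
  then show ?thesis
    using closed_segment_subset[of a "cball 0 1" b] assms by auto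
qed

lemma disc_path_class:
  assumes f: "continuous_on {0..1} f" "f ` {0..1} \<subseteq> cball 0 1" "f 0 = vertex \<rho> i" "f 1 = vertex \<rho> j"
    "i \<le> 4 * \<rho>" "j \<le> 4 * \<rho>" "\<And>t. t \<in> {0..1} \<Longrightarrow> p t = glue \<rho> (f t)"
  shows "surface_loop_class \<rho> p = disc_class \<rho> i j"
  unfolding disc_class_def
  by (rule loop_class_eqI, rule loop_homotopic_convex[OF continuous_map_glue, where f = f and
        g = "linepath (vertex \<rho> i) (vertex \<rho> j)"])
    (use f glue_vertex linepath_in_cball in \<open>auto simp: linepath_0' linepath_1'\<close>)

lemma disc_class_loop:
  "i \<le> 4 * \<rho> \<Longrightarrow> j \<le> 4 * \<rho> \<Longrightarrow> (\<lambda>t. glue \<rho> (linepath (vertex \<rho> i) (vertex \<rho> j) t)) \<in> surface_loops \<rho>"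
  by (rule disc_path_loop[of "linepath (vertex \<rho> i) (vertex \<rho> j)" \<rho> i j])
    (use linepath_in_cball in \<open>auto simp: linepath_0' linepath_1'\<close>)

lemma disc_class_carrier:
  "i \<le> 4 * \<rho> \<Longrightarrow> j \<le> 4 * \<rho> \<Longrightarrow> disc_class \<rho> i j \<in> carrier (surface_pi1 \<rho>)"
  unfolding disc_class_def carrier_fundamental_group using disc_class_loop by blast

lemma disc_class_mult:
  assumes "i \<le> 4 * \<rho>" "j \<le> 4 * \<rho>" "k \<le> 4 * \<rho>"
  shows "disc_class \<rho> i j \<otimes>\<^bsub>surface_pi1 \<rho>\<^esub> disc_class \<rho> j k = disc_class \<rho> i k"
proof -
  let ?f = "linepath (vertex \<rho> i) (vertex \<rho> j) +++ linepath (vertex \<rho> j) (vertex \<rho> k)"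
  have path: "path ?f" by (simp add: pathfinish_linepath)
  have "disc_class \<rho> i j \<otimes>\<^bsub>surface_pi1 \<rho>\<^esub> disc_class \<rho> j k = surface_loop_class \<rho>
      (loop_join (\<lambda>t. glue \<rho> (linepath (vertex \<rho> i) (vertex \<rho> j) t)) (\<lambda>t. glue \<rho> (linepath (vertex \<rho> j) (vertex \<rho> k) t)))"
    unfolding disc_class_def using disc_class_loop assms by (intro mult_fundamental_group)
  also have "\<dots> = disc_class \<rho> i k"
  proof (rule disc_path_class[where f = ?f])
    show "continuous_on {0..1} ?f" using path by (simp add: path_def)
    show "?f ` {0..1} \<subseteq> cball 0 1"
      using linepath_in_cball by (auto simp: joinpaths_def)
  qed (use assms in \<open>auto simp: joinpaths_def loop_join_def linepath_0' linepath_1'\<close>)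
  finally show ?thesis .
qed

lemma disc_class_refl:
  assumes "vertex \<rho> i = vertex \<rho> j" "i \<le> 4 * \<rho>" shows "disc_class \<rho> i j = \<one>\<^bsub>surface_pi1 \<rho>\<^esub>"
  unfolding disc_class_def one_fundamental_group
  by (rule loop_class_eq_on)
    (use assms disc_class_loop[of i \<rho> i] glue_vertex[of i \<rho>] in \<open>auto simp: linepath_refl\<close>)

lemma disc_class_inv:
  assumes "i \<le> 4 * \<rho>" "j \<le> 4 * \<rho>"
  shows "inv\<^bsub>surface_pi1 \<rho>\<^esub> disc_class \<rho> i j = disc_class \<rho> j i"
proof -
  interpret group "surface_pi1 \<rho>" by (rule group_surface_pi1)
  show ?thesis
    using assms disc_class_mult[of j \<rho> i j] disc_class_refl[of \<rho> j j] disc_class_carrier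
    by (intro inv_equality) auto
qed

abbreviation canonical_class :: "nat \<Rightarrow> surface_gen \<Rightarrow> (real \<Rightarrow> complex set) set" where
  "canonical_class \<rho> s \<equiv> surface_loop_class \<rho> (canonical_loop \<rho> s)"

lemma side_path:
  "continuous_on S (side \<rho> k)" "side \<rho> k ` {0..1} \<subseteq> cball 0 1"
  "side \<rho> k 0 = vertex \<rho> k" "side \<rho> k 1 = vertex \<rho> (k + 1)"
  by (auto simp: side_eq add.commute intro!: continuous_intros)

text \<open>Each generator labels two sides: the first is traversed forwards, the second, two sides
  further on, backwards. Equating the two descriptions is how the gluing enters the fundamental
  group.\<close>

lemma canonical_class_side:
  assumes "1 \<le> i" "i \<le> \<rho>"
  shows "canonical_class \<rho> (Alpha i) = disc_class \<rho> (4 * (i - 1)) (4 * (i - 1) + 1)"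
    and "canonical_class \<rho> (Beta i) = disc_class \<rho> (4 * (i - 1) + 1) (4 * (i - 1) + 2)"
    and "canonical_class \<rho> (Alpha i) = disc_class \<rho> (4 * (i - 1) + 3) (4 * (i - 1) + 2)"
    and "canonical_class \<rho> (Beta i) = disc_class \<rho> (4 * (i - 1) + 4) (4 * (i - 1) + 3)"
    and "canonical_loop \<rho> (Alpha i) \<in> surface_loops \<rho>" "canonical_loop \<rho> (Beta i) \<in> surface_loops \<rho>"
proof -
  define m where "m = i - 1"
  have m: "m < \<rho>" "i = Suc m" using assms by (auto simp: m_def)
  have mod: "(4 * m) mod 4 = 0" "(4 * m + 1) mod 4 = 1" by (simp_all add: mod_Suc)
  have a: "canonical_loop \<rho> (Alpha i) t = glue \<rho> (side \<rho> (4 * m) t)"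
    "canonical_loop \<rho> (Beta i) t = glue \<rho> (side \<rho> (4 * m + 1) t)" for t
    by (simp_all add: m_def)
  have b: "canonical_loop \<rho> (Alpha i) t = glue \<rho> (side \<rho> (4 * m + 2) (1 - t))"
    "canonical_loop \<rho> (Beta i) t = glue \<rho> (side \<rho> (4 * m + 3) (1 - t))" if "t \<in> {0..1}" for t
    using glue_side[of "4 * m" \<rho> t] glue_side[of "4 * m + 1" \<rho> t] mod m(1) that
    unfolding a side_eq by (simp_all add: algebra_simps)
  have rev: "continuous_on {0..1} (\<lambda>t. side \<rho> k (1 - t))" "(\<lambda>t. side \<rho> k (1 - t)) ` {0..1} \<subseteq> cball 0 1" for k
    by (auto simp: side_eq intro!: continuous_intros)
  show "canonical_class \<rho> (Alpha i) = disc_class \<rho> (4 * (i - 1)) (4 * (i - 1) + 1)"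
    by (rule disc_path_class[OF side_path(1)[where k = "4 * m" and \<rho> = \<rho>] side_path(2)[of \<rho> "4 * m"]]) (use m a side_path in auto)
  show "canonical_class \<rho> (Beta i) = disc_class \<rho> (4 * (i - 1) + 1) (4 * (i - 1) + 2)"
    by (rule disc_path_class[OF side_path(1)[where k = "4 * m + 1" and \<rho> = \<rho>] side_path(2)[of \<rho> "4 * m + 1"]]) (use m a side_path(3,4)[of \<rho> "4 * m + 1"] in auto)
  show "canonical_class \<rho> (Alpha i) = disc_class \<rho> (4 * (i - 1) + 3) (4 * (i - 1) + 2)"
    by (rule disc_path_class[OF rev(1)[of "4 * m + 2"] rev(2)[of "4 * m + 2"]]) (use m b side_path(3,4)[of \<rho> "4 * m + 2"] in \<open>auto simp: add.commute\<close>)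
  show "canonical_class \<rho> (Beta i) = disc_class \<rho> (4 * (i - 1) + 4) (4 * (i - 1) + 3)"
    by (rule disc_path_class[OF rev(1)[of "4 * m + 3"] rev(2)[of "4 * m + 3"]]) (use m b side_path(3,4)[of \<rho> "4 * m + 3"] in \<open>auto simp: add.commute\<close>)
  show "canonical_loop \<rho> (Alpha i) \<in> surface_loops \<rho>"
    by (rule disc_path_loop[where i = "4 * m" and j = "4 * m + 1", OF side_path(1)[where k = "4 * m" and \<rho> = \<rho>] side_path(2)[of \<rho> "4 * m"]])
      (use m a side_path(3,4)[of \<rho> "4 * m"] in auto)
  show "canonical_loop \<rho> (Beta i) \<in> surface_loops \<rho>"
    by (rule disc_path_loop[where i = "4 * m + 1" and j = "4 * m + 2", OF side_path(1)[where k = "4 * m + 1" and \<rho> = \<rho>] side_path(2)[of \<rho> "4 * m + 1"]])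
      (use m a side_path(3,4)[of \<rho> "4 * m + 1"] in auto)
qed

lemma canonical_loop_loops: "s \<in> surface_gens \<rho> \<Longrightarrow> canonical_loop \<rho> s \<in> surface_loops \<rho>"
  using canonical_class_side(5,6) by (auto simp: surface_gens_def)

lemma canonical_class_Pi: "canonical_class \<rho> \<in> surface_gens \<rho> \<rightarrow> carrier (surface_pi1 \<rho>)"
  using canonical_loop_loops by (auto simp: carrier_fundamental_group)

text \<open>The product telescopes: the block of a handle is the chord from vertex
  \<open>4 * m\<close> to vertex \<open>4 * m + 4\<close>, and the whole relator ends at vertex
  \<open>4 * \<rho>\<close>, which is the same point as vertex 0.\<close>

lemma canonical_class_relator:
  assumes "\<rho> > 0"
  shows "word_eval (surface_pi1 \<rho>) (canonical_class \<rho>) (surface_relator \<rho>) = \<one>\<^bsub>surface_pi1 \<rho>\<^esub>"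
proof -
  interpret group "surface_pi1 \<rho>" by (rule group_surface_pi1)
  have block: "word_eval (surface_pi1 \<rho>) (canonical_class \<rho>) (surface_block (Suc m)) = disc_class \<rho> (4 * m) (4 * m + 4)"
    if "m < \<rho>" for m
  proof -
    have i: "1 \<le> Suc m" "Suc m \<le> \<rho>" using that by auto
    note c = canonical_class_side(1-4)[OF i, unfolded diff_Suc_1]
    have "word_eval (surface_pi1 \<rho>) (canonical_class \<rho>) (surface_block (Suc m)) =
        canonical_class \<rho> (Alpha (Suc m)) \<otimes>\<^bsub>surface_pi1 \<rho>\<^esub> (canonical_class \<rho> (Beta (Suc m)) \<otimes>\<^bsub>surface_pi1 \<rho>\<^esub>
        (inv\<^bsub>surface_pi1 \<rho>\<^esub> canonical_class \<rho> (Alpha (Suc m)) \<otimes>\<^bsub>surface_pi1 \<rho>\<^esub> inv\<^bsub>surface_pi1 \<rho>\<^esub> canonical_class \<rho> (Beta (Suc m))))"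
      using canonical_class_Pi[of \<rho>] i by (simp add: surface_block_def Pi_iff del: canonical_loop.simps)
    also have "\<dots> = disc_class \<rho> (4 * m) (4 * m + 1) \<otimes>\<^bsub>surface_pi1 \<rho>\<^esub> (disc_class \<rho> (4 * m + 1) (4 * m + 2) \<otimes>\<^bsub>surface_pi1 \<rho>\<^esub>
        (inv\<^bsub>surface_pi1 \<rho>\<^esub> disc_class \<rho> (4 * m + 3) (4 * m + 2) \<otimes>\<^bsub>surface_pi1 \<rho>\<^esub> inv\<^bsub>surface_pi1 \<rho>\<^esub> disc_class \<rho> (4 * m + 4) (4 * m + 3)))"
      using c by metis
    also have "\<dots> = disc_class \<rho> (4 * m) (4 * m + 4)"
      using that by (simp add: disc_class_inv disc_class_mult del: add_Suc_right add_2_eq_Suc')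
    finally show ?thesis .
  qed
  have "word_eval (surface_pi1 \<rho>) (canonical_class \<rho>) (concat (map surface_block [1..<Suc m])) = disc_class \<rho> 0 (4 * m)"
    if "m \<le> \<rho>" for m
    using that
  proof (induction m)
    case 0
    show ?case using disc_class_refl[of \<rho> 0 0] by simp
  next
    case (Suc m)
    have "concat (map surface_block [1..<Suc m]) \<in> words (surface_gens \<rho>)"
      by (rule concat_surface_block_words) (use Suc.prems in auto)
    then have "word_eval (surface_pi1 \<rho>) (canonical_class \<rho>) (concat (map surface_block [1..<Suc m]) @ surface_block (Suc m))
      = disc_class \<rho> 0 (4 * m) \<otimes>\<^bsub>surface_pi1 \<rho>\<^esub> disc_class \<rho> (4 * m) (4 * m + 4)"
      using Suc block[of m] surface_block_words[of "Suc m" \<rho>]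
      by (subst word_eval_append[OF canonical_class_Pi]) auto
    also have "\<dots> = disc_class \<rho> 0 (4 * Suc m)"
      using Suc.prems disc_class_mult[of 0 \<rho> "4 * m" "4 * m + 4"] by (simp add: add.commute)
    finally show ?case by simp
  qed
  from this[of \<rho>] have "word_eval (surface_pi1 \<rho>) (canonical_class \<rho>) (surface_relator \<rho>) = disc_class \<rho> 0 (4 * \<rho>)"
    by (simp add: surface_relator_eq)
  also have "\<dots> = \<one>\<^bsub>surface_pi1 \<rho>\<^esub>"
    using boundary_point_wrap[OF assms] by (intro disc_class_refl) auto
  finally show ?thesis .
qed

definition surface_Phi :: "nat \<Rightarrow> surface_gen word set \<Rightarrow> (real \<Rightarrow> complex set) set" where
  "surface_Phi \<rho> = surface_lift \<rho> (surface_pi1 \<rho>) (canonical_class \<rho>)"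

lemma surface_Phi:
  assumes "\<rho> > 0"
  shows "surface_Phi \<rho> \<in> hom (surface_group \<rho>) (surface_pi1 \<rho>)"
    and "s \<in> surface_gens \<rho> \<Longrightarrow> surface_Phi \<rho> (gen \<rho> s) = canonical_class \<rho> s"
  unfolding surface_Phi_def
  using surface_lift[OF group_surface_pi1 canonical_class_Pi canonical_class_relator[OF assms]] by blast+

text \<open>The two halves of the path leave and re-enter the disc through a glued pair of sides. Sliding
  the crossing point along these sides moves it to a vertex.\<close>

lemma disc_path_class_crossing:
  assumes f: "continuous_on {0..1/2} f" "f ` {0..1/2} \<subseteq> cball 0 1" "f 0 = vertex \<rho> i" "f (1/2) = side \<rho> m (1/2)"
    and g: "continuous_on {1/2..1} g" "g ` {1/2..1} \<subseteq> cball 0 1" "g (1/2) = side \<rho> m' (1/2)" "g 1 = vertex \<rho> j"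
    and le: "i \<le> 4 * \<rho>" "j \<le> 4 * \<rho>" "m \<le> 4 * \<rho>" "m' < 4 * \<rho>"
    and glue: "\<And>s. s \<in> {0..1} \<Longrightarrow> glue \<rho> (side \<rho> m s) = glue \<rho> (side \<rho> m' (1 - s))"
    and p: "\<And>t. t \<in> {0..1/2} \<Longrightarrow> p t = glue \<rho> (f t)" "\<And>t. t \<in> {1/2..1} \<Longrightarrow> p t = glue \<rho> (g t)"
  shows "surface_loop_class \<rho> p = disc_class \<rho> i m \<otimes>\<^bsub>surface_pi1 \<rho>\<^esub> disc_class \<rho> (m' + 1) j"
proof -
  \<comment> \<open>The interpolations below may leave the disc; the radial retraction pushes them
    back and fixes the disc pointwise.\<close>
  define ret where "ret z = z /\<^sub>R max 1 (norm z)" for z :: complex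
  have ret_cont: "continuous_on S (\<lambda>z. ret (h z))" if "continuous_on S h" for S :: "(real \<times> real) set" and h
    unfolding ret_def by (intro continuous_intros that) (auto simp: max_def)
  have ret_mem: "ret z \<in> cball 0 1" for z
    by (auto simp: ret_def divide_simps max_def)
  have ret_id: "ret z = z" if "z \<in> cball 0 1" for z
    using that by (simp add: ret_def max_def)
  \<comment> \<open>At time \<open>s = fst z\<close> the path lies between \<open>f\<close> and the
    chord to vertex \<open>m\<close>. The last summand vanishes at the start of the path and
    corrects its end, so that the exit point is exactly \<open>side \<rho> m ((1 - s) / 2)\<close>
    and moves from the midpoint of the side to its first vertex.\<close>
  define F where "F z = ret ((1 - fst z) *\<^sub>R f (snd z) + fst z *\<^sub>R linepath (vertex \<rho> i) (vertex \<rho> m) (2 * snd z)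
     + (2 * snd z) *\<^sub>R (side \<rho> m ((1 - fst z) / 2) - (1 - fst z) *\<^sub>R side \<rho> m (1/2) - fst z *\<^sub>R vertex \<rho> m))" for z :: "real \<times> real"
  \<comment> \<open>The entry point \<open>side \<rho> m' ((1 + s) / 2)\<close> moves in step to the
    last vertex \<open>m' + 1\<close>; the two parameters add up to 1, so entry and exit stay
    glued.\<close>
  define H where "H z = ret ((1 - fst z) *\<^sub>R g (snd z) + fst z *\<^sub>R linepath (vertex \<rho> (m' + 1)) (vertex \<rho> j) (2 * snd z - 1)
     + (2 - 2 * snd z) *\<^sub>R (side \<rho> m' ((1 + fst z) / 2) - (1 - fst z) *\<^sub>R side \<rho> m' (1/2) - fst z *\<^sub>R vertex \<rho> (m' + 1)))" for z :: "real \<times> real"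
  have cF: "continuous_on ({0..1} \<times> {0..1/2}) F"
    unfolding F_def side_eq linepath_def
    by (intro ret_cont continuous_intros continuous_on_compose2[OF f(1)]) auto
  have cH: "continuous_on ({0..1} \<times> {1/2..1}) H"
    unfolding H_def side_eq linepath_def
    by (intro ret_cont continuous_intros continuous_on_compose2[OF g(1)]) auto
  have F0: "F (s, 0) = vertex \<rho> i" for s
  proof -
    have "(1 - s) *\<^sub>R vertex \<rho> i + s *\<^sub>R vertex \<rho> i = vertex \<rho> i"
      by (simp flip: scaleR_add_left)
    then show ?thesis by (simp add: F_def f(3) linepath_0' ret_id)
  qed
  have F1: "F (s, 1/2) = side \<rho> m ((1 - s) / 2)" for s
    by (simp add: F_def f(4) linepath_1' ret_id side_eq)
  have H0: "H (s, 1/2) = side \<rho> m' ((1 + s) / 2)" for s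
    by (simp add: H_def g(3) linepath_0' ret_id side_eq)
  have H1: "H (s, 1) = vertex \<rho> j" for s
  proof -
    have "(1 - s) *\<^sub>R vertex \<rho> j + s *\<^sub>R vertex \<rho> j = vertex \<rho> j"
      by (simp flip: scaleR_add_left)
    then show ?thesis by (simp add: H_def g(4) linepath_1' ret_id)
  qed
  have Fs: "F (0, t) = f t" if "t \<in> {0..1/2}" for t
    using f(2) that by (simp add: F_def ret_id image_subset_iff)
  have Fe: "F (1, t) = linepath (vertex \<rho> i) (vertex \<rho> m) (2 * t)" if "t \<in> {0..1/2}" for t
    using that linepath_in_cball[of "vertex \<rho> i" "vertex \<rho> m" "2 * t"] by (simp add: F_def ret_id side_eq)
  have Hs: "H (0, t) = g t" if "t \<in> {1/2..1}" for t
    using g(2) that by (simp add: H_def ret_id image_subset_iff)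
  have He: "H (1, t) = linepath (vertex \<rho> (m' + 1)) (vertex \<rho> j) (2 * t - 1)" if "t \<in> {1/2..1}" for t
    using that linepath_in_cball[of "vertex \<rho> (m' + 1)" "vertex \<rho> j" "2 * t - 1"]
    by (simp add: H_def ret_id side_eq add.commute)
  let ?I = "top_of_set {0..1::real}"
  let ?II = "prod_topology ?I ?I"
  have II: "?II = top_of_set ({0..1} \<times> {0..1})"
    by (simp add: prod_topology_subtopology_eu)
  define K where "K z = (if snd z \<le> 1/2 then glue \<rho> (F z) else glue \<rho> (H z))" for z
  have cgF: "continuous_map (top_of_set ({0..1} \<times> {0..1/2})) (surface \<rho>) (glue \<rho> \<circ> F)"
    by (rule continuous_map_compose[OF _ continuous_map_glue])
      (use cF in \<open>auto simp: continuous_map_in_subtopology F_def ret_mem[simplified]\<close>)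
  have cgH: "continuous_map (top_of_set ({0..1} \<times> {1/2..1})) (surface \<rho>) (glue \<rho> \<circ> H)"
    by (rule continuous_map_compose[OF _ continuous_map_glue])
      (use cH in \<open>auto simp: continuous_map_in_subtopology H_def ret_mem[simplified]\<close>)
  have "continuous_map ?II (surface \<rho>) (\<lambda>z. if snd z \<le> 1/2 then (glue \<rho> \<circ> F) z else (glue \<rho> \<circ> H) z)"
  proof (rule continuous_map_cases_le)
    have "({0..1::real} \<times> {0..1::real}) \<inter> {z \<in> topspace ?II. snd z \<le> 1/2} = {0..1} \<times> {0..1/2}" by auto
    then show "continuous_map (subtopology ?II {z \<in> topspace ?II. snd z \<le> 1/2}) (surface \<rho>) (glue \<rho> \<circ> F)"
      unfolding II subtopology_subtopology using cgF by (simp add: II)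
    have "({0..1::real} \<times> {0..1::real}) \<inter> {z \<in> topspace ?II. 1/2 \<le> snd z} = {0..1} \<times> {1/2..1}" by auto
    then show "continuous_map (subtopology ?II {z \<in> topspace ?II. 1/2 \<le> snd z}) (surface \<rho>) (glue \<rho> \<circ> H)"
      unfolding II subtopology_subtopology using cgH by (simp add: II)
    show "continuous_map ?II euclideanreal snd"
      unfolding II by (auto intro!: continuous_intros)
    show "(glue \<rho> \<circ> F) z = (glue \<rho> \<circ> H) z" if "z \<in> topspace ?II" "snd z = 1/2" for z
    proof -
      define s where "s = fst z"
      have z: "z = (s, 1/2)" "s \<in> {0..1}"
        using that by (auto simp: s_def prod_eq_iff II)
      then show ?thesis
        using glue[of "(1 - s) / 2"] by (simp add: F1[simplified] H0[simplified] field_simps)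
    qed
  qed auto
  then have K: "continuous_map ?II (surface \<rho>) K"
    by (simp only: K_def[abs_def] o_def)
  have "loop_homotopic (surface \<rho>) (surface_base \<rho>) (\<lambda>t. K (0, t)) (\<lambda>t. K (1, t))"
    unfolding homotopic_with_def
    by (rule exI[of _ K]) (use K le glue_vertex in \<open>auto simp: K_def F0 H1\<close>)
  then have "loop_homotopic (surface \<rho>) (surface_base \<rho>) p
      (loop_join (\<lambda>t. glue \<rho> (linepath (vertex \<rho> i) (vertex \<rho> m) t)) (\<lambda>t. glue \<rho> (linepath (vertex \<rho> (m' + 1)) (vertex \<rho> j) t)))"
    by (rule homotopic_with_eq) (auto simp: K_def loop_join_def Fs Fe Hs He p)
  then have "surface_loop_class \<rho> p = surface_loop_class \<rho>
      (loop_join (\<lambda>t. glue \<rho> (linepath (vertex \<rho> i) (vertex \<rho> m) t)) (\<lambda>t. glue \<rho> (linepath (vertex \<rho> (m' + 1)) (vertex \<rho> j) t)))"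
    by (rule loop_class_eqI)
  also have "\<dots> = disc_class \<rho> i m \<otimes>\<^bsub>surface_pi1 \<rho>\<^esub> disc_class \<rho> (m' + 1) j"
    unfolding disc_class_def by (intro mult_fundamental_group[symmetric] disc_class_loop) (use le in simp_all)
  finally show ?thesis .
qed

section \<open>Twists along strips in the polygon\<close>

text \<open>The circle is the union of two arcs, both parametrised by the real part
  \<open>x\<close>: \<open>P\<close> is the strip over the upper half and \<open>Q\<close> the strip
  over the lower half. They meet in the surface at \<open>x = 1\<close> and \<open>x = -1\<close>,
  and \<open>s\<close> runs across the strips.\<close>

locale annulus_chart =
  fixes \<rho> :: nat and P Q :: "real \<Rightarrow> real \<Rightarrow> complex"
  assumes contP: "continuous_on ({-1..1} \<times> {0..1}) (\<lambda>y. P (fst y) (snd y))"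
    and contQ: "continuous_on ({-1..1} \<times> {0..1}) (\<lambda>y. Q (fst y) (snd y))"
    and memP: "\<And>x s. x \<in> {-1..1} \<Longrightarrow> s \<in> {0..1} \<Longrightarrow> P x s \<in> cball 0 1"
    and memQ: "\<And>x s. x \<in> {-1..1} \<Longrightarrow> s \<in> {0..1} \<Longrightarrow> Q x s \<in> cball 0 1"
    and glue_ends: "\<And>x s. x \<in> {-1, 1} \<Longrightarrow> s \<in> {0..1} \<Longrightarrow> glue \<rho> (P x s) = glue \<rho> (Q x s)"
begin

text \<open>The points of the disc above a point of the annulus: a single one inside an arc, but a
  \<open>P\<close>-point and a \<open>Q\<close>-point where the arcs meet. These two may be distinct
  partners on the boundary of the polygon.\<close>

definition reps :: "complex \<times> real \<Rightarrow> complex set" where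
  "reps a = {w. Im (fst a) \<ge> 0 \<and> w = P (Re (fst a)) (snd a) \<or> Im (fst a) \<le> 0 \<and> w = Q (Re (fst a)) (snd a)}"

definition chart :: "complex \<times> real \<Rightarrow> complex set" where
  "chart a = (if 0 \<le> Im (fst a) then glue \<rho> (P (Re (fst a)) (snd a)) else glue \<rho> (Q (Re (fst a)) (snd a)))"

lemma Re_mem: "z \<in> sphere 0 1 \<Longrightarrow> Re z \<in> {-1..1}"
  using abs_Re_le_cmod[of z] by auto

lemma Re_end: "z \<in> sphere 0 1 \<Longrightarrow> Im z = 0 \<Longrightarrow> Re z \<in> {-1, 1}"
  by (auto simp: cmod_def power2_eq_1_iff)

lemma chart_eq: "a \<in> closed_annulus \<Longrightarrow> w \<in> reps a \<Longrightarrow> chart a = glue \<rho> w"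
  using glue_ends[OF Re_end[of "fst a"], of "snd a"]
  by (cases a) (force simp: reps_def chart_def)

lemma reps_mem: "a \<in> closed_annulus \<Longrightarrow> w \<in> reps a \<Longrightarrow> w \<in> cball 0 1"
  using Re_mem[of "fst a"] memP[of "Re (fst a)" "snd a"] memQ[of "Re (fst a)" "snd a"]
  by (cases a) (auto simp: reps_def)

lemma reps_nonempty: "\<exists>w. w \<in> reps a"
  by (cases "Im (fst a) \<ge> 0") (auto simp: reps_def)

lemma continuous_chart: "continuous_map (top_of_set closed_annulus) (surface \<rho>) chart"
proof -
  let ?A = "top_of_set closed_annulus"
  have half: "continuous_map (top_of_set A) (surface \<rho>) (glue \<rho> \<circ> (\<lambda>a. f (Re (fst a)) (snd a)))"
    if "continuous_on ({-1..1} \<times> {0..1}) (\<lambda>y. f (fst y) (snd y))" "A \<subseteq> closed_annulus"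
      "\<And>x s. x \<in> {-1..1} \<Longrightarrow> s \<in> {0..1} \<Longrightarrow> f x s \<in> cball 0 1" for f :: "real \<Rightarrow> real \<Rightarrow> complex" and A
  proof (rule continuous_map_compose[OF _ continuous_map_glue])
    have im: "(\<lambda>a. (Re (fst a), snd a)) ` A \<subseteq> {-1..1} \<times> {0..1}"
      using that(2) Re_mem by fastforce
    have "continuous_on A (\<lambda>a. (\<lambda>y. f (fst y) (snd y)) (Re (fst a), snd a))"
      by (rule continuous_on_compose2[OF that(1) _ im]) (intro continuous_intros)
    moreover have "f (Re (fst a)) (snd a) \<in> cball 0 1" if "a \<in> A" for a
      using im that \<open>\<And>x s. x \<in> {-1..1} \<Longrightarrow> s \<in> {0..1} \<Longrightarrow> f x s \<in> cball 0 1\<close> by blast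
    ultimately show "continuous_map (top_of_set A) (top_of_set (cball 0 1)) (\<lambda>a. f (Re (fst a)) (snd a))"
      unfolding continuous_map_in_subtopology by simp
  qed
  have "continuous_map ?A (surface \<rho>) (\<lambda>a. if 0 \<le> Im (fst a)
      then (glue \<rho> \<circ> (\<lambda>a. P (Re (fst a)) (snd a))) a else (glue \<rho> \<circ> (\<lambda>a. Q (Re (fst a)) (snd a))) a)"
  proof (rule continuous_map_cases_le)
    show "continuous_map ?A euclideanreal (\<lambda>a. Im (fst a))"
      by (auto intro!: continuous_intros)
    show "continuous_map (subtopology ?A {x \<in> topspace ?A. 0 \<le> Im (fst x)}) (surface \<rho>) (glue \<rho> \<circ> (\<lambda>a. P (Re (fst a)) (snd a)))"
      unfolding subtopology_subtopology by (rule half[OF contP _ memP]) auto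
    show "continuous_map (subtopology ?A {x \<in> topspace ?A. Im (fst x) \<le> 0}) (surface \<rho>) (glue \<rho> \<circ> (\<lambda>a. Q (Re (fst a)) (snd a)))"
      unfolding subtopology_subtopology by (rule half[OF contQ _ memQ]) auto
    show "(glue \<rho> \<circ> (\<lambda>a. P (Re (fst a)) (snd a))) a = (glue \<rho> \<circ> (\<lambda>a. Q (Re (fst a)) (snd a))) a"
      if "a \<in> topspace ?A" "0 = Im (fst a)" for a
      using that glue_ends[OF Re_end[of "fst a"]] by auto
  qed auto
  then show ?thesis
    by (simp only: chart_def[abs_def] o_def)
qed

lemma compact_reps:
  assumes "compact C" "C \<subseteq> closed_annulus"
  shows "compact (\<Union>a\<in>C. reps a)"
proof -
  have "compact ((\<lambda>a. f (Re (fst a)) (snd a)) ` D)"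
    if "continuous_on ({-1..1} \<times> {0..1}) (\<lambda>y. f (fst y) (snd y))" "D \<subseteq> closed_annulus" "compact D"
    for f :: "real \<Rightarrow> real \<Rightarrow> complex" and D
  proof (rule compact_continuous_image[OF _ that(3)])
    have im: "(\<lambda>a. (Re (fst a), snd a)) ` D \<subseteq> {-1..1} \<times> {0..1}"
      using that(2) Re_mem by fastforce
    show "continuous_on D (\<lambda>a. f (Re (fst a)) (snd a))"
      using continuous_on_compose2[OF that(1) _ im, OF continuous_on_Pair]
      by (simp add: continuous_intros)
  qed
  note img = this
  have cl: "closed {a :: complex \<times> real. 0 \<le> Im (fst a)}" "closed {a :: complex \<times> real. Im (fst a) \<le> 0}"
    by (auto intro!: closed_Collect_le continuous_intros)
  have "(\<Union>a\<in>C. reps a) = (\<lambda>a. P (Re (fst a)) (snd a)) ` (C \<inter> {a. 0 \<le> Im (fst a)})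
      \<union> (\<lambda>a. Q (Re (fst a)) (snd a)) ` (C \<inter> {a. Im (fst a) \<le> 0})"
    by (auto simp: reps_def)
  also have "compact \<dots>"
    using assms cl by (intro compact_Un img[OF contP] img[OF contQ] compact_Int_closed) auto
  finally show ?thesis .
qed

end

text \<open>An embedding into a quotient, expressed in the disc: \<open>saturated\<close> and
  \<open>disjoint\<close> make the sets \<open>reps a\<close> complete and disjoint fibres of the
  gluing, and \<open>open_reps\<close> is openness in the quotient topology.\<close>

locale embedded_annulus_chart = annulus_chart +
  assumes saturated: "\<And>a w w'. a \<in> closed_annulus \<Longrightarrow> w \<in> reps a \<Longrightarrow>
      side_pairing \<rho> w w' \<or> side_pairing \<rho> w' w \<Longrightarrow> w' \<in> reps a"
    and disjoint: "\<And>a b w. a \<in> closed_annulus \<Longrightarrow> b \<in> closed_annulus \<Longrightarrow> w \<in> reps a \<Longrightarrow> w \<in> reps b \<Longrightarrow> a = b"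
    and open_reps: "openin (top_of_set (cball 0 1)) (\<Union>a\<in>open_annulus. reps a)"
begin

lemma reps_glue:
  assumes "a \<in> closed_annulus" "w \<in> reps a" "glue \<rho> w = glue \<rho> w'"
  shows "w' \<in> reps a"
proof -
  have "equivclp (side_pairing \<rho>) w w'"
    using assms(3) by (simp add: glue_eq_iff)
  then show ?thesis
    by (induction rule: equivclp_induct) (use assms saturated in blast)+
qed

lemma glue_mem_chart:
  assumes "a \<in> closed_annulus" "glue \<rho> w = chart a"
  shows "w \<in> reps a"
  using reps_nonempty[of a] chart_eq reps_glue assms by metis

text \<open>Through this equality, closedness and openness in the surface become statements about
  subsets of the disc.\<close>

lemma chart_preimage:
  assumes "B \<subseteq> closed_annulus"
  shows "{w \<in> cball 0 1. glue \<rho> w \<in> chart ` B} = (\<Union>a\<in>B. reps a)"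
proof (rule Set.set_eqI, rule iffI)
  fix w assume "w \<in> {w \<in> cball 0 1. glue \<rho> w \<in> chart ` B}"
  then show "w \<in> (\<Union>a\<in>B. reps a)"
    using glue_mem_chart assms by blast
next
  fix w assume "w \<in> (\<Union>a\<in>B. reps a)"
  then obtain a where a: "a \<in> B" "w \<in> reps a" by blast
  then have "glue \<rho> w = chart a" "w \<in> cball 0 1"
    using chart_eq reps_mem assms by blast+
  then show "w \<in> {w \<in> cball 0 1. glue \<rho> w \<in> chart ` B}"
    using a(1) by blast
qed

lemma chart_in_surface: "a \<in> closed_annulus \<Longrightarrow> chart a \<in> topspace (surface \<rho>)"
  using reps_nonempty[of a] chart_eq[of a] reps_mem[of a] by (auto simp: topspace_surface)

lemma embedded_annulus: "embedded_annulus (surface \<rho>) chart"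
proof
  show "continuous_map (top_of_set closed_annulus) (surface \<rho>) chart"
    by (rule continuous_chart)
  show "closedin (surface \<rho>) (chart ` C)" if C: "C \<subseteq> closed_annulus" "compact C" for C
  proof -
    have "closedin (top_of_set (cball 0 1)) (\<Union>a\<in>C. reps a)"
      using compact_reps[OF C(2,1)] reps_mem C(1)
      by (intro closed_subset compact_imp_closed) auto
    then have "closedin (top_of_set (cball 0 1)) {w \<in> topspace (top_of_set (cball 0 1)). glue \<rho> w \<in> chart ` C}"
      using chart_preimage[OF C(1)] by simp
    moreover have "chart ` C \<subseteq> topspace (surface \<rho>)"
      using C(1) chart_in_surface by blast
    ultimately show ?thesis
      using quotient_map_glue[of \<rho>] unfolding quotient_map_closedin by blast
  qed
  show "inj_on chart closed_annulus"
  proof (rule inj_onI)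
    fix a b assume ab: "a \<in> closed_annulus" "b \<in> closed_annulus" "chart a = chart b"
    obtain w where w: "w \<in> reps a" using reps_nonempty by blast
    then have "w \<in> reps b"
      using glue_mem_chart[OF ab(2)] chart_eq[OF ab(1) w] ab(3) by metis
    then show "a = b" using disjoint ab w by blast
  qed
  have "openin (top_of_set (cball 0 1)) {w \<in> cball 0 1. glue \<rho> w \<in> chart ` open_annulus}"
    using open_reps chart_preimage[of open_annulus] by force
  moreover have "chart ` open_annulus \<subseteq> glue \<rho> ` cball 0 1"
    using chart_in_surface by (auto simp: topspace_surface)
  ultimately show "openin (surface \<rho>) (chart ` open_annulus)"
    unfolding openin_surface by blast
qed

sublocale embedded_annulus "surface \<rho>" chart
  by (rule embedded_annulus)

text \<open>Lets a twist be computed in the disc with any convenient representative of the twisted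
  point.\<close>

lemma twist_reps:
  assumes "a \<in> closed_annulus" "w \<in> reps a" "w' \<in> reps (annulus_twist \<sigma> a)"
  shows "twist \<sigma> (glue \<rho> w) = glue \<rho> w'"
proof -
  have "annulus_twist \<sigma> a \<in> closed_annulus"
    using assms(1) annulus_twist_mem by blast
  then show ?thesis
    using twist_E[OF assms(1)] chart_eq assms by metis
qed

lemma twist_off:
  assumes "\<And>a. a \<in> closed_annulus \<Longrightarrow> w \<notin> reps a"
  shows "twist \<sigma> (glue \<rho> w) = glue \<rho> w"
proof -
  have "glue \<rho> w \<notin> chart ` closed_annulus"
    using glue_mem_chart assms by blast
  then show ?thesis by (simp add: twist_def)
qed

end

section \<open>Families of parallel chords of the disc\<close>

text \<open>The segment from the boundary point with coordinate \<open>c - d\<close> to that with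
  coordinate \<open>c + d\<close>, with position \<open>x\<close> between -1 and 1. Chords with the
  same \<open>c\<close> are perpendicular to one direction, hence parallel, and disjoint for
  different \<open>d\<close> between 0 and \<open>2 * \<rho>\<close>.\<close>

definition chord :: "nat \<Rightarrow> real \<Rightarrow> real \<Rightarrow> real \<Rightarrow> complex" where
  "chord \<rho> c d x = cis (2 * pi * c / (4 * real \<rho>)) *
     Complex (cos (2 * pi * d / (4 * real \<rho>))) (x * sin (2 * pi * d / (4 * real \<rho>)))"

lemma chord_ends:
  "chord \<rho> c d 1 = boundary_point \<rho> (c + d)" "chord \<rho> c d (- 1) = boundary_point \<rho> (c - d)"
proof -
  have "Complex (cos t) (1 * sin t) = cis t" "Complex (cos t) (- 1 * sin t) = cis (- t)" for t
    by (simp_all add: complex_eq_iff)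
  then show "chord \<rho> c d 1 = boundary_point \<rho> (c + d)" "chord \<rho> c d (- 1) = boundary_point \<rho> (c - d)"
    by (simp_all only: chord_def boundary_point_def cis_mult)
      (simp_all add: field_simps add_divide_distrib diff_divide_distrib)
qed

lemma norm_chord_sq: "(norm (chord \<rho> c d x))\<^sup>2 = 1 - (1 - x\<^sup>2) * (sin (2 * pi * d / (4 * real \<rho>)))\<^sup>2"
  by (simp add: chord_def norm_mult cmod_power2 power_mult_distrib cos_squared_eq algebra_simps)

lemma chord_mem: "\<bar>x\<bar> \<le> 1 \<Longrightarrow> chord \<rho> c d x \<in> cball 0 1"
proof -
  assume "\<bar>x\<bar> \<le> 1"
  then have "x\<^sup>2 \<le> 1" by (simp add: abs_square_le_1)
  then have "(norm (chord \<rho> c d x))\<^sup>2 \<le> 1"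
    unfolding norm_chord_sq by simp
  then show ?thesis
    using power2_le_imp_le[of "norm (chord \<rho> c d x)" 1] by simp
qed

lemma chord_angle:
  assumes "0 < d" "d < 2 * real \<rho>"
  shows "0 < 2 * pi * d / (4 * real \<rho>)" "2 * pi * d / (4 * real \<rho>) < pi" "sin (2 * pi * d / (4 * real \<rho>)) > 0"
proof -
  show 1: "0 < 2 * pi * d / (4 * real \<rho>)" "2 * pi * d / (4 * real \<rho>) < pi"
    using assms by (auto simp: field_simps)
  then show "sin (2 * pi * d / (4 * real \<rho>)) > 0" by (rule sin_gt_zero)
qed

lemma chord_boundary:
  assumes "0 < d" "d < 2 * real \<rho>" "norm (chord \<rho> c d x) = 1"
  shows "x = 1 \<or> x = -1"
  using norm_chord_sq[of \<rho> c d x] assms(3) chord_angle(3)[OF assms(1,2)] by (simp add: power2_eq_1_iff)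

lemma chord_inj:
  assumes "0 < d" "d < 2 * real \<rho>" "0 < d'" "d' < 2 * real \<rho>" "chord \<rho> c d x = chord \<rho> c d' x'"
  shows "d = d'" "x = x'"
proof -
  let ?t = "2 * pi * d / (4 * real \<rho>)" and ?t' = "2 * pi * d' / (4 * real \<rho>)"
  have e: "cos ?t = cos ?t'" "x * sin ?t = x' * sin ?t'"
    using assms(5) by (auto simp: chord_def)
  have "?t = ?t'"
    using cos_inj_pi[of ?t ?t'] e(1) chord_angle(1,2)[OF assms(1,2)] chord_angle(1,2)[OF assms(3,4)] by simp
  then show "d = d'"
    using assms by (cases "\<rho> = 0") auto
  then show "x = x'"
    using e(2) chord_angle(3)[OF assms(1,2)] by simp
qed

lemma chord_Re: "Re (cis (- (2 * pi * c / (4 * real \<rho>))) * chord \<rho> c d x) = cos (2 * pi * d / (4 * real \<rho>))"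
proof -
  have "cis (- t) * (cis t * z) = z" for t z
    by (simp only: mult.assoc[symmetric] cis_mult) simp
  then show ?thesis
    unfolding chord_def by (simp only: complex.sel)
qed

text \<open>After rotation the chord of half-width \<open>d\<close> lies on the vertical line whose
  real part is the cosine of its angle. As the cosine decreases on [0, pi], the chords between two
  half-widths fill the part of the disc between two parallel lines.\<close>

lemma chord_region:
  assumes "0 < d1" "d1 < d2" "d2 < 2 * real \<rho>"
  shows "(\<Union>d\<in>{d1<..<d2}. chord \<rho> c d ` {-1..1}) =
    cball 0 1 \<inter> {z. cos (2 * pi * d2 / (4 * real \<rho>)) < Re (cis (- (2 * pi * c / (4 * real \<rho>))) * z) \<and>
                 Re (cis (- (2 * pi * c / (4 * real \<rho>))) * z) < cos (2 * pi * d1 / (4 * real \<rho>))}"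
proof (rule Set.set_eqI, rule iffI)
  have r: "\<rho> > 0" using assms by (cases "\<rho> = 0") auto
  fix z assume "z \<in> (\<Union>d\<in>{d1<..<d2}. chord \<rho> c d ` {-1..1})"
  then obtain d x where d: "d1 < d" "d < d2" "x \<in> {-1..1}" "z = chord \<rho> c d x" by auto
  have b: "0 < d" "d < 2 * real \<rho>" "d2 < 2 * real \<rho>" "0 < d2" "0 < d1" "d1 < 2 * real \<rho>" using d assms by auto
  have "2 * pi * d1 / (4 * real \<rho>) < 2 * pi * d / (4 * real \<rho>)" "2 * pi * d / (4 * real \<rho>) < 2 * pi * d2 / (4 * real \<rho>)"
    using d r by (auto simp: divide_strict_right_mono)
  then have "cos (2 * pi * d2 / (4 * real \<rho>)) < cos (2 * pi * d / (4 * real \<rho>))"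
      "cos (2 * pi * d / (4 * real \<rho>)) < cos (2 * pi * d1 / (4 * real \<rho>))"
    using chord_angle(1,2)[OF b(1,2)] chord_angle(1,2)[OF b(4,3)] chord_angle(1,2)[OF b(5,6)]
    by (auto intro!: cos_monotone_0_pi)
  then show "z \<in> cball 0 1 \<inter> {z. cos (2 * pi * d2 / (4 * real \<rho>)) < Re (cis (- (2 * pi * c / (4 * real \<rho>))) * z) \<and>
                 Re (cis (- (2 * pi * c / (4 * real \<rho>))) * z) < cos (2 * pi * d1 / (4 * real \<rho>))}"
    using d(3) chord_mem[of x \<rho> c d] unfolding d(4) Int_iff mem_Collect_eq chord_Re by auto
next
  have r: "\<rho> > 0" using assms by (cases "\<rho> = 0") auto
  fix z assume z: "z \<in> cball 0 1 \<inter> {z. cos (2 * pi * d2 / (4 * real \<rho>)) < Re (cis (- (2 * pi * c / (4 * real \<rho>))) * z) \<and>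
                 Re (cis (- (2 * pi * c / (4 * real \<rho>))) * z) < cos (2 * pi * d1 / (4 * real \<rho>))}"
  define u where "u = cis (- (2 * pi * c / (4 * real \<rho>))) * z"
  have zu: "z = cis (2 * pi * c / (4 * real \<rho>)) * u"
    by (simp add: u_def mult.assoc[symmetric] cis_mult)
  have nu: "norm u \<le> 1" using z by (simp add: u_def norm_mult)
  have b: "d2 < 2 * real \<rho>" "0 < d2" "0 < d1" "d1 < 2 * real \<rho>" using assms by auto
  have Re1: "\<bar>Re u\<bar> \<le> 1" using abs_Re_le_cmod[of u] nu by simp
  \<comment> \<open>The half-width is recovered from the real part by \<open>arccos\<close>, and the
    position on the chord from the imaginary part; the latter is at most \<open>sin t\<close> in
    absolute value because the point lies in the disc.\<close>
  define t where "t = arccos (Re u)"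
  have t: "cos t = Re u" "0 \<le> t" "t \<le> pi"
    using Re1 by (auto simp: t_def cos_arccos arccos_lbound arccos_ubound)
  have ct: "cos (2 * pi * d2 / (4 * real \<rho>)) < cos t" "cos t < cos (2 * pi * d1 / (4 * real \<rho>))"
    using z by (auto simp: t u_def)
  have t1: "2 * pi * d1 / (4 * real \<rho>) < t"
    using ct(2) cos_mono_less_eq[of t "2 * pi * d1 / (4 * real \<rho>)"] t chord_angle(1,2)[OF b(3,4)] by simp
  have t2: "t < 2 * pi * d2 / (4 * real \<rho>)"
    using ct(1) cos_mono_less_eq[of "2 * pi * d2 / (4 * real \<rho>)" t] t chord_angle(1,2)[OF b(2,1)] by simp
  define d where "d = t * (4 * real \<rho>) / (2 * pi)"
  have td: "t = 2 * pi * d / (4 * real \<rho>)" using r by (simp add: d_def)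
  have d12: "d1 < d" "d < d2"
    using t1 t2 r unfolding td by (simp_all add: divide_less_cancel)
  have s: "sin t > 0"
    using chord_angle(3)[of d \<rho>] d12 b unfolding td by simp
  define x where "x = Im u / sin t"
  have "(Im u)\<^sup>2 \<le> (sin t)\<^sup>2"
  proof -
    have "(Re u)\<^sup>2 + (Im u)\<^sup>2 \<le> 1"
      using nu power_mono[of "norm u" 1 2] by (simp add: cmod_power2)
    then show ?thesis by (simp add: sin_squared_eq t)
  qed
  then have "\<bar>x\<bar> \<le> 1"
    using s by (simp add: x_def abs_le_square_iff[symmetric] field_simps)
  moreover have "z = chord \<rho> c d x"
    unfolding zu chord_def td[symmetric] using s t(1) by (simp add: x_def complex_eq_iff)
  ultimately show "z \<in> (\<Union>d\<in>{d1<..<d2}. chord \<rho> c d ` {-1..1})"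
    using d12 by fastforce
qed

lemma open_chord_region:
  assumes "0 < d1" "d1 < d2" "d2 < 2 * real \<rho>"
  shows "openin (top_of_set (cball 0 1)) (\<Union>d\<in>{d1<..<d2}. chord \<rho> c d ` {-1..1})"
  unfolding chord_region[OF assms]
  by (intro openin_open_Int open_Collect_conj open_Collect_less continuous_intros)

lemma continuous_chord [continuous_intros]:
  fixes S :: "'c::t2_space set"
  assumes "continuous_on S f" "continuous_on S g"
  shows "continuous_on S (\<lambda>y. chord \<rho> c (f y) (g y))"
proof -
  have c: "continuous_on S (\<lambda>y. 2 * pi * f y / (4 * real \<rho>))"
    unfolding divide_inverse by (intro continuous_intros assms)
  show ?thesis
    unfolding chord_def Complex_eq
    by (intro continuous_on_mult continuous_on_add continuous_on_const continuous_on_of_real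
        continuous_on_cos[OF c] continuous_on_sin[OF c] assms)
qed

text \<open>One of the two coordinates is strictly inside the range, which excludes the coincidence
  of 0 and \<open>4 * \<rho>\<close>.\<close>

lemma boundary_point_inj:
  assumes "0 < y" "y < 4 * real \<rho>" "0 \<le> y'" "y' \<le> 4 * real \<rho>" "boundary_point \<rho> y = boundary_point \<rho> y'"
  shows "y = y'"
proof -
  let ?t = "2 * pi * y / (4 * real \<rho>)" and ?t' = "2 * pi * y' / (4 * real \<rho>)"
  have "sin ?t = sin ?t' \<and> cos ?t = cos ?t'"
    using assms(5) by (simp add: boundary_point_def complex_eq_iff)
  then obtain n :: int where n: "?t = ?t' + 2 * pi * n"
    using sin_cos_eq_iff by auto
  have r: "real \<rho> > 0" using assms by linarith
  have "2 * pi * y = 2 * pi * (y' + 4 * real \<rho> * n)"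
    using n r by (simp add: field_simps)
  then have y: "y = y' + 4 * real \<rho> * n" by simp
  have "real_of_int n < 1" "real_of_int n > -1"
  proof -
    have "4 * real \<rho> * n < 4 * real \<rho> * 1" "4 * real \<rho> * (-1) < 4 * real \<rho> * n"
      using y assms by linarith+
    then show "real_of_int n < 1" "real_of_int n > -1"
      using mult_left_less_imp_less[of "4 * real \<rho>" "real_of_int n" 1]
        mult_left_less_imp_less[of "4 * real \<rho>" "-1" "real_of_int n"] r by simp_all
  qed
  then have "n = 0" by linarith
  then show ?thesis using y by simp
qed

lemma side_pairing_bounds:
  assumes "k < 4 * \<rho>" "k mod 4 \<in> {0, 1 :: nat}"
  shows "k + 3 \<le> 4 * \<rho>"
proof -
  have "k div 4 < \<rho>" using assms(1) by (simp add: less_mult_imp_div_less)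
  moreover have "k mod 4 \<le> 1" using assms(2) by auto
  ultimately show ?thesis using div_mult_mod_eq[of k 4] by linarith
qed

lemma side_pairing_norm: "side_pairing \<rho> z w \<Longrightarrow> norm z = 1 \<and> norm w = 1"
  by (auto simp: side_pairing_def side_eq)

text \<open>Unlike a vertex, an inner point of a side has exactly one partner. On the first side of
  a pair the coordinate \<open>q + t\<close> goes to \<open>q + 3 - t\<close>; the second formula
  inverts this map, with \<open>q = k + 2\<close> for the first side \<open>k\<close>.\<close>

lemma side_pairing_partner:
  assumes q: "q < 4 * \<rho>" "real q < y" "y < real q + 1"
    and sp: "side_pairing \<rho> (boundary_point \<rho> y) w \<or> side_pairing \<rho> w (boundary_point \<rho> y)"
  shows "q mod 4 \<in> {0, 1} \<and> w = boundary_point \<rho> (2 * real q + 3 - y) \<or>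
         q mod 4 \<in> {2, 3} \<and> w = boundary_point \<rho> (2 * real q - 1 - y)"
proof -
  have y: "0 < y" "y < 4 * real \<rho>" using q by linarith+
  from sp obtain k t where k: "k < 4 * \<rho>" "k mod 4 \<in> {0, 1}" "t \<in> {0..1}"
    and c: "boundary_point \<rho> y = boundary_point \<rho> (real k + t) \<and> w = boundary_point \<rho> (real k + 3 - t) \<or>
            w = boundary_point \<rho> (real k + t) \<and> boundary_point \<rho> y = boundary_point \<rho> (real k + 3 - t)"
    by (auto simp: side_pairing_def side_eq algebra_simps)
  have k3: "real k + 3 \<le> 4 * real \<rho>" using side_pairing_bounds[OF k(1,2)] by linarith
  from c show ?thesis
  proof
    assume *: "boundary_point \<rho> y = boundary_point \<rho> (real k + t) \<and> w = boundary_point \<rho> (real k + 3 - t)"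
    then have yk: "y = real k + t"
      using boundary_point_inj[OF y, of "real k + t"] k(3) k3 by auto
    have "real q < real k + 1" "real k < real q + 1" using q k(3) yk by auto
    then have "q = k" by linarith
    then show ?thesis using * k yk by (simp add: algebra_simps)
  next
    assume *: "w = boundary_point \<rho> (real k + t) \<and> boundary_point \<rho> y = boundary_point \<rho> (real k + 3 - t)"
    then have yk: "y = real k + 3 - t"
      using boundary_point_inj[OF y, of "real k + 3 - t"] k(3) k3 by auto
    have "real q < real k + 3" "real k + 2 < real q + 1" using q k(3) yk by auto
    then have "q = k + 2" by linarith
    moreover have "(k + 2) mod 4 \<in> {2, 3}"
    proof -
      have "k mod 4 = 0 \<or> k mod 4 = 1" using k(2) by auto
      then have "(k + 2) mod 4 = 2 \<or> (k + 2) mod 4 = 3" by presburger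
      then show ?thesis by auto
    qed
    ultimately have "q mod 4 \<in> {2, 3}" "2 * real q - 1 - y = real k + t"
      using yk by (auto simp: algebra_simps)
    then show ?thesis using * by simp
  qed
qed

lemma half_circle:
  assumes "\<bar>y\<bar> \<le> 1"
  shows "\<exists>z\<in>sphere 0 1. Re z = y \<and> 0 \<le> Im z" "\<exists>z\<in>sphere 0 1. Re z = y \<and> Im z \<le> 0"
proof -
  have "y\<^sup>2 \<le> 1" using assms by (simp add: abs_square_le_1)
  then have "Complex y (sqrt (1 - y\<^sup>2)) \<in> sphere 0 1" "Complex y (- sqrt (1 - y\<^sup>2)) \<in> sphere 0 1"
    by (simp_all add: cmod_def)
  then show "\<exists>z\<in>sphere 0 1. Re z = y \<and> 0 \<le> Im z" "\<exists>z\<in>sphere 0 1. Re z = y \<and> Im z \<le> 0"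
    using \<open>y\<^sup>2 \<le> 1\<close> by (force intro: bexI[rotated])+
qed

lemma sphere_eqI:
  fixes z w :: complex
  assumes "z \<in> sphere 0 1" "w \<in> sphere 0 1" "Re z = Re w"
    and "0 \<le> Im z \<and> 0 \<le> Im w \<or> Im z \<le> 0 \<and> Im w \<le> 0 \<or> Re z \<in> {-1, 1}"
  shows "z = w"
proof -
  have n: "(Re z)\<^sup>2 + (Im z)\<^sup>2 = 1" "(Re w)\<^sup>2 + (Im w)\<^sup>2 = 1"
    using assms(1,2) cmod_power2[of z] cmod_power2[of w] by auto
  then have "(Im z)\<^sup>2 = (Im w)\<^sup>2" using assms(3) by simp
  then have "Im z = Im w \<or> Im z = - Im w" by (simp add: power2_eq_iff)
  moreover have "Im z = 0 \<and> Im w = 0" if "Re z \<in> {-1, 1}"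
    using n that assms(3) by auto
  ultimately show ?thesis
    using assms(3,4) by (auto intro!: complex_eqI)
qed

lemma Im_0_if_Re_end: "z \<in> sphere 0 1 \<Longrightarrow> Re z = 1 \<or> Re z = -1 \<Longrightarrow> Im z = 0"
  using cmod_power2[of z] by auto

lemma cos_sin_nonneg:
  assumes "0 \<le> u" "u \<le> 1/2" shows "0 \<le> cos (pi * u)" "0 \<le> sin (2 * pi * u)"
proof -
  have "0 \<le> pi * u" "pi * u \<le> pi * (1/2)"
    using assms by (auto intro!: mult_left_mono)
  moreover from this have "- (pi/2) \<le> pi * u" using pi_gt_zero by linarith
  ultimately show "0 \<le> cos (pi * u)" "0 \<le> sin (2 * pi * u)"
    by (auto intro!: cos_ge_zero sin_ge_zero)
qed

subsection \<open>Strips joining a glued pair of sides\<close>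

text \<open>Chords around \<open>k + 3/2\<close> with half-width between 3/4 and 5/4 join the middle
  halves of the glued sides \<open>k\<close> and \<open>k + 2\<close>. The strip is cut along the
  midpoints of its chords: its two halves meet there at parameter 1, and their outer ends are glued
  at parameter -1. Both ends of a chord carry the same \<open>s\<close> since the gluing exchanges
  them.\<close>

definition single_upper :: "nat \<Rightarrow> nat \<Rightarrow> real \<Rightarrow> real \<Rightarrow> complex" where
  "single_upper \<rho> k x s = chord \<rho> (real k + 3/2) (5/4 - s/2) ((x - 1)/2)"

definition single_lower :: "nat \<Rightarrow> nat \<Rightarrow> real \<Rightarrow> real \<Rightarrow> complex" where
  "single_lower \<rho> k x s = chord \<rho> (real k + 3/2) (5/4 - s/2) ((1 - x)/2)"

lemmas single_defs = single_upper_def single_lower_def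

context
  fixes \<rho> k :: nat
  assumes k: "k < 4 * \<rho>" "k mod 4 \<in> {0, 1}"
begin

lemma single_chart: "annulus_chart \<rho> (single_upper \<rho> k) (single_lower \<rho> k)"
proof
  show "continuous_on ({-1..1} \<times> {0..1}) (\<lambda>y. single_upper \<rho> k (fst y) (snd y))"
    "continuous_on ({-1..1} \<times> {0..1}) (\<lambda>y. single_lower \<rho> k (fst y) (snd y))"
    unfolding single_defs by (intro continuous_intros; simp)+
  show "single_upper \<rho> k x s \<in> cball 0 1" "single_lower \<rho> k x s \<in> cball 0 1" if "x \<in> {-1..1}" "s \<in> {0..1}" for x s
    unfolding single_defs by (intro chord_mem; use that in \<open>simp add: abs_le_iff\<close>)+
  show "glue \<rho> (single_upper \<rho> k x s) = glue \<rho> (single_lower \<rho> k x s)" if "x \<in> {-1, 1}" "s \<in> {0..1}" for x s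
  proof (cases "x = 1")
    case False
    then have "x = -1" using that by auto
    then show ?thesis
      using glue_side[OF k, of "1/4 + s/2"] that(2) by (simp add: single_defs chord_ends algebra_simps)
  qed (simp add: single_defs)
qed

interpretation annulus_chart \<rho> "single_upper \<rho> k" "single_lower \<rho> k" by (rule single_chart)

text \<open>Both halves are described by one coordinate along the whole chord, nonpositive on the
  upper half and nonnegative on the lower one.\<close>

lemma single_reps:
  assumes "w \<in> reps (z, s)" "z \<in> sphere 0 1"
  obtains x where "w = chord \<rho> (real k + 3/2) (5/4 - s/2) x" "\<bar>x\<bar> \<le> 1"
    "x \<le> 0 \<and> Re z = 2 * x + 1 \<and> 0 \<le> Im z \<or> 0 \<le> x \<and> Re z = 1 - 2 * x \<and> Im z \<le> 0"
proof -
  have "Re z \<in> {-1..1}" using Re_mem assms(2) by blast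
  then have "(0 \<le> Im z \<and> w = chord \<rho> (real k + 3/2) (5/4 - s/2) ((Re z - 1)/2) \<and> \<bar>(Re z - 1)/2\<bar> \<le> 1) \<or>
      (Im z \<le> 0 \<and> w = chord \<rho> (real k + 3/2) (5/4 - s/2) ((1 - Re z)/2) \<and> \<bar>(1 - Re z)/2\<bar> \<le> 1)"
    using assms(1) by (auto simp: reps_def single_defs)
  then show ?thesis
  proof
    assume *: "0 \<le> Im z \<and> w = chord \<rho> (real k + 3/2) (5/4 - s/2) ((Re z - 1)/2) \<and> \<bar>(Re z - 1)/2\<bar> \<le> 1"
    show ?thesis by (rule that[of "(Re z - 1)/2"]) (use * \<open>Re z \<in> {-1..1}\<close> in \<open>auto simp: field_simps\<close>)
  next
    assume *: "Im z \<le> 0 \<and> w = chord \<rho> (real k + 3/2) (5/4 - s/2) ((1 - Re z)/2) \<and> \<bar>(1 - Re z)/2\<bar> \<le> 1"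
    show ?thesis by (rule that[of "(1 - Re z)/2"]) (use * \<open>Re z \<in> {-1..1}\<close> in \<open>auto simp: field_simps\<close>)
  qed
qed

lemma single_width: "s \<in> {0..1} \<Longrightarrow> 0 < 5/4 - s/2 \<and> 5/4 - s/2 < 2 * real \<rho>"
  using k(1) by (cases \<rho>) auto

text \<open>The annulus meets the boundary of the polygon only over the circle point -1, where the
  strip is glued to itself.\<close>

lemma single_reps_boundary:
  assumes "w \<in> reps (z, s)" "z \<in> sphere 0 1" "s \<in> {0..1}" "norm w = 1"
  shows "z = -1" "w = boundary_point \<rho> (real k + 1/4 + s/2) \<or> w = boundary_point \<rho> (real k + 11/4 - s/2)"
proof -
  obtain x where x: "w = chord \<rho> (real k + 3/2) (5/4 - s/2) x" "\<bar>x\<bar> \<le> 1"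
    "x \<le> 0 \<and> Re z = 2 * x + 1 \<and> 0 \<le> Im z \<or> 0 \<le> x \<and> Re z = 1 - 2 * x \<and> Im z \<le> 0"
    using single_reps[OF assms(1,2)] by metis
  have x1: "x = 1 \<or> x = -1"
    using chord_boundary single_width[OF assms(3)] assms(4) x(1) by blast
  then have "Re z = -1" using x(3) by auto
  then show "z = -1"
    using Im_0_if_Re_end[OF assms(2)] by (simp add: complex_eq_iff)
  show "w = boundary_point \<rho> (real k + 1/4 + s/2) \<or> w = boundary_point \<rho> (real k + 11/4 - s/2)"
    using x1 unfolding x(1) by (auto simp: chord_ends algebra_simps)
qed

lemma single_end_reps:
  "boundary_point \<rho> (real k + 1/4 + s/2) \<in> reps (-1, s)" "boundary_point \<rho> (real k + 11/4 - s/2) \<in> reps (-1, s)"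
  by (auto simp: reps_def single_defs chord_ends algebra_simps)

lemma single_region: "(\<Union>a\<in>open_annulus. reps a) = (\<Union>d\<in>{3/4<..<5/4}. chord \<rho> (real k + 3/2) d ` {-1..1})"
proof (rule Set.set_eqI, rule iffI)
  fix w assume "w \<in> (\<Union>a\<in>open_annulus. reps a)"
  then obtain z s where zs: "z \<in> sphere 0 1" "s \<in> {0<..<1}" "w \<in> reps (z, s)" by blast
  obtain x where "w = chord \<rho> (real k + 3/2) (5/4 - s/2) x" "\<bar>x\<bar> \<le> 1"
    using single_reps[OF zs(3,1)] by metis
  then show "w \<in> (\<Union>d\<in>{3/4<..<5/4}. chord \<rho> (real k + 3/2) d ` {-1..1})"
    using zs(2) by (intro UN_I[of "5/4 - s/2"]) (auto intro!: imageI)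
next
  fix w assume "w \<in> (\<Union>d\<in>{3/4<..<5/4}. chord \<rho> (real k + 3/2) d ` {-1..1})"
  then obtain d x where d: "d \<in> {3/4<..<5/4}" "x \<in> {-1..1}" "w = chord \<rho> (real k + 3/2) d x" by auto
  define s where "s = 5/2 - 2 * d"
  have s: "s \<in> {0<..<1}" "5/4 - s/2 = d" using d(1) by (auto simp: s_def field_simps)
  have "\<exists>z\<in>sphere 0 1. w \<in> reps (z, s)"
  proof (cases "x \<le> 0")
    case True
    then have "\<bar>2 * x + 1\<bar> \<le> 1" using d(2) by auto
    then obtain z where "z \<in> sphere 0 1" "Re z = 2 * x + 1" "0 \<le> Im z"
      using half_circle(1) by blast
    then show ?thesis
      using d(3) s(2) by (intro bexI[of _ z]) (auto simp: reps_def single_defs)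
  next
    case False
    then have "\<bar>1 - 2 * x\<bar> \<le> 1" using d(2) by auto
    then obtain z where "z \<in> sphere 0 1" "Re z = 1 - 2 * x" "Im z \<le> 0"
      using half_circle(2) by blast
    then show ?thesis
      using d(3) s(2) by (intro bexI[of _ z]) (auto simp: reps_def single_defs)
  qed
  then show "w \<in> (\<Union>a\<in>open_annulus. reps a)"
    using s(1) by blast
qed

lemma single_embedded: "embedded_annulus_chart \<rho> (single_upper \<rho> k) (single_lower \<rho> k)"
proof
  show "w' \<in> reps a" if a: "a \<in> closed_annulus" "w \<in> reps a" and sp: "side_pairing \<rho> w w' \<or> side_pairing \<rho> w' w" for a w w'
  proof -
    obtain z s where zs: "a = (z, s)" "z \<in> sphere 0 1" "s \<in> {0..1}" using a(1) by blast
    have "norm w = 1" using sp side_pairing_norm by blast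
    note b = single_reps_boundary[OF a(2)[unfolded zs(1)] zs(2,3) this]
    have k2: "k + 2 < 4 * \<rho>" using side_pairing_bounds[OF k] by simp
    from b(2) show ?thesis
    proof
      assume w: "w = boundary_point \<rho> (real k + 1/4 + s/2)"
      then have "w' = boundary_point \<rho> (real k + 11/4 - s/2)"
        using side_pairing_partner[of k \<rho> "real k + 1/4 + s/2" w'] sp k zs(3) by (auto simp: algebra_simps)
      then show ?thesis using single_end_reps b(1) zs(1) by simp
    next
      assume w: "w = boundary_point \<rho> (real k + 11/4 - s/2)"
      have "k mod 4 = 0 \<or> k mod 4 = 1" using k(2) by auto
      then have "(k + 2) mod 4 = 2 \<or> (k + 2) mod 4 = 3" by presburger
      then have "w' = boundary_point \<rho> (real k + 1/4 + s/2)"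
        using side_pairing_partner[of "k + 2" \<rho> "real k + 11/4 - s/2" w'] sp k2 zs(3) w by (auto simp: algebra_simps)
      then show ?thesis using single_end_reps b(1) zs(1) by simp
    qed
  qed
  show "a = b" if ab: "a \<in> closed_annulus" "b \<in> closed_annulus" "w \<in> reps a" "w \<in> reps b" for a b w
  proof -
    obtain z s where a: "a = (z, s)" "z \<in> sphere 0 1" "s \<in> {0..1}" using ab(1) by blast
    obtain z' s' where b: "b = (z', s')" "z' \<in> sphere 0 1" "s' \<in> {0..1}" using ab(2) by blast
    obtain x where x: "w = chord \<rho> (real k + 3/2) (5/4 - s/2) x"
      "x \<le> 0 \<and> Re z = 2 * x + 1 \<and> 0 \<le> Im z \<or> 0 \<le> x \<and> Re z = 1 - 2 * x \<and> Im z \<le> 0"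
      using single_reps[OF ab(3)[unfolded a(1)] a(2)] by metis
    obtain x' where x': "w = chord \<rho> (real k + 3/2) (5/4 - s'/2) x'"
      "x' \<le> 0 \<and> Re z' = 2 * x' + 1 \<and> 0 \<le> Im z' \<or> 0 \<le> x' \<and> Re z' = 1 - 2 * x' \<and> Im z' \<le> 0"
      using single_reps[OF ab(4)[unfolded b(1)] b(2)] by metis
    have "5/4 - s/2 = 5/4 - s'/2" "x = x'"
      using chord_inj[of "5/4 - s/2" \<rho> "5/4 - s'/2" "real k + 3/2" x x'] single_width a(3) b(3) x(1) x'(1) by auto
    then have "s = s'" "z = z'"
      using x(2) x'(2) by (auto intro!: sphere_eqI a(2) b(2))
    then show ?thesis using a b by simp
  qed
  show "openin (top_of_set (cball 0 1)) (\<Union>a\<in>open_annulus. reps a)"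
    unfolding single_region using single_width[of 0] by (intro open_chord_region) auto
qed

interpretation S: embedded_annulus_chart \<rho> "single_upper \<rho> k" "single_lower \<rho> k" by (rule single_embedded)

abbreviation "single_twist \<equiv> S.twist 1"

lemma single_twist_off:
  assumes y: "0 \<le> y" "y \<le> 4 * real \<rho>"
    and "\<not> (real k + 1/4 \<le> y \<and> y \<le> real k + 3/4)" "\<not> (real k + 9/4 \<le> y \<and> y \<le> real k + 11/4)"
  shows "single_twist (glue \<rho> (boundary_point \<rho> y)) = glue \<rho> (boundary_point \<rho> y)"
proof (rule S.twist_off)
  fix a :: "complex \<times> real" assume "a \<in> closed_annulus"
  then obtain z s where a: "a = (z, s)" "z \<in> sphere 0 1" "s \<in> {0..1}" by blast
  show "boundary_point \<rho> y \<notin> reps a"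
  proof
    assume "boundary_point \<rho> y \<in> reps a"
    then have "boundary_point \<rho> (real k + 1/4 + s/2) = boundary_point \<rho> y \<or> boundary_point \<rho> (real k + 11/4 - s/2) = boundary_point \<rho> y"
      using single_reps_boundary(2)[of "boundary_point \<rho> y" z s] a by auto
    moreover have "real k + 3 \<le> 4 * real \<rho>" using side_pairing_bounds[OF k] by linarith
    ultimately have "real k + 1/4 + s/2 = y \<or> real k + 11/4 - s/2 = y"
      using boundary_point_inj[of "real k + 1/4 + s/2" \<rho> y] boundary_point_inj[of "real k + 11/4 - s/2" \<rho> y] a(3) y by auto
    then show False using assms(3,4) a(3) by auto
  qed
qed

lemma single_twist_base: "single_twist (surface_base \<rho>) = surface_base \<rho>"
  using single_twist_off[of 0] by (simp add: surface_base_def boundary_point_def)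

lemma single_twist_other_side:
  assumes "j < 4 * \<rho>" "j mod 4 \<in> {0, 1}" "j \<noteq> k" "t \<in> {0..1}"
  shows "single_twist (glue \<rho> (side \<rho> j t)) = glue \<rho> (side \<rho> j t)"
  unfolding side_eq
proof (rule single_twist_off)
  show "\<not> (real k + 1/4 \<le> real j + t \<and> real j + t \<le> real k + 3/4)"
  proof
    assume "real k + 1/4 \<le> real j + t \<and> real j + t \<le> real k + 3/4"
    then have "real k < real j + 1" "real j < real k + 1" using assms(4) by auto
    then show False using assms(3) by linarith
  qed
  show "\<not> (real k + 9/4 \<le> real j + t \<and> real j + t \<le> real k + 11/4)"
  proof
    assume "real k + 9/4 \<le> real j + t \<and> real j + t \<le> real k + 11/4"
    then have "real k + 2 < real j + 1" "real j < real k + 3" using assms(4) by auto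
    then have "j = k + 2" by linarith
    moreover have "k mod 4 = 0 \<or> k mod 4 = 1" using k(2) by auto
    ultimately have "j mod 4 = 2 \<or> j mod 4 = 3" by presburger
    then show False using assms(2) by auto
  qed
qed (use assms(1,4) in auto)

text \<open>The circle point -1 is turned by the angle \<open>2 * pi * \<phi>\<close>. Along the
  chord its position is the square of \<open>cos (pi * \<phi>)\<close> on the lower half and minus
  that square on the upper half, which is the cosine times its absolute value. For \<open>t\<close>
  outside the middle half the profile is 0 or 1 and the formula returns the side or its glued
  partner, so one path in the disc describes the image of the entire side.\<close>

lemma single_twist_side:
  assumes t: "t \<in> {0..1}"
  defines "\<phi> \<equiv> twist_profile (2 * t - 1/2)"
  shows "single_twist (glue \<rho> (side \<rho> k t)) = glue \<rho> (chord \<rho> (real k + 3/2) (3/2 - t) (cos (pi * \<phi>) * \<bar>cos (pi * \<phi>)\<bar>))"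
proof -
  have k3: "real k + 3 \<le> 4 * real \<rho>" using side_pairing_bounds[OF k] by linarith
  consider "t < 1/4" | "t \<in> {1/4..3/4}" | "3/4 < t" using t by fastforce
  then show ?thesis
  proof cases
    case 1
    then have "\<phi> = 0" by (simp add: \<phi>_def twist_profile_def)
    then have "glue \<rho> (chord \<rho> (real k + 3/2) (3/2 - t) (cos (pi * \<phi>) * \<bar>cos (pi * \<phi>)\<bar>)) = glue \<rho> (side \<rho> k t)"
      using glue_side[OF k t] by (simp add: chord_ends side_eq algebra_simps)
    moreover have "single_twist (glue \<rho> (side \<rho> k t)) = glue \<rho> (side \<rho> k t)"
      unfolding side_eq by (rule single_twist_off) (use 1 t k3 in auto)
    ultimately show ?thesis by simp
  next
    case 3
    then have "\<phi> = 1" by (simp add: \<phi>_def twist_profile_def)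
    then have "glue \<rho> (chord \<rho> (real k + 3/2) (3/2 - t) (cos (pi * \<phi>) * \<bar>cos (pi * \<phi>)\<bar>)) = glue \<rho> (side \<rho> k t)"
      by (simp add: chord_ends side_eq algebra_simps)
    moreover have "single_twist (glue \<rho> (side \<rho> k t)) = glue \<rho> (side \<rho> k t)"
      unfolding side_eq by (rule single_twist_off) (use 3 t k3 in auto)
    ultimately show ?thesis by simp
  next
    case 2
    define s where "s = 2 * t - 1/2"
    have s: "s \<in> {0..1}" "t = 1/4 + s/2" using 2 by (auto simp: s_def field_simps)
    have \<phi>: "0 \<le> \<phi>" "\<phi> \<le> 1" by (auto simp: \<phi>_def twist_profile_def)
    have tw: "annulus_twist 1 (-1, s) = (- cis (2 * pi * \<phi>), s)"
      by (simp add: annulus_twist_def \<phi>_def s_def)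
    have d: "3/2 - t = 5/4 - s/2" using s(2) by simp
    have c2: "cos (2 * pi * \<phi>) = 2 * (cos (pi * \<phi>))\<^sup>2 - 1"
      using cos_double_cos[of "pi * \<phi>"] by (simp add: mult.assoc)
    have "chord \<rho> (real k + 3/2) (3/2 - t) (cos (pi * \<phi>) * \<bar>cos (pi * \<phi>)\<bar>) \<in> reps (- cis (2 * pi * \<phi>), s)"
    proof (cases "\<phi> \<le> 1/2")
      case True
      then have "cos (pi * \<phi>) \<ge> 0" "sin (2 * pi * \<phi>) \<ge> 0"
        using cos_sin_nonneg[of \<phi>] \<phi> by auto
      moreover from this have X: "cos (pi * \<phi>) * \<bar>cos (pi * \<phi>)\<bar> = (1 - Re (- cis (2 * pi * \<phi>)))/2"
        by (simp add: c2 power2_eq_square)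
      have "chord \<rho> (real k + 3/2) (3/2 - t) (cos (pi * \<phi>) * \<bar>cos (pi * \<phi>)\<bar>) =
          single_lower \<rho> k (Re (- cis (2 * pi * \<phi>))) s"
        by (simp only: single_defs X d)
      ultimately show ?thesis
        by (simp add: reps_def)
    next
      case False
      have "cos (pi * \<phi>) = - cos (pi * (1 - \<phi>))" "sin (2 * pi * \<phi>) = - sin (2 * pi * (1 - \<phi>))"
        by (simp_all add: right_diff_distrib cos_diff sin_diff)
      moreover have "cos (pi * (1 - \<phi>)) \<ge> 0" "sin (2 * pi * (1 - \<phi>)) \<ge> 0"
        using cos_sin_nonneg[of "1 - \<phi>"] \<phi> False by auto
      ultimately have "cos (pi * \<phi>) \<le> 0" "sin (2 * pi * \<phi>) \<le> 0" by linarith+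
      moreover from this have X: "cos (pi * \<phi>) * \<bar>cos (pi * \<phi>)\<bar> = (Re (- cis (2 * pi * \<phi>)) - 1)/2"
        by (simp add: c2 power2_eq_square)
      have "chord \<rho> (real k + 3/2) (3/2 - t) (cos (pi * \<phi>) * \<bar>cos (pi * \<phi>)\<bar>) =
          single_upper \<rho> k (Re (- cis (2 * pi * \<phi>))) s"
        by (simp only: single_defs X d)
      ultimately show ?thesis
        by (simp add: reps_def)
    qed
    moreover have "side \<rho> k t \<in> reps (-1, s)"
      using single_end_reps(1)[of s] s(2) by (simp add: side_eq algebra_simps)
    ultimately show ?thesis
      using s(1) by (intro S.twist_reps[of "(-1, s)"]) (auto simp: tw)
  qed
qed

text \<open>The image path starts at position 1 on the chord of half-width 3/2, which is vertex
  \<open>k + 3\<close>, and ends at position -1 on that of half-width 1/2, which is vertex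
  \<open>k + 1\<close>.\<close>

lemma single_twist_class:
  "surface_loop_class \<rho> (\<lambda>t. single_twist (glue \<rho> (side \<rho> k t))) = disc_class \<rho> (k + 3) (k + 1)"
proof (rule disc_path_class)
  let ?X = "\<lambda>t. cos (pi * twist_profile (2 * t - 1/2))"
  let ?f = "\<lambda>t. chord \<rho> (real k + 3/2) (3/2 - t) (?X t * \<bar>?X t\<bar>)"
  show "continuous_on {0..1} ?f" by (intro continuous_intros)
  have "\<bar>?X t * \<bar>?X t\<bar>\<bar> \<le> 1" for t
    using mult_le_one[of "\<bar>?X t\<bar>" "\<bar>?X t\<bar>"] by (simp add: abs_mult)
  then show "?f ` {0..1} \<subseteq> cball 0 1"
    using chord_mem by blast
  have "?X 0 = 1" "?X 1 = -1" by (simp_all add: twist_profile_def)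
  then show "?f 0 = vertex \<rho> (k + 3)" "?f 1 = vertex \<rho> (k + 1)"
    by (simp_all add: chord_ends algebra_simps)
  show "k + 3 \<le> 4 * \<rho>" "k + 1 \<le> 4 * \<rho>" using side_pairing_bounds[OF k] by auto
  show "single_twist (glue \<rho> (side \<rho> k t)) = glue \<rho> (?f t)" if "t \<in> {0..1}" for t
    using single_twist_side[OF that] .
qed

lemma single_twist_exists:
  obtains h where "homeomorphic_map (surface \<rho>) (surface \<rho>) h" "orientation_preserving (surface \<rho>) h"
    "h (surface_base \<rho>) = surface_base \<rho>"
    "surface_loop_class \<rho> (\<lambda>t. h (glue \<rho> (side \<rho> k t))) = disc_class \<rho> (k + 3) (k + 1)"
    "\<And>j t. j < 4 * \<rho> \<Longrightarrow> j mod 4 \<in> {0, 1} \<Longrightarrow> j \<noteq> k \<Longrightarrow> t \<in> {0..1} \<Longrightarrow> h (glue \<rho> (side \<rho> j t)) = glue \<rho> (side \<rho> j t)"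
  using that[OF S.homeomorphic_twist S.orientation_preserving_twist single_twist_base single_twist_class]
    single_twist_other_side by blast

end

subsection \<open>Pairs of strips through two adjacent handles\<close>

text \<open>Two strips of chords around \<open>k + 7/2\<close>: the narrow one joins the sides
  \<open>k + 2\<close> and \<open>k + 4\<close>, the wide one the sides \<open>k\<close> and
  \<open>k + 6\<close>. Since \<open>k\<close> is glued to \<open>k + 2\<close> and
  \<open>k + 4\<close> to \<open>k + 6\<close>, they close up to one annulus through both handles.
  The half-widths change in opposite directions with \<open>s\<close> because the gluings reverse
  the sides.\<close>

definition double_upper :: "nat \<Rightarrow> nat \<Rightarrow> real \<Rightarrow> real \<Rightarrow> complex" where
  "double_upper \<rho> k x s = chord \<rho> (real k + 7/2) (3/4 + s/2) x"

definition double_lower :: "nat \<Rightarrow> nat \<Rightarrow> real \<Rightarrow> real \<Rightarrow> complex" where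
  "double_lower \<rho> k x s = chord \<rho> (real k + 7/2) (13/4 - s/2) x"

lemmas double_defs = double_upper_def double_lower_def

context
  fixes \<rho> k :: nat
  assumes k: "k + 8 \<le> 4 * \<rho>" "k mod 4 = 0"
begin

lemma double_side_facts:
  "k < 4 * \<rho>" "k mod 4 \<in> {0, 1}" "k + 4 < 4 * \<rho>" "(k + 4) mod 4 \<in> {0, 1}"
  "(k + 2) mod 4 = 2" "(k + 6) mod 4 = 2" "(k + 4) mod 4 = 0"
proof -
  show "(k + 2) mod 4 = 2" "(k + 6) mod 4 = 2" using k(2) by presburger+
qed (use k in auto)

lemma double_chart: "annulus_chart \<rho> (double_upper \<rho> k) (double_lower \<rho> k)"
proof
  show "continuous_on ({-1..1} \<times> {0..1}) (\<lambda>y. double_upper \<rho> k (fst y) (snd y))"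
    "continuous_on ({-1..1} \<times> {0..1}) (\<lambda>y. double_lower \<rho> k (fst y) (snd y))"
    unfolding double_defs by (intro continuous_intros; simp)+
  show "double_upper \<rho> k x s \<in> cball 0 1" "double_lower \<rho> k x s \<in> cball 0 1" if "x \<in> {-1..1}" "s \<in> {0..1}" for x s
    unfolding double_defs by (intro chord_mem; use that in \<open>simp add: abs_le_iff\<close>)+
  show "glue \<rho> (double_upper \<rho> k x s) = glue \<rho> (double_lower \<rho> k x s)" if "x \<in> {-1, 1}" "s \<in> {0..1}" for x s
  proof (cases "x = 1")
    case True
    then show ?thesis
      using glue_side[OF double_side_facts(3,4), of "1/4 + s/2"] that(2) by (simp add: double_defs chord_ends algebra_simps)
  next
    case False
    then have "x = -1" using that by auto
    then show ?thesis
      using glue_side[OF double_side_facts(1,2), of "1/4 + s/2"] that(2) by (simp add: double_defs chord_ends algebra_simps)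
  qed
qed

interpretation annulus_chart \<rho> "double_upper \<rho> k" "double_lower \<rho> k" by (rule double_chart)

lemma double_reps:
  assumes "w \<in> reps (z, s)"
  shows "w = chord \<rho> (real k + 7/2) (3/4 + s/2) (Re z) \<and> 0 \<le> Im z \<or>
         w = chord \<rho> (real k + 7/2) (13/4 - s/2) (Re z) \<and> Im z \<le> 0"
  using assms by (auto simp: reps_def double_defs)

lemma double_width:
  "s \<in> {0..1} \<Longrightarrow> 0 < 3/4 + s/2 \<and> 3/4 + s/2 < 2 * real \<rho> \<and> 0 < 13/4 - s/2 \<and> 13/4 - s/2 < 2 * real \<rho>"
  using k(1) by auto

lemma double_end_reps:
  "boundary_point \<rho> (real k + 17/4 + s/2) \<in> reps (1, s)" "boundary_point \<rho> (real k + 27/4 - s/2) \<in> reps (1, s)"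
  "boundary_point \<rho> (real k + 11/4 - s/2) \<in> reps (-1, s)" "boundary_point \<rho> (real k + 1/4 + s/2) \<in> reps (-1, s)"
  by (auto simp: reps_def double_defs chord_ends algebra_simps)

lemma double_reps_boundary:
  assumes "w \<in> reps (z, s)" "z \<in> sphere 0 1" "s \<in> {0..1}" "norm w = 1"
  shows "z = 1 \<and> (w = boundary_point \<rho> (real k + 17/4 + s/2) \<or> w = boundary_point \<rho> (real k + 27/4 - s/2)) \<or>
    z = -1 \<and> (w = boundary_point \<rho> (real k + 11/4 - s/2) \<or> w = boundary_point \<rho> (real k + 1/4 + s/2))"
proof -
  have "Re z = 1 \<or> Re z = -1"
    using double_reps[OF assms(1)] chord_boundary double_width[OF assms(3)] assms(4) by blast
  then have "z = 1 \<or> z = -1"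
    using Im_0_if_Re_end[OF assms(2)] by (auto simp: complex_eq_iff)
  then show ?thesis
    using double_reps[OF assms(1)] by (auto simp: chord_ends algebra_simps)
qed

lemma double_region: "(\<Union>a\<in>open_annulus. reps a) =
    (\<Union>d\<in>{3/4<..<5/4}. chord \<rho> (real k + 7/2) d ` {-1..1}) \<union> (\<Union>d\<in>{11/4<..<13/4}. chord \<rho> (real k + 7/2) d ` {-1..1})"
proof (rule Set.set_eqI, rule iffI)
  fix w assume "w \<in> (\<Union>a\<in>open_annulus. reps a)"
  then obtain z s where zs: "z \<in> sphere 0 1" "s \<in> {0<..<1}" "w \<in> reps (z, s)" by blast
  have "Re z \<in> {-1..1}" using Re_mem zs(1) by blast
  moreover have "3/4 + s/2 \<in> {3/4<..<5/4}" "13/4 - s/2 \<in> {11/4<..<13/4}" using zs(2) by auto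
  ultimately show "w \<in> (\<Union>d\<in>{3/4<..<5/4}. chord \<rho> (real k + 7/2) d ` {-1..1}) \<union> (\<Union>d\<in>{11/4<..<13/4}. chord \<rho> (real k + 7/2) d ` {-1..1})"
    using double_reps[OF zs(3)] by blast
next
  fix w assume "w \<in> (\<Union>d\<in>{3/4<..<5/4}. chord \<rho> (real k + 7/2) d ` {-1..1}) \<union> (\<Union>d\<in>{11/4<..<13/4}. chord \<rho> (real k + 7/2) d ` {-1..1})"
  then show "w \<in> (\<Union>a\<in>open_annulus. reps a)"
  proof
    assume "w \<in> (\<Union>d\<in>{3/4<..<5/4}. chord \<rho> (real k + 7/2) d ` {-1..1})"
    then obtain d x where d: "d \<in> {3/4<..<5/4}" "\<bar>x\<bar> \<le> 1" "w = chord \<rho> (real k + 7/2) d x"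
      by (auto simp: abs_le_iff)
    define s where "s = 2 * d - 3/2"
    have s: "s \<in> {0<..<1}" "3/4 + s/2 = d" using d(1) by (auto simp: s_def field_simps)
    obtain z where z: "z \<in> sphere 0 1" "Re z = x" "0 \<le> Im z" using half_circle(1) d(2) by blast
    then have "w \<in> reps (z, s)" using d(3) s(2) by (auto simp: reps_def double_defs)
    then show "w \<in> (\<Union>a\<in>open_annulus. reps a)" using z(1) s(1) by blast
  next
    assume "w \<in> (\<Union>d\<in>{11/4<..<13/4}. chord \<rho> (real k + 7/2) d ` {-1..1})"
    then obtain d x where d: "d \<in> {11/4<..<13/4}" "\<bar>x\<bar> \<le> 1" "w = chord \<rho> (real k + 7/2) d x"
      by (auto simp: abs_le_iff)
    define s where "s = 13/2 - 2 * d"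
    have s: "s \<in> {0<..<1}" "13/4 - s/2 = d" using d(1) by (auto simp: s_def field_simps)
    obtain z where z: "z \<in> sphere 0 1" "Re z = x" "Im z \<le> 0" using half_circle(2) d(2) by blast
    then have "w \<in> reps (z, s)" using d(3) s(2) by (auto simp: reps_def double_defs)
    then show "w \<in> (\<Union>a\<in>open_annulus. reps a)" using z(1) s(1) by blast
  qed
qed

lemma double_embedded: "embedded_annulus_chart \<rho> (double_upper \<rho> k) (double_lower \<rho> k)"
proof
  show "w' \<in> reps a" if a: "a \<in> closed_annulus" "w \<in> reps a" and sp: "side_pairing \<rho> w w' \<or> side_pairing \<rho> w' w" for a w w'
  proof -
    obtain z s where zs: "a = (z, s)" "z \<in> sphere 0 1" "s \<in> {0..1}" using a(1) by blast
    have "norm w = 1" using sp side_pairing_norm by blast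
    note b = double_reps_boundary[OF a(2)[unfolded zs(1)] zs(2,3) this]
    have lt: "k + 2 < 4 * \<rho>" "k + 6 < 4 * \<rho>" using k by auto
    have p1: "w' = boundary_point \<rho> (real k + 27/4 - s/2)" if w: "w = boundary_point \<rho> (real k + 17/4 + s/2)"
    proof -
      have "2 * real (k + 4) + 3 - (real k + 17/4 + s/2) = real k + 27/4 - s/2" by simp
      moreover have "w' = boundary_point \<rho> (2 * real (k + 4) + 3 - (real k + 17/4 + s/2))"
        using side_pairing_partner[of "k + 4" \<rho> "real k + 17/4 + s/2" w'] sp zs(3) double_side_facts(3,7) unfolding w by auto
      ultimately show ?thesis by (simp only:)
    qed
    have p2: "w' = boundary_point \<rho> (real k + 17/4 + s/2)" if w: "w = boundary_point \<rho> (real k + 27/4 - s/2)"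
    proof -
      have "2 * real (k + 6) - 1 - (real k + 27/4 - s/2) = real k + 17/4 + s/2" by simp
      moreover have "w' = boundary_point \<rho> (2 * real (k + 6) - 1 - (real k + 27/4 - s/2))"
        using side_pairing_partner[of "k + 6" \<rho> "real k + 27/4 - s/2" w'] sp zs(3) lt(2) double_side_facts(6) unfolding w by auto
      ultimately show ?thesis by (simp only:)
    qed
    have p3: "w' = boundary_point \<rho> (real k + 1/4 + s/2)" if w: "w = boundary_point \<rho> (real k + 11/4 - s/2)"
    proof -
      have "2 * real (k + 2) - 1 - (real k + 11/4 - s/2) = real k + 1/4 + s/2" by simp
      moreover have "w' = boundary_point \<rho> (2 * real (k + 2) - 1 - (real k + 11/4 - s/2))"
        using side_pairing_partner[of "k + 2" \<rho> "real k + 11/4 - s/2" w'] sp zs(3) lt(1) double_side_facts(5) unfolding w by auto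
      ultimately show ?thesis by (simp only:)
    qed
    have p4: "w' = boundary_point \<rho> (real k + 11/4 - s/2)" if w: "w = boundary_point \<rho> (real k + 1/4 + s/2)"
    proof -
      have "2 * real (k) + 3 - (real k + 1/4 + s/2) = real k + 11/4 - s/2" by simp
      moreover have "w' = boundary_point \<rho> (2 * real (k) + 3 - (real k + 1/4 + s/2))"
        using side_pairing_partner[of "k" \<rho> "real k + 1/4 + s/2" w'] sp zs(3) double_side_facts(1) k(2) unfolding w by auto
      ultimately show ?thesis by (simp only:)
    qed
    have "z = 1 \<and> w = boundary_point \<rho> (real k + 17/4 + s/2) \<and> w' = boundary_point \<rho> (real k + 27/4 - s/2) \<or>
        z = 1 \<and> w = boundary_point \<rho> (real k + 27/4 - s/2) \<and> w' = boundary_point \<rho> (real k + 17/4 + s/2) \<or>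
        z = -1 \<and> w = boundary_point \<rho> (real k + 11/4 - s/2) \<and> w' = boundary_point \<rho> (real k + 1/4 + s/2) \<or>
        z = -1 \<and> w = boundary_point \<rho> (real k + 1/4 + s/2) \<and> w' = boundary_point \<rho> (real k + 11/4 - s/2)"
      using b p1 p2 p3 p4 by blast
    then show ?thesis using double_end_reps zs(1) by auto
  qed
  show "a = b" if ab: "a \<in> closed_annulus" "b \<in> closed_annulus" "w \<in> reps a" "w \<in> reps b" for a b w
  proof -
    obtain z s where a: "a = (z, s)" "z \<in> sphere 0 1" "s \<in> {0..1}" using ab(1) by blast
    obtain z' s' where b: "b = (z', s')" "z' \<in> sphere 0 1" "s' \<in> {0..1}" using ab(2) by blast
    define d where "d = (if w = chord \<rho> (real k + 7/2) (3/4 + s/2) (Re z) \<and> 0 \<le> Im z then 3/4 + s/2 else 13/4 - s/2)"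
    define d' where "d' = (if w = chord \<rho> (real k + 7/2) (3/4 + s'/2) (Re z') \<and> 0 \<le> Im z' then 3/4 + s'/2 else 13/4 - s'/2)"
    have w: "w = chord \<rho> (real k + 7/2) d (Re z)" "w = chord \<rho> (real k + 7/2) d' (Re z')"
      using double_reps[OF ab(3)[unfolded a(1)]] double_reps[OF ab(4)[unfolded b(1)]] by (auto simp: d_def d'_def)
    have "0 < d" "d < 2 * real \<rho>" "0 < d'" "d' < 2 * real \<rho>"
      using double_width[OF a(3)] double_width[OF b(3)] by (auto simp: d_def d'_def)
    from chord_inj[OF this, of "real k + 7/2" "Re z" "Re z'"] have e: "d = d'" "Re z = Re z'"
      using w by auto
    have sgn: "d = 3/4 + s/2 \<and> 0 \<le> Im z \<or> d = 13/4 - s/2 \<and> Im z \<le> 0"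
      "d' = 3/4 + s'/2 \<and> 0 \<le> Im z' \<or> d' = 13/4 - s'/2 \<and> Im z' \<le> 0"
      using double_reps[OF ab(3)[unfolded a(1)]] double_reps[OF ab(4)[unfolded b(1)]] by (auto simp: d_def d'_def)
    \<comment> \<open>The ranges [3/4, 5/4] and [11/4, 13/4] of the two half-widths are disjoint, so
      equal half-widths put both points in the same strip.\<close>
    then have "s = s'" "0 \<le> Im z \<and> 0 \<le> Im z' \<or> Im z \<le> 0 \<and> Im z' \<le> 0"
      using e(1) a(3) b(3) by auto
    then show ?thesis
      using sphere_eqI[OF a(2) b(2) e(2)] a(1) b(1) by auto
  qed
  show "openin (top_of_set (cball 0 1)) (\<Union>a\<in>open_annulus. reps a)"
    unfolding double_region using double_width[of 0] double_width[of 1] by (intro openin_Un open_chord_region) auto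
qed

interpretation S: embedded_annulus_chart \<rho> "double_upper \<rho> k" "double_lower \<rho> k" by (rule double_embedded)

abbreviation "double_twist \<equiv> S.twist 1"

lemma double_twist_off:
  assumes y: "0 \<le> y" "y \<le> 4 * real \<rho>"
    and ny: "\<not> (real k + 1/4 \<le> y \<and> y \<le> real k + 3/4)" "\<not> (real k + 9/4 \<le> y \<and> y \<le> real k + 11/4)"
      "\<not> (real k + 17/4 \<le> y \<and> y \<le> real k + 19/4)" "\<not> (real k + 25/4 \<le> y \<and> y \<le> real k + 27/4)"
  shows "double_twist (glue \<rho> (boundary_point \<rho> y)) = glue \<rho> (boundary_point \<rho> y)"
proof (rule S.twist_off)
  fix a :: "complex \<times> real" assume "a \<in> closed_annulus"
  then obtain z s where a: "a = (z, s)" "z \<in> sphere 0 1" "s \<in> {0..1}" by blast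
  show "boundary_point \<rho> y \<notin> reps a"
  proof
    assume "boundary_point \<rho> y \<in> reps a"
    then obtain y' where y': "boundary_point \<rho> y = boundary_point \<rho> y'"
      "y' \<in> {real k + 17/4 + s/2, real k + 27/4 - s/2, real k + 11/4 - s/2, real k + 1/4 + s/2}"
      using double_reps_boundary[of "boundary_point \<rho> y" z s] a by auto
    have "real k + 8 \<le> 4 * real \<rho>" using k(1) by linarith
    then have "0 < y'" "y' < 4 * real \<rho>" using y'(2) a(3) by auto
    then have "y' = y" using boundary_point_inj[of y' \<rho> y] y y'(1) by simp
    then show False using ny a(3) y'(2) by auto
  qed
qed

lemma double_twist_base: "double_twist (surface_base \<rho>) = surface_base \<rho>"
  using double_twist_off[of 0] by (simp add: surface_base_def boundary_point_def)

lemma double_twist_other_side: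
  assumes j: "j < 4 * \<rho>" "j mod 4 \<in> {0, 1}" "j \<noteq> k" "j \<noteq> k + 4" and t: "t \<in> {0..1}"
  shows "double_twist (glue \<rho> (side \<rho> j t)) = glue \<rho> (side \<rho> j t)"
  unfolding side_eq
proof (rule double_twist_off)
  have j2: "j \<noteq> k + 2" "j \<noteq> k + 6" using j(2) double_side_facts(5,6) by auto
  have *: "\<not> (real q + 1/4 \<le> real j + t \<and> real j + t \<le> real q + 3/4)" if "j \<noteq> q" for q :: nat
  proof
    assume "real q + 1/4 \<le> real j + t \<and> real j + t \<le> real q + 3/4"
    then have "real q < real j + 1" "real j < real q + 1" using t by auto
    then show False using that by linarith
  qed
  show "\<not> (real k + 1/4 \<le> real j + t \<and> real j + t \<le> real k + 3/4)" using *[OF j(3)] by (auto simp: algebra_simps)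
  show "\<not> (real k + 9/4 \<le> real j + t \<and> real j + t \<le> real k + 11/4)" using *[OF j2(1)] by (auto simp: algebra_simps)
  show "\<not> (real k + 17/4 \<le> real j + t \<and> real j + t \<le> real k + 19/4)" using *[OF j(4)] by (auto simp: algebra_simps)
  show "\<not> (real k + 25/4 \<le> real j + t \<and> real j + t \<le> real k + 27/4)" using *[OF j2(2)] by (auto simp: algebra_simps)
qed (use j t in auto)

text \<open>The twist carries the side \<open>k\<close> (where \<open>\<epsilon> = -1\<close>) or \<open>k + 4\<close> (where \<open>\<epsilon> = 1\<close>) once through both strips.\<close>

lemma double_twist_core:
  assumes t: "t \<in> {1/4..3/4}" and \<epsilon>: "\<epsilon> \<in> {-1, 1 :: real}"
    and q: "q = (if \<epsilon> = 1 then k + 4 else k)"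
  defines "x \<equiv> \<epsilon> * cos (2 * pi * twist_profile (2 * t - 1/2))"
  shows "(t \<le> 1/2 \<longleftrightarrow> \<epsilon> = 1) \<or> t = 1/2 \<Longrightarrow> double_twist (glue \<rho> (side \<rho> q t)) = glue \<rho> (chord \<rho> (real k + 7/2) (1/2 + t) x)"
    and "(t \<le> 1/2 \<longleftrightarrow> \<epsilon> = -1) \<or> t = 1/2 \<Longrightarrow> double_twist (glue \<rho> (side \<rho> q t)) = glue \<rho> (chord \<rho> (real k + 7/2) (7/2 - t) x)"
proof -
  define \<phi> where "\<phi> = twist_profile (2 * t - 1/2)"
  define s where "s = 2 * t - 1/2"
  have s: "s \<in> {0..1}" "t = 1/4 + s/2" using t by (auto simp: s_def field_simps)
  have \<phi>: "0 \<le> \<phi>" "\<phi> \<le> 1" "\<phi> \<le> 1/2 \<longleftrightarrow> t \<le> 1/2" "\<phi> \<ge> 1/2 \<longleftrightarrow> t \<ge> 1/2" by (auto simp: \<phi>_def twist_profile_def max_def min_def)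
  have tw: "annulus_twist 1 (of_real \<epsilon>, s) = (of_real \<epsilon> * cis (2 * pi * \<phi>), s)"
    by (simp add: annulus_twist_def \<phi>_def s_def)
  have src: "side \<rho> q t \<in> reps (of_real \<epsilon>, s)"
    using \<epsilon> double_end_reps(1,4)[of s] s(2) by (auto simp: side_eq q algebra_simps)
  have mem: "(of_real \<epsilon>, s) \<in> closed_annulus" using \<epsilon> s(1) by auto
  have sgn1: "sin (2 * pi * \<phi>) \<ge> 0" if "t \<le> 1/2" using cos_sin_nonneg(2)[of \<phi>] \<phi> that by auto
  have sgn2: "sin (2 * pi * \<phi>) \<le> 0" if "1/2 \<le> t"
  proof -
    have "sin (2 * pi * \<phi>) = - sin (2 * pi * (1 - \<phi>))" by (simp add: right_diff_distrib sin_diff)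
    then show ?thesis using cos_sin_nonneg(2)[of "1 - \<phi>"] \<phi> that by auto
  qed
  have x: "x = Re (of_real \<epsilon> * cis (2 * pi * \<phi>))" by (simp add: x_def \<phi>_def)
  have d: "1/2 + t = 3/4 + s/2" "7/2 - t = 13/4 - s/2" using s(2) by simp_all
  show "double_twist (glue \<rho> (side \<rho> q t)) = glue \<rho> (chord \<rho> (real k + 7/2) (1/2 + t) x)"
    if "(t \<le> 1/2 \<longleftrightarrow> \<epsilon> = 1) \<or> t = 1/2"
  proof (rule S.twist_reps[OF mem src])
    have "Im (of_real \<epsilon> * cis (2 * pi * \<phi>)) \<ge> 0"
      using that \<epsilon> sgn1 sgn2 by (cases "t = 1/2") (auto simp: not_le)
    then show "chord \<rho> (real k + 7/2) (1/2 + t) x \<in> reps (annulus_twist 1 (of_real \<epsilon>, s))"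
      unfolding tw reps_def double_defs d x by simp
  qed
  show "double_twist (glue \<rho> (side \<rho> q t)) = glue \<rho> (chord \<rho> (real k + 7/2) (7/2 - t) x)"
    if "(t \<le> 1/2 \<longleftrightarrow> \<epsilon> = -1) \<or> t = 1/2"
  proof (rule S.twist_reps[OF mem src])
    have "Im (of_real \<epsilon> * cis (2 * pi * \<phi>)) \<le> 0"
      using that \<epsilon> sgn1 sgn2 by (cases "t = 1/2") (auto simp: not_le)
    then show "chord \<rho> (real k + 7/2) (7/2 - t) x \<in> reps (annulus_twist 1 (of_real \<epsilon>, s))"
      unfolding tw reps_def double_defs d x by simp
  qed
qed

lemma double_twist_fixed_side:
  assumes t: "t \<in> {0..1}" "t \<notin> {1/4..3/4}" and q: "q \<in> {k, k + 4}"
  shows "double_twist (glue \<rho> (side \<rho> q t)) = glue \<rho> (side \<rho> q t)"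
  unfolding side_eq
proof (rule double_twist_off)
  have "real k + 8 \<le> 4 * real \<rho>" using k(1) by linarith
  then show "0 \<le> real q + t" "real q + t \<le> 4 * real \<rho>" using t q by auto
qed (use t q in auto)

text \<open>The real part of the circle point \<open>\<epsilon>\<close> turned by the profile: it
  goes from \<open>\<epsilon>\<close> to \<open>- \<epsilon>\<close> at time 1/2, where the path
  changes strips, and back.\<close>

definition double_coord :: "real \<Rightarrow> real \<Rightarrow> real" where
  "double_coord \<epsilon> t = \<epsilon> * cos (2 * pi * twist_profile (2 * t - 1/2))"

lemma double_coord_ends: "t < 1/4 \<or> t > 3/4 \<Longrightarrow> double_coord \<epsilon> t = \<epsilon>"
  "double_coord \<epsilon> 0 = \<epsilon>" "double_coord \<epsilon> 1 = \<epsilon>" "double_coord \<epsilon> (1/2) = - \<epsilon>"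
  by (auto simp: double_coord_def twist_profile_def)

text \<open>On each half of the parameter interval the image stays in one strip, and the formulas
  also cover the fixed ends of the side. At \<open>t = 1/2\<close> both hold and give two glued
  points, where the path crosses the boundary of the polygon.\<close>

lemma double_twist_side:
  assumes t: "t \<in> {0..1}"
  shows "t \<le> 1/2 \<Longrightarrow> double_twist (glue \<rho> (side \<rho> k t)) = glue \<rho> (chord \<rho> (real k + 7/2) (7/2 - t) (double_coord (-1) t))"
    and "1/2 \<le> t \<Longrightarrow> double_twist (glue \<rho> (side \<rho> k t)) = glue \<rho> (chord \<rho> (real k + 7/2) (1/2 + t) (double_coord (-1) t))"
    and "t \<le> 1/2 \<Longrightarrow> double_twist (glue \<rho> (side \<rho> (k + 4) t)) = glue \<rho> (chord \<rho> (real k + 7/2) (1/2 + t) (double_coord 1 t))"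
    and "1/2 \<le> t \<Longrightarrow> double_twist (glue \<rho> (side \<rho> (k + 4) t)) = glue \<rho> (chord \<rho> (real k + 7/2) (7/2 - t) (double_coord 1 t))"
proof -
  note g = glue_side[OF double_side_facts(1,2) t] glue_side[OF double_side_facts(3,4) t]
  have out: "double_twist (glue \<rho> (side \<rho> k t)) = glue \<rho> (side \<rho> k t)"
    "double_twist (glue \<rho> (side \<rho> (k + 4) t)) = glue \<rho> (side \<rho> (k + 4) t)"
    "double_coord 1 t = 1" "double_coord (-1) t = -1" if "t \<notin> {1/4..3/4}"
    using double_twist_fixed_side[OF t that] double_coord_ends(1)[of t] that by auto
  show "double_twist (glue \<rho> (side \<rho> k t)) = glue \<rho> (chord \<rho> (real k + 7/2) (7/2 - t) (double_coord (-1) t))" if "t \<le> 1/2"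
    using double_twist_core(2)[of t "-1" k] that out g
    by (cases "t \<in> {1/4..3/4}") (auto simp: double_coord_def chord_ends side_eq algebra_simps)
  show "double_twist (glue \<rho> (side \<rho> k t)) = glue \<rho> (chord \<rho> (real k + 7/2) (1/2 + t) (double_coord (-1) t))" if "1/2 \<le> t"
    using double_twist_core(1)[of t "-1" k] that out g
    by (cases "t \<in> {1/4..3/4}") (auto simp: double_coord_def chord_ends side_eq algebra_simps)
  show "double_twist (glue \<rho> (side \<rho> (k + 4) t)) = glue \<rho> (chord \<rho> (real k + 7/2) (1/2 + t) (double_coord 1 t))" if "t \<le> 1/2"
    using double_twist_core(1)[of t 1 "k + 4"] that out g
    by (cases "t \<in> {1/4..3/4}") (auto simp: double_coord_def chord_ends side_eq algebra_simps)
  show "double_twist (glue \<rho> (side \<rho> (k + 4) t)) = glue \<rho> (chord \<rho> (real k + 7/2) (7/2 - t) (double_coord 1 t))" if "1/2 \<le> t"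
    using double_twist_core(2)[of t 1 "k + 4"] that out g
    by (cases "t \<in> {1/4..3/4}") (auto simp: double_coord_def chord_ends side_eq algebra_simps)
qed

lemma double_path:
  assumes "\<epsilon> \<in> {-1, 1}" "continuous_on S d"
  shows "continuous_on S (\<lambda>t. chord \<rho> (real k + 7/2) (d t) (double_coord \<epsilon> t))"
    and "(\<lambda>t. chord \<rho> (real k + 7/2) (d t) (double_coord \<epsilon> t)) ` S \<subseteq> cball 0 1"
proof -
  show "continuous_on S (\<lambda>t. chord \<rho> (real k + 7/2) (d t) (double_coord \<epsilon> t))"
    unfolding double_coord_def by (intro continuous_intros assms(2))
  have "\<bar>double_coord \<epsilon> t\<bar> \<le> 1" for t
    using assms(1) by (auto simp: double_coord_def)
  then show "(\<lambda>t. chord \<rho> (real k + 7/2) (d t) (double_coord \<epsilon> t)) ` S \<subseteq> cball 0 1"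
    using chord_mem by blast
qed

text \<open>The image of side \<open>k\<close> follows the wide strip, leaves the polygon at the
  midpoint of side \<open>k + 6\<close>, re-enters from side \<open>k + 4\<close> and follows the
  narrow strip. The image of side \<open>k + 4\<close> takes the narrow strip to side
  \<open>k + 2\<close> and, from side \<open>k\<close>, the wide one.\<close>

lemma double_twist_class:
  "surface_loop_class \<rho> (\<lambda>t. double_twist (glue \<rho> (side \<rho> k t))) =
     disc_class \<rho> k (k + 6) \<otimes>\<^bsub>surface_pi1 \<rho>\<^esub> disc_class \<rho> (k + 4 + 1) (k + 2)"
  "surface_loop_class \<rho> (\<lambda>t. double_twist (glue \<rho> (side \<rho> (k + 4) t))) =
     disc_class \<rho> (k + 4) (k + 2) \<otimes>\<^bsub>surface_pi1 \<rho>\<^esub> disc_class \<rho> (k + 1) (k + 6)"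
proof -
  let ?f = "\<lambda>\<epsilon> t. chord \<rho> (real k + 7/2) (7/2 - t) (double_coord \<epsilon> t)"
  let ?g = "\<lambda>\<epsilon> t. chord \<rho> (real k + 7/2) (1/2 + t) (double_coord \<epsilon> t)"
  have c: "continuous_on S (?f \<epsilon>)" "?f \<epsilon> ` S \<subseteq> cball 0 1" "continuous_on S (?g \<epsilon>)" "?g \<epsilon> ` S \<subseteq> cball 0 1"
    if "\<epsilon> \<in> {-1, 1}" for S \<epsilon>
    by (rule double_path[OF that]; intro continuous_intros)+
  have g: "glue \<rho> (side \<rho> (k + 6) s) = glue \<rho> (side \<rho> (k + 4) (1 - s))"
    "glue \<rho> (side \<rho> (k + 2) s) = glue \<rho> (side \<rho> k (1 - s))" if "s \<in> {0..1}" for s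
    using glue_side[OF double_side_facts(1,2), of "1 - s"] glue_side[OF double_side_facts(3,4), of "1 - s"] that
    by (auto simp: side_eq algebra_simps)
  note simps = double_coord_ends chord_ends side_eq algebra_simps
  show "surface_loop_class \<rho> (\<lambda>t. double_twist (glue \<rho> (side \<rho> k t))) =
     disc_class \<rho> k (k + 6) \<otimes>\<^bsub>surface_pi1 \<rho>\<^esub> disc_class \<rho> (k + 4 + 1) (k + 2)"
  proof (rule disc_path_class_crossing[where f = "?f (-1)" and g = "?g (-1)"])
    show "?f (-1) 0 = vertex \<rho> k" "?f (-1) (1/2) = side \<rho> (k + 6) (1/2)"
      "?g (-1) (1/2) = side \<rho> (k + 4) (1/2)" "?g (-1) 1 = vertex \<rho> (k + 2)"
      unfolding double_coord_ends minus_minus chord_ends side_eq by (simp_all add: algebra_simps)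
  qed (use c[of "-1"] g k double_twist_side(1,2) in auto)
  show "surface_loop_class \<rho> (\<lambda>t. double_twist (glue \<rho> (side \<rho> (k + 4) t))) =
     disc_class \<rho> (k + 4) (k + 2) \<otimes>\<^bsub>surface_pi1 \<rho>\<^esub> disc_class \<rho> (k + 1) (k + 6)"
  proof (rule disc_path_class_crossing[where f = "?g 1" and g = "?f 1"])
    show "?g 1 0 = vertex \<rho> (k + 4)" "?g 1 (1/2) = side \<rho> (k + 2) (1/2)"
      "?f 1 (1/2) = side \<rho> k (1/2)" "?f 1 1 = vertex \<rho> (k + 6)"
      unfolding double_coord_ends chord_ends side_eq by (simp_all add: algebra_simps)
  qed (use c[of 1] g k double_twist_side(3,4) in auto)
qed

lemma double_twist_exists:
  obtains h where "homeomorphic_map (surface \<rho>) (surface \<rho>) h" "orientation_preserving (surface \<rho>) h"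
    "h (surface_base \<rho>) = surface_base \<rho>"
    "surface_loop_class \<rho> (\<lambda>t. h (glue \<rho> (side \<rho> k t))) =
       disc_class \<rho> k (k + 6) \<otimes>\<^bsub>surface_pi1 \<rho>\<^esub> disc_class \<rho> (k + 5) (k + 2)"
    "surface_loop_class \<rho> (\<lambda>t. h (glue \<rho> (side \<rho> (k + 4) t))) =
       disc_class \<rho> (k + 4) (k + 2) \<otimes>\<^bsub>surface_pi1 \<rho>\<^esub> disc_class \<rho> (k + 1) (k + 6)"
    "\<And>j t. j < 4 * \<rho> \<Longrightarrow> j mod 4 \<in> {0, 1} \<Longrightarrow> j \<noteq> k \<Longrightarrow> j \<noteq> k + 4 \<Longrightarrow> t \<in> {0..1} \<Longrightarrow>
       h (glue \<rho> (side \<rho> j t)) = glue \<rho> (side \<rho> j t)"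
proof (rule that[OF S.homeomorphic_twist S.orientation_preserving_twist double_twist_base])
  show "surface_loop_class \<rho> (\<lambda>t. double_twist (glue \<rho> (side \<rho> k t))) =
     disc_class \<rho> k (k + 6) \<otimes>\<^bsub>surface_pi1 \<rho>\<^esub> disc_class \<rho> (k + 5) (k + 2)"
  proof -
    have "k + 4 + 1 = k + 5" by simp
    then show ?thesis using double_twist_class(1) by (simp only:)
  qed
qed (use double_twist_class(2) double_twist_other_side in auto)

end

section \<open>Automorphisms realized by homeomorphisms\<close>

text \<open>The condition defining \<open>Aut_surface_group\<close> with the one homomorphism
  \<open>surface_Phi\<close> in place of an existential one, so that the witnesses of several
  automorphisms can be composed and inverted.\<close>

definition realized :: "nat \<Rightarrow> (surface_gen word set \<Rightarrow> surface_gen word set) \<Rightarrow> bool" where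
  "realized \<rho> \<xi> \<longleftrightarrow> \<xi> \<in> iso (surface_group \<rho>) (surface_group \<rho>) \<and>
     (\<exists>h. homeomorphic_map (surface \<rho>) (surface \<rho>) h \<and> orientation_preserving (surface \<rho>) h \<and>
        h (surface_base \<rho>) = surface_base \<rho> \<and>
        (\<forall>\<gamma> \<in> carrier (surface_group \<rho>).
           surface_Phi \<rho> (\<xi> \<gamma>) = pi1_induced (surface \<rho>) (surface_base \<rho>) h (surface_Phi \<rho> \<gamma>)))"

lemma realized_Aut: "\<rho> > 0 \<Longrightarrow> realized \<rho> \<xi> \<Longrightarrow> \<xi> \<in> Aut_surface_group \<rho>"
  unfolding realized_def Aut_surface_group_def Let_def using surface_Phi[of \<rho>] by auto

text \<open>Both \<open>surface_Phi\<close> after the substitution and the map induced by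
  \<open>h\<close> after \<open>surface_Phi\<close> are homomorphisms, so it is enough to compare
  them on generators. The first alternative in \<open>loop\<close> covers the generators whose loops
  are fixed pointwise.\<close>

lemma realizedI:
  assumes \<rho>: "\<rho> > 0"
    and iso: "word_subst \<rho> \<sigma> \<in> iso (surface_group \<rho>) (surface_group \<rho>)"
    and ev: "\<And>s. s \<in> surface_gens \<rho> \<Longrightarrow> word_subst \<rho> \<sigma> (gen \<rho> s) = word_eval (surface_group \<rho>) (gen \<rho>) (\<sigma> s)"
    and w: "\<And>s. s \<in> surface_gens \<rho> \<Longrightarrow> \<sigma> s \<in> words (surface_gens \<rho>)"
    and h: "homeomorphic_map (surface \<rho>) (surface \<rho>) h" "orientation_preserving (surface \<rho>) h"
      "h (surface_base \<rho>) = surface_base \<rho>"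
    and loop: "\<And>s. s \<in> surface_gens \<rho> \<Longrightarrow>
      \<sigma> s = [(s, False)] \<and> (\<forall>t\<in>{0..1}. h (canonical_loop \<rho> s t) = canonical_loop \<rho> s t) \<or>
      surface_loop_class \<rho> (\<lambda>t. h (canonical_loop \<rho> s t)) = word_eval (surface_pi1 \<rho>) (canonical_class \<rho>) (\<sigma> s)"
  shows "realized \<rho> (word_subst \<rho> \<sigma>)"
proof -
  let ?h = "pi1_induced (surface \<rho>) (surface_base \<rho>) h"
  have hc: "continuous_map (surface \<rho>) (surface \<rho>) h"
    using h(1) homeomorphic_imp_continuous_map by blast
  interpret P: group "surface_pi1 \<rho>" by (rule group_surface_pi1)
  note G = group_surface_group[of \<rho>] and P = group_surface_pi1[of \<rho>]
  note Phi = surface_Phi[OF \<rho>]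
  have "surface_Phi \<rho> (word_subst \<rho> \<sigma> \<gamma>) = ?h (surface_Phi \<rho> \<gamma>)" if "\<gamma> \<in> carrier (surface_group \<rho>)" for \<gamma>
  proof -
    have "(surface_Phi \<rho> \<circ> word_subst \<rho> \<sigma>) \<gamma> = (?h \<circ> surface_Phi \<rho>) \<gamma>"
    proof (rule surface_hom_eqI[OF P _ _ _ that])
      show "surface_Phi \<rho> \<circ> word_subst \<rho> \<sigma> \<in> hom (surface_group \<rho>) (surface_pi1 \<rho>)"
        using iso Phi(1) by (intro hom_compose) (auto simp: iso_def)
      show "?h \<circ> surface_Phi \<rho> \<in> hom (surface_group \<rho>) (surface_pi1 \<rho>)"
        by (rule hom_compose[OF Phi(1) pi1_induced_hom[OF hc h(3)]])
      fix s assume s: "s \<in> surface_gens \<rho>"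
      have "surface_Phi \<rho> (word_subst \<rho> \<sigma> (gen \<rho> s)) = word_eval (surface_pi1 \<rho>) (\<lambda>s. surface_Phi \<rho> (gen \<rho> s)) (\<sigma> s)"
        unfolding ev[OF s] by (rule hom_word_eval[OF G P Phi(1) gen_Pi w[OF s]])
      also have "\<dots> = word_eval (surface_pi1 \<rho>) (canonical_class \<rho>) (\<sigma> s)"
        by (rule word_eval_cong[OF Phi(2) w[OF s]])
      also have "\<dots> = surface_loop_class \<rho> (\<lambda>t. h (canonical_loop \<rho> s t))"
        using loop[OF s]
      proof
        assume *: "\<sigma> s = [(s, False)] \<and> (\<forall>t\<in>{0..1}. h (canonical_loop \<rho> s t) = canonical_loop \<rho> s t)"
        then have "canonical_class \<rho> s = surface_loop_class \<rho> (\<lambda>t. h (canonical_loop \<rho> s t))"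
          by (intro loop_class_eq_on[OF canonical_loop_loops[OF s]]) auto
        moreover have "canonical_class \<rho> s \<in> carrier (surface_pi1 \<rho>)"
          using canonical_class_Pi s by blast
        ultimately show ?thesis using * by (simp del: canonical_loop.simps)
      qed (rule sym)
      also have "\<dots> = ?h (canonical_class \<rho> s)"
        using pi1_induced_loop_class[OF hc h(3) canonical_loop_loops[OF s]] by (simp only: o_def)
      finally show "(surface_Phi \<rho> \<circ> word_subst \<rho> \<sigma>) (gen \<rho> s) = (?h \<circ> surface_Phi \<rho>) (gen \<rho> s)"
        using Phi(2)[OF s] by simp
    qed
    then show ?thesis by simp
  qed
  then show ?thesis
    unfolding realized_def using iso h by blast
qed

fun side_index :: "surface_gen \<Rightarrow> nat" where
  "side_index (Alpha i) = 4 * (i - 1)"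
| "side_index (Beta i) = 4 * (i - 1) + 1"

lemma canonical_loop_side: "canonical_loop \<rho> s = (\<lambda>t. glue \<rho> (side \<rho> (side_index s) t))"
  by (cases s) auto

lemma side_index:
  assumes "s \<in> surface_gens \<rho>"
  shows "side_index s < 4 * \<rho>" "side_index s mod 4 \<in> {0, 1}"
  using assms by (auto simp: surface_gens_def mod_Suc)

lemma side_index_inj:
  assumes "s \<in> surface_gens \<rho>" "s' \<in> surface_gens \<rho>" "side_index s = side_index s'"
  shows "s = s'"
proof -
  have "4 * a \<noteq> 4 * b + 1" for a b :: nat by presburger
  then show ?thesis
    using assms by (cases s; cases s') (auto, metis+)
qed

lemma realized_single:
  assumes s: "s \<in> surface_gens \<rho>" and i: "1 \<le> i" "i \<le> \<rho>" and \<sigma>: "\<sigma> \<in> {subst_alpha i, subst_beta i}"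
    and other: "\<And>s'. s' \<noteq> s \<Longrightarrow> \<sigma> s' = [(s', False)]"
    and ev: "disc_class \<rho> (side_index s + 3) (side_index s + 1) = word_eval (surface_pi1 \<rho>) (canonical_class \<rho>) (\<sigma> s)"
  shows "realized \<rho> (word_subst \<rho> \<sigma>)"
proof -
  let ?k = "side_index s"
  have \<rho>: "\<rho> > 0" using i by simp
  obtain h where h: "homeomorphic_map (surface \<rho>) (surface \<rho>) h" "orientation_preserving (surface \<rho>) h"
    "h (surface_base \<rho>) = surface_base \<rho>"
    and hk: "surface_loop_class \<rho> (\<lambda>t. h (glue \<rho> (side \<rho> ?k t))) = disc_class \<rho> (?k + 3) (?k + 1)"
    and ho: "\<And>j t. j < 4 * \<rho> \<Longrightarrow> j mod 4 \<in> {0, 1} \<Longrightarrow> j \<noteq> ?k \<Longrightarrow> t \<in> {0..1} \<Longrightarrow> h (glue \<rho> (side \<rho> j t)) = glue \<rho> (side \<rho> j t)"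
    using single_twist_exists[OF side_index[OF s]] by metis
  show ?thesis
  proof (rule realizedI[OF \<rho> word_subst_single[OF i \<sigma>] _ h])
    show "\<sigma> s' \<in> words (surface_gens \<rho>)" if "s' \<in> surface_gens \<rho>" for s'
      using subst_words(1)[OF i(1) that i(2)] \<sigma> by auto
    show "\<sigma> s' = [(s', False)] \<and> (\<forall>t\<in>{0..1}. h (canonical_loop \<rho> s' t) = canonical_loop \<rho> s' t) \<or>
      surface_loop_class \<rho> (\<lambda>t. h (canonical_loop \<rho> s' t)) = word_eval (surface_pi1 \<rho>) (canonical_class \<rho>) (\<sigma> s')"
      if s': "s' \<in> surface_gens \<rho>" for s'
    proof (cases "s' = s")
      case True
      then show ?thesis using hk ev by (simp add: canonical_loop_side)
    next
      case False
      then have "side_index s' \<noteq> ?k" using side_index_inj s s' by blast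
      then show ?thesis using False other ho side_index[OF s'] by (simp add: canonical_loop_side)
    qed
  qed
qed

text \<open>The twisted side, with number \<open>k'\<close> say, has the class of the chord from
  vertex \<open>k' + 3\<close> to vertex \<open>k' + 1\<close>. Passing through vertex
  \<open>k' + 2\<close> splits it into two sides, and these spell the substituted word.\<close>

lemma realized_subst_single:
  assumes i: "1 \<le> i" "i \<le> \<rho>"
  shows "realized \<rho> (word_subst \<rho> (subst_alpha i))" "realized \<rho> (word_subst \<rho> (subst_beta i))"
proof -
  interpret group "surface_pi1 \<rho>" by (rule group_surface_pi1)
  define k where "k = 4 * (i - 1)"
  have k: "k + 4 \<le> 4 * \<rho>" using i by (auto simp: k_def)
  note c = canonical_class_side[OF i, folded k_def]
  have "Alpha i \<in> surface_gens \<rho>" "Beta i \<in> surface_gens \<rho>" using i by auto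
  then have cc: "canonical_class \<rho> (Alpha i) \<in> carrier (surface_pi1 \<rho>)" "canonical_class \<rho> (Beta i) \<in> carrier (surface_pi1 \<rho>)"
    using canonical_class_Pi by blast+
  show "realized \<rho> (word_subst \<rho> (subst_alpha i))"
  proof (rule realized_single[of "Beta i" _ i])
    have e: "side_index (Beta i) + 3 = k + 4" "side_index (Beta i) + 1 = k + 2" by (simp_all add: k_def)
    have "disc_class \<rho> (k + 4) (k + 2) = disc_class \<rho> (k + 4) (k + 3) \<otimes>\<^bsub>surface_pi1 \<rho>\<^esub> disc_class \<rho> (k + 3) (k + 2)"
      using k by (simp add: disc_class_mult)
    also have "\<dots> = word_eval (surface_pi1 \<rho>) (canonical_class \<rho>) (subst_alpha i (Beta i))"
      using c cc by (simp add: subst_alpha_def del: canonical_loop.simps)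
    finally show "disc_class \<rho> (side_index (Beta i) + 3) (side_index (Beta i) + 1) =
        word_eval (surface_pi1 \<rho>) (canonical_class \<rho>) (subst_alpha i (Beta i))"
      unfolding e .
  qed (use i in \<open>auto simp: subst_alpha_def\<close>)
  show "realized \<rho> (word_subst \<rho> (subst_beta i))"
  proof (rule realized_single[of "Alpha i" _ i])
    have "disc_class \<rho> (k + 3) (k + 1) = disc_class \<rho> (k + 3) (k + 2) \<otimes>\<^bsub>surface_pi1 \<rho>\<^esub> inv\<^bsub>surface_pi1 \<rho>\<^esub> disc_class \<rho> (k + 1) (k + 2)"
      using k by (simp add: disc_class_inv disc_class_mult)
    also have "\<dots> = word_eval (surface_pi1 \<rho>) (canonical_class \<rho>) (subst_beta i (Alpha i))"
      using c cc by (simp add: subst_beta_def del: canonical_loop.simps)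
    finally show "disc_class \<rho> (side_index (Alpha i) + 3) (side_index (Alpha i) + 1) =
        word_eval (surface_pi1 \<rho>) (canonical_class \<rho>) (subst_beta i (Alpha i))"
      by (simp add: k_def)
  qed (use i in \<open>auto simp: subst_beta_def\<close>)
qed

lemma realized_subst_mix:
  assumes i: "1 \<le> i" "i < \<rho>"
  shows "realized \<rho> (word_subst \<rho> (subst_mix i))"
proof -
  interpret group "surface_pi1 \<rho>" by (rule group_surface_pi1)
  define k where "k = 4 * (i - 1)"
  have \<rho>: "\<rho> > 0" using i by simp
  have i': "1 \<le> i" "i \<le> \<rho>" "1 \<le> Suc i" "Suc i \<le> \<rho>" using i by auto
  have k: "k + 8 \<le> 4 * \<rho>" "k mod 4 = 0" using i by (auto simp: k_def)
  have k4: "4 * (Suc i - 1) = k + 4" using i by (simp add: k_def)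
  obtain h where h: "homeomorphic_map (surface \<rho>) (surface \<rho>) h" "orientation_preserving (surface \<rho>) h"
    "h (surface_base \<rho>) = surface_base \<rho>"
    and hk: "surface_loop_class \<rho> (\<lambda>t. h (glue \<rho> (side \<rho> k t))) =
       disc_class \<rho> k (k + 6) \<otimes>\<^bsub>surface_pi1 \<rho>\<^esub> disc_class \<rho> (k + 5) (k + 2)"
    and hk4: "surface_loop_class \<rho> (\<lambda>t. h (glue \<rho> (side \<rho> (k + 4) t))) =
       disc_class \<rho> (k + 4) (k + 2) \<otimes>\<^bsub>surface_pi1 \<rho>\<^esub> disc_class \<rho> (k + 1) (k + 6)"
    and ho: "\<And>j t. j < 4 * \<rho> \<Longrightarrow> j mod 4 \<in> {0, 1} \<Longrightarrow> j \<noteq> k \<Longrightarrow> j \<noteq> k + 4 \<Longrightarrow> t \<in> {0..1} \<Longrightarrow>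
       h (glue \<rho> (side \<rho> j t)) = glue \<rho> (side \<rho> j t)"
    using double_twist_exists[OF k] by metis
  have num: "k + 4 + 1 = k + 5" "k + 4 + 2 = k + 6" "k + 4 + 3 = k + 7" "k + 4 + 4 = k + 8" by simp_all
  let ?D = "disc_class \<rho>"
  have c: "canonical_class \<rho> (Alpha i) = ?D k (k + 1)" "canonical_class \<rho> (Beta i) = ?D (k + 1) (k + 2)"
    "?D (k + 3) (k + 2) = ?D k (k + 1)" "?D (k + 4) (k + 3) = ?D (k + 1) (k + 2)"
    "canonical_class \<rho> (Alpha (Suc i)) = ?D (k + 4) (k + 5)" "canonical_class \<rho> (Beta (Suc i)) = ?D (k + 5) (k + 6)"
    using canonical_class_side(1-4)[OF i'(1,2), folded k_def] canonical_class_side(1-4)[OF i'(3,4), unfolded k4 num] by metis+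
  have dc: "?D a b \<in> carrier (surface_pi1 \<rho>)" if "a \<le> k + 8" "b \<le> k + 8" for a b
    using that k disc_class_carrier by simp
  have dm: "?D a b \<otimes>\<^bsub>surface_pi1 \<rho>\<^esub> ?D b d = ?D a d" if "a \<le> k + 8" "b \<le> k + 8" "d \<le> k + 8" for a b d
    using that k disc_class_mult by simp
  have di: "inv\<^bsub>surface_pi1 \<rho>\<^esub> ?D a b = ?D b a" if "a \<le> k + 8" "b \<le> k + 8" for a b
    using that k disc_class_inv by simp
  \<comment> \<open>The chords in the image are broken along the boundary of the polygon. For handle
    \<open>i\<close> this uses both sides carrying each generator, which \<open>c\<close>
    identifies; the sides then spell the words of \<open>subst_mix\<close>.\<close>
  have split1: "?D k (k + 6) = ?D k (k + 1) \<otimes>\<^bsub>surface_pi1 \<rho>\<^esub> (?D (k + 1) (k + 2) \<otimes>\<^bsub>surface_pi1 \<rho>\<^esub>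
      (inv\<^bsub>surface_pi1 \<rho>\<^esub> ?D (k + 3) (k + 2) \<otimes>\<^bsub>surface_pi1 \<rho>\<^esub> (inv\<^bsub>surface_pi1 \<rho>\<^esub> ?D (k + 4) (k + 3) \<otimes>\<^bsub>surface_pi1 \<rho>\<^esub>
      (?D (k + 4) (k + 5) \<otimes>\<^bsub>surface_pi1 \<rho>\<^esub> ?D (k + 5) (k + 6)))))"
    by (simp only: dm di le_add2 add_le_cancel_left numeral_le_iff one_le_numeral le_add1 semiring_norm)
  have split2: "?D (k + 5) (k + 2) = inv\<^bsub>surface_pi1 \<rho>\<^esub> ?D (k + 4) (k + 5) \<otimes>\<^bsub>surface_pi1 \<rho>\<^esub>
      (?D (k + 4) (k + 3) \<otimes>\<^bsub>surface_pi1 \<rho>\<^esub> ?D (k + 3) (k + 2))"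
    by (simp only: dm di le_add2 add_le_cancel_left numeral_le_iff one_le_numeral le_add1 semiring_norm)
  have split3: "?D (k + 4) (k + 2) = ?D (k + 4) (k + 3) \<otimes>\<^bsub>surface_pi1 \<rho>\<^esub> ?D (k + 3) (k + 2)"
    by (simp only: dm di le_add2 add_le_cancel_left numeral_le_iff one_le_numeral le_add1 semiring_norm)
  have split4: "?D (k + 1) (k + 6) = ?D (k + 1) (k + 2) \<otimes>\<^bsub>surface_pi1 \<rho>\<^esub>
      (inv\<^bsub>surface_pi1 \<rho>\<^esub> ?D (k + 3) (k + 2) \<otimes>\<^bsub>surface_pi1 \<rho>\<^esub> (inv\<^bsub>surface_pi1 \<rho>\<^esub> ?D (k + 4) (k + 3) \<otimes>\<^bsub>surface_pi1 \<rho>\<^esub>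
      (?D (k + 4) (k + 5) \<otimes>\<^bsub>surface_pi1 \<rho>\<^esub> ?D (k + 5) (k + 6))))"
    by (simp only: dm di le_add2 add_le_cancel_left numeral_le_iff one_le_numeral le_add1 semiring_norm)
  have car: "?D k (k + 1) \<in> carrier (surface_pi1 \<rho>)" "?D (k + 1) (k + 2) \<in> carrier (surface_pi1 \<rho>)"
    "?D (k + 4) (k + 5) \<in> carrier (surface_pi1 \<rho>)" "?D (k + 5) (k + 6) \<in> carrier (surface_pi1 \<rho>)"
    using dc by simp_all
  show ?thesis
  proof (rule realizedI[OF \<rho> word_subst_mix[OF i] _ h])
    show "subst_mix i s \<in> words (surface_gens \<rho>)" if "s \<in> surface_gens \<rho>" for s
      by (rule subst_words(2)[OF i(1) that i(2)]) simp
    fix s assume s: "s \<in> surface_gens \<rho>"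
    have k_eq: "side_index (Alpha i) = k" "side_index (Alpha (Suc i)) = k + 4" using k4 by (simp_all add: k_def)
    consider "s = Alpha i" | "s = Alpha (Suc i)" | "s \<noteq> Alpha i" "s \<noteq> Alpha (Suc i)" by blast
    then show "subst_mix i s = [(s, False)] \<and> (\<forall>t\<in>{0..1}. h (canonical_loop \<rho> s t) = canonical_loop \<rho> s t) \<or>
      surface_loop_class \<rho> (\<lambda>t. h (canonical_loop \<rho> s t)) = word_eval (surface_pi1 \<rho>) (canonical_class \<rho>) (subst_mix i s)"
    proof cases
      case 1
      have "?D k (k + 6) \<otimes>\<^bsub>surface_pi1 \<rho>\<^esub> ?D (k + 5) (k + 2) = word_eval (surface_pi1 \<rho>) (canonical_class \<rho>) (subst_mix i s)"
        unfolding split1 split2 using car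
        by (simp add: 1 subst_mix_def c m_assoc del: canonical_loop.simps One_nat_def add_2_eq_Suc')
      moreover have "canonical_loop \<rho> s = (\<lambda>t. glue \<rho> (side \<rho> k t))"
        by (simp only: 1 canonical_loop_side k_eq)
      ultimately show ?thesis using hk by (intro disjI2) (simp only:)
    next
      case 2
      have "?D (k + 4) (k + 2) \<otimes>\<^bsub>surface_pi1 \<rho>\<^esub> ?D (k + 1) (k + 6) = word_eval (surface_pi1 \<rho>) (canonical_class \<rho>) (subst_mix i s)"
        unfolding split3 split4 using car
        by (simp add: 2 subst_mix_def c m_assoc del: canonical_loop.simps One_nat_def add_2_eq_Suc')
      moreover have "canonical_loop \<rho> s = (\<lambda>t. glue \<rho> (side \<rho> (k + 4) t))"
        by (simp only: 2 canonical_loop_side k_eq)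
      ultimately show ?thesis using hk4 by (intro disjI2) (simp only:)
    next
      case 3
      have "Alpha i \<in> surface_gens \<rho>" "Alpha (Suc i) \<in> surface_gens \<rho>" using i' by auto
      then have "side_index s \<noteq> k" "side_index s \<noteq> k + 4"
        using 3 side_index_inj[OF s] k_eq by metis+
      then show ?thesis
        using 3 ho side_index[OF s] by (simp add: subst_mix_def canonical_loop_side)
    qed
  qed
qed

section \<open>Composition and inversion of realized automorphisms\<close>

lemma pi1_induced_compose:
  assumes "continuous_map X X h" "h x = x" "continuous_map X X k" "k x = x" "c \<in> carrier (fundamental_group X x)"
  shows "pi1_induced X x h (pi1_induced X x k c) = pi1_induced X x (h \<circ> k) c"
proof -
  obtain p where p: "p \<in> loops X x" "c = loop_class X x p" using assms(5) by (auto simp: carrier_fundamental_group)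
  show ?thesis
    unfolding p(2) using assms p(1) loops_compose[OF assms(3,4) p(1)] continuous_map_compose[OF assms(3,1)]
    by (simp add: pi1_induced_loop_class o_assoc)
qed

lemma pi1_induced_eq_self:
  assumes "\<And>y. y \<in> topspace X \<Longrightarrow> h y = y" "continuous_map X X h" "h x = x" "c \<in> carrier (fundamental_group X x)"
  shows "pi1_induced X x h c = c"
proof -
  obtain p where p: "p \<in> loops X x" "c = loop_class X x p" using assms(4) by (auto simp: carrier_fundamental_group)
  have "loop_class X x p = loop_class X x (h \<circ> p)"
    by (rule loop_class_eq_on[OF p(1)])
      (use p(1) assms(1) in \<open>auto simp: loops_def pathin_def continuous_map_def Pi_iff\<close>)
  then show ?thesis
    unfolding p(2) pi1_induced_loop_class[OF assms(2,3) p(1)] by (rule sym)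
qed

lemma realized_compose:
  assumes \<rho>: "\<rho> > 0" and "realized \<rho> \<xi>" "realized \<rho> \<zeta>"
  shows "realized \<rho> (\<xi> \<circ> \<zeta>)"
proof -
  let ?S = "surface \<rho>" and ?G = "surface_group \<rho>"
  obtain h where h: "\<xi> \<in> iso ?G ?G" "homeomorphic_map ?S ?S h" "orientation_preserving ?S h" "h (surface_base \<rho>) = surface_base \<rho>"
    "\<And>\<gamma>. \<gamma> \<in> carrier ?G \<Longrightarrow> surface_Phi \<rho> (\<xi> \<gamma>) = pi1_induced ?S (surface_base \<rho>) h (surface_Phi \<rho> \<gamma>)"
    using assms(2) unfolding realized_def by blast
  obtain k where k: "\<zeta> \<in> iso ?G ?G" "homeomorphic_map ?S ?S k" "orientation_preserving ?S k" "k (surface_base \<rho>) = surface_base \<rho>"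
    "\<And>\<gamma>. \<gamma> \<in> carrier ?G \<Longrightarrow> surface_Phi \<rho> (\<zeta> \<gamma>) = pi1_induced ?S (surface_base \<rho>) k (surface_Phi \<rho> \<gamma>)"
    using assms(3) unfolding realized_def by blast
  have hc: "continuous_map ?S ?S h" "continuous_map ?S ?S k"
    using h(2) k(2) homeomorphic_imp_continuous_map by blast+
  have "\<xi> \<circ> \<zeta> \<in> iso ?G ?G"
    using h(1) k(1) by (rule iso_set_trans[rotated])
  moreover have "homeomorphic_map ?S ?S (h \<circ> k)"
    using homeomorphic_map_compose h(2) k(2) by blast
  moreover have "orientation_preserving ?S (h \<circ> k)"
    using h(3) k(3) hom_induced_compose_empty[OF hc(2,1), of 2] by (simp add: orientation_preserving_def)
  moreover have "surface_Phi \<rho> ((\<xi> \<circ> \<zeta>) \<gamma>) = pi1_induced ?S (surface_base \<rho>) (h \<circ> k) (surface_Phi \<rho> \<gamma>)"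
    if "\<gamma> \<in> carrier ?G" for \<gamma>
  proof -
    have "\<zeta> \<gamma> \<in> carrier ?G" using k(1) that by (auto simp: iso_def hom_def)
    moreover have "surface_Phi \<rho> \<gamma> \<in> carrier (surface_pi1 \<rho>)"
      using surface_Phi(1)[OF \<rho>] that by (auto simp: hom_def)
    ultimately show ?thesis
      using h(5) k(5)[OF that] pi1_induced_compose[OF hc(1) h(4) hc(2) k(4)] by simp
  qed
  ultimately show ?thesis
    unfolding realized_def using h(4) k(4) by (intro conjI exI[of _ "h \<circ> k"]) auto
qed

lemma realized_inverse:
  assumes \<rho>: "\<rho> > 0" and "realized \<rho> \<xi>"
  shows "realized \<rho> (inv_into (carrier (surface_group \<rho>)) \<xi>)"
proof -
  let ?S = "surface \<rho>" and ?G = "surface_group \<rho>" and ?b = "surface_base \<rho>"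
  let ?\<zeta> = "inv_into (carrier ?G) \<xi>"
  interpret group ?G by (rule group_surface_group)
  obtain h where h: "\<xi> \<in> iso ?G ?G" "homeomorphic_map ?S ?S h" "orientation_preserving ?S h" "h ?b = ?b"
    "\<And>\<gamma>. \<gamma> \<in> carrier ?G \<Longrightarrow> surface_Phi \<rho> (\<xi> \<gamma>) = pi1_induced ?S ?b h (surface_Phi \<rho> \<gamma>)"
    using assms(2) unfolding realized_def by blast
  obtain k where hk: "homeomorphic_maps ?S ?S h k"
    using h(2) homeomorphic_map_maps by blast
  then have kh: "\<And>y. y \<in> topspace ?S \<Longrightarrow> k (h y) = y" and hc: "continuous_map ?S ?S h" "continuous_map ?S ?S k"
    by (auto simp: homeomorphic_maps_def)
  have kb: "k ?b = ?b" using kh[OF surface_base_topspace] h(4) by simp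
  have iso: "?\<zeta> \<in> iso ?G ?G" using iso_set_sym[OF h(1)] .
  moreover have "homeomorphic_map ?S ?S k"
    using hk homeomorphic_maps_map by blast
  moreover have "orientation_preserving ?S k"
    unfolding orientation_preserving_def
  proof
    fix c assume c: "c \<in> carrier (homology_group 2 ?S)"
    have "hom_induced 2 ?S {} ?S {} k c = hom_induced 2 ?S {} ?S {} k (hom_induced 2 ?S {} ?S {} h c)"
      using h(3) c by (simp add: orientation_preserving_def)
    also have "\<dots> = hom_induced 2 ?S {} ?S {} (k \<circ> h) c"
      using hom_induced_compose_empty[OF hc, of 2] by simp
    also have "\<dots> = c"
      by (rule hom_induced_id_gen) (use c kh continuous_map_compose[OF hc] in auto)
    finally show "hom_induced 2 ?S {} ?S {} k c = c" .
  qed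
  moreover have "surface_Phi \<rho> (?\<zeta> \<gamma>) = pi1_induced ?S ?b k (surface_Phi \<rho> \<gamma>)" if g: "\<gamma> \<in> carrier ?G" for \<gamma>
  proof -
    have im: "\<xi> ` carrier ?G = carrier ?G" using h(1) by (auto simp: iso_def bij_betw_def)
    have z: "?\<zeta> \<gamma> \<in> carrier ?G" "\<xi> (?\<zeta> \<gamma>) = \<gamma>"
      using g im inv_into_into[of \<gamma> \<xi> "carrier ?G"] f_inv_into_f[of \<gamma> \<xi> "carrier ?G"] by auto
    have P: "surface_Phi \<rho> (?\<zeta> \<gamma>) \<in> carrier (surface_pi1 \<rho>)"
      using surface_Phi(1)[OF \<rho>] z(1) by (auto simp: hom_def)
    have "pi1_induced ?S ?b k (surface_Phi \<rho> \<gamma>) = pi1_induced ?S ?b (k \<circ> h) (surface_Phi \<rho> (?\<zeta> \<gamma>))"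
      using h(5)[OF z(1)] z(2) pi1_induced_compose[OF hc(2) kb hc(1) h(4) P] by simp
    also have "\<dots> = surface_Phi \<rho> (?\<zeta> \<gamma>)"
      by (rule pi1_induced_eq_self) (use kh P h(4) kb continuous_map_compose[OF hc] in auto)
    finally show ?thesis ..
  qed
  ultimately show ?thesis
    unfolding realized_def using kb by blast
qed

text \<open>Compared with \<open>aut_equivalent\<close> the inverse of \<open>\<xi>\<close> is moved
  to the other side, so that transitivity is composition of the witnesses.\<close>

definition realized_equivalent ::
    "nat \<Rightarrow> ('a, 'b) monoid_scheme \<Rightarrow> (surface_gen word set \<Rightarrow> 'a) \<Rightarrow> (surface_gen word set \<Rightarrow> 'a) \<Rightarrow> bool" where
  "realized_equivalent \<rho> G \<eta> \<eta>' \<longleftrightarrow> (\<exists>\<omega> \<in> iso G G. \<exists>\<xi>. realized \<rho> \<xi> \<and>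
     (\<forall>\<gamma> \<in> carrier (surface_group \<rho>). \<eta>' (\<xi> \<gamma>) = \<omega> (\<eta> \<gamma>)))"

lemma realized_bij:
  assumes "realized \<rho> \<xi>"
  shows "bij_betw \<xi> (carrier (surface_group \<rho>)) (carrier (surface_group \<rho>))"
  using assms by (auto simp: realized_def iso_def)

lemma realized_equivalent_imp:
  assumes "\<rho> > 0" "realized_equivalent \<rho> G \<eta> \<eta>'"
  shows "aut_equivalent \<rho> G \<eta> \<eta>'"
proof -
  obtain \<omega> \<xi> where w: "\<omega> \<in> iso G G" "realized \<rho> \<xi>" "\<And>\<gamma>. \<gamma> \<in> carrier (surface_group \<rho>) \<Longrightarrow> \<eta>' (\<xi> \<gamma>) = \<omega> (\<eta> \<gamma>)"
    using assms(2) unfolding realized_equivalent_def by blast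
  have "\<eta>' \<gamma> = \<omega> (\<eta> (inv_into (carrier (surface_group \<rho>)) \<xi> \<gamma>))" if "\<gamma> \<in> carrier (surface_group \<rho>)" for \<gamma>
    using w(3)[of "inv_into (carrier (surface_group \<rho>)) \<xi> \<gamma>"] that realized_bij[OF w(2)]
    by (simp add: bij_betw_def inv_into_into f_inv_into_f)
  then show ?thesis
    unfolding aut_equivalent_def using w(1) realized_Aut[OF assms(1) w(2)] by blast
qed

lemma realized_equivalent_trans:
  assumes "\<rho> > 0" "realized_equivalent \<rho> G \<eta> \<eta>'" "realized_equivalent \<rho> G \<eta>' \<eta>''"
  shows "realized_equivalent \<rho> G \<eta> \<eta>''"
proof -
  obtain \<omega> \<xi> where w: "\<omega> \<in> iso G G" "realized \<rho> \<xi>" "\<And>\<gamma>. \<gamma> \<in> carrier (surface_group \<rho>) \<Longrightarrow> \<eta>' (\<xi> \<gamma>) = \<omega> (\<eta> \<gamma>)"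
    using assms(2) unfolding realized_equivalent_def by blast
  obtain \<omega>' \<zeta> where w': "\<omega>' \<in> iso G G" "realized \<rho> \<zeta>" "\<And>\<gamma>. \<gamma> \<in> carrier (surface_group \<rho>) \<Longrightarrow> \<eta>'' (\<zeta> \<gamma>) = \<omega>' (\<eta>' \<gamma>)"
    using assms(3) unfolding realized_equivalent_def by blast
  have "\<xi> \<gamma> \<in> carrier (surface_group \<rho>)" if "\<gamma> \<in> carrier (surface_group \<rho>)" for \<gamma>
    using realized_bij[OF w(2)] that by (auto simp: bij_betw_def)
  then show ?thesis
    unfolding realized_equivalent_def
    by (intro bexI[of _ "\<omega>' \<circ> \<omega>"] exI[of _ "\<zeta> \<circ> \<xi>"])
      (use w w' realized_compose[OF assms(1) w'(2) w(2)] iso_set_trans[OF w(1) w'(1)] in auto)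
qed

text \<open>The identity is obtained as a twist composed with its inverse. Agreement is stated on
  the carrier because \<open>inv_into\<close> is unspecified elsewhere.\<close>

lemma realized_identity:
  assumes "\<rho> > 0"
  shows "\<exists>\<xi>. realized \<rho> \<xi> \<and> (\<forall>\<gamma> \<in> carrier (surface_group \<rho>). \<xi> \<gamma> = \<gamma>)"
proof -
  obtain \<xi> where \<xi>: "realized \<rho> \<xi>"
    using realized_subst_single[of 1 \<rho>] assms by auto
  let ?\<zeta> = "inv_into (carrier (surface_group \<rho>)) \<xi>"
  have "realized \<rho> (\<xi> \<circ> ?\<zeta>)"
    using realized_compose realized_inverse assms \<xi> by blast
  moreover have "(\<xi> \<circ> ?\<zeta>) \<gamma> = \<gamma>" if "\<gamma> \<in> carrier (surface_group \<rho>)" for \<gamma>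
    using that realized_bij[OF \<xi>] by (simp add: bij_betw_def f_inv_into_f)
  ultimately show ?thesis by blast
qed

lemma realized_equivalent_iso:
  assumes "\<rho> > 0" "\<theta> \<in> iso G G"
  shows "realized_equivalent \<rho> G \<eta> (\<theta> \<circ> \<eta>)"
  using realized_identity[OF assms(1)] assms(2) unfolding realized_equivalent_def by force

lemma realized_equivalent_refl: "\<rho> > 0 \<Longrightarrow> realized_equivalent \<rho> G \<eta> \<eta>"
  using realized_equivalent_iso[of \<rho> "\<lambda>x. x" G \<eta>]
  by (auto simp: iso_def hom_def bij_betw_def inj_on_def o_def)

text \<open>The new epimorphism is \<eta> precomposed with the substitution, and the inverse of the
  substitution is the witness of equivalence.\<close>

lemma realized_equivalent_subst:
  assumes "\<rho> > 0" "group G" and \<eta>: "\<eta> \<in> epi (surface_group \<rho>) G" and r: "realized \<rho> (word_subst \<rho> \<sigma>)"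
    and ev: "\<And>s. s \<in> surface_gens \<rho> \<Longrightarrow> word_subst \<rho> \<sigma> (gen \<rho> s) = word_eval (surface_group \<rho>) (gen \<rho>) (\<sigma> s)"
    and w: "\<And>s. s \<in> surface_gens \<rho> \<Longrightarrow> \<sigma> s \<in> words (surface_gens \<rho>)"
  shows "\<exists>\<eta>' \<in> epi (surface_group \<rho>) G. realized_equivalent \<rho> G \<eta> \<eta>' \<and>
    (\<forall>s \<in> surface_gens \<rho>. \<eta>' (gen \<rho> s) = word_eval G (\<lambda>s. \<eta> (gen \<rho> s)) (\<sigma> s))"
proof (intro bexI conjI)
  let ?\<xi> = "word_subst \<rho> \<sigma>" and ?\<Gamma> = "surface_group \<rho>"
  interpret group G by fact
  have h: "\<eta> \<in> hom ?\<Gamma> G" "\<eta> ` carrier ?\<Gamma> = carrier G" using \<eta> by (auto simp: epi_def)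
  have x: "?\<xi> \<in> hom ?\<Gamma> ?\<Gamma>" "?\<xi> ` carrier ?\<Gamma> = carrier ?\<Gamma>"
    using r by (auto simp: realized_def iso_def bij_betw_def)
  show "\<eta> \<circ> ?\<xi> \<in> epi ?\<Gamma> G"
  proof -
    have "(\<eta> \<circ> ?\<xi>) ` carrier ?\<Gamma> = carrier G"
      by (simp only: image_comp[symmetric] x(2) h(2))
    then show ?thesis using Group.hom_compose[OF x(1) h(1)] unfolding epi_def by blast
  qed
  show "\<forall>s \<in> surface_gens \<rho>. (\<eta> \<circ> ?\<xi>) (gen \<rho> s) = word_eval G (\<lambda>s. \<eta> (gen \<rho> s)) (\<sigma> s)"
    using ev hom_word_eval[OF group_surface_group assms(2) h(1) gen_Pi w] by auto
  have "(\<eta> \<circ> ?\<xi>) (inv_into (carrier ?\<Gamma>) ?\<xi> \<gamma>) = \<eta> \<gamma>" if "\<gamma> \<in> carrier ?\<Gamma>" for \<gamma>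
    using that x(2) by (simp add: f_inv_into_f)
  moreover have "(\<lambda>x. x) \<in> iso G G" by (auto simp: iso_def hom_def bij_betw_def inj_on_def)
  ultimately show "realized_equivalent \<rho> G \<eta> (\<eta> \<circ> ?\<xi>)"
    unfolding realized_equivalent_def
    by (intro bexI[of _ "\<lambda>x. x"] exI[of _ "inv_into (carrier ?\<Gamma>) ?\<xi>"])
      (use realized_inverse[OF assms(1) r] in simp_all)
qed

section \<open>Reduction of integer matrices\<close>

text \<open>The effect on coordinates of the endomorphism of the group that sends
  \<open>\<omega> l\<close> to \<open>u\<close> times itself plus the combination of the other
  generators with coefficients \<open>g\<close>, and fixes these other generators.\<close>

definition row_aut :: "nat \<Rightarrow> int \<Rightarrow> (nat \<Rightarrow> int) \<Rightarrow> (nat \<Rightarrow> int) \<Rightarrow> nat \<Rightarrow> int" where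
  "row_aut l u g v = (\<lambda>j. if j = l then u * v l else v j + v l * g j)"

text \<open>\<open>R A B\<close> stands for: some epimorphism in the orbit sends \<open>\<alpha>\<^sub>i\<close> to \<open>\<Sum>\<^sub>j A i j \<omega>\<^sub>j\<close> and \<open>\<beta>\<^sub>i\<close> to
  \<open>\<Sum>\<^sub>j B i j \<omega>\<^sub>j\<close>. The assumption \<open>col\<close> is what surjectivity says about a single coordinate.\<close>

locale matrix_orbit =
  fixes \<rho> r :: nat and n :: "nat \<Rightarrow> nat" and R :: "(nat \<Rightarrow> nat \<Rightarrow> int) \<Rightarrow> (nat \<Rightarrow> nat \<Rightarrow> int) \<Rightarrow> bool"
  assumes rho2: "2 \<le> \<rho>"
    and n_gt1: "\<And>i. i \<in> {1..r} \<Longrightarrow> 1 < n i"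
    and n_step: "\<And>i. 1 \<le> i \<Longrightarrow> i < r \<Longrightarrow> n (i + 1) dvd n i"
    and twist_a: "\<And>A B i. R A B \<Longrightarrow> i \<in> {1..\<rho>} \<Longrightarrow> R A (B(i := \<lambda>j. B i j + A i j))"
    and twist_b: "\<And>A B i. R A B \<Longrightarrow> i \<in> {1..\<rho>} \<Longrightarrow> R (A(i := \<lambda>j. A i j - B i j)) B"
    and twist_mix: "\<And>A B i. R A B \<Longrightarrow> 1 \<le> i \<Longrightarrow> i < \<rho> \<Longrightarrow>
      R (A(i := \<lambda>j. A i j + B i j + B (Suc i) j, Suc i := \<lambda>j. A (Suc i) j + B i j + B (Suc i) j)) B"
    and R_cong: "\<And>A B A' B'. R A B \<Longrightarrow>
      (\<And>i j. i \<in> {1..\<rho>} \<Longrightarrow> j \<in> {1..r} \<Longrightarrow> int (n j) dvd A' i j - A i j \<and> int (n j) dvd B' i j - B i j) \<Longrightarrow> R A' B'"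
    and R_aut: "\<And>A B l u g. R A B \<Longrightarrow> l \<in> {1..r} \<Longrightarrow> coprime u (int (n l)) \<Longrightarrow> g l = 0 \<Longrightarrow>
      (\<And>j. j \<in> {1..r} \<Longrightarrow> int (n j) dvd int (n l) * g j) \<Longrightarrow> R (\<lambda>i. row_aut l u g (A i)) (\<lambda>i. row_aut l u g (B i))"
    and col: "\<And>A B l d. R A B \<Longrightarrow> l \<in> {1..r} \<Longrightarrow> d dvd int (n l) \<Longrightarrow>
      (\<And>i. i \<in> {1..\<rho>} \<Longrightarrow> d dvd A i l \<and> d dvd B i l) \<Longrightarrow> is_unit d"
begin

lemma n_dvd: "1 \<le> i \<Longrightarrow> i \<le> j \<Longrightarrow> j \<le> r \<Longrightarrow> n j dvd n i"
proof (induction j)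
  case (Suc j)
  then show ?case
    using n_step[of j] by (cases "i = Suc j") (auto intro: dvd_trans)
qed simp

lemma R_eq:
  assumes "R A B" "\<And>i j. i \<in> {1..\<rho>} \<Longrightarrow> j \<in> {1..r} \<Longrightarrow> A' i j = A i j \<and> B' i j = B i j"
  shows "R A' B'"
  by (rule R_cong[OF assms(1)]) (use assms(2) in auto)

text \<open>All orders divide \<open>n 1\<close>, so this is the exponent of the group; the value 1
  in rank 0 keeps it positive.\<close>

definition expn :: int where "expn = (if r = 0 then 1 else int (n 1))"

lemma expn: "0 < expn" "j \<in> {1..r} \<Longrightarrow> int (n j) dvd expn"
  using n_gt1[of 1] n_dvd[of 1 j] by (auto simp: expn_def)

lemma expn_dvd: "j \<in> {1..r} \<Longrightarrow> int (n j) dvd c * b - int (nat (c mod expn)) * b"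
proof -
  assume j: "j \<in> {1..r}"
  have "int (nat (c mod expn)) = c mod expn" using expn(1) by simp
  moreover have "int (n j) dvd c - c mod expn"
    using expn(2)[OF j] by (simp add: minus_mod_eq_mult_div dvd_mult2)
  ultimately have "int (n j) dvd (c - int (nat (c mod expn))) * b" by (simp add: dvd_mult2)
  then show ?thesis by (simp add: left_diff_distrib)
qed

text \<open>Every move has finite order modulo the exponent of the group, so negative multiples are available.\<close>

lemma add_a_to_b:
  assumes "R A B" "i \<in> {1..\<rho>}"
  shows "R A (B(i := \<lambda>j. B i j + c * A i j))"
proof -
  have nat: "R A (B(i := \<lambda>j. B i j + int k * A i j))" for k
  proof (induction k)
    case (Suc k)
    show ?case
      by (rule R_eq[OF twist_a[OF Suc assms(2)]]) (simp add: algebra_simps)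
  qed (use assms in \<open>simp add: fun_upd_idem\<close>)
  show ?thesis
    by (rule R_cong[OF nat[of "nat (c mod expn)"]]) (auto intro: expn_dvd simp del: int_nat_eq)
qed

lemma add_b_to_a:
  assumes "R A B" "i \<in> {1..\<rho>}"
  shows "R (A(i := \<lambda>j. A i j + c * B i j)) B"
proof -
  have nat: "R (A(i := \<lambda>j. A i j - int k * B i j)) B" for k
  proof (induction k)
    case (Suc k)
    show ?case
      by (rule R_eq[OF twist_b[OF Suc assms(2)]]) (simp add: algebra_simps)
  qed (use assms in \<open>simp add: fun_upd_idem\<close>)
  have "int (n j) dvd (A i j + c * B i j) - (A i j - int (nat ((- c) mod expn)) * B i j)" if "j \<in> {1..r}" for j
    using expn_dvd[OF that, of "- c" "- B i j"] by (simp add: algebra_simps del: int_nat_eq)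
  then show ?thesis
    by (intro R_cong[OF nat[of "nat ((- c) mod expn)"]]) auto
qed

text \<open>The quarter turn of a symplectic plane is a product of three transvections.\<close>

lemma rot:
  assumes "R A B" "i \<in> {1..\<rho>}"
  shows "R (A(i := \<lambda>j. - B i j)) (B(i := A i))"
proof -
  note 1 = add_a_to_b[OF assms, of 1]
  note 2 = add_b_to_a[OF 1 assms(2), of "-1"]
  show ?thesis
    by (rule R_eq[OF add_a_to_b[OF 2 assms(2), of 1]]) auto
qed

lemma neg:
  assumes "R A B" "i \<in> {1..\<rho>}"
  shows "R (A(i := \<lambda>j. - A i j)) (B(i := \<lambda>j. - B i j))"
  by (rule R_eq[OF rot[OF rot[OF assms] assms(2)]]) auto

lemma rot_inv:
  assumes "R A B" "i \<in> {1..\<rho>}"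
  shows "R (A(i := B i)) (B(i := \<lambda>j. - A i j))"
  by (rule R_eq[OF neg[OF rot[OF assms] assms(2)]]) auto

text \<open>The mixed twist adds \<open>B i + B (Suc i)\<close> to both rows of \<open>A\<close>;
  removing from each row the share of its own handle leaves the cross terms.\<close>

lemma add_bb_adj:
  assumes "R A B" "1 \<le> i" "i < \<rho>"
  shows "R (A(i := \<lambda>j. A i j + c * B (Suc i) j, Suc i := \<lambda>j. A (Suc i) j + c * B i j)) B"
proof -
  have i: "i \<in> {1..\<rho>}" "Suc i \<in> {1..\<rho>}" using assms by auto
  have nat: "R (A(i := \<lambda>j. A i j + int k * B (Suc i) j, Suc i := \<lambda>j. A (Suc i) j + int k * B i j)) B" for k
  proof (induction k)
    case (Suc k)
    note 1 = twist_mix[OF Suc assms(2,3)]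
    note 2 = add_b_to_a[OF 1 i(1), of "-1"]
    show ?case
      by (rule R_eq[OF add_b_to_a[OF 2 i(2), of "-1"]]) (auto simp: algebra_simps)
  qed (use assms in \<open>simp add: fun_upd_idem\<close>)
  show ?thesis
    by (rule R_cong[OF nat[of "nat (c mod expn)"]]) (auto intro: expn_dvd simp del: int_nat_eq)
qed

text \<open>Conjugating \<open>add_bb_adj\<close> by a quarter turn of handle \<open>k\<close>
  exchanges the roles of \<open>A k\<close> and \<open>B k\<close>. The result is an elementary
  change of basis of the rows of \<open>A\<close>, accompanied by the inverse transpose on the rows
  of \<open>B\<close>.\<close>

lemma transvect_adj:
  assumes "R A B" "i \<in> {1..\<rho>}" "k \<in> {1..\<rho>}" "k = Suc i \<or> i = Suc k"
  shows "R (A(i := \<lambda>j. A i j - c * A k j)) (B(k := \<lambda>j. B k j + c * B i j))"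
proof -
  note 1 = rot[OF assms(1,3)]
  from assms(4) show ?thesis
  proof
    assume k: "k = Suc i"
    then have "1 \<le> i" "i < \<rho>" using assms by auto
    note 2 = add_bb_adj[OF 1 this, of "- c"]
    show ?thesis
      by (rule R_eq[OF rot_inv[OF 2 assms(3)]]) (auto simp: k)
  next
    assume k: "i = Suc k"
    then have "1 \<le> k" "k < \<rho>" using assms by auto
    note 2 = add_bb_adj[OF 1 this, of "- c"]
    show ?thesis
      by (rule R_eq[OF rot_inv[OF 2 assms(3)]]) (auto simp: k)
  qed
qed

text \<open>Three elementary changes of basis give the exchange up to the sign of one handle, which
  \<open>neg\<close> corrects.\<close>

lemma swap_adj:
  assumes "R A B" "1 \<le> i" "i < \<rho>"
  shows "R (A(i := A (Suc i), Suc i := A i)) (B(i := B (Suc i), Suc i := B i))"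
proof -
  have i: "i \<in> {1..\<rho>}" "Suc i \<in> {1..\<rho>}" using assms by auto
  note 1 = transvect_adj[OF assms(1) i, of 1, simplified]
  note 2 = transvect_adj[OF 1 i(2,1), of "-1", simplified]
  note 3 = transvect_adj[OF 2 i, of 1, simplified]
  show ?thesis
    by (rule R_eq[OF neg[OF 3 i(1)]]) auto
qed

lemma swap_less:
  assumes "R A B" "1 \<le> i" "i < k" "k \<le> \<rho>"
  shows "R (A(i := A k, k := A i)) (B(i := B k, k := B i))"
  using assms
proof (induction "k - i" arbitrary: A B k)
  case 0
  then show ?case by simp
next
  case (Suc d)
  show ?case
  proof (cases "k = Suc i")
    case True
    then show ?thesis using swap_adj[OF Suc.prems(1,2)] Suc.prems by simp
  next
    case False
    define m where "m = k - 1"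
    have m: "k = Suc m" "1 \<le> m" "m < \<rho>" "d = m - i" "i < m" "m \<le> \<rho>" using Suc False by (auto simp: m_def)
    note 1 = swap_adj[OF Suc.prems(1) m(2,3)]
    note 2 = Suc.hyps(1)[OF m(4) 1 Suc.prems(2) m(5,6)]
    show ?thesis
      by (rule R_eq[OF swap_adj[OF 2 m(2,3)]]) (use m in auto)
  qed
qed

lemma swap:
  assumes "R A B" "i \<in> {1..\<rho>}" "k \<in> {1..\<rho>}"
  shows "R (A(i := A k, k := A i)) (B(i := B k, k := B i))"
proof -
  consider "i < k" | "k < i" | "i = k" by linarith
  then show ?thesis
  proof cases
    case 1
    then show ?thesis using swap_less assms by auto
  next
    case 2
    have "R (A(k := A i, i := A k)) (B(k := B i, i := B k))" using swap_less 2 assms by auto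
    then show ?thesis using 2 by (simp add: fun_upd_twist)
  next
    case 3
    then show ?thesis using assms by (simp add: fun_upd_idem)
  qed
qed

text \<open>Handle \<open>k\<close> is exchanged with a neighbour \<open>m\<close> of
  \<open>i\<close>, which exists since \<open>\<rho>\<close> is at least 2; then the adjacent move
  is applied and the exchange undone.\<close>

lemma transvect:
  assumes "R A B" "i \<in> {1..\<rho>}" "k \<in> {1..\<rho>}" "i \<noteq> k"
  shows "R (A(i := \<lambda>j. A i j - c * A k j)) (B(k := \<lambda>j. B k j + c * B i j))"
proof -
  define m where "m = (if i < \<rho> then Suc i else i - 1)"
  have m: "m \<in> {1..\<rho>}" "m = Suc i \<or> i = Suc m" "m \<noteq> i" using assms rho2 by (auto simp: m_def)
  note 1 = swap[OF assms(1,3) m(1)]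
  note 2 = transvect_adj[OF 1 assms(2) m(1,2), of c]
  show ?thesis
    by (rule R_eq[OF swap[OF 2 assms(3) m(1)]]) (use assms(4) m(3) in \<open>auto split: if_splits\<close>)
qed

lemma add_aa:
  assumes "R A B" "i \<in> {1..\<rho>}" "k \<in> {1..\<rho>}" "i \<noteq> k"
  shows "R A (B(i := \<lambda>j. B i j + c * A k j, k := \<lambda>j. B k j + c * A i j))"
proof -
  note 1 = rot[OF assms(1,2)]
  note 2 = transvect[OF 1 assms(2,3,4), of "c"]
  show ?thesis
    by (rule R_eq[OF rot_inv[OF 2 assms(2)]]) (use assms(4) in auto)
qed

end

text \<open>Division by gcd(a, b) reduces to coprime a', b'. Let \<open>c\<close> be the product of
  the primes of \<open>m\<close> that do not divide a'. A prime of \<open>m\<close> dividing a'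
  divides neither \<open>c\<close> nor b', and any other one divides \<open>c\<close> but not a', so
  a' + c b' is coprime to \<open>m\<close>.\<close>

lemma gcd_add_multiple_attained:
  fixes a b m :: int
  assumes "m > 0"
  shows "\<exists>c. gcd (a + c * b) m = gcd (gcd a b) m"
proof (cases "a = 0 \<and> b = 0")
  case False
  define g where "g = gcd a b"
  have g: "g \<noteq> 0" using False by (simp add: g_def)
  obtain a' b' where ab: "a = a' * g" "b = b' * g" "coprime a' b'"
    using gcd_coprime_exists[of a b] g unfolding g_def by blast
  define c where "c = \<Prod>{p. prime p \<and> p dvd m \<and> \<not> p dvd a'}"
  have fin: "finite {p. prime p \<and> p dvd m \<and> \<not> p dvd a'}"
    by (rule finite_subset[of _ "{p. p dvd m \<and> 0 \<le> p}"]) (use assms finite_divisors_int in \<open>auto simp: prime_ge_0_int intro: finite_subset[OF _ finite_divisors_int[of m]]\<close>)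
  have "coprime (a' + c * b') m"
  proof (rule ccontr)
    assume "\<not> coprime (a' + c * b') m"
    then have "\<not> is_unit (gcd (a' + c * b') m)" "gcd (a' + c * b') m \<noteq> 0"
      using assms by (auto simp: coprime_iff_gcd_eq_1)
    then obtain p where p: "prime p" "p dvd gcd (a' + c * b') m"
      using prime_divisor_exists by blast
    then have pm: "p dvd m" "p dvd a' + c * b'" by auto
    show False
    proof (cases "p dvd a'")
      case True
      then have "p dvd c * b'" using pm(2) by (simp add: dvd_add_right_iff)
      then have "p dvd c \<or> p dvd b'" using p(1) by (simp add: prime_dvd_mult_iff)
      moreover have "\<not> p dvd b'"
        using True ab(3) p(1) by (meson coprime_common_divisor not_prime_unit)
      moreover have "\<not> p dvd c"
      proof
        assume "p dvd c"
        then obtain q where q: "q \<in> {p. prime p \<and> p dvd m \<and> \<not> p dvd a'}" "p dvd q"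
          unfolding c_def using prime_dvd_prod_iff[OF fin p(1), of "\<lambda>x. x"] by auto
        then have "p = q" using p(1) primes_dvd_imp_eq by blast
        then show False using True q(1) by simp
      qed
      ultimately show False by blast
    next
      case False
      then have "p dvd c" unfolding c_def using p(1) pm(1) fin by (intro dvd_prodI) auto
      then have "p dvd c * b'" by simp
      then have "p dvd a'" using pm(2) by (simp add: dvd_add_left_iff)
      then show False using False by simp
    qed
  qed
  then have "gcd ((a' + c * b') * g) m = gcd g m"
    by (intro gcd_mult_left_left_cancel) (simp add: coprime_commute)
  then have "gcd (a + c * b) m = gcd g m"
    by (simp add: ab(1,2) algebra_simps)
  then show ?thesis unfolding g_def by blast
qed simp

section \<open>Normalising the images of the \<alpha>-generators\<close>

context matrix_orbit
begin

text \<open>After \<open>K\<close> steps the first \<open>K\<close> rows of \<open>A\<close> are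
  unit vectors with strictly upper triangular rows of \<open>B\<close>, and the other handles only
  involve the generators of \<open>G\<close> beyond \<open>K\<close>.\<close>

definition Inv :: "nat \<Rightarrow> (nat \<Rightarrow> nat \<Rightarrow> int) \<Rightarrow> (nat \<Rightarrow> nat \<Rightarrow> int) \<Rightarrow> bool" where
  "Inv K A B \<longleftrightarrow> (\<forall>i\<in>{1..\<rho>}. \<forall>j\<in>{1..r}.
     (i \<le> K \<longrightarrow> A i j = (if j = i then 1 else 0) \<and> (j \<le> i \<longrightarrow> B i j = 0)) \<and>
     (K < i \<longrightarrow> j \<le> K \<longrightarrow> A i j = 0 \<and> B i j = 0))"

lemma InvD:
  assumes "Inv K A B" "i \<in> {1..\<rho>}" "j \<in> {1..r}"
  shows "i \<le> K \<Longrightarrow> A i j = (if j = i then 1 else 0)" "i \<le> K \<Longrightarrow> j \<le> i \<Longrightarrow> B i j = 0"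
    "K < i \<Longrightarrow> j \<le> K \<Longrightarrow> A i j = 0" "K < i \<Longrightarrow> j \<le> K \<Longrightarrow> B i j = 0"
  using assms unfolding Inv_def by blast+

text \<open>Adding the handle \<open>i\<close> to the handle \<open>t\<close> changes \<open>\<eta>(\<alpha>\<^sub>i)\<close>, which an automorphism of the group
  repairs, and puts multiples of \<open>\<omega>\<^sub>l\<close> with \<open>l \<le> K\<close> into \<open>\<eta>(\<beta>\<^sub>t)\<close>, which are removed with the
  help of \<open>\<eta>(\<alpha>\<^sub>l) = \<omega>\<^sub>l\<close>.\<close>

lemma down:
  assumes R: "R A B" and I: "Inv K A B" and i: "1 \<le> i" "i < t" "t \<le> \<rho>" "i \<le> K" and K: "K \<le> r"
  shows "\<exists>B' \<gamma>. R A B' \<and> (\<forall>j\<in>{1..r}. B' t j = (if j \<le> min K t then 0 else B t j + c * B i j)) \<and>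
    (\<forall>p j. p \<noteq> t \<longrightarrow> B' p j = B p j + \<gamma> p * A t j) \<and> (\<forall>p. \<gamma> p \<noteq> 0 \<longrightarrow> p < t \<and> p \<le> K)"
proof -
  have it: "i \<in> {1..\<rho>}" "t \<in> {1..\<rho>}" "i \<in> {1..r}" using i K by auto
  \<comment> \<open>The automorphism adding \<open>c\<close> times \<open>A t\<close> to
    \<open>\<omega> i\<close> cancels the change of row \<open>A i\<close>. It also acts on each row
    \<open>B p\<close> with \<open>p < i\<close> through the coefficient \<open>B p i\<close>, which
    is what \<open>\<gamma>0\<close> records.\<close>
  define g where "g j = (if j = i then 0 else c * A t j)" for j
  define \<gamma>0 where "\<gamma>0 p = (if p < i then B p i * c else 0)" for p
  define B0 where "B0 p = (if p = t then (\<lambda>j. B t j + c * B i j) else (\<lambda>j. B p j + \<gamma>0 p * A t j))" for p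
  have Ati: "A t i = 0"
    using InvD[OF I it(2,3)] i by (cases "t \<le> K") auto
  have Bti: "B t i = 0" "B i i = 0"
    using InvD[OF I it(2,3)] InvD[OF I it(1,3)] i by (cases "t \<le> K"; auto)+
  note 1 = transvect[OF R it(1,2), of c]
  have "R (\<lambda>p. row_aut i 1 g ((A(i := \<lambda>j. A i j - c * A t j)) p)) (\<lambda>p. row_aut i 1 g ((B(t := \<lambda>j. B t j + c * B i j)) p))"
  proof (rule R_aut[OF 1 it(3)])
    fix j assume j: "j \<in> {1..r}"
    show "int (n j) dvd int (n i) * g j"
    proof (cases "j = i \<or> A t j = 0")
      case False
      then have "i < j" using InvD[OF I it(2) j] i by (cases "t \<le> K"; force)
      then have "n j dvd n i" using n_dvd[of i j] i j by auto
      then show ?thesis by (simp add: dvd_mult2)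
    qed (auto simp: g_def)
  qed (use i in \<open>auto simp: g_def\<close>)
  then have R0: "R A B0"
  proof (rule R_eq)
    fix p j assume p: "p \<in> {1..\<rho>}" and j: "j \<in> {1..r}"
    have "A p i = (if p = i then 1 else 0)"
      using InvD[OF I p it(3)] i by (cases "p \<le> K") auto
    moreover have "B p i = 0" if "i \<le> p"
      using InvD[OF I p it(3)] i that by (cases "p \<le> K") auto
    ultimately show "A p j = row_aut i 1 g ((A(i := \<lambda>j. A i j - c * A t j)) p) j \<and>
        B0 p j = row_aut i 1 g ((B(t := \<lambda>j. B t j + c * B i j)) p) j"
      using Ati Bti i by (auto simp: row_aut_def g_def B0_def \<gamma>0_def)
  qed
  have "\<exists>B' \<gamma>. R A B' \<and> (\<forall>j\<in>{1..r}. B' t j = (if j \<le> m then 0 else B t j + c * B i j)) \<and>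
    (\<forall>p j. p \<noteq> t \<longrightarrow> B' p j = B p j + \<gamma> p * A t j) \<and> (\<forall>p. \<gamma> p \<noteq> 0 \<longrightarrow> p < t \<and> p \<le> K)"
    if "i \<le> m" "m \<le> min K t" for m
    using that
  proof (induction m rule: dec_induct)
    case base
    have B0p: "B0 p j = B p j + \<gamma>0 p * A t j" if "p \<noteq> t" for p j
      using that by (simp add: B0_def)
    have "B0 t j = (if j \<le> i then 0 else B t j + c * B i j)" if j: "j \<in> {1..r}" for j
      using InvD[OF I it(1) j] InvD[OF I it(2) j] i by (cases "t \<le> K") (auto simp: B0_def)
    then show ?case
      using R0 i by (intro exI[of _ B0] exI[of _ \<gamma>0]) (auto simp: B0p \<gamma>0_def)
  next
    case (step m)
    then obtain B' \<gamma> where B'0: "R A B'" "\<forall>j\<in>{1..r}. B' t j = (if j \<le> m then 0 else B t j + c * B i j)"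
      "\<forall>p j. p \<noteq> t \<longrightarrow> B' p j = B p j + \<gamma> p * A t j" "\<forall>p. \<gamma> p \<noteq> 0 \<longrightarrow> p < t \<and> p \<le> K"
      by auto
    then have B': "R A B'" "\<And>j. j\<in>{1..r} \<Longrightarrow> B' t j = (if j \<le> m then 0 else B t j + c * B i j)"
      "\<And>p j. p \<noteq> t \<Longrightarrow> B' p j = B p j + \<gamma> p * A t j" "\<And>p. \<gamma> p \<noteq> 0 \<Longrightarrow> p < t \<and> p \<le> K"
      by blast+
    define l where "l = Suc m"
    define x where "x = B' t l"
    have l: "l \<le> K" "l \<le> t" "l \<in> {1..\<rho>}" "l \<in> {1..r}" using step i K by (auto simp: l_def)
    have Al: "A l j = (if j = l then 1 else 0)" if "j \<in> {1..r}" for j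
      using InvD(1)[OF I l(3) that l(1)] .
    show ?case
    proof (cases "l = t")
      case True
      note 2 = add_a_to_b[OF B'(1) it(2), of "- x"]
      have "B' t j + - x * A t j = (if j \<le> Suc m then 0 else B t j + c * B i j)" if j: "j \<in> {1..r}" for j
        using B'(2)[OF j] Al[OF j] True by (auto simp: l_def x_def le_Suc_eq)
      moreover define B'' where "B'' = B'(t := \<lambda>j. B' t j + - x * A t j)"
      ultimately have "R A B''" "\<And>j. j \<in> {1..r} \<Longrightarrow> B'' t j = (if j \<le> Suc m then 0 else B t j + c * B i j)"
        "\<And>p j. p \<noteq> t \<Longrightarrow> B'' p j = B p j + \<gamma> p * A t j"
        using 2 B'(3) by simp_all
      then show ?thesis
        using B'(4) by blast
    next
      case False
      \<comment> \<open>Adding a multiple of \<open>A l\<close> to row \<open>B t\<close> forces the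
        same multiple of \<open>A t\<close> onto row \<open>B l\<close>; this is absorbed in
        \<open>\<gamma>'\<close>.\<close>
      note 2 = add_aa[OF B'(1) it(2) l(3), of "- x"]
      have "B' t j + - x * A l j = (if j \<le> Suc m then 0 else B t j + c * B i j)" if j: "j \<in> {1..r}" for j
        using B'(2)[OF j] Al[OF j] by (auto simp: l_def x_def le_Suc_eq)
      moreover define B'' where "B'' = B'(t := \<lambda>j. B' t j + - x * A l j, l := \<lambda>j. B' l j + - x * A t j)"
      moreover define \<gamma>' where "\<gamma>' = \<gamma>(l := \<gamma> l - x)"
      ultimately have "R A B''" "\<And>j. j \<in> {1..r} \<Longrightarrow> B'' t j = (if j \<le> Suc m then 0 else B t j + c * B i j)"
        "\<And>p j. p \<noteq> t \<Longrightarrow> B'' p j = B p j + \<gamma>' p * A t j" "\<And>p. \<gamma>' p \<noteq> 0 \<Longrightarrow> p < t \<and> p \<le> K"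
        using 2 B'(3,4) l False by (simp_all add: algebra_simps split: if_splits)
      then show ?thesis by blast
    qed
  qed
  from this[of "min K t"] show ?thesis using i by simp
qed

text \<open>A row \<open>B p\<close> only receives multiples of \<open>A t\<close> when
  \<open>p < t\<close> and \<open>p \<le> K\<close>, and \<open>A t\<close> vanishes in the columns
  up to \<open>p\<close>, where \<open>B p\<close> has to be zero.\<close>

lemma down_Inv:
  assumes I: "Inv K A B" and t: "t \<in> {1..\<rho>}"
    and B't: "\<forall>j\<in>{1..r}. B' t j = (if j \<le> min K t then 0 else B t j + c * B i j)"
    and B'p: "\<forall>p j. p \<noteq> t \<longrightarrow> B' p j = B p j + \<gamma> p * A t j" and \<gamma>: "\<forall>p. \<gamma> p \<noteq> 0 \<longrightarrow> p < t \<and> p \<le> K"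
  shows "Inv K A B'"
  unfolding Inv_def
proof (intro ballI)
  fix p j assume p: "p \<in> {1..\<rho>}" and j: "j \<in> {1..r}"
  note Ip = InvD[OF I p j] and It = InvD[OF I t j]
  have "B' p j = 0" if "p \<le> K \<and> j \<le> p \<or> K < p \<and> j \<le> K"
  proof (cases "p = t")
    case True
    then show ?thesis using B't j that by auto
  next
    case False
    have "B p j = 0" using Ip that by auto
    moreover have "\<gamma> p * A t j = 0"
    proof (cases "\<gamma> p = 0")
      case False
      then have "p < t" "p \<le> K" using \<gamma> by auto
      then have "A t j = 0" using It that by (cases "t \<le> K") auto
      then show ?thesis by simp
    qed simp
    ultimately show ?thesis using B'p False by simp
  qed
  then show "(p \<le> K \<longrightarrow> A p j = (if j = p then 1 else 0) \<and> (j \<le> p \<longrightarrow> B' p j = 0)) \<and>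
      (K < p \<longrightarrow> j \<le> K \<longrightarrow> A p j = 0 \<and> B' p j = 0)"
    using Ip by auto
qed


lemma R_col_rep:
  assumes "R A B" "t \<in> {1..r}"
  shows "\<exists>A'. R A' B \<and> A' s t > 0 \<and> (\<forall>i j. (i, j) \<noteq> (s, t) \<longrightarrow> A' i j = A i j)"
proof -
  define x where "x = A s t mod int (n t) + int (n t)"
  have nt: "int (n t) > 0" using n_gt1[OF assms(2)] by simp
  have "int (n t) dvd x - A s t"
    by (simp add: x_def mod_eq_dvd_iff[symmetric])
  then have "R (A(s := (A s)(t := x))) B"
    by (intro R_cong[OF assms(1)]) auto
  moreover have "x > 0" using nt pos_mod_sign[OF nt, of "A s t"] unfolding x_def by linarith
  ultimately show ?thesis by (intro exI[of _ "A(s := (A s)(t := x))"]) auto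
qed

text \<open>Let \<open>d\<close> be the least positive entry at \<open>(t, t)\<close>, where
  \<open>t = Suc K\<close>, that occurs in the orbit under the invariant. A nonzero remainder modulo
  \<open>d\<close> that can be moved to this place would be smaller, so \<open>d\<close> divides the
  whole column and \<open>n t\<close>, and \<open>col\<close> makes it a unit.\<close>

lemma phase1_unit:
  assumes R: "R A B" and I: "Inv K A B" and K: "K < \<rho>" "K < r"
  shows "\<exists>A B. R A B \<and> Inv K A B \<and> A (Suc K) (Suc K) = 1"
proof -
  define t where "t = Suc K"
  have t: "t \<in> {1..\<rho>}" "t \<in> {1..r}" "K < t" using K by (auto simp: t_def)
  define P where "P d \<longleftrightarrow> d > 0 \<and> (\<exists>A B. R A B \<and> Inv K A B \<and> A t t = int d)" for d :: nat
  have "\<exists>d. P d"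
  proof -
    obtain A' where A': "R A' B" "A' t t > 0" "\<And>i j. (i, j) \<noteq> (t, t) \<Longrightarrow> A' i j = A i j"
      using R_col_rep[OF R t(2), of t] by blast
    have "Inv K A' B"
      unfolding Inv_def
    proof (intro ballI)
      fix i j assume i: "i \<in> {1..\<rho>}" and j: "j \<in> {1..r}"
      show "(i \<le> K \<longrightarrow> A' i j = (if j = i then 1 else 0) \<and> (j \<le> i \<longrightarrow> B i j = 0)) \<and>
          (K < i \<longrightarrow> j \<le> K \<longrightarrow> A' i j = 0 \<and> B i j = 0)"
        using InvD[OF I i j] A'(3)[of i j] t(3) by (cases "(i, j) = (t, t)") auto
    qed
    then have "R A' B \<and> Inv K A' B \<and> A' t t = int (nat (A' t t))" "nat (A' t t) > 0" using A'(1,2) by auto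
    then show ?thesis unfolding P_def by blast
  qed
  then obtain d where d: "P d" and min: "\<And>e. P e \<Longrightarrow> d \<le> e"
    by (metis LeastI Least_le)
  have d0: "d > 0" using d by (simp add: P_def)
  have rem: "int d dvd x" if "\<And>y. 0 < y \<Longrightarrow> y < int d \<Longrightarrow> y = x mod int d \<Longrightarrow> \<exists>A B. R A B \<and> Inv K A B \<and> A t t = y" for x
  proof (rule ccontr)
    assume "\<not> int d dvd x"
    then have "x mod int d \<noteq> 0" by (simp add: mod_eq_0_iff_dvd)
    moreover have "0 \<le> x mod int d" "x mod int d < int d" using d0 by simp_all
    ultimately have y: "0 < x mod int d" "x mod int d < int d" by linarith+
    then have "P (nat (x mod int d))"
      using that[OF y refl] by (simp add: P_def)
    then have "d \<le> nat (x mod int d)" by (rule min)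
    then show False using y by linarith
  qed
  have key1: "int d dvd B t t" if R: "R A B" and I: "Inv K A B" and A: "A t t = int d" for A B
  proof (rule rem)
    fix y assume y: "y = B t t mod int d"
    define q where "q = - (B t t div int d)"
    note 1 = add_a_to_b[OF R t(1), of q]
    note 2 = rot_inv[OF 1 t(1)]
    show "\<exists>A B. R A B \<and> Inv K A B \<and> A t t = y"
    proof (intro exI conjI, rule 2)
      show "Inv K (A(t := (B(t := \<lambda>j. B t j + q * A t j)) t)) ((B(t := \<lambda>j. B t j + q * A t j))(t := \<lambda>j. - A t j))"
        using I t(3) unfolding Inv_def by auto
    qed (simp add: y q_def A minus_mult_div_eq_mod mult.commute)
  qed
  have key2: "int d dvd A i t" if R: "R A B" and I: "Inv K A B" and A: "A t t = int d" and i: "i \<in> {1..\<rho>}" "t < i" for A B i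
  proof (rule rem)
    fix y assume y: "y = A i t mod int d"
    define q where "q = A i t div int d"
    have it: "i \<noteq> t" using i by simp
    note 1 = transvect[OF R i(1) t(1) it, of q]
    note 2 = swap[OF 1 t(1) i(1)]
    show "\<exists>A B. R A B \<and> Inv K A B \<and> A t t = y"
    proof (intro exI conjI, rule 2)
      show "Inv K ((A(i := \<lambda>j. A i j - q * A t j))(t := (A(i := \<lambda>j. A i j - q * A t j)) i, i := (A(i := \<lambda>j. A i j - q * A t j)) t))
          ((B(t := \<lambda>j. B t j + q * B i j))(t := (B(t := \<lambda>j. B t j + q * B i j)) i, i := (B(t := \<lambda>j. B t j + q * B i j)) t))"
        using I t i unfolding Inv_def by auto
    qed (use it in \<open>simp add: y q_def A minus_mult_div_eq_mod mult.commute\<close>)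
  qed
  have key3: "int d dvd B i t" if R: "R A B" and I: "Inv K A B" and A: "A t t = int d" and i: "i \<in> {1..\<rho>}" "t < i" for A B i
  proof -
    note 1 = rot[OF R i(1)]
    have "Inv K (A(i := \<lambda>j. - B i j)) (B(i := A i))"
      using I t i unfolding Inv_def by auto
    from key2[OF 1 this _ i] show ?thesis using A i by simp
  qed
  have key4: "int d dvd B i t" if R: "R A B" and I: "Inv K A B" and A: "A t t = int d" and i: "i \<in> {1..K}" for A B i
  proof -
    have "1 \<le> i" "i < t" "t \<le> \<rho>" "i \<le> K" "K \<le> r" using i t K by auto
    \<comment> \<open>Exchanging a finished row with row \<open>t\<close> would destroy the
      invariant; instead \<open>B i\<close> is added to \<open>B t\<close>, and the result for the
      handle \<open>t\<close> itself applies before and after.\<close>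
    from down[OF R I this, of 1] obtain B' \<gamma> where B': "R A B'" "\<forall>j\<in>{1..r}. B' t j = (if j \<le> min K t then 0 else B t j + 1 * B i j)"
      "\<forall>p j. p \<noteq> t \<longrightarrow> B' p j = B p j + \<gamma> p * A t j" "\<forall>p. \<gamma> p \<noteq> 0 \<longrightarrow> p < t \<and> p \<le> K" by blast
    have "int d dvd B' t t"
      by (rule key1[OF B'(1) down_Inv[OF I t(1) B'(2-4)] A])
    moreover have "B' t t = B t t + B i t" using B'(2) t by auto
    ultimately show ?thesis using key1[OF R I A] by (simp add: dvd_add_right_iff)
  qed
  obtain A B where AB: "R A B" "Inv K A B" "A t t = int d" using d unfolding P_def by blast
  \<comment> \<open>Entries matter only modulo \<open>n t\<close>: the divisibility holds both for
    \<open>B t t\<close> and for \<open>B t t + n t\<close>.\<close>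
  have "int d dvd int (n t)"
  proof -
    have R': "R A (B(t := (B t)(t := B t t + int (n t))))"
      by (rule R_cong[OF AB(1)]) auto
    have I': "Inv K A (B(t := (B t)(t := B t t + int (n t))))"
      unfolding Inv_def
    proof (intro ballI)
      fix i j assume i: "i \<in> {1..\<rho>}" and j: "j \<in> {1..r}"
      show "(i \<le> K \<longrightarrow> A i j = (if j = i then 1 else 0) \<and> (j \<le> i \<longrightarrow> (B(t := (B t)(t := B t t + int (n t)))) i j = 0)) \<and>
          (K < i \<longrightarrow> j \<le> K \<longrightarrow> A i j = 0 \<and> (B(t := (B t)(t := B t t + int (n t)))) i j = 0)"
        using InvD[OF AB(2) i j] t(3) by auto
    qed
    have "int d dvd B t t + int (n t)"
      using key1[OF R' I' AB(3)] by simp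
    then show ?thesis using key1[OF AB] by (simp add: dvd_add_right_iff)
  qed
  then have "is_unit (int d)"
  proof (rule col[OF AB(1) t(2)])
    fix i assume i: "i \<in> {1..\<rho>}"
    consider "i \<le> K" | "i = t" | "t < i" using t_def by linarith
    then show "int d dvd A i t \<and> int d dvd B i t"
    proof cases
      case 1
      then show ?thesis
        using InvD(1)[OF AB(2) i t(2)] key4[OF AB, of i] i t(3) by auto
    qed (use AB key1 key2 key3 i in auto)
  qed
  then have "d = 1" using d0 by simp
  then show ?thesis using AB by (auto simp: t_def)
qed

text \<open>With the unit in place, column \<open>t\<close> is cleared in the later handles,
  \<open>A t\<close> clears \<open>B t t\<close>, and an automorphism of the group turns the rest of
  \<open>A t\<close> into the unit vector.\<close>

lemma phase1_step:
  assumes R: "R A B" and I: "Inv K A B" and K: "K < \<rho>" "K < r"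
  shows "\<exists>A B. R A B \<and> Inv (Suc K) A B"
proof -
  define t where "t = Suc K"
  have t: "t \<in> {1..\<rho>}" "t \<in> {1..r}" "K < t" using K by (auto simp: t_def)
  obtain A B where AB: "R A B" "Inv K A B" "A t t = 1"
    using phase1_unit[OF assms] unfolding t_def by blast
  have "\<exists>A B. R A B \<and> Inv K A B \<and> A t t = 1 \<and> (\<forall>i\<in>{1..\<rho>}. t < i \<and> i \<le> m \<longrightarrow> A i t = 0 \<and> B i t = 0)" if "m \<le> \<rho>" for m
    using that
  proof (induction m)
    case 0
    then show ?case using AB by auto
  next
    case (Suc m)
    then obtain A B where AB: "R A B" "Inv K A B" "A t t = 1" "\<And>i. i \<in> {1..\<rho>} \<Longrightarrow> t < i \<Longrightarrow> i \<le> m \<Longrightarrow> A i t = 0 \<and> B i t = 0"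
      by auto
    show ?case
    proof (cases "t < Suc m")
      case False
      then show ?thesis using AB by (intro exI[of _ A] exI[of _ B]) auto
    next
      case True
      define i where "i = Suc m"
      have i: "i \<in> {1..\<rho>}" "t < i" "i \<noteq> t" "t \<noteq> i" using True Suc.prems by (auto simp: i_def)
      define A' where "A' = A(i := \<lambda>j. A i j - A i t * A t j)"
      define B' where "B' = B(t := \<lambda>j. B t j + A i t * B i j)"
      have 1: "R A' B'" unfolding A'_def B'_def by (rule transvect[OF AB(1) i(1) t(1) i(3)])
      define B'' where "B'' = B'(i := \<lambda>j. B' i j + - B i t * A' t j, t := \<lambda>j. B' t j + - B i t * A' i j)"
      have 2: "R A' B''" unfolding B''_def by (rule add_aa[OF 1 i(1) t(1) i(3)])
      have "Inv K A' B''"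
        unfolding Inv_def
      proof (intro ballI)
        fix k j assume k: "k \<in> {1..\<rho>}" and j: "j \<in> {1..r}"
        have z: "A i j = 0 \<and> B i j = 0 \<and> A t j = 0 \<and> B t j = 0" if "j \<le> K"
          using InvD(3,4)[OF AB(2) i(1) j] InvD(3,4)[OF AB(2) t(1) j] t(3) i(2) that by auto
        show "(k \<le> K \<longrightarrow> A' k j = (if j = k then 1 else 0) \<and> (j \<le> k \<longrightarrow> B'' k j = 0)) \<and>
          (K < k \<longrightarrow> j \<le> K \<longrightarrow> A' k j = 0 \<and> B'' k j = 0)"
          using InvD[OF AB(2) k j] z t(3) i(2)
          by (cases "k = i"; cases "k = t") (auto simp: A'_def B''_def B'_def)
      qed
      moreover have "A' t t = 1" using i AB(3) by (simp add: A'_def)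
      moreover have "A' k t = 0 \<and> B'' k t = 0" if "k \<in> {1..\<rho>}" "t < k" "k \<le> Suc m" for k
        using AB(3) AB(4)[of k] that i by (cases "k = i") (auto simp: A'_def B''_def B'_def i_def)
      ultimately show ?thesis using 2 by blast
    qed
  qed
  from this[of \<rho>] obtain A B where AB: "R A B" "Inv K A B" "A t t = 1"
    "\<And>i. i \<in> {1..\<rho>} \<Longrightarrow> t < i \<Longrightarrow> A i t = 0 \<and> B i t = 0" by auto
  define B' where "B' = B(t := \<lambda>j. B t j + - B t t * A t j)"
  have R': "R A B'" unfolding B'_def by (rule add_a_to_b[OF AB(1) t(1)])
  have I': "Inv K A B'" using AB(2) t unfolding Inv_def B'_def by auto
  have Bt: "B' i t = 0" if "i \<in> {1..\<rho>}" "t \<le> i" for i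
    using AB(3,4) that by (cases "i = t") (auto simp: B'_def)
  \<comment> \<open>Sends \<open>\<omega> t\<close> to itself minus the remaining part of
    \<open>A t\<close>. Only later generators occur there, and their orders divide
    \<open>n t\<close>.\<close>
  define g where "g j = (if j = t then 0 else - A t j)" for j
  have "R (\<lambda>i. row_aut t 1 g (A i)) (\<lambda>i. row_aut t 1 g (B' i))"
  proof (rule R_aut[OF R' t(2)])
    fix j assume j: "j \<in> {1..r}"
    show "int (n j) dvd int (n t) * g j"
    proof (cases "j = t \<or> A t j = 0")
      case False
      then have "\<not> j \<le> K" "j \<noteq> Suc K" using InvD(3)[OF AB(2) t(1) j t(3)] by (auto simp: t_def)
      then have "t < j" by (simp add: t_def)
      then have "n j dvd n t" using n_dvd[of t j] t j by auto
      then show ?thesis by (simp add: dvd_mult2)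
    qed (auto simp: g_def)
  qed (auto simp: g_def)
  moreover have "Inv t (\<lambda>i. row_aut t 1 g (A i)) (\<lambda>i. row_aut t 1 g (B' i))"
    unfolding Inv_def
  proof (intro ballI)
    fix i j assume i: "i \<in> {1..\<rho>}" and j: "j \<in> {1..r}"
    have g0: "g j = 0" if "j \<le> t" using InvD(3)[OF AB(2) t(1) j t(3)] that by (auto simp: g_def t_def le_Suc_eq)
    consider "i \<le> K" | "i = t" | "t < i" using t_def by linarith
    then show "(i \<le> t \<longrightarrow> row_aut t 1 g (A i) j = (if j = i then 1 else 0) \<and> (j \<le> i \<longrightarrow> row_aut t 1 g (B' i) j = 0)) \<and>
          (t < i \<longrightarrow> j \<le> t \<longrightarrow> row_aut t 1 g (A i) j = 0 \<and> row_aut t 1 g (B' i) j = 0)"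
    proof cases
      case 1
      then show ?thesis
        using InvD(1)[OF AB(2) i j] InvD(1)[OF AB(2) i t(2)] InvD(2)[OF I' i j] g0 t(3) by (auto simp: row_aut_def)
    next
      case 2
      then show ?thesis
        using InvD(4)[OF I' i j] Bt[OF i] AB(3) t(3) by (auto simp: row_aut_def g_def t_def le_Suc_eq)
    next
      case 3
      then show ?thesis
        using InvD(3)[OF AB(2) i j] InvD(4)[OF I' i j] Bt[OF i] AB(4)[OF i] t(3) by (auto simp: row_aut_def t_def le_Suc_eq)
    qed
  qed
  ultimately show ?thesis unfolding t_def by blast
qed

lemma phase1:
  assumes "R A B" "K \<le> \<rho>" "K \<le> r"
  shows "\<exists>A B. R A B \<and> Inv K A B"
  using assms(2,3)
proof (induction K)
  case 0
  then show ?case using assms(1) by (auto simp: Inv_def)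
next
  case (Suc K)
  then show ?case using phase1_step by (metis Suc_le_lessD Suc_leD)
qed

section \<open>Pivots in the images of the \<beta>-generators for large rank\<close>

text \<open>In the rows \<open>i > 2\<rho> - r\<close> the pivot of \<open>\<eta>(\<beta>\<^sub>i)\<close> sits in the column \<open>2\<rho> - i + 1\<close>.\<close>

definition pivoted :: "nat \<Rightarrow> (nat \<Rightarrow> nat \<Rightarrow> int) \<Rightarrow> bool" where
  "pivoted i B \<longleftrightarrow> (\<forall>k\<in>{i..\<rho>}. B k (2 * \<rho> - k + 1) = 1 \<and> (\<forall>j\<in>{1..r}. 2 * \<rho> - k + 1 < j \<longrightarrow> B k j = 0) \<and>
     (\<forall>j\<in>{k+1..2*\<rho>-k}. B k j = 0 \<or> \<not> int (n j) dvd B k j * int (n r)))"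

text \<open>In the pivot column \<open>l\<close> the least value \<open>d\<close> of the gcd of
  \<open>B i l\<close> and \<open>n l\<close> over the orbit is considered. The rows of
  \<open>A\<close> vanish there as \<open>l > \<rho>\<close>, the lower rows of \<open>B\<close>
  because their pivots lie further left, and the upper rows of \<open>B\<close> are multiples of
  \<open>d\<close> by minimality. So \<open>d = 1\<close> by \<open>col\<close>, and an automorphism
  makes the pivot 1.\<close>

lemma phase2_step:
  assumes R: "R A B" and I: "Inv \<rho> A B" and S: "pivoted (Suc i) B" and i: "2 * \<rho> - r < i" "i \<le> \<rho>" and r: "\<rho> < r" "r \<le> 2 * \<rho>"
  shows "\<exists>A B. R A B \<and> Inv \<rho> A B \<and> pivoted i B"
proof -
  define l where "l = 2 * \<rho> - i + 1"
  have l: "l \<in> {1..r}" "\<rho> < l" using i r by (auto simp: l_def)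
  have ir: "i \<in> {1..\<rho>}" "i \<in> {1..r}" using i r by auto
  have nl: "int (n l) > 0" using n_gt1[OF l(1)] by simp
  define P where "P d \<longleftrightarrow> (\<exists>A B. R A B \<and> Inv \<rho> A B \<and> pivoted (Suc i) B \<and> gcd (B i l) (int (n l)) = int d)" for d
  have Pn: "P (nat (gcd (B i l) (int (n l))))" if "R A B" "Inv \<rho> A B" "pivoted (Suc i) B" for A B
  proof -
    have "R A B \<and> Inv \<rho> A B \<and> pivoted (Suc i) B \<and> gcd (B i l) (int (n l)) = int (nat (gcd (B i l) (int (n l))))"
      using that by simp
    then show ?thesis unfolding P_def by blast
  qed
  from Pn[OF R I S] obtain d where d: "P d" and min: "\<And>e. P e \<Longrightarrow> d \<le> e"
    by (metis LeastI Least_le)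
  obtain A B where AB: "R A B" "Inv \<rho> A B" "pivoted (Suc i) B" "gcd (B i l) (int (n l)) = int d"
    using d unfolding P_def by blast
  have d0: "d > 0" using AB(4) nl by (metis gcd_pos_int of_nat_0_less_iff less_irrefl)
  have above: "int d dvd B k l" if k: "1 \<le> k" "k < i" for k
  proof -
    \<comment> \<open>One multiple of \<open>B k\<close> added to \<open>B i\<close> already attains
      the gcd of both entries with the modulus, so the minimality of \<open>d\<close> applies to
      that gcd.\<close>
    obtain c where c: "gcd (B i l + c * B k l) (int (n l)) = gcd (gcd (B i l) (B k l)) (int (n l))"
      using gcd_add_multiple_attained[OF nl] by blast
    have "k \<le> \<rho>" "\<rho> \<le> r" using k i r by auto
    from down[OF AB(1,2) k i(2) this, of c] obtain B' \<gamma> where B': "R A B'"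
      "\<forall>j\<in>{1..r}. B' i j = (if j \<le> min \<rho> i then 0 else B i j + c * B k j)"
      "\<forall>p j. p \<noteq> i \<longrightarrow> B' p j = B p j + \<gamma> p * A i j" "\<forall>p. \<gamma> p \<noteq> 0 \<longrightarrow> p < i \<and> p \<le> \<rho>" by blast
    have "Inv \<rho> A B'" by (rule down_Inv[OF AB(2) ir(1) B'(2-4)])
    moreover have "B' p j = B p j" if "i < p" for p j
      using B'(3,4) that by (metis add.right_neutral less_not_sym mult_zero_left nat_neq_iff)
    then have "pivoted (Suc i) B'" using AB(3) by (simp add: pivoted_def)
    ultimately have "P (nat (gcd (B' i l) (int (n l))))" using Pn B'(1) by blast
    moreover have "B' i l = B i l + c * B k l" using B'(2) l i by auto
    ultimately have "P (nat (gcd (gcd (B i l) (B k l)) (int (n l))))" using c by simp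
    then have "d \<le> nat (gcd (gcd (B i l) (B k l)) (int (n l)))" by (rule min)
    then have "int d \<le> gcd (gcd (B i l) (B k l)) (int (n l))" by (simp add: le_nat_iff)
    moreover have "gcd (gcd (B i l) (B k l)) (int (n l)) = gcd (int d) (B k l)"
      using AB(4) by (metis gcd.assoc gcd.commute)
    ultimately have "int d \<le> gcd (int d) (B k l)" by simp
    moreover have "gcd (int d) (B k l) \<le> int d" using d0 by (intro zdvd_imp_le) auto
    ultimately have "gcd (int d) (B k l) = int d" by linarith
    then show ?thesis by (metis gcd_dvd2)
  qed
  have below: "B k l = 0" if "k \<in> {1..\<rho>}" "i < k" for k
    using AB(3) that l i by (auto simp: pivoted_def l_def)
  have Al: "A k l = 0" if "k \<in> {1..\<rho>}" for k
    using InvD(1)[OF AB(2) that l(1)] that l(2) by auto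
  have "is_unit (int d)"
  proof (rule col[OF AB(1) l(1)])
    show "int d dvd int (n l)" using AB(4) by (metis gcd_dvd2)
    fix k assume k: "k \<in> {1..\<rho>}"
    consider "k < i" | "k = i" | "i < k" by linarith
    then show "int d dvd A k l \<and> int d dvd B k l"
    proof cases
      case 1
      then show ?thesis using above Al k by auto
    next
      case 2
      then show ?thesis using AB(4) Al[OF k] by (metis dvd_0_right gcd_dvd1)
    qed (use below Al k in auto)
  qed
  then have cop: "coprime (B i l) (int (n l))"
    using AB(4) d0 by (simp add: coprime_iff_gcd_eq_1)
  obtain u v where uv: "u * B i l + v * int (n l) = 1"
    using bezout_int[of "B i l" "int (n l)"] cop by (auto simp: coprime_iff_gcd_eq_1)
  have u: "int (n l) dvd u * B i l - 1" using uv by (auto simp: algebra_simps intro: dvdI[of _ _ "- v"])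
  have copu: "coprime u (int (n l))"
  proof (rule coprimeI)
    fix c assume "c dvd u" "c dvd int (n l)"
    then have "c dvd u * B i l + v * int (n l)" by (simp add: dvd_mult2)
    then show "is_unit c" using uv by simp
  qed
  \<comment> \<open>The entries to be removed: those right of the pivot, and those for which
    \<open>B i j\<close> times \<open>\<omega> j\<close> has order dividing \<open>n r\<close>. In
    both cases \<open>n j\<close> divides \<open>n l * B i j\<close>, which makes the automorphism
    well defined.\<close>
  define bad where "bad j \<longleftrightarrow> l < j \<or> (i < j \<and> j < l \<and> int (n j) dvd B i j * int (n r))" for j
  define g where "g j = (if bad j then - u * B i j else 0)" for j
  have nr: "n r dvd n l" using n_dvd[of l r] l by auto
  have gdvd: "int (n j) dvd int (n l) * (if bad j then B i j else 0)" if j: "j \<in> {1..r}" for j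
  proof (cases "l < j")
    case True
    then have "n j dvd n l" using n_dvd[of l j] l j by auto
    then show ?thesis by (simp add: dvd_mult2)
  next
    case False
    then show ?thesis
    proof (cases "bad j")
      case True
      then have "int (n j) dvd B i j * int (n r)" using False by (simp add: bad_def)
      then have "int (n j) dvd B i j * int (n l)" using nr by (meson dvd_trans int_dvd_int_iff mult_dvd_mono dvd_refl)
      then show ?thesis using True by (simp add: mult.commute)
    qed simp
  qed
  have R1: "R (\<lambda>k. row_aut l u g (A k)) (\<lambda>k. row_aut l u g (B k))"
  proof (rule R_aut[OF AB(1) l(1) copu])
    show "g l = 0" by (simp add: g_def bad_def)
    fix j assume j: "j \<in> {1..r}"
    have "int (n l) * g j = - u * (int (n l) * (if bad j then B i j else 0))" by (simp add: g_def)
    then show "int (n j) dvd int (n l) * g j" using gdvd[OF j] by (metis dvd_mult)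
  qed
  \<comment> \<open>Up to the orders, row \<open>i\<close> becomes exactly this under the
    automorphism; the rows below are unchanged because they vanish in column
    \<open>l\<close>.\<close>
  define B' where "B' k = (if k = i then (\<lambda>j. if j = l then 1 else if bad j then 0 else B i j) else row_aut l u g (B k))" for k
  have R2: "R A B'"
  proof (rule R_cong[OF R1])
    fix k j assume k: "k \<in> {1..\<rho>}" and j: "j \<in> {1..r}"
    have "int (n j) dvd B' k j - row_aut l u g (B k) j"
    proof (cases "k = i")
      case True
      consider "j = l" | "j \<noteq> l" "bad j" | "j \<noteq> l" "\<not> bad j" by blast
      then show ?thesis
      proof cases
        case 1
        then show ?thesis using u True by (simp add: B'_def row_aut_def dvd_diff_commute)
      next
        case 2
        have "int (n j) dvd (u * B i l - 1) * B i j"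
        proof -
          have "int (n l) * B i j dvd (u * B i l - 1) * B i j" using u by (intro mult_dvd_mono) auto
          then show ?thesis using gdvd[OF j] 2 by (auto intro: dvd_trans)
        qed
        then show ?thesis using 2 True by (simp add: B'_def row_aut_def g_def algebra_simps)
      qed (simp add: B'_def row_aut_def g_def True)
    qed (simp add: B'_def)
    moreover have "A k j = row_aut l u g (A k) j" using Al[OF k] by (auto simp: row_aut_def)
    ultimately show "int (n j) dvd A k j - row_aut l u g (A k) j \<and> int (n j) dvd B' k j - row_aut l u g (B k) j" by simp
  qed
  have B'p: "B' k = B k" if "k \<in> {1..\<rho>}" "i < k" for k
    using below[OF that] that by (auto simp: B'_def row_aut_def)
  have "Inv \<rho> A B'"
    unfolding Inv_def
  proof (intro ballI)
    fix k j assume k: "k \<in> {1..\<rho>}" and j: "j \<in> {1..r}"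
    have "B' k j = 0" if "j \<le> k"
    proof -
      have "j \<noteq> l" "B k j = 0" using that k l(2) InvD(2)[OF AB(2) k j] by auto
      moreover have "g j = 0" if "k \<le> i" using that \<open>j \<le> k\<close> l(2) i(2) by (auto simp: g_def bad_def)
      ultimately show ?thesis
        using B'p[OF k] k by (cases "k = i"; cases "k < i") (auto simp: B'_def row_aut_def)
    qed
    then show "(k \<le> \<rho> \<longrightarrow> A k j = (if j = k then 1 else 0) \<and> (j \<le> k \<longrightarrow> B' k j = 0)) \<and>
          (\<rho> < k \<longrightarrow> j \<le> \<rho> \<longrightarrow> A k j = 0 \<and> B' k j = 0)"
      using InvD(1)[OF AB(2) k j] k by auto
  qed
  moreover have "pivoted i B'"
    unfolding pivoted_def
  proof
    fix k assume k: "k \<in> {i..\<rho>}"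
    show "B' k (2 * \<rho> - k + 1) = 1 \<and> (\<forall>j\<in>{1..r}. 2 * \<rho> - k + 1 < j \<longrightarrow> B' k j = 0) \<and>
     (\<forall>j\<in>{k+1..2*\<rho>-k}. B' k j = 0 \<or> \<not> int (n j) dvd B' k j * int (n r))"
    proof (cases "k = i")
      case True
      then show ?thesis by (auto simp: B'_def l_def bad_def)
    next
      case False
      then have "B' k = B k" using B'p[of k] k ir by auto
      then show ?thesis using AB(3) k False by (simp add: pivoted_def)
    qed
  qed
  ultimately show ?thesis using R2 by blast
qed

lemma phase2:
  assumes "R A B" "\<rho> < r" "r \<le> 2 * \<rho>"
  shows "\<exists>A B. R A B \<and> Inv \<rho> A B \<and> pivoted (2 * \<rho> - r + 1) B"
proof -
  \<comment> \<open>The rows are treated upwards from \<rho>, since the step for a row uses the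
    zeros of the lower rows in its pivot column.\<close>
  have "\<exists>A B. R A B \<and> Inv \<rho> A B \<and> pivoted (Suc \<rho> - m) B" if "m \<le> r - \<rho>" for m
    using that
  proof (induction m)
    case 0
    have "\<rho> \<le> \<rho>" "\<rho> \<le> r" using assms by auto
    then show ?case using phase1[OF assms(1)] by (fastforce simp: pivoted_def)
  next
    case (Suc m)
    then obtain A B where AB: "R A B" "Inv \<rho> A B" "pivoted (Suc (\<rho> - m)) B"
      using assms by (auto simp: Suc_diff_le)
    have "2 * \<rho> - r < \<rho> - m" "\<rho> - m \<le> \<rho>" using Suc.prems assms by auto
    from phase2_step[OF AB this assms(2,3)] show ?case by simp
  qed
  from this[of "r - \<rho>"] show ?thesis using assms by (auto simp: numeral_2_eq_2 Suc_diff_le)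
qed


section \<open>The last column and the superdiagonal\<close>

text \<open>The gcd with \<open>n r\<close> generates the same subgroup of the last cyclic factor as
  \<open>B (i + 1) r\<close>, so this is the required inclusion of subgroups, in column
  \<open>r\<close> only.\<close>

definition chain :: "nat \<Rightarrow> (nat \<Rightarrow> nat \<Rightarrow> int) \<Rightarrow> bool" where
  "chain q B \<longleftrightarrow> (\<forall>i. 1 \<le> i \<and> i < q \<longrightarrow> gcd (B (i + 1) r) (int (n r)) dvd B i r)"

text \<open>The entry is only required to be congruent to 1; the representative 1 itself is chosen
  at the end in \<open>normal_coeff\<close>.\<close>

definition superdiagonal :: "nat \<Rightarrow> (nat \<Rightarrow> nat \<Rightarrow> int) \<Rightarrow> bool" where
  "superdiagonal q B \<longleftrightarrow> (\<forall>i. 1 \<le> i \<and> i < q \<longrightarrow>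
     gcd (int (n (i + 1))) (B i (i + 1)) > 1 \<or> int (n (i + 1)) dvd B i (i + 1) - 1)"

text \<open>Going down the rows, a multiple of row \<open>m\<close> is added to row
  \<open>t = Suc m\<close> so that the last entry of row \<open>t\<close> attains the gcd with that
  of row \<open>m\<close>, and hence divides it modulo \<open>n r\<close>. In the last column the
  other rows keep their values, because \<open>A t r = 0\<close> for \<open>t < r\<close>.\<close>

lemma make_chain:
  assumes R: "R A B" and I: "Inv K A B" and K: "K \<le> \<rho>" "K \<le> r" and q: "q \<le> K" "q < r"
  shows "\<exists>B'. R A B' \<and> Inv K A B' \<and> chain q B' \<and> (\<forall>k\<in>{q+1..\<rho>}. \<forall>j. B' k j = B k j)"
  using q
proof (induction q)
  case 0
  then show ?case using R I by (auto simp: chain_def)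
next
  case (Suc m)
  then obtain B1 where B1: "R A B1" "Inv K A B1" "chain m B1" "\<forall>k\<in>{m+1..\<rho>}. \<forall>j. B1 k j = B k j"
    by auto
  show ?case
  proof (cases "m = 0")
    case True
    then show ?thesis using B1 by (intro exI[of _ B1]) (auto simp: chain_def)
  next
    case False
    define t where "t = Suc m"
    have t: "t \<in> {1..\<rho>}" "t \<in> {1..r}" "t \<le> K" "t \<noteq> r" "min K t = t" and rr: "r \<in> {1..r}"
      using Suc.prems K by (auto simp: t_def)
    have nr: "int (n r) > 0" using n_gt1[OF rr] by simp
    obtain c where c: "gcd (B1 t r + c * B1 m r) (int (n r)) = gcd (gcd (B1 t r) (B1 m r)) (int (n r))"
      using gcd_add_multiple_attained[OF nr] by blast
    have "1 \<le> m" "m < t" "t \<le> \<rho>" "m \<le> K" using False t Suc.prems by (auto simp: t_def)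
    from down[OF B1(1,2) this K(2), of c] obtain B' \<gamma> where B': "R A B'" "\<forall>j\<in>{1..r}. B' t j = (if j \<le> min K t then 0 else B1 t j + c * B1 m j)"
      "\<forall>p j. p \<noteq> t \<longrightarrow> B' p j = B1 p j + \<gamma> p * A t j" "\<forall>p. \<gamma> p \<noteq> 0 \<longrightarrow> p < t \<and> p \<le> K" by blast
    have I': "Inv K A B'" by (rule down_Inv[OF B1(2) t(1) B'(2-4)])
    have At: "A t r = 0" using InvD(1)[OF B1(2) t(1) rr t(3)] t(4) by simp
    have "B' t r = B1 t r + c * B1 m r" using B'(2) rr t by auto
    moreover have Br: "B' p r = B1 p r" if "p \<noteq> t" for p using B'(3) At that by simp
    ultimately have m: "gcd (B' t r) (int (n r)) dvd B' m r"
      using c \<open>m < t\<close> by (auto intro: dvd_trans[OF gcd_dvd1 gcd_dvd2])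
    have "chain t B'"
      unfolding chain_def
    proof (intro allI impI)
      fix i assume i: "1 \<le> i \<and> i < t"
      show "gcd (B' (i + 1) r) (int (n r)) dvd B' i r"
      proof (cases "i = m")
        case True
        then show ?thesis using m by (simp add: t_def)
      next
        case False
        then have "i < m" using i by (simp add: t_def)
        then show ?thesis using B1(3) i Br[of i] Br[of "i + 1"] by (simp add: chain_def t_def)
      qed
    qed
    moreover have "B' k j = B k j" if "k \<in> {t+1..\<rho>}" for k j
    proof -
      have "\<gamma> k = 0" using B'(4) that by force
      then show ?thesis using B'(3) B1(4) that by (auto simp: t_def)
    qed
    ultimately show ?thesis using B'(1) I' unfolding t_def by blast
  qed
qed

text \<open>Scaling \<open>\<omega>\<^sub>l\<close> by a unit \<open>u\<close> turns \<open>\<eta>(\<alpha>\<^sub>l)\<close> into \<open>u \<omega>\<^sub>l\<close>; the diagonal matrix with entries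
  \<open>u\<^sup>-\<^sup>1\<close> and \<open>u\<close> in the handle \<open>l\<close>, a product of transvections modulo \<open>n\<^sub>l\<close>, undoes this.\<close>

lemma scale:
  assumes R: "R A B" and I: "Inv K A B" and K: "K \<le> \<rho>" "K \<le> r" and l: "1 \<le> l" "l \<le> K" and u: "coprime u (int (n l))"
  defines "B' \<equiv> \<lambda>p j. (if p = l then u else 1) * ((if j = l then u else 1) * B p j)"
  shows "R A B'" "Inv K A B'"
proof -
  have lr: "l \<in> {1..r}" "l \<in> {1..\<rho>}" using l K by auto
  obtain v w where vw: "v * u + w * int (n l) = 1"
    using bezout_int[of u "int (n l)"] u by (auto simp: coprime_iff_gcd_eq_1)
  have uv: "int (n l) dvd v * u - 1" using vw by (auto simp: algebra_simps intro: dvdI[of _ _ "- w"])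
  have uvB: "int (n j) dvd (v * u - 1) * B l j" if j: "j \<in> {1..r}" for j
  proof (cases "j \<le> l")
    case True
    then show ?thesis using InvD(2)[OF I lr(2) j l(2)] by simp
  next
    case False
    then have "n j dvd n l" using n_dvd[of l j] l j by auto
    then have "int (n j) dvd v * u - 1" using uv by (meson dvd_trans int_dvd_int_iff)
    then show ?thesis by simp
  qed
  have Al: "A l j = (if j = l then 1 else 0)" if "j \<in> {1..r}" for j using InvD(1)[OF I lr(2) that l(2)] .
  have Bll: "B l l = 0" using InvD(2)[OF I lr(2,1) l(2)] by simp
  define A1 where "A1 = A(l := \<lambda>j. u * A l j)"
  define B1 where "B1 = (\<lambda>p j. (if j = l then u else 1) * B p j)"
  have "R (\<lambda>i. row_aut l u (\<lambda>_. 0) (A i)) (\<lambda>i. row_aut l u (\<lambda>_. 0) (B i))"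
    by (rule R_aut[OF R lr(1) u]) auto
  then have R1: "R A1 B1"
  proof (rule R_eq)
    fix i j assume i: "i \<in> {1..\<rho>}" and j: "j \<in> {1..r}"
    have "A i l = 0" if "i \<noteq> l" using InvD(1,3)[OF I i lr(1)] that l(2) by (cases "i \<le> K") auto
    then show "A1 i j = row_aut l u (\<lambda>_. 0) (A i) j \<and> B1 i j = row_aut l u (\<lambda>_. 0) (B i) j"
      using Al[OF j] Al[OF lr(1)] by (auto simp: A1_def B1_def row_aut_def)
  qed
  have B1l: "B1 l j = B l j" if "j \<in> {1..r}" for j using Bll by (simp add: B1_def)
  \<comment> \<open>With u v = 1 modulo \<open>n l\<close>, row \<open>l\<close> of the pair (A, B)
    has become (u A, B) and passes through (u A + u B, B), (u A + u B, -A), (u B, -A) and (-A, -u B)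
    to (A, u B).\<close>
  note 1 = add_b_to_a[OF R1 lr(2), of u]
  note 2 = add_a_to_b[OF 1 lr(2), of "- v"]
  have 3: "R (A1(l := \<lambda>j. A1 l j + u * B1 l j)) (B1(l := \<lambda>j. - A l j))"
  proof (rule R_cong[OF 2])
    fix i j assume i: "i \<in> {1..\<rho>}" and j: "j \<in> {1..r}"
    have "int (n j) dvd (v * u - 1) * (A l j + B l j)"
      using uvB[OF j] Al[OF j] uv by (auto simp: distrib_left)
    then have "int (n j) dvd - A l j - (B1 l j + - v * (u * A l j + u * B1 l j))"
      unfolding B1l[OF j] by (simp add: algebra_simps)
    then show "int (n j) dvd (A1(l := \<lambda>j. A1 l j + u * B1 l j)) i j - (A1(l := \<lambda>j. A1 l j + u * B1 l j)) i j \<and>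
        int (n j) dvd (B1(l := \<lambda>j. - A l j)) i j - (B1(l := \<lambda>j. B1 l j + - v * (A1(l := \<lambda>j. A1 l j + u * B1 l j)) l j)) i j"
      by (simp add: A1_def)
  qed
  note 4 = neg[OF rot_inv[OF add_b_to_a[OF 3 lr(2), of u] lr(2)] lr(2)]
  show "R A B'"
    by (rule R_eq[OF 4]) (auto simp: A1_def B'_def B1_def)
  show "Inv K A B'"
    using I unfolding Inv_def B'_def by auto
qed

text \<open>An entry at \<open>(m, l)\<close> with \<open>l = Suc m\<close> that is coprime to
  \<open>n l\<close> becomes 1 modulo \<open>n l\<close> by scaling with its inverse. Scaling
  multiplies row \<open>l\<close> and column \<open>l\<close>, so the earlier superdiagonal entries
  stay, and \<open>chain\<close> survives since a unit modulo \<open>n l\<close> is one modulo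
  \<open>n r\<close>.\<close>

lemma make_superdiagonal:
  assumes R: "R A B" and I: "Inv K A B" and K: "K \<le> \<rho>" "K \<le> r" and c: "chain e B" and p: "p \<le> K"
  shows "q \<le> p \<Longrightarrow> \<exists>B'. R A B' \<and> Inv K A B' \<and> chain e B' \<and> superdiagonal q B' \<and>
    (\<forall>k\<in>{p+1..\<rho>}. \<forall>j\<in>{1..r}. B' k j = B k j)"
proof (induction q)
  case 0
  then show ?case using R I c by (auto simp: superdiagonal_def)
next
  case (Suc m)
  then obtain B1 where B1: "R A B1" "Inv K A B1" "chain e B1" "superdiagonal m B1" "\<forall>k\<in>{p+1..\<rho>}. \<forall>j\<in>{1..r}. B1 k j = B k j"
    by auto
  define l where "l = Suc m"
  have l: "1 \<le> l" "l \<le> K" "l \<in> {1..r}" "l \<le> p" "l \<in> {1..\<rho>}" using Suc.prems p K by (auto simp: l_def)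
  have nl: "int (n l) > 0" using n_gt1[OF l(3)] by simp
  show ?case
  proof (cases "m = 0 \<or> gcd (int (n l)) (B1 m l) > 1")
    case True
    then have "superdiagonal l B1"
      using B1(4) unfolding superdiagonal_def l_def by (metis One_nat_def add.commute less_Suc_eq not_less_zero less_le_trans plus_1_eq_Suc zero_less_one)
    then show ?thesis using B1 unfolding l_def by blast
  next
    case False
    then have "\<not> gcd (B1 m l) (int (n l)) > 1" by (simp add: gcd.commute)
    moreover have "gcd (B1 m l) (int (n l)) > 0" using nl by simp
    ultimately have "gcd (B1 m l) (int (n l)) = 1" by linarith
    then obtain u w where uw: "u * B1 m l + w * int (n l) = 1"
      using bezout_int[of "B1 m l" "int (n l)"] by auto
    have u1: "int (n l) dvd u * B1 m l - 1" using uw by (auto simp: algebra_simps intro: dvdI[of _ _ "- w"])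
    have u: "coprime u (int (n l))"
    proof (rule coprimeI)
      fix c assume "c dvd u" "c dvd int (n l)"
      then have "c dvd u * B1 m l + w * int (n l)" by (simp add: dvd_mult2)
      then show "is_unit c" using uw by simp
    qed
    define B' where "B' = (\<lambda>p j. (if p = l then u else 1) * ((if j = l then u else 1) * B1 p j))"
    have S: "R A B'" "Inv K A B'" unfolding B'_def by (rule scale[OF B1(1,2) K l(1,2) u])+
    have "n r dvd n l" using n_dvd[of l r] l K by auto
    then have unr: "coprime u (int (n r))"
      using u by (meson coprime_divisors dvd_refl int_dvd_int_iff)
    have "chain e B'"
      unfolding chain_def
    proof (intro allI impI)
      fix i assume i: "1 \<le> i \<and> i < e"
      have "coprime x (int (n r)) \<Longrightarrow> gcd (x * y) (int (n r)) = gcd y (int (n r))" for x y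
        by (rule gcd_mult_left_left_cancel) (simp add: coprime_commute)
      then have "gcd (B' (i + 1) r) (int (n r)) = gcd (B1 (i + 1) r) (int (n r))"
        using unr unfolding B'_def by auto
      moreover have "gcd (B1 (i + 1) r) (int (n r)) dvd B1 i r" using B1(3) i by (simp add: chain_def)
      ultimately show "gcd (B' (i + 1) r) (int (n r)) dvd B' i r"
        unfolding B'_def by (simp add: dvd_mult)
    qed
    moreover have "superdiagonal l B'"
      unfolding superdiagonal_def
    proof (intro allI impI)
      fix i assume i: "1 \<le> i \<and> i < l"
      show "gcd (int (n (i + 1))) (B' i (i + 1)) > 1 \<or> int (n (i + 1)) dvd B' i (i + 1) - 1"
      proof (cases "i = m")
        case True
        then show ?thesis using u1 by (simp add: B'_def l_def)
      next
        case False
        then have "i < m" "i + 1 \<noteq> l" "i \<noteq> l" using i by (auto simp: l_def)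
        then show ?thesis using B1(4) i by (simp add: superdiagonal_def B'_def)
      qed
    qed
    moreover have "B' k j = B k j" if k: "k \<in> {p+1..\<rho>}" and j: "j \<in> {1..r}" for k j
    proof -
      have "B1 k l = 0"
        using InvD(2,4)[OF B1(2) _ l(3), of k] k l by (cases "k \<le> K") auto
      then show ?thesis using B1(5) k j l(4) by (auto simp: B'_def)
    qed
    ultimately show ?thesis using S unfolding l_def by blast
  qed
qed


theorem small_rank_normal_matrix:
  assumes "R A B" "r \<le> \<rho>"
  shows "\<exists>A B. R A B \<and> Inv r A B \<and> chain (r - 1) B \<and> superdiagonal r B"
proof -
  obtain A B where AB: "R A B" "Inv r A B"
    using phase1[OF assms(1), of r] assms(2) by blast
  have "\<exists>B1. R A B1 \<and> Inv r A B1 \<and> chain (r - 1) B1"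
  proof (cases "r = 0")
    case True
    then have "chain (r - 1) B" unfolding chain_def by simp
    then show ?thesis using AB by blast
  next
    case False
    then show ?thesis using make_chain[OF AB assms(2) order_refl, of "r - 1"] by auto
  qed
  then obtain B1 where B1: "R A B1" "Inv r A B1" "chain (r - 1) B1" by blast
  show ?thesis
    using make_superdiagonal[OF B1(1,2) assms(2) order_refl B1(3) order_refl order_refl] by blast
qed

lemma pivoted_cong:
  assumes "\<And>k j. k \<in> {2 * \<rho> - r + 1..\<rho>} \<Longrightarrow> j \<in> {1..r} \<Longrightarrow> B' k j = B k j"
    and "\<rho> < r" "r \<le> 2 * \<rho>" "pivoted (2 * \<rho> - r + 1) B"
  shows "pivoted (2 * \<rho> - r + 1) B'"
  unfolding pivoted_def
proof
  fix k assume k: "k \<in> {2 * \<rho> - r + 1..\<rho>}"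
  have "2 * \<rho> - k + 1 \<in> {1..r}" "{k+1..2*\<rho>-k} \<subseteq> {1..r}" using k assms(2,3) by auto
  then show "B' k (2 * \<rho> - k + 1) = 1 \<and> (\<forall>j\<in>{1..r}. 2 * \<rho> - k + 1 < j \<longrightarrow> B' k j = 0) \<and>
     (\<forall>j\<in>{k+1..2*\<rho>-k}. B' k j = 0 \<or> \<not> int (n j) dvd B' k j * int (n r))"
    using assms(1)[OF k] assms(4) k unfolding pivoted_def by (auto simp: subset_iff)
qed

text \<open>The reductions for \<open>chain\<close> and \<open>superdiagonal\<close> stop at row
  \<open>2 * \<rho> - r\<close> and leave the pivot rows below unchanged.\<close>

theorem large_rank_normal_matrix:
  assumes "R A B" "\<rho> < r" "r \<le> 2 * \<rho>"
  shows "\<exists>A B. R A B \<and> Inv \<rho> A B \<and> pivoted (2 * \<rho> - r + 1) B \<and> chain (2 * \<rho> - r) B \<and> superdiagonal (2 * \<rho> - r) B"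
proof -
  obtain A B where AB: "R A B" "Inv \<rho> A B" "pivoted (2 * \<rho> - r + 1) B"
    using phase2[OF assms] by blast
  have s: "2 * \<rho> - r \<le> \<rho>" "2 * \<rho> - r < r" "\<rho> \<le> r" using assms by auto
  obtain B1 where B1: "R A B1" "Inv \<rho> A B1" "chain (2 * \<rho> - r) B1"
    "\<forall>k\<in>{2 * \<rho> - r + 1..\<rho>}. \<forall>j. B1 k j = B k j"
    using make_chain[OF AB(1,2) order_refl s(3,1,2)] by blast
  obtain B2 where B2: "R A B2" "Inv \<rho> A B2" "chain (2 * \<rho> - r) B2" "superdiagonal (2 * \<rho> - r) B2"
    "\<forall>k\<in>{2 * \<rho> - r + 1..\<rho>}. \<forall>j\<in>{1..r}. B2 k j = B1 k j"
    using make_superdiagonal[OF B1(1,2) order_refl s(3) B1(3) s(1) order_refl] by blast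
  have "pivoted (2 * \<rho> - r + 1) B2"
    by (rule pivoted_cong[OF _ assms(2,3) AB(3)]) (use B1(4) B2(5) in auto)
  then show ?thesis using B2 by blast
qed

end

section \<open>The normal forms\<close>

locale factor_basis = comm_group G for G (structure) +
  fixes r :: nat and n :: "nat \<Rightarrow> nat" and \<omega> :: "nat \<Rightarrow> 'a"
  assumes fin: "finite (carrier G)" and basis: "invariant_factor_generators G r n \<omega>"
begin

definition val :: "(nat \<Rightarrow> int) \<Rightarrow> 'a" where
  "val x = (\<Otimes>j\<in>{1..r}. \<omega> j [^] x j)"

lemma \<omega>_facts:
  assumes "i \<in> {1..r}"
  shows "1 < n i" "\<omega> i \<in> carrier G" "ord (\<omega> i) = n i"
  using basis assms by (auto simp: invariant_factor_generators_def)

lemma n_dvd_step: "1 \<le> i \<Longrightarrow> i < r \<Longrightarrow> n (i + 1) dvd n i"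
  using basis by (auto simp: invariant_factor_generators_def)

lemma val_closed [simp]: "val x \<in> carrier G"
  unfolding val_def by (intro finprod_closed) (auto simp: \<omega>_facts)

lemma \<omega>_pow_eq_iff: "j \<in> {1..r} \<Longrightarrow> \<omega> j [^] a = \<omega> j [^] b \<longleftrightarrow> int (n j) dvd a - b" for a b :: int
  using int_pow_eq[of "\<omega> j" a b] \<omega>_facts[of j] by (simp add: dvd_diff_commute)

lemma val_cong: "(\<And>j. j \<in> {1..r} \<Longrightarrow> int (n j) dvd x j - y j) \<Longrightarrow> val x = val y"
  unfolding val_def by (intro finprod_cong) (auto simp: \<omega>_pow_eq_iff \<omega>_facts simp_implies_def)

lemma val_add: "val x \<otimes> val y = val (\<lambda>j. x j + y j)"
proof -
  have "val (\<lambda>j. x j + y j) = (\<Otimes>j\<in>{1..r}. \<omega> j [^] x j \<otimes> \<omega> j [^] y j)"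
    unfolding val_def by (intro finprod_cong) (auto simp: \<omega>_facts int_pow_mult simp_implies_def)
  also have "\<dots> = val x \<otimes> val y"
    unfolding val_def by (intro finprod_multf) (auto simp: \<omega>_facts)
  finally show ?thesis ..
qed

lemma val_zero: "val (\<lambda>_. 0) = \<one>"
  unfolding val_def by (intro finprod_one_eqI) auto

lemma val_minus: "inv (val x) = val (\<lambda>j. - x j)"
  using val_add[of "\<lambda>j. - x j" x] val_zero by (intro inv_equality) auto

lemma val_single: "i \<in> {1..r} \<Longrightarrow> val (\<lambda>j. if j = i then 1 else 0) = \<omega> i"
proof -
  assume i: "i \<in> {1..r}"
  have "val (\<lambda>j. if j = i then 1 else 0) = (\<Otimes>j\<in>{1..r}. if i = j then \<omega> j else \<one>)"
    unfolding val_def by (intro finprod_cong) (auto simp: \<omega>_facts simp_implies_def)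
  also have "\<dots> = \<omega> i" using i \<omega>_facts by (intro finprod_singleton) auto
  finally show ?thesis .
qed

lemma val_support:
  assumes "J \<subseteq> {1..r}" "\<And>j. j \<in> {1..r} \<Longrightarrow> j \<notin> J \<Longrightarrow> x j = 0" "\<And>j. j \<in> J \<Longrightarrow> int (n j) dvd x j - y j"
  shows "val x = (\<Otimes>j\<in>J. \<omega> j [^] y j)"
proof -
  have "val x = val (\<lambda>j. if j \<in> J then y j else 0)"
    by (rule val_cong) (use assms in auto)
  also have "\<dots> = (\<Otimes>j\<in>J. \<omega> j [^] y j)"
    unfolding val_def using assms(1) \<omega>_facts by (intro finprod_mono_neutral_cong_right) auto
  finally show ?thesis .
qed

lemma carrier_cyclic: "i \<in> {1..r} \<Longrightarrow> carrier (subgroup_generated G {\<omega> i}) = range (\<lambda>k::int. \<omega> i [^] k)"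
  using \<omega>_facts[of i] by (simp add: carrier_subgroup_generated_by_singleton)

lemma basis_iso: "(\<lambda>x. finprod G x {1..r}) \<in> iso (product_group {1..r} (\<lambda>i. subgroup_generated G {\<omega> i})) G"
  using basis by (simp add: invariant_factor_generators_def)

lemma val_surj:
  assumes "g \<in> carrier G" shows "\<exists>x. val x = g"
proof -
  have "g \<in> (\<lambda>x. finprod G x {1..r}) ` carrier (product_group {1..r} (\<lambda>i. subgroup_generated G {\<omega> i}))"
    using basis_iso assms by (simp add: iso_def bij_betw_def)
  then obtain f where f: "f \<in> (\<Pi>\<^sub>E i\<in>{1..r}. carrier (subgroup_generated G {\<omega> i}))" "g = finprod G f {1..r}"
    by (auto simp: carrier_product_group)
  have "\<forall>i\<in>{1..r}. \<exists>k::int. f i = \<omega> i [^] k"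
    using f(1) carrier_cyclic by (fastforce simp: PiE_iff)
  then obtain x :: "nat \<Rightarrow> int" where x: "\<And>i. i \<in> {1..r} \<Longrightarrow> f i = \<omega> i [^] x i" by metis
  have "val x = g"
    unfolding val_def f(2) by (intro finprod_cong) (auto simp: x \<omega>_facts simp_implies_def)
  then show ?thesis by blast
qed

text \<open>The orders of the \<open>\<omega> j\<close> are the only relations between them, because
  the product of the cyclic subgroups is direct.\<close>

lemma val_eq_iff: "val x = val y \<longleftrightarrow> (\<forall>j\<in>{1..r}. int (n j) dvd x j - y j)"
proof
  assume e: "val x = val y"
  define X where "X x = (\<lambda>j\<in>{1..r}. \<omega> j [^] (x j :: int))" for x
  have X: "X x \<in> carrier (product_group {1..r} (\<lambda>i. subgroup_generated G {\<omega> i}))" "finprod G (X x) {1..r} = val x" for x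
  proof -
    show "X x \<in> carrier (product_group {1..r} (\<lambda>i. subgroup_generated G {\<omega> i}))"
      by (auto simp: X_def carrier_product_group carrier_cyclic)
    show "finprod G (X x) {1..r} = val x"
      unfolding val_def X_def by (intro finprod_cong) (auto simp: \<omega>_facts simp_implies_def)
  qed
  have "inj_on (\<lambda>x. finprod G x {1..r}) (carrier (product_group {1..r} (\<lambda>i. subgroup_generated G {\<omega> i})))"
    using basis_iso by (simp add: iso_def bij_betw_def)
  then have "X x = X y"
    by (rule inj_onD) (use X e in auto)
  then have "\<omega> j [^] x j = \<omega> j [^] y j" if "j \<in> {1..r}" for j
  proof -
    have "X x j = X y j" using \<open>X x = X y\<close> by simp
    then show ?thesis using that by (simp add: X_def)
  qed
  then show "\<forall>j\<in>{1..r}. int (n j) dvd x j - y j" using \<omega>_pow_eq_iff by blast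
qed (use val_cong in blast)

section \<open>Automorphisms of the finite group in coordinates\<close>

definition coord_aut :: "nat \<Rightarrow> int \<Rightarrow> (nat \<Rightarrow> int) \<Rightarrow> 'a \<Rightarrow> 'a" where
  "coord_aut l u g a = val (row_aut l u g (SOME x. val x = a))"

context
  fixes l :: nat and u :: int and g :: "nat \<Rightarrow> int"
  assumes l: "l \<in> {1..r}" and u: "coprime u (int (n l))" and gl: "g l = 0"
    and g: "\<And>j. j \<in> {1..r} \<Longrightarrow> int (n j) dvd int (n l) * g j"
begin

text \<open>Two coordinate vectors of one element differ by multiples of the orders, and the
  condition on \<open>g\<close> makes their images equal; hence the choice in
  \<open>coord_aut\<close> is harmless.\<close>

lemma coord_aut_val: "coord_aut l u g (val x) = val (row_aut l u g x)"
proof -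
  define y where "y = (SOME y. val y = val x)"
  have "val y = val x" unfolding y_def by (rule someI[of "\<lambda>y. val y = val x" x]) simp
  then have d: "int (n j) dvd y j - x j" if "j \<in> {1..r}" for j using that val_eq_iff by blast
  have "val (row_aut l u g y) = val (row_aut l u g x)"
  proof (rule val_cong)
    fix j assume j: "j \<in> {1..r}"
    have "int (n j) dvd (y l - x l) * g j"
      using d[OF l] g[OF j] by (meson dvd_trans dvd_refl mult_dvd_mono)
    then have "int (n j) dvd (y j - x j) + (y l - x l) * g j" using d[OF j] by simp
    moreover have "int (n l) dvd u * (y l - x l)" using d[OF l] by simp
    ultimately show "int (n j) dvd row_aut l u g y j - row_aut l u g x j"
      by (auto simp: row_aut_def algebra_simps)
  qed
  then show ?thesis unfolding coord_aut_def y_def .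
qed

text \<open>Injectivity is settled for the coordinate \<open>l\<close> since \<open>u\<close> is a
  unit there, and then for the others; surjectivity follows by finiteness.\<close>

lemma coord_aut_iso: "coord_aut l u g \<in> iso G G"
proof -
  have "coord_aut l u g \<in> hom G G"
  proof (rule homI)
    fix a assume "a \<in> carrier G"
    show "coord_aut l u g a \<in> carrier G" by (simp add: coord_aut_def)
    fix b assume "b \<in> carrier G"
    obtain x y where xy: "a = val x" "b = val y" using val_surj \<open>a \<in> carrier G\<close> \<open>b \<in> carrier G\<close> by metis
    have "row_aut l u g (\<lambda>j. x j + y j) = (\<lambda>j. row_aut l u g x j + row_aut l u g y j)"
      by (auto simp: row_aut_def algebra_simps)
    then show "coord_aut l u g (a \<otimes> b) = coord_aut l u g a \<otimes> coord_aut l u g b"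
      unfolding xy val_add coord_aut_val by simp
  qed
  moreover have "inj_on (coord_aut l u g) (carrier G)"
  proof (rule inj_onI)
    fix a b assume ab: "a \<in> carrier G" "b \<in> carrier G" "coord_aut l u g a = coord_aut l u g b"
    obtain x y where xy: "a = val x" "b = val y" using val_surj ab by metis
    have d: "int (n j) dvd row_aut l u g x j - row_aut l u g y j" if "j \<in> {1..r}" for j
      using ab(3) that unfolding xy coord_aut_val val_eq_iff by blast
    have "int (n l) dvd u * (x l - y l)" using d[OF l] by (simp add: row_aut_def algebra_simps)
    then have dl: "int (n l) dvd x l - y l"
      using u by (simp add: coprime_dvd_mult_right_iff coprime_commute)
    have "int (n j) dvd x j - y j" if j: "j \<in> {1..r}" for j
    proof (cases "j = l")
      case False
      have "int (n j) dvd (x l - y l) * g j"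
        using dl g[OF j] by (meson dvd_trans dvd_refl mult_dvd_mono)
      moreover have "int (n j) dvd (x j - y j) + (x l - y l) * g j"
        using d[OF j] False by (simp add: row_aut_def algebra_simps)
      ultimately show ?thesis by (simp add: dvd_add_left_iff)
    qed (use dl in simp)
    then show "a = b" unfolding xy by (rule val_cong)
  qed
  ultimately show ?thesis
    using endo_inj_surj[OF fin, of "coord_aut l u g"] by (auto simp: iso_def bij_betw_def hom_def)
qed

end


section \<open>The orbit of an epimorphism as a relation between matrices\<close>

definition represents :: "nat \<Rightarrow> (surface_gen word set \<Rightarrow> 'a) \<Rightarrow> (nat \<Rightarrow> nat \<Rightarrow> int) \<Rightarrow> (nat \<Rightarrow> nat \<Rightarrow> int) \<Rightarrow> bool" where
  "represents \<rho> \<eta> A B \<longleftrightarrow> (\<forall>i\<in>{1..\<rho>}. \<eta> (gen \<rho> (Alpha i)) = val (A i) \<and> \<eta> (gen \<rho> (Beta i)) = val (B i))"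

definition orbit :: "nat \<Rightarrow> (surface_gen word set \<Rightarrow> 'a) \<Rightarrow> (nat \<Rightarrow> nat \<Rightarrow> int) \<Rightarrow> (nat \<Rightarrow> nat \<Rightarrow> int) \<Rightarrow> bool" where
  "orbit \<rho> \<eta> A B \<longleftrightarrow> (\<exists>\<eta>'\<in>epi (surface_group \<rho>) G. realized_equivalent \<rho> G \<eta> \<eta>' \<and> represents \<rho> \<eta>' A B)"

text \<open>Elements with an \<open>l\<close>-th coordinate divisible by \<open>d\<close> are closed
  under products and inverses, and \<open>d\<close> dividing \<open>n l\<close> makes this
  independent of the chosen coordinates. If all generators are sent there, so is some preimage of
  \<open>\<omega> l\<close>, and \<open>d\<close> divides 1.\<close>

lemma represents_column:
  assumes \<eta>: "\<eta> \<in> epi (surface_group \<rho>) G" and rep: "represents \<rho> \<eta> A B" and l: "l \<in> {1..r}" and d: "d dvd int (n l)"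
    and dAB: "\<And>i. i \<in> {1..\<rho>} \<Longrightarrow> d dvd A i l \<and> d dvd B i l"
  shows "is_unit d"
proof -
  have ge: "\<exists>x. \<eta> (gen \<rho> s) = val x \<and> d dvd x l" if "s \<in> surface_gens \<rho>" for s
    using that rep dAB by (auto simp: surface_gens_def represents_def)
  have ev: "\<exists>x. word_eval G (\<lambda>s. \<eta> (gen \<rho> s)) w = val x \<and> d dvd x l" if "w \<in> words (surface_gens \<rho>)" for w
    using that
  proof (induction w)
    case Nil
    show ?case using val_zero by (intro exI[of _ "\<lambda>_. 0"]) simp
  next
    case (Cons c w)
    obtain s b where c: "c = (s, b)" by fastforce
    obtain y where y: "word_eval G (\<lambda>s. \<eta> (gen \<rho> s)) w = val y" "d dvd y l"
      using Cons by (auto simp: c)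
    obtain x where x: "\<eta> (gen \<rho> s) = val x" "d dvd x l"
      using ge Cons.prems by (auto simp: c)
    show ?case
      using x y by (intro exI[of _ "\<lambda>j. (if b then - x j else x j) + y j"])
        (auto simp: c val_minus val_add)
  qed
  have "\<omega> l \<in> \<eta> ` carrier (surface_group \<rho>)"
    using \<eta> \<omega>_facts(2)[OF l] by (auto simp: epi_def)
  then obtain w where w: "w \<in> words (surface_gens \<rho>)" "\<omega> l = \<eta> (pres_class (surface_gens \<rho>) {surface_relator \<rho>} w)"
    by (auto simp: surface_group_def presented_group_def)
  have "\<eta> \<in> hom (presented_group (surface_gens \<rho>) {surface_relator \<rho>}) G"
    using \<eta> by (simp add: epi_def surface_group_def)
  then have "\<omega> l = word_eval G (\<lambda>s. \<eta> (gen \<rho> s)) w"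
    using hom_presented_group_eval[OF _ w(1)] w(2) by (simp add: gen_def)
  then obtain x where x: "\<omega> l = val x" "d dvd x l" using ev[OF w(1)] by auto
  have "val (\<lambda>j. if j = l then 1 else 0) = val x" using val_single[OF l] x(1) by simp
  then have "int (n l) dvd 1 - x l" using l unfolding val_eq_iff by fastforce
  then have "d dvd 1 - x l" using d by (rule dvd_trans[rotated])
  then have "d dvd (1 - x l) + x l" using x(2) by (rule dvd_add)
  then show ?thesis by simp
qed

text \<open>The new matrices are found by evaluating the substituted words in the abelian group;
  this is how a twist of the surface becomes a row operation.\<close>

lemma orbit_subst:
  assumes "\<rho> > 0" "orbit \<rho> \<eta> A B" "realized \<rho> (word_subst \<rho> \<sigma>)"
    and "\<And>s. s \<in> surface_gens \<rho> \<Longrightarrow> word_subst \<rho> \<sigma> (gen \<rho> s) = word_eval (surface_group \<rho>) (gen \<rho>) (\<sigma> s)"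
    and "\<And>s. s \<in> surface_gens \<rho> \<Longrightarrow> \<sigma> s \<in> words (surface_gens \<rho>)"
    and AB: "\<And>f i. i \<in> {1..\<rho>} \<Longrightarrow> (\<And>i. i \<in> {1..\<rho>} \<Longrightarrow> f (Alpha i) = val (A i)) \<Longrightarrow> (\<And>i. i \<in> {1..\<rho>} \<Longrightarrow> f (Beta i) = val (B i)) \<Longrightarrow>
      word_eval G f (\<sigma> (Alpha i)) = val (A' i) \<and> word_eval G f (\<sigma> (Beta i)) = val (B' i)"
  shows "orbit \<rho> \<eta> A' B'"
proof -
  obtain \<eta>1 where e1: "\<eta>1 \<in> epi (surface_group \<rho>) G" "realized_equivalent \<rho> G \<eta> \<eta>1" "represents \<rho> \<eta>1 A B"
    using assms(2) by (auto simp: orbit_def)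
  obtain \<eta>2 where e2: "\<eta>2 \<in> epi (surface_group \<rho>) G" "realized_equivalent \<rho> G \<eta>1 \<eta>2"
    "\<And>s. s \<in> surface_gens \<rho> \<Longrightarrow> \<eta>2 (gen \<rho> s) = word_eval G (\<lambda>s. \<eta>1 (gen \<rho> s)) (\<sigma> s)"
    using realized_equivalent_subst[OF assms(1) is_group e1(1) assms(3-5)] by blast
  have "represents \<rho> \<eta>2 A' B'"
    unfolding represents_def
  proof
    fix i assume i: "i \<in> {1..\<rho>}"
    then show "\<eta>2 (gen \<rho> (Alpha i)) = val (A' i) \<and> \<eta>2 (gen \<rho> (Beta i)) = val (B' i)"
      using AB[OF i, of "\<lambda>s. \<eta>1 (gen \<rho> s)"] e1(3) e2(3)[of "Alpha i"] e2(3)[of "Beta i"] by (simp add: represents_def)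
  qed
  then show ?thesis
    unfolding orbit_def using e2(1) realized_equivalent_trans[OF assms(1) e1(2) e2(2)] by blast
qed

lemma orbit_matrix_orbit:
  assumes \<rho>: "2 \<le> \<rho>"
  shows "matrix_orbit \<rho> r n (orbit \<rho> \<eta>)"
proof
  have \<rho>0: "\<rho> > 0" using \<rho> by simp
  show "2 \<le> \<rho>" by fact
  show "1 < n i" if "i \<in> {1..r}" for i using \<omega>_facts(1)[OF that] .
  show "n (i + 1) dvd n i" if "1 \<le> i" "i < r" for i using n_dvd_step that .
  show "orbit \<rho> \<eta> A (B(i := \<lambda>j. B i j + A i j))" if O: "orbit \<rho> \<eta> A B" and i: "i \<in> {1..\<rho>}" for A B i
  proof (rule orbit_subst[OF \<rho>0 O realized_subst_single(1)])
    show "word_subst \<rho> (subst_alpha i) (gen \<rho> s) = word_eval (surface_group \<rho>) (gen \<rho>) (subst_alpha i s)"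
      "subst_alpha i s \<in> words (surface_gens \<rho>)" if "s \<in> surface_gens \<rho>" for s
      using word_subst_single(2)[of i \<rho> "subst_alpha i" s] subst_words(1)[of i s \<rho> "subst_alpha i"] i that by auto
    show "word_eval G f (subst_alpha i (Alpha k)) = val (A k) \<and>
        word_eval G f (subst_alpha i (Beta k)) = val ((B(i := \<lambda>j. B i j + A i j)) k)"
      if "k \<in> {1..\<rho>}" "\<And>i. i \<in> {1..\<rho>} \<Longrightarrow> f (Alpha i) = val (A i)" "\<And>i. i \<in> {1..\<rho>} \<Longrightarrow> f (Beta i) = val (B i)" for f k
      using that i by (auto simp: subst_alpha_def val_add)
  qed (use i in auto)
  show "orbit \<rho> \<eta> (A(i := \<lambda>j. A i j - B i j)) B" if O: "orbit \<rho> \<eta> A B" and i: "i \<in> {1..\<rho>}" for A B i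
  proof (rule orbit_subst[OF \<rho>0 O realized_subst_single(2)])
    show "word_subst \<rho> (subst_beta i) (gen \<rho> s) = word_eval (surface_group \<rho>) (gen \<rho>) (subst_beta i s)"
      "subst_beta i s \<in> words (surface_gens \<rho>)" if "s \<in> surface_gens \<rho>" for s
      using word_subst_single(2)[of i \<rho> "subst_beta i" s] subst_words(1)[of i s \<rho> "subst_beta i"] i that by auto
    show "word_eval G f (subst_beta i (Alpha k)) = val ((A(i := \<lambda>j. A i j - B i j)) k) \<and>
        word_eval G f (subst_beta i (Beta k)) = val (B k)"
      if "k \<in> {1..\<rho>}" "\<And>i. i \<in> {1..\<rho>} \<Longrightarrow> f (Alpha i) = val (A i)" "\<And>i. i \<in> {1..\<rho>} \<Longrightarrow> f (Beta i) = val (B i)" for f k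
      using that i by (auto simp: subst_beta_def val_add val_minus)
  qed (use i in auto)
  show "orbit \<rho> \<eta> (A(i := \<lambda>j. A i j + B i j + B (Suc i) j, Suc i := \<lambda>j. A (Suc i) j + B i j + B (Suc i) j)) B"
    if O: "orbit \<rho> \<eta> A B" and i: "1 \<le> i" "i < \<rho>" for A B i
  proof (rule orbit_subst[OF \<rho>0 O realized_subst_mix[OF i]])
    show "word_subst \<rho> (subst_mix i) (gen \<rho> s) = word_eval (surface_group \<rho>) (gen \<rho>) (subst_mix i s)"
      "subst_mix i s \<in> words (surface_gens \<rho>)" if "s \<in> surface_gens \<rho>" for s
      using word_subst_mix(2)[OF i that] subst_words(2)[of i s \<rho> "subst_mix i"] i that by auto
    show "word_eval G f (subst_mix i (Alpha k)) =
         val ((A(i := \<lambda>j. A i j + B i j + B (Suc i) j, Suc i := \<lambda>j. A (Suc i) j + B i j + B (Suc i) j)) k) \<and>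
        word_eval G f (subst_mix i (Beta k)) = val (B k)"
      if "k \<in> {1..\<rho>}" "\<And>i. i \<in> {1..\<rho>} \<Longrightarrow> f (Alpha i) = val (A i)" "\<And>i. i \<in> {1..\<rho>} \<Longrightarrow> f (Beta i) = val (B i)" for f k
    proof -
      have "f (Alpha i) = val (A i)" "f (Beta i) = val (B i)" "f (Alpha (Suc i)) = val (A (Suc i))" "f (Beta (Suc i)) = val (B (Suc i))"
        "f (Alpha k) = val (A k)" "f (Beta k) = val (B k)"
        using that i by auto
      then show ?thesis
        by (auto simp: subst_mix_def val_add val_minus intro!: arg_cong[of _ _ val])
    qed
  qed
  show "orbit \<rho> \<eta> A' B'" if "orbit \<rho> \<eta> A B"
    "\<And>i j. i \<in> {1..\<rho>} \<Longrightarrow> j \<in> {1..r} \<Longrightarrow> int (n j) dvd A' i j - A i j \<and> int (n j) dvd B' i j - B i j" for A B A' B'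
  proof -
    have "val (A' i) = val (A i)" "val (B' i) = val (B i)" if "i \<in> {1..\<rho>}" for i
      using that \<open>\<And>i j. i \<in> {1..\<rho>} \<Longrightarrow> j \<in> {1..r} \<Longrightarrow> int (n j) dvd A' i j - A i j \<and> int (n j) dvd B' i j - B i j\<close>
      by (auto intro: val_cong)
    then have "represents \<rho> \<eta>' A' B'" if "represents \<rho> \<eta>' A B" for \<eta>'
      using that by (simp add: represents_def)
    then show ?thesis using that(1) unfolding orbit_def by blast
  qed
  show "orbit \<rho> \<eta> (\<lambda>i. row_aut l u g (A i)) (\<lambda>i. row_aut l u g (B i))"
    if O: "orbit \<rho> \<eta> A B" and l: "l \<in> {1..r}" "coprime u (int (n l))" "g l = 0"
      "\<And>j. j \<in> {1..r} \<Longrightarrow> int (n j) dvd int (n l) * g j" for A B l u g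
  proof -
    obtain \<eta>1 where e1: "\<eta>1 \<in> epi (surface_group \<rho>) G" "realized_equivalent \<rho> G \<eta> \<eta>1" "represents \<rho> \<eta>1 A B"
      using O by (auto simp: orbit_def)
    let ?\<theta> = "coord_aut l u g"
    have iso: "?\<theta> \<in> iso G G" by (rule coord_aut_iso[OF l])
    have "(?\<theta> \<circ> \<eta>1) ` carrier (surface_group \<rho>) = carrier G"
      using e1(1) iso unfolding image_comp[symmetric] by (auto simp: epi_def iso_def bij_betw_def)
    moreover have "?\<theta> \<circ> \<eta>1 \<in> hom (surface_group \<rho>) G"
      using e1(1) iso by (intro Group.hom_compose) (auto simp: epi_def iso_def)
    ultimately have "?\<theta> \<circ> \<eta>1 \<in> epi (surface_group \<rho>) G" unfolding epi_def by blast
    moreover have "realized_equivalent \<rho> G \<eta> (?\<theta> \<circ> \<eta>1)"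
      by (rule realized_equivalent_trans[OF \<rho>0 e1(2) realized_equivalent_iso[OF \<rho>0 iso]])
    moreover have "represents \<rho> (?\<theta> \<circ> \<eta>1) (\<lambda>i. row_aut l u g (A i)) (\<lambda>i. row_aut l u g (B i))"
      using e1(3) coord_aut_val[OF l] by (simp add: represents_def)
    ultimately show ?thesis unfolding orbit_def by blast
  qed
  show "is_unit d" if "orbit \<rho> \<eta> A B" "l \<in> {1..r}" "d dvd int (n l)"
    "\<And>i. i \<in> {1..\<rho>} \<Longrightarrow> d dvd A i l \<and> d dvd B i l" for A B l d
    using that represents_column unfolding orbit_def by metis
qed

lemma orbit_nonempty:
  assumes "\<rho> > 0" "\<eta> \<in> epi (surface_group \<rho>) G"
  shows "\<exists>A B. orbit \<rho> \<eta> A B"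
proof -
  have c: "\<eta> (gen \<rho> s) \<in> carrier G" if "s \<in> surface_gens \<rho>" for s
    using assms(2) gen_carrier[OF that] by (auto simp: epi_def hom_def)
  have "\<forall>i\<in>{1..\<rho>}. \<exists>x. val x = \<eta> (gen \<rho> (Alpha i))" "\<forall>i\<in>{1..\<rho>}. \<exists>x. val x = \<eta> (gen \<rho> (Beta i))"
    using val_surj c by auto
  then obtain A B where "\<forall>i\<in>{1..\<rho>}. val (A i) = \<eta> (gen \<rho> (Alpha i))" "\<forall>i\<in>{1..\<rho>}. val (B i) = \<eta> (gen \<rho> (Beta i))"
    by metis
  then have "represents \<rho> \<eta> A B" by (simp add: represents_def)
  then show ?thesis unfolding orbit_def using assms(2) realized_equivalent_refl[OF assms(1)] by blast
qed

text \<open>Write the gcd of \<open>b\<close> and \<open>n r\<close> as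
  \<open>u * b + v * n r\<close> and \<open>a\<close> as \<open>q\<close> times this gcd. Then
  \<open>a\<close> is congruent to \<open>b * u * q\<close>, so the first element is a power of the
  second.\<close>

lemma generate_pow_subset:
  assumes r: "r \<in> {1..r}" and d: "gcd b (int (n r)) dvd a"
    and a: "int (n r) dvd a' - a" and b: "int (n r) dvd b' - b"
  shows "generate G {\<omega> r [^] a'} \<subseteq> generate G {\<omega> r [^] (b' :: int)}"
proof -
  obtain u v where uv: "u * b + v * int (n r) = gcd b (int (n r))" using bezout_int by blast
  obtain q where q: "a = gcd b (int (n r)) * q" using d by (elim dvdE)
  have e: "a' - b' * (u * q) = (a' - a) - (b' - b) * (u * q) + int (n r) * (v * q)"
    unfolding q uv[symmetric] by (simp add: algebra_simps)
  have "int (n r) dvd a' - b' * (u * q)"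
    unfolding e by (rule dvd_add[OF dvd_diff[OF a dvd_mult2[OF b]]]) simp
  then have "\<omega> r [^] a' = (\<omega> r [^] b') [^] (u * q)"
    using \<omega>_facts(2)[OF r] r by (simp add: int_pow_pow \<omega>_pow_eq_iff)
  also have "\<dots> \<in> generate G {\<omega> r [^] b'}"
    using \<omega>_facts(2)[OF r] by (auto simp: generate_pow)
  finally show ?thesis
    using \<omega>_facts(2)[OF r] by (intro generate_subgroup_incl generate_is_subgroup) auto
qed


section \<open>Reading off the normal forms\<close>

text \<open>The condition on the largest \<open>j\<close> with \<open>N i j \<noteq> 0\<close> refers to integers: choosing the nonzero
  representative \<open>n r\<close> of \<open>0\<close> in the column \<open>r\<close> makes \<open>j = r\<close> the only case.\<close>

definition normal_coeff :: "nat \<Rightarrow> (nat \<Rightarrow> nat \<Rightarrow> int) \<Rightarrow> nat \<Rightarrow> nat \<Rightarrow> int" where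
  "normal_coeff q B i j =
     (if i \<le> q then
        if j = i + 1 \<and> i < q then if int (n j) dvd B i j - 1 then 1 else B i j
        else if j = r \<and> B i j = 0 then int (n r) else B i j
      else B i j)"

lemma normal_coeff_cong: "int (n j) dvd normal_coeff q B i j - B i j"
  by (auto simp: normal_coeff_def dvd_diff_commute)

lemma normal_coeff_last: "i \<le> q \<Longrightarrow> i + 1 < r \<Longrightarrow> normal_coeff q B i r \<noteq> 0"
  using \<omega>_facts(1)[of r] by (auto simp: normal_coeff_def)

lemma val_normal_coeff:
  assumes "J \<subseteq> {1..r}" "\<And>j. j \<in> {1..r} \<Longrightarrow> j \<notin> J \<Longrightarrow> B i j = 0"
  shows "val (B i) = (\<Otimes>j\<in>J. \<omega> j [^] normal_coeff q B i j)"
  using normal_coeff_cong assms by (intro val_support) (auto simp: dvd_diff_commute)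

lemma small_rank:
  assumes \<rho>: "2 \<le> \<rho>" "r \<le> \<rho>" and \<eta>: "\<eta> \<in> epi (surface_group \<rho>) G"
  shows "\<exists>\<eta>' \<in> epi (surface_group \<rho>) G. \<exists>N. realized_equivalent \<rho> G \<eta> \<eta>' \<and> normal_form_small_rank \<rho> G r n \<omega> N \<eta>'"
proof -
  interpret M: matrix_orbit \<rho> r n "orbit \<rho> \<eta>" by (rule orbit_matrix_orbit[OF \<rho>(1)])
  obtain A0 B0 where "orbit \<rho> \<eta> A0 B0" using orbit_nonempty[OF _ \<eta>] \<rho> by auto
  then obtain A B where O: "orbit \<rho> \<eta> A B" and I: "M.Inv r A B" and ch: "M.chain (r - 1) B" and sd: "M.superdiagonal r B"
    using M.small_rank_normal_matrix \<rho>(2) by blast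
  obtain \<eta>' where e: "\<eta>' \<in> epi (surface_group \<rho>) G" "realized_equivalent \<rho> G \<eta> \<eta>'" "represents \<rho> \<eta>' A B"
    using O by (auto simp: orbit_def)
  let ?N = "normal_coeff r B"
  have a: "\<eta>' (gen \<rho> (Alpha i)) = val (A i)" and b: "\<eta>' (gen \<rho> (Beta i)) = val (B i)" if "i \<in> {1..\<rho>}" for i
    using e(3) that by (auto simp: represents_def)
  have "normal_form_small_rank \<rho> G r n \<omega> ?N \<eta>'"
    unfolding normal_form_small_rank_def
  proof (intro conjI ballI allI impI)
    fix i assume i: "i \<in> {1..\<rho>}"
    show "\<eta>' (gen \<rho> (Alpha i)) = (if i \<le> r then \<omega> i else \<one>)"
    proof (cases "i \<le> r")
      case True
      have "val (A i) = val (\<lambda>j. if j = i then 1 else 0)"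
        using M.InvD(1)[OF I i _ True] by (intro val_cong) auto
      then show ?thesis using a[OF i] val_single[of i] i True by simp
    next
      case False
      have "val (A i) = val (\<lambda>_. 0)"
        using M.InvD(3)[OF I i] False by (intro val_cong) auto
      then show ?thesis using a[OF i] val_zero False by simp
    qed
    show "\<eta>' (gen \<rho> (Beta i)) = (if i \<le> r then (\<Otimes>j\<in>{i+1..r}. \<omega> j [^] ?N i j) else \<one>)"
    proof (cases "i \<le> r")
      case True
      have "val (B i) = (\<Otimes>j\<in>{i+1..r}. \<omega> j [^] ?N i j)"
        using M.InvD(2)[OF I i _ True] by (intro val_normal_coeff) auto
      then show ?thesis using b[OF i] True by simp
    next
      case False
      have "val (B i) = val (\<lambda>_. 0)"
        using M.InvD(4)[OF I i] False by (intro val_cong) auto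
      then show ?thesis using b[OF i] val_zero False by simp
    qed
  next
    fix i assume i: "1 \<le> i \<and> i + 1 \<le> r"
    then have "gcd (int (n (i + 1))) (B i (i + 1)) > 1 \<or> int (n (i + 1)) dvd B i (i + 1) - 1"
      using sd by (auto simp: M.superdiagonal_def)
    then show "gcd (int (n (i + 1))) (?N i (i + 1)) > 1 \<or> ?N i (i + 1) = 1"
      using i by (auto simp: normal_coeff_def)
  next
    fix i j assume ij: "1 \<le> i \<and> i + 1 < j \<and> j \<le> r \<and> ?N i j \<noteq> 0 \<and> (\<forall>k\<in>{j+1..r}. ?N i k = 0)"
    have "j = r"
    proof (rule ccontr)
      assume "j \<noteq> r"
      then have "r \<in> {j+1..r}" using ij by auto
      then show False using ij normal_coeff_last[of i r B] by auto
    qed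
    moreover have "generate G {\<omega> r [^] ?N i r} \<subseteq> generate G {\<omega> r [^] ?N (i + 1) r}"
    proof (rule generate_pow_subset[OF _ _ normal_coeff_cong normal_coeff_cong])
      show "gcd (B (i + 1) r) (int (n r)) dvd B i r"
      proof -
        have "i < r - 1" using ij by auto
        then show ?thesis using ch ij by (simp add: M.chain_def)
      qed
    qed (use ij in auto)
    ultimately show "generate G {\<omega> j [^] ?N i j} \<subseteq> generate G {\<omega> j [^] ?N (i + 1) j}" by simp
  qed
  then show ?thesis using e by blast
qed

lemma large_rank:
  assumes \<rho>: "2 \<le> \<rho>" "\<rho> < r" "r \<le> 2 * \<rho>" and \<eta>: "\<eta> \<in> epi (surface_group \<rho>) G"
  shows "\<exists>\<eta>' \<in> epi (surface_group \<rho>) G. \<exists>N. realized_equivalent \<rho> G \<eta> \<eta>' \<and> normal_form_large_rank \<rho> G r n \<omega> N \<eta>'"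
proof -
  interpret M: matrix_orbit \<rho> r n "orbit \<rho> \<eta>" by (rule orbit_matrix_orbit[OF \<rho>(1)])
  define q where "q = 2 * \<rho> - r"
  have q: "q < \<rho>" "q + r = 2 * \<rho>" using \<rho> by (auto simp: q_def)
  obtain A0 B0 where "orbit \<rho> \<eta> A0 B0" using orbit_nonempty[OF _ \<eta>] \<rho> by auto
  then obtain A B where O: "orbit \<rho> \<eta> A B" and I: "M.Inv \<rho> A B" and pv: "M.pivoted (q + 1) B"
    and ch: "M.chain q B" and sd: "M.superdiagonal q B"
    using M.large_rank_normal_matrix[OF _ \<rho>(2,3)] unfolding q_def by blast
  obtain \<eta>' where e: "\<eta>' \<in> epi (surface_group \<rho>) G" "realized_equivalent \<rho> G \<eta> \<eta>'" "represents \<rho> \<eta>' A B"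
    using O by (auto simp: orbit_def)
  let ?N = "normal_coeff q B"
  have a: "\<eta>' (gen \<rho> (Alpha i)) = val (A i)" and b: "\<eta>' (gen \<rho> (Beta i)) = val (B i)" if "i \<in> {1..\<rho>}" for i
    using e(3) that by (auto simp: represents_def)
  have rr: "r \<in> {1..r}" using \<rho> by auto
  have zero: "B i j = 0" if "i \<in> {1..\<rho>}" "j \<in> {1..r}" "j \<le> i" for i j
    using M.InvD(2)[OF I that(1,2) _ that(3)] that(1) by auto
  have pivot: "B i (2 * \<rho> - i + 1) = 1" "\<And>j. j \<in> {1..r} \<Longrightarrow> 2 * \<rho> - i + 1 < j \<Longrightarrow> B i j = 0"
      "\<And>j. j \<in> {i+1..2*\<rho>-i} \<Longrightarrow> B i j = 0 \<or> \<not> int (n j) dvd B i j * int (n r)"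
    if "q < i" "i \<le> \<rho>" for i
    using pv that unfolding M.pivoted_def by auto
  have N: "?N i j = B i j" if "q < i" for i j using that by (simp add: normal_coeff_def)
  have row: "\<eta>' (gen \<rho> (Beta i)) = \<omega> (2 * \<rho> - i + 1) \<otimes> (\<Otimes>j\<in>{i+1..2*\<rho>-i}. \<omega> j [^] ?N i j)"
    if i: "q < i" "i \<le> \<rho>" for i
  proof -
    define l where "l = 2 * \<rho> - i + 1"
    have l: "l \<in> {1..r}" "{i+1..2*\<rho>-i} \<subseteq> {1..r}" "l \<notin> {i+1..2*\<rho>-i}" and ir: "i \<in> {1..\<rho>}"
      using i q by (auto simp: l_def)
    have "val (B i) = (\<Otimes>j\<in>insert l {i+1..2*\<rho>-i}. \<omega> j [^] ?N i j)"
    proof (rule val_normal_coeff)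
      show "insert l {i+1..2*\<rho>-i} \<subseteq> {1..r}" using l by blast
      fix j assume j: "j \<in> {1..r}" "j \<notin> insert l {i+1..2*\<rho>-i}"
      then have "j \<le> i \<or> l < j" by (auto simp: l_def)
      then show "B i j = 0" using zero[OF ir j(1)] pivot(2)[OF i j(1)] by (auto simp: l_def)
    qed
    also have "\<dots> = \<omega> l [^] ?N i l \<otimes> (\<Otimes>j\<in>{i+1..2*\<rho>-i}. \<omega> j [^] ?N i j)"
    proof (rule finprod_insert)
      show "(\<lambda>j. \<omega> j [^] ?N i j) \<in> {i+1..2*\<rho>-i} \<rightarrow> carrier G" using l(2) \<omega>_facts(2) by blast
    qed (use l \<omega>_facts(2)[OF l(1)] in auto)
    also have "?N i l = 1" using pivot(1)[OF i] N[OF i(1)] by (simp add: l_def)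
    finally show ?thesis using b[OF ir] \<omega>_facts(2)[OF l(1)] by (simp add: l_def)
  qed
  have "normal_form_large_rank \<rho> G r n \<omega> ?N \<eta>'"
    unfolding normal_form_large_rank_def q_def[symmetric]
  proof (intro conjI ballI allI impI)
    fix i assume i: "i \<in> {1..\<rho>}"
    have "val (A i) = val (\<lambda>j. if j = i then 1 else 0)"
      using M.InvD(1)[OF I i] i by (intro val_cong) auto
    then show "\<eta>' (gen \<rho> (Alpha i)) = \<omega> i" using a[OF i] val_single[of i] i \<rho>(2) by simp
  next
    fix i assume i: "1 \<le> i \<and> i \<le> q"
    then have ir: "i \<in> {1..\<rho>}" using q by auto
    have "val (B i) = (\<Otimes>j\<in>{i+1..r}. \<omega> j [^] ?N i j)"
      using zero[OF ir] by (intro val_normal_coeff) auto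
    then show "\<eta>' (gen \<rho> (Beta i)) = (\<Otimes>j\<in>{i+1..r}. \<omega> j [^] ?N i j)" using b[OF ir] by simp
  next
    fix i assume "q < i \<and> i < \<rho>"
    then show "\<eta>' (gen \<rho> (Beta i)) = \<omega> (2 * \<rho> - i + 1) \<otimes> (\<Otimes>j\<in>{i+1..2*\<rho>-i}. \<omega> j [^] ?N i j)"
      using row by simp
  next
    have "\<rho> + 1 \<in> {1..r}" using \<rho> by auto
    then show "\<eta>' (gen \<rho> (Beta \<rho>)) = \<omega> (\<rho> + 1)"
      using row[of \<rho>] q(1) \<omega>_facts(2)[of "\<rho> + 1"] by simp
  next
    fix i j assume ij: "q < i \<and> i < \<rho> \<and> j \<in> {i+1..2*\<rho>-i}"
    then have j: "j \<in> {1..r}" using q by auto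
    show "\<not> ord (\<omega> j [^] ?N i j) dvd n r \<or> ?N i j = 0"
    proof (rule ccontr)
      assume *: "\<not> (\<not> ord (\<omega> j [^] ?N i j) dvd n r \<or> ?N i j = 0)"
      have c: "\<omega> j \<in> carrier G" using \<omega>_facts(2)[OF j] .
      \<comment> \<open>An order dividing \<open>n r\<close> means that \<open>n j\<close> divides
        the coefficient times \<open>n r\<close>, the form in which \<open>pivoted\<close> excludes
        it.\<close>
      have "(\<omega> j [^] ?N i j) [^] n r = \<one>" using * c by (simp add: pow_eq_id)
      then have "\<omega> j [^] (?N i j * int (n r)) = \<omega> j [^] (0 :: int)"
        using c by (simp add: int_pow_pow flip: int_pow_int)
      then have "int (n j) dvd ?N i j * int (n r)" using \<omega>_pow_eq_iff[OF j, of _ 0] by simp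
      then show False using pivot(3)[of i j] ij N[of i j] * by auto
    qed
  next
    fix i j assume ij: "1 \<le> i \<and> i \<le> q \<and> i + 1 < j \<and> j \<le> r \<and> ?N i j \<noteq> 0 \<and> (\<forall>k\<in>{j+1..r}. ?N i k = 0)"
    have "j = r"
    proof (rule ccontr)
      assume "j \<noteq> r"
      then have "r \<in> {j+1..r}" using ij by auto
      then show False using ij normal_coeff_last[of i q B] by auto
    qed
    moreover have "generate G {\<omega> r [^] ?N i r} \<subseteq> generate G {\<omega> r [^] large_rank_coeff \<rho> r ?N (i + 1) r}"
    proof (cases "i = q")
      case True
      \<comment> \<open>Row \<open>q + 1\<close> has its pivot in column
        \<open>2 * \<rho> - q = r\<close>, so the subgroup on the right is the whole cyclic
        factor.\<close>
      then have "large_rank_coeff \<rho> r ?N (i + 1) r = 1"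
        using q by (auto simp: large_rank_coeff_def)
      then show ?thesis
        using generate_pow_subset[OF rr, of 1 "B i r" "?N i r" 1] normal_coeff_cong[of r q B i] by simp
    next
      case False
      then have "large_rank_coeff \<rho> r ?N (i + 1) r = ?N (i + 1) r"
        using q ij by (auto simp: large_rank_coeff_def)
      moreover have "gcd (B (i + 1) r) (int (n r)) dvd B i r"
        using ch ij False by (simp add: M.chain_def)
      ultimately show ?thesis
        using generate_pow_subset[OF rr _ normal_coeff_cong normal_coeff_cong] by simp
    qed
    ultimately show "generate G {\<omega> j [^] ?N i j} \<subseteq> generate G {\<omega> j [^] large_rank_coeff \<rho> r ?N (i + 1) j}" by simp
  next
    fix i assume i: "1 \<le> i \<and> i + 1 \<le> q"
    then have s: "gcd (int (n (i + 1))) (B i (i + 1)) > 1 \<or> int (n (i + 1)) dvd B i (i + 1) - 1"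
      using sd by (auto simp: M.superdiagonal_def)
    have "i < r" using i q by auto
    \<comment> \<open>The matrix condition concerns \<open>n (i + 1)\<close>, the normal form
      \<open>n i\<close>; as the former divides the latter, the gcd can only grow.\<close>
    then have "gcd (int (n (i + 1))) (B i (i + 1)) dvd gcd (int (n i)) (B i (i + 1))"
      using n_dvd_step[of i] i by (intro gcd_mono) auto
    moreover have "gcd (int (n i)) (B i (i + 1)) > 0" using \<omega>_facts(1)[of i] i \<open>i < r\<close> by simp
    ultimately have "gcd (int (n (i + 1))) (B i (i + 1)) \<le> gcd (int (n i)) (B i (i + 1))"
      by (intro zdvd_imp_le)
    then show "gcd (int (n i)) (?N i (i + 1)) > 1 \<or> ?N i (i + 1) = 1"
      using s i by (auto simp: normal_coeff_def)
  qed
  then show ?thesis using e by blast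
qed

end

theorem proposition14:
  fixes G :: "('a, 'b) monoid_scheme"
    and \<rho> r :: nat and n :: "nat \<Rightarrow> nat" and \<omega> :: "nat \<Rightarrow> 'a"
    and \<eta> :: "surface_gen word set \<Rightarrow> 'a"
  assumes "\<rho> \<ge> 2"
    and "comm_group G" and "finite (carrier G)"
    and "r \<le> 2 * \<rho>"
    and "invariant_factor_generators G r n \<omega>"
    and "\<eta> \<in> epi (surface_group \<rho>) G"
  shows "\<exists>\<eta>' \<in> epi (surface_group \<rho>) G. \<exists>N :: nat \<Rightarrow> nat \<Rightarrow> int.
           aut_equivalent \<rho> G \<eta> \<eta>' \<and>
           (r \<le> \<rho> \<longrightarrow> normal_form_small_rank \<rho> G r n \<omega> N \<eta>') \<and>
           (r > \<rho> \<longrightarrow> normal_form_large_rank \<rho> G r n \<omega> N \<eta>')"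
proof -
  interpret factor_basis G r n \<omega>
    using assms by (simp add: factor_basis_def factor_basis_axioms_def)
  have \<rho>: "\<rho> > 0" using assms(1) by simp
  show ?thesis
  proof (cases "r \<le> \<rho>")
    case True
    then obtain \<eta>' N where "\<eta>' \<in> epi (surface_group \<rho>) G" "realized_equivalent \<rho> G \<eta> \<eta>'"
      "normal_form_small_rank \<rho> G r n \<omega> N \<eta>'"
      using small_rank[OF assms(1) True assms(6)] by blast
    then show ?thesis using realized_equivalent_imp[OF \<rho>] True by (metis not_less)
  next
    case False
    then have "\<rho> < r" by simp
    then obtain \<eta>' N where "\<eta>' \<in> epi (surface_group \<rho>) G" "realized_equivalent \<rho> G \<eta> \<eta>'"
      "normal_form_large_rank \<rho> G r n \<omega> N \<eta>'"
      using large_rank[OF assms(1) _ assms(4,6)] by blast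
    then show ?thesis using realized_equivalent_imp[OF \<rho>] False by metis
  qed
qed

end
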